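(* Let $\mathcal{S}$ be an integrable Pfaffian system of rank $q$ on a manifold $M$, let $\Sigma=\mathcal{S}^{\perp}$ be the corresponding distribution, of rank $p$, and suppose that $\mathcal{S}$ is invariant under a transversally free infinitesimal action $\Phi:g\to\chi(M)$ of a finite dimensional real Lie algebra $g$. Then the finite resolution $$\Phi^{0,p}\xrightarrow{\;E\;}\Xi^1\xrightarrow{\;d_V\;}\Xi^2\xrightarrow{\;d_V\;}\cdots\xrightarrow{\;d_V\;}\Xi^q\longrightarrow 0$$ of the Euler operator $E$ is equal, in positive dimensions, to the cochain complex $(C^\bullet(g,\Xi^0),\delta)$ of the Lie algebra $g$ with values in $\Xi^0$, relative to the representation $\rho(v)(\mathbf{q}_0\mu)=\mathbf{q}_0(\theta(\Phi(v))\mu)$, $v\in g$, $\mu\in\Phi^{0,p}$. Explicitly: for every $r\geq 1$ the map $$\Xi^r\to C^r(g,\Xi^0)=\mathrm{Hom}_{\mathbf{R}}(\wedge^r g,\Xi^0),\qquad \tau\mapsto\Big((v_1,\dots,v_r)\mapsto[\tau]([\Phi(v_1)],\dots,[\Phi(v_r)])\Big)$$ is bijective, and under these identifications $d_V:\Xi^r\to\Xi^{r+1}$ becomes $\delta:C^r(g,\Xi^0)\to C^{r+1}(g,\Xi^0)$ for all $r\ge 1$, while $E:\Phi^{0,p}\to\Xi^1$ becomes $\delta\circ\mathbf{q}_0:\Phi^{0,p}\to C^0(g,\Xi^0)=\Xi^0\to C^1(g,\Xi^0)$.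
   Context: Conventions. All data are $C^\infty$; manifolds are finite dimensional, connected and second countable, not necessarily orientable; functions, vector fields and forms are globally defined on $M$. $\chi(M)$ is the Lie algebra of vector fields on $M$, $\mathcal{F}=C^\infty(M)$, $\theta(\xi)$ is the Lie derivative along $\xi$. Pfaffian systems. A Pfaffian system $\mathcal{S}$ of rank $q$ on $M$ is a rank $q$ vector subbundle of $T^*M$; $\Sigma=\mathcal{S}^{\perp}\subset TM$ is its annihilator, of rank $p=\dim M-q$. $\mathcal{S}$ is integrable when $\Sigma$ is involutive. Let $\mathcal{B}=\Gamma(\Sigma)$, $\mathcal{C}=\Gamma(\mathcal{S})$, and let $\mathcal{A}$ be the Lie algebra of infinitesimal automorphisms of $\mathcal{S}$, i.e. the $\xi\in\chi(M)$ with $\theta(\xi)\mathcal{C}\subset\mathcal{C}$ (equivalently $[\xi,\mathcal{B}]\subset\mathcal{B}$). For integrable $\mathcal{S}$, $\mathcal{B}$ is an ideal of $\mathcal{A}$. Let $\mathcal{I}=\{f\in\mathcal{F}:\eta(f)=0\ \forall\eta\in\mathcal{B}\}$ be the ring of first integrals. Then $\mathcal{S(R)}:=\mathcal{A}/\mathcal{B}$ is a Lie algebra and an $\mathcal{I}$-module; $[\xi]$ denotes the class of $\xi\in\mathcal{A}$. Horizontal operator. Let $\mathcal{H}=\Gamma(\Sigma^* )$, so $\wedge^s\mathcal{H}=\Gamma(\wedge^s\Sigma^* )$, and $\Phi^{r,s}=(\wedge^r\mathcal{C})\otimes_{\mathcal{F}}(\wedge^s\mathcal{H})$, regarded as the $\wedge^r\mathcal{C}$-valued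 alternating $\mathcal{F}$-multilinear $s$-forms on $\mathcal{B}$ (and $\Phi^{r,-1}=0$). The operator $d_H:\Phi^{r,s}\to\Phi^{r,s+1}$ is $$d_H(\omega\otimes\mu)(\eta_1,\dots,\eta_{s+1})=\sum_i(-1)^{i+1}\theta(\eta_i)[\mu(\eta_1,\dots,\widehat{\eta_i},\dots,\eta_{s+1})\,\omega]+\sum_{i<j}(-1)^{i+j}\mu([\eta_i,\eta_j],\eta_1,\dots,\widehat{\eta_i},\dots,\widehat{\eta_j},\dots,\eta_{s+1})\,\omega,$$ for $\eta_i\in\mathcal{B}$. Vertical operator. Put $\Xi^r=\Phi^{r,p}/d_H\Phi^{r,p-1}$, with quotient map $\mathbf{q}_r:\Phi^{r,p}\to\Xi^r$. An element $\omega\otimes\mu\in\Phi^{r,s}$ defines an alternating $\mathcal{I}$-multilinear form on $\mathcal{S(R)}$ with values in $\wedge^s\mathcal{H}=\Phi^{0,s}$ by $(\omega\otimes\mu)([\xi_1],\dots,[\xi_r])=\omega(\xi_1,\dots,\xi_r)\mu$, extended additively. For $\tau\in\Xi^r$ with $\tau=\mathbf{q}_r(\Omega)$, $\Omega\in\Phi^{r,p}$, the form $[\tau]$ on $\mathcal{S(R)}$ with values in $\Xi^0$ is $[\tau]([\xi_1],\dots,[\xi_r])=\mathbf{q}_0(\Omega([\xi_1],\dots,[\xi_r]))$; it does not depend on the choice of $\Omega$, and $\tau$ is identified with $[\tau]$. For $\xi\in\mathcal{A}$ and $\mu\in\wedge^p\mathcal{H}$, $\theta(\xi)\mu\in\wedge^p\mathcal{H}$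 is defined by $(\theta(\xi)\mu)(\eta_1,\dots,\eta_p)=\xi(\mu(\eta_1,\dots,\eta_p))-\sum_i\mu(\eta_1,\dots,[\xi,\eta_i],\dots,\eta_p)$; the class $\mathbf{q}_0(\theta(\xi)\mu)$ depends only on $[\xi]$ and $\mathbf{q}_0\mu$. The operator $d_V:\Xi^r\to\Xi^{r+1}$ is defined, for $\omega\otimes\mu\in\Phi^{r,p}$ (and additively), by $$[d_V\mathbf{q}_r(\omega\otimes\mu)]([\xi_1],\dots,[\xi_{r+1}])=\mathbf{q}_0\Big\{\sum_i(-1)^{i+1}\theta(\xi_i)\big[\omega(\xi_1,\dots,\widehat{\xi_i},\dots,\xi_{r+1})\mu\big]\Big\}+\mathbf{q}_0\Big\{\sum_{i<j}(-1)^{i+j}\omega([\xi_i,\xi_j],\xi_1,\dots,\widehat{\xi_i},\dots,\widehat{\xi_j},\dots,\xi_{r+1})\mu\Big\},\quad \xi_i\in\mathcal{A}.$$ The Euler operator is $E=d_V\circ\mathbf{q}_0:\Phi^{0,p}\to\Xi^0\to\Xi^1$. Invariance. An infinitesimal action of $g$ on $M$ is a Lie algebra morphism $\Phi:g\to\chi(M)$ (not to be confused with the modules $\Phi^{r,s}$). $\mathcal{S}$ is invariant under $\Phi$ when $\Phi(v)\in\mathcal{A}$ for all $v\in g$. The action is transversally free (with respect to $\mathcal{S}$) when, writing $\Phi(g)_x=\{\Phi(v)_x: v\in g\}\subset T_xM$, one has for all $x\in M$: (i) $\dim g=\dim\Phi(g)_x$, and (ii) $T_xM=\Sigma_x\oplus\Phi(g)_x$.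 Lie algebra cochains. $(C^\bullet(g,\Xi^0),\delta)$ is the standard (Chevalley–Eilenberg) complex of alternating $\mathbf{R}$-multilinear maps $g^r\to\Xi^0$ with $$\delta c(v_1,\dots,v_{r+1})=\sum_i(-1)^{i+1}\rho(v_i)c(v_1,\dots,\widehat{v_i},\dots,v_{r+1})+\sum_{i<j}(-1)^{i+j}c([v_i,v_j],v_1,\dots,\widehat{v_i},\dots,\widehat{v_j},\dots,v_{r+1}).$$ *)

theory Defs
  imports "HOL-Analysis.Analysis" "HOL-Library.Function_Algebras"
begin

section \<open>Preliminaries\<close>

text \<open>Functions into a real vector space form a real vector space (addition comes from
  \<^theory>\<open>HOL-Library.Function_Algebras\<close>).  Functions on a manifold, tangent vectors (as operators on
  functions), covectors, vector fields and forms below are all nested function types, so that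
  linear notions such as \<^const>\<open>independent\<close>, \<^const>\<open>span\<close> and \<^const>\<open>dim\<close> apply to them.\<close>

instantiation "fun" :: (type, real_vector) real_vector
begin

definition scaleR_fun :: "real \<Rightarrow> ('a \<Rightarrow> 'b) \<Rightarrow> 'a \<Rightarrow> 'b" where
  "scaleR_fun c f = (\<lambda>x. c *\<^sub>R f x)"

instance
  by standard (simp_all add: scaleR_fun_def fun_eq_iff algebra_simps)

end

text \<open>\<open>r\<close>-tuples are lists of length \<open>r\<close>, with entries numbered from \<open>0\<close>.  Shifting both indices
  by one does not change \<open>(-1)^(i+j)\<close>, and turns \<open>(-1)^(i+1)\<close> into \<open>(-1)^i\<close>.\<close>

definition tuples :: "'a set \<Rightarrow> nat \<Rightarrow> 'a list set" where
  "tuples V r = {xs. length xs = r \<and> set xs \<subseteq> V}"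

definition del :: "nat \<Rightarrow> 'a list \<Rightarrow> 'a list" where
  "del i xs = take i xs @ drop (Suc i) xs"

section \<open>Smooth manifolds\<close>

primrec Ck_on :: "nat \<Rightarrow> 'a::real_normed_vector set \<Rightarrow> ('a \<Rightarrow> 'b::real_normed_vector) \<Rightarrow> bool" where
  "Ck_on 0 U f \<longleftrightarrow> continuous_on U f"
| "Ck_on (Suc k) U f \<longleftrightarrow>
     (\<forall>x\<in>U. f differentiable (at x)) \<and> (\<forall>v. Ck_on k U (\<lambda>x. frechet_derivative f (at x) v))"

definition smooth_on :: "'a::real_normed_vector set \<Rightarrow> ('a \<Rightarrow> 'b::real_normed_vector) \<Rightarrow> bool" where
  "smooth_on U f \<longleftrightarrow> (\<forall>k. Ck_on k U f)"

text \<open>A manifold is a Hausdorff, second countable, connected type \<open>'m\<close> with an atlas of charts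
  \<open>(U, \<phi>)\<close> whose model space \<open>'e\<close> is a finite dimensional inner product space.  The class
  \<^class>\<open>euclidean_space\<close> is not used for \<open>'e\<close> because it excludes dimension \<open>0\<close>.\<close>

definition smooth_manifold ::
  "('m::{t2_space, second_countable_topology} set \<times> ('m \<Rightarrow> 'e::real_inner)) set \<Rightarrow> bool" where
  "smooth_manifold atl \<longleftrightarrow>
     connected (UNIV :: 'm set) \<and>
     (\<exists>b :: 'e set. finite b \<and> span b = UNIV) \<and>
     (\<Union>(U, \<phi>)\<in>atl. U) = UNIV \<and>
     (\<forall>(U, \<phi>)\<in>atl. open U \<and> open (\<phi> ` U) \<and> homeomorphism U (\<phi> ` U) \<phi> (inv_into U \<phi>)) \<and>
     (\<forall>(U, \<phi>)\<in>atl. \<forall>(V, \<psi>)\<in>atl. smooth_on (\<phi> ` (U \<inter> V)) (\<psi> \<circ> inv_into U \<phi>))"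

type_synonym 'm tvec = "('m \<Rightarrow> real) \<Rightarrow> real"
type_synonym 'm covec = "'m tvec \<Rightarrow> real"
type_synonym 'm vf = "('m \<Rightarrow> real) \<Rightarrow> 'm \<Rightarrow> real"
type_synonym 'm form = "'m vf list \<Rightarrow> 'm \<Rightarrow> real"
type_synonym 'm hform = "'m vf list \<Rightarrow> 'm form"

text \<open>The value at \<open>x\<close> of a vector field, and the bracket of two vector fields.\<close>

definition vf_at :: "'m vf \<Rightarrow> 'm \<Rightarrow> 'm tvec" where
  "vf_at X x = (\<lambda>f. X f x)"

definition vbr :: "'m vf \<Rightarrow> 'm vf \<Rightarrow> 'm vf" where
  "vbr X Y = (\<lambda>f. X (Y f) - Y (X f))"

text \<open>Multiplication by a function, for vector fields and for forms.\<close>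

definition fmul :: "('m \<Rightarrow> real) \<Rightarrow> ('a \<Rightarrow> 'm \<Rightarrow> real) \<Rightarrow> 'a \<Rightarrow> 'm \<Rightarrow> real" where
  "fmul f X = (\<lambda>a. f * X a)"

text \<open>A function as a form of degree \<open>0\<close>.\<close>

definition zform :: "('m \<Rightarrow> real) \<Rightarrow> 'm form" where
  "zform f = (\<lambda>Xs. if Xs = [] then f else 0)"

context
  fixes atl :: "('m::topological_space set \<times> ('m \<Rightarrow> 'e::real_normed_vector)) set"
begin

definition smooth_fn_on :: "'m set \<Rightarrow> ('m \<Rightarrow> real) \<Rightarrow> bool" where
  "smooth_fn_on W f \<longleftrightarrow> (\<forall>(U, \<phi>)\<in>atl. smooth_on (\<phi> ` (U \<inter> W)) (f \<circ> inv_into U \<phi>))"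

definition smooth_fns :: "('m \<Rightarrow> real) set" where
  "smooth_fns = {f. smooth_fn_on UNIV f}"

text \<open>Tangent vectors at \<open>x\<close> are the derivations at \<open>x\<close> of the algebra of smooth functions.  They
  (and covectors, and multilinear maps below) are set to \<open>0\<close> outside their domain, so that
  equality of HOL functions is the intended equality.\<close>

definition tangent :: "'m \<Rightarrow> 'm tvec set" where
  "tangent x = {v.
     (\<forall>f\<in>smooth_fns. \<forall>g\<in>smooth_fns. v (f + g) = v f + v g) \<and>
     (\<forall>c. \<forall>f\<in>smooth_fns. v (c *\<^sub>R f) = c * v f) \<and>
     (\<forall>f\<in>smooth_fns. \<forall>g\<in>smooth_fns. v (f * g) = f x * v g + g x * v f) \<and>
     (\<forall>f. f \<notin> smooth_fns \<longrightarrow> v f = 0)}"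

definition cotangent :: "'m \<Rightarrow> 'm covec set" where
  "cotangent x = {\<alpha>.
     (\<forall>v\<in>tangent x. \<forall>w\<in>tangent x. \<alpha> (v + w) = \<alpha> v + \<alpha> w) \<and>
     (\<forall>c. \<forall>v\<in>tangent x. \<alpha> (c *\<^sub>R v) = c * \<alpha> v) \<and>
     (\<forall>v. v \<notin> tangent x \<longrightarrow> \<alpha> v = 0)}"

definition vfields :: "'m vf set" where
  "vfields = {X. (\<forall>x. vf_at X x \<in> tangent x) \<and> (\<forall>f\<in>smooth_fns. X f \<in> smooth_fns)}"

text \<open>Evaluation of a field of covectors on a vector field, and smoothness of such a field on
  an open set.\<close>

definition pair :: "('m \<Rightarrow> 'm covec) \<Rightarrow> 'm vf \<Rightarrow> 'm \<Rightarrow> real" where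
  "pair s X = (\<lambda>x. s x (vf_at X x))"

definition smooth_covecs_on :: "'m set \<Rightarrow> ('m \<Rightarrow> 'm covec) \<Rightarrow> bool" where
  "smooth_covecs_on W s \<longleftrightarrow>
     (\<forall>x\<in>W. s x \<in> cotangent x) \<and> (\<forall>X\<in>vfields. smooth_fn_on W (pair s X))"

text \<open>\<open>1\<close>-forms as maps on (one-element lists of) vector fields, and their wedge products,
  normalised by \<open>(\<omega>\<^sub>1 \<and> \<dots> \<and> \<omega>\<^sub>r) (X\<^sub>1, \<dots>, X\<^sub>r) = det (\<omega>\<^sub>i X\<^sub>j)\<close>.\<close>

definition one_form :: "('m \<Rightarrow> 'm covec) \<Rightarrow> 'm form" where
  "one_form s = (\<lambda>Xs. if Xs \<in> tuples vfields 1 then pair s (hd Xs) else 0)"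

definition wedge :: "'m form list \<Rightarrow> 'm form" where
  "wedge \<omega>s = (\<lambda>Xs. if Xs \<in> tuples vfields (length \<omega>s)
     then (\<lambda>x. \<Sum>\<sigma> | \<sigma> permutes {..<length \<omega>s}.
                 of_int (sign \<sigma>) * (\<Prod>i<length \<omega>s. (\<omega>s ! i) [Xs ! \<sigma> i] x))
     else 0)"

text \<open>Lie derivative of a form of any degree, \<open>\<theta>(\<xi>) \<omega>\<close>.\<close>

definition lie_form :: "'m vf \<Rightarrow> 'm form \<Rightarrow> 'm form" where
  "lie_form \<xi> \<omega> = (\<lambda>Xs. if set Xs \<subseteq> vfields
     then \<xi> (\<omega> Xs) - (\<Sum>i<length Xs. \<omega> (Xs[i := vbr \<xi> (Xs ! i)])) else 0)"

end

section \<open>Pfaffian systems\<close>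

text \<open>A rank \<open>q\<close> subbundle of the cotangent bundle, given by its fibres: locally it is spanned
  by \<open>q\<close> pointwise linearly independent smooth covector fields.\<close>

definition pfaffian_system ::
  "('m::topological_space set \<times> ('m \<Rightarrow> 'e::real_normed_vector)) set \<Rightarrow> nat \<Rightarrow> ('m \<Rightarrow> 'm covec set) \<Rightarrow> bool" where
  "pfaffian_system atl q S \<longleftrightarrow>
     (\<forall>x. \<exists>W \<sigma>. open W \<and> x \<in> W \<and>
        (\<forall>i<q. smooth_covecs_on atl W (\<sigma> i)) \<and>
        (\<forall>y\<in>W. inj_on (\<lambda>i. \<sigma> i y) {..<q} \<and>
                independent ((\<lambda>i. \<sigma> i y) ` {..<q}) \<and>
                S y = span ((\<lambda>i. \<sigma> i y) ` {..<q})))"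

context
  fixes atl :: "('m::topological_space set \<times> ('m \<Rightarrow> 'e::real_normed_vector)) set"
    and S :: "'m \<Rightarrow> 'm covec set"
begin

text \<open>The annihilator \<open>\<Sigma>\<close> of \<open>S\<close>, and the sections \<open>\<B>\<close> of \<open>\<Sigma>\<close> and \<open>\<C>\<close> of \<open>S\<close>.\<close>

definition annih :: "'m \<Rightarrow> 'm tvec set" where
  "annih x = {v \<in> tangent atl x. \<forall>\<alpha>\<in>S x. \<alpha> v = 0}"

definition Bsec :: "'m vf set" where
  "Bsec = {\<eta> \<in> vfields atl. \<forall>x. vf_at \<eta> x \<in> annih x}"

definition Csec :: "'m form set" where
  "Csec = one_form atl ` {s. smooth_covecs_on atl UNIV s \<and> (\<forall>x. s x \<in> S x)}"

definition integrable_system :: bool where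
  "integrable_system \<longleftrightarrow> (\<forall>X\<in>Bsec. \<forall>Y\<in>Bsec. vbr X Y \<in> Bsec)"

text \<open>Infinitesimal automorphisms, and the class of such a field modulo \<open>\<B>\<close>.\<close>

definition auts :: "'m vf set" where
  "auts = {\<xi> \<in> vfields atl. lie_form atl \<xi> ` Csec \<subseteq> Csec}"

definition cls :: "'m vf \<Rightarrow> 'm vf set" where
  "cls \<xi> = {(\<zeta>, \<zeta>'). \<zeta> \<in> auts \<and> \<zeta>' \<in> auts \<and> \<zeta>' - \<zeta> \<in> Bsec} `` {\<xi>}"

text \<open>\<open>\<And>\<^sup>r \<C>\<close>, as a module over the smooth functions.\<close>

definition extC :: "nat \<Rightarrow> 'm form set" where
  "extC r = {\<Sum>k<N. fmul (f k) (wedge atl (w k)) | (N::nat) f w.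
     \<forall>k<N. f k \<in> smooth_fns atl \<and> w k \<in> tuples Csec r}"

section \<open>The horizontal operator\<close>

text \<open>\<open>\<Phi>\<^sup>r\<^sup>,\<^sup>s\<close>: alternating \<open>s\<close>-linear maps (over the smooth functions) from \<open>\<B>\<close> to \<open>\<And>\<^sup>r \<C>\<close>; the
  element \<open>\<omega> \<otimes> \<mu>\<close> is the map sending \<open>\<eta>s\<close> to \<open>\<mu>(\<eta>s) \<omega>\<close>.  In particular \<open>\<Phi>\<^sup>0\<^sup>,\<^sup>s\<close> is \<open>\<And>\<^sup>s \<H>\<close>.\<close>

definition Phi :: "nat \<Rightarrow> nat \<Rightarrow> 'm hform set" where
  "Phi r s = {\<Omega>.
     (\<forall>\<eta>s. if \<eta>s \<in> tuples Bsec s then \<Omega> \<eta>s \<in> extC r else \<Omega> \<eta>s = 0) \<and>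
     (\<forall>\<eta>s\<in>tuples Bsec s. \<forall>i<s. \<forall>X\<in>Bsec. \<forall>Y\<in>Bsec.
        \<Omega> (\<eta>s[i := X + Y]) = \<Omega> (\<eta>s[i := X]) + \<Omega> (\<eta>s[i := Y])) \<and>
     (\<forall>\<eta>s\<in>tuples Bsec s. \<forall>i<s. \<forall>X\<in>Bsec. \<forall>f\<in>smooth_fns atl.
        \<Omega> (\<eta>s[i := fmul f X]) = fmul f (\<Omega> (\<eta>s[i := X]))) \<and>
     (\<forall>\<eta>s\<in>tuples Bsec s. \<forall>j<s. \<forall>i<j. \<eta>s ! i = \<eta>s ! j \<longrightarrow> \<Omega> \<eta>s = 0)}"

definition dH :: "nat \<Rightarrow> 'm hform \<Rightarrow> 'm hform" where
  "dH s \<Omega> = (\<lambda>\<eta>s. if \<eta>s \<in> tuples Bsec (Suc s) then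
       (\<Sum>i<Suc s. (-1) ^ i *\<^sub>R lie_form atl (\<eta>s ! i) (\<Omega> (del i \<eta>s))) +
       (\<Sum>j<Suc s. \<Sum>i<j. (-1) ^ (i + j) *\<^sub>R \<Omega> (vbr (\<eta>s ! i) (\<eta>s ! j) # del i (del j \<eta>s)))
     else 0)"

text \<open>The image of \<open>\<Phi>\<^sup>r\<^sup>,\<^sup>p\<^sup>-\<^sup>1\<close> under \<^term>\<open>dH\<close>, with \<open>\<Phi>\<^sup>r\<^sup>,\<^sup>-\<^sup>1 = 0\<close>.\<close>

definition dH_image :: "nat \<Rightarrow> nat \<Rightarrow> 'm hform set" where
  "dH_image p r = (case p of 0 \<Rightarrow> {0} | Suc s \<Rightarrow> dH s ` Phi r s)"

text \<open>Lie derivative of an element of \<open>\<Phi>\<^sup>r\<^sup>,\<^sup>s\<close>; only used for \<open>r = 0\<close>, where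
  \<^term>\<open>lie_form atl \<xi> (\<mu> \<eta>s)\<close> is the function \<open>\<xi>(\<mu>(\<eta>s))\<close>.\<close>

definition lie_Phi :: "'m vf \<Rightarrow> 'm hform \<Rightarrow> 'm hform" where
  "lie_Phi \<xi> \<mu> = (\<lambda>\<eta>s. if set \<eta>s \<subseteq> Bsec
     then lie_form atl \<xi> (\<mu> \<eta>s) - (\<Sum>i<length \<eta>s. \<mu> (\<eta>s[i := vbr \<xi> (\<eta>s ! i)])) else 0)"

text \<open>\<open>\<Omega>(\<xi>\<^sub>1, \<dots>, \<xi>\<^sub>r) \<in> \<Phi>\<^sup>0\<^sup>,\<^sup>s\<close> for \<open>\<Omega> \<in> \<Phi>\<^sup>r\<^sup>,\<^sup>s\<close>.\<close>

definition ev :: "'m vf list \<Rightarrow> 'm hform \<Rightarrow> 'm hform" where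
  "ev \<xi>s \<Omega> = (\<lambda>\<eta>s. zform (\<Omega> \<eta>s \<xi>s))"

end

section \<open>The vertical operator\<close>

context
  fixes atl :: "('m::topological_space set \<times> ('m \<Rightarrow> 'e::real_normed_vector)) set"
    and S :: "'m \<Rightarrow> 'm covec set"
    and p :: nat
begin

definition qrel :: "nat \<Rightarrow> ('m hform \<times> 'm hform) set" where
  "qrel r = {(\<Omega>, \<Omega>'). \<Omega> \<in> Phi atl S r p \<and> \<Omega>' \<in> Phi atl S r p \<and> \<Omega>' - \<Omega> \<in> dH_image atl S p r}"

definition Xi :: "nat \<Rightarrow> 'm hform set set" where
  "Xi r = Phi atl S r p // qrel r"

definition qmap :: "nat \<Rightarrow> 'm hform \<Rightarrow> 'm hform set" where
  "qmap r \<Omega> = qrel r `` {\<Omega>}"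

text \<open>Vector space structure of \<open>\<Xi>\<^sup>0\<close>.  Operations on classes are given by unions over
  representatives, as in \<^theory>\<open>HOL.Equiv_Relations\<close>.\<close>

definition xzero :: "'m hform set" where
  "xzero = qmap 0 0"

definition xadd :: "'m hform set \<Rightarrow> 'm hform set \<Rightarrow> 'm hform set" where
  "xadd a b = (\<Union>\<mu>\<in>a. \<Union>\<nu>\<in>b. qmap 0 (\<mu> + \<nu>))"

definition xscale :: "real \<Rightarrow> 'm hform set \<Rightarrow> 'm hform set" where
  "xscale c a = (\<Union>\<mu>\<in>a. qmap 0 (c *\<^sub>R \<mu>))"

definition xsum :: "'m hform set list \<Rightarrow> 'm hform set" where
  "xsum as = foldr xadd as xzero"

text \<open>The form \<open>[\<tau>]\<close> with values in \<open>\<Xi>\<^sup>0\<close>; its arguments are classes \<^term>\<open>cls atl S \<xi>\<close>.\<close>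

definition bform :: "'m hform set \<Rightarrow> 'm vf set list \<Rightarrow> 'm hform set" where
  "bform \<tau> cs = (\<Union>\<Omega>\<in>\<tau>. \<Union>\<xi>s\<in>listset cs. qmap 0 (ev \<xi>s \<Omega>))"

definition dV_val :: "'m hform \<Rightarrow> 'm vf list \<Rightarrow> 'm hform set" where
  "dV_val \<Omega> \<xi>s = xadd
     (qmap 0 (\<Sum>i<length \<xi>s. (-1) ^ i *\<^sub>R lie_Phi atl S (\<xi>s ! i) (ev (del i \<xi>s) \<Omega>)))
     (qmap 0 (\<Sum>j<length \<xi>s. \<Sum>i<j.
        (-1) ^ (i + j) *\<^sub>R ev (vbr (\<xi>s ! i) (\<xi>s ! j) # del i (del j \<xi>s)) \<Omega>))"

definition dV :: "nat \<Rightarrow> 'm hform set \<Rightarrow> 'm hform set" where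
  "dV r \<tau> = (THE \<tau>'. \<tau>' \<in> Xi (Suc r) \<and>
     (\<forall>\<Omega>\<in>\<tau>. \<forall>\<xi>s\<in>tuples (auts atl S) (Suc r). bform \<tau>' (map (cls atl S) \<xi>s) = dV_val \<Omega> \<xi>s))"

definition Euler :: "'m hform \<Rightarrow> 'm hform set" where
  "Euler \<mu> = dV 0 (qmap 0 \<mu>)"

end

section \<open>Infinitesimal actions and Lie algebra cochains\<close>

definition findim_lie_algebra :: "('g::real_vector \<Rightarrow> 'g \<Rightarrow> 'g) \<Rightarrow> bool" where
  "findim_lie_algebra br \<longleftrightarrow>
     (\<exists>b :: 'g set. finite b \<and> span b = UNIV) \<and>
     bilinear br \<and> (\<forall>x. br x x = 0) \<and>
     (\<forall>x y z. br x (br y z) + br y (br z x) + br z (br x y) = 0)"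

definition infinitesimal_action ::
  "('m::topological_space set \<times> ('m \<Rightarrow> 'e::real_normed_vector)) set \<Rightarrow>
   ('g::real_vector \<Rightarrow> 'g \<Rightarrow> 'g) \<Rightarrow> ('g \<Rightarrow> 'm vf) \<Rightarrow> bool" where
  "infinitesimal_action atl br act \<longleftrightarrow>
     linear act \<and> range act \<subseteq> vfields atl \<and> (\<forall>v w. act (br v w) = vbr (act v) (act w))"

definition orbit_space :: "('g::real_vector \<Rightarrow> 'm vf) \<Rightarrow> 'm \<Rightarrow> 'm tvec set" where
  "orbit_space act x = range (\<lambda>v. vf_at (act v) x)"

definition transversally_free ::
  "('m::topological_space set \<times> ('m \<Rightarrow> 'e::real_normed_vector)) set \<Rightarrow> ('m \<Rightarrow> 'm covec set) \<Rightarrow>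
   ('g::real_vector \<Rightarrow> 'm vf) \<Rightarrow> bool" where
  "transversally_free atl S act \<longleftrightarrow>
     (\<forall>x. dim (UNIV :: 'g set) = dim (orbit_space act x) \<and>
          tangent atl x = {u + w | u w. u \<in> annih atl S x \<and> w \<in> orbit_space act x} \<and>
          annih atl S x \<inter> orbit_space act x = {0})"

context
  fixes atl :: "('m::topological_space set \<times> ('m \<Rightarrow> 'e::real_normed_vector)) set"
    and S :: "'m \<Rightarrow> 'm covec set"
    and p :: nat
begin

definition lie_rep :: "('g::real_vector \<Rightarrow> 'g \<Rightarrow> 'g) \<Rightarrow> ('g \<Rightarrow> 'm hform set \<Rightarrow> 'm hform set) \<Rightarrow> bool" where
  "lie_rep br R \<longleftrightarrow>
     (\<forall>v. \<forall>a\<in>Xi atl S p 0. R v a \<in> Xi atl S p 0) \<and>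
     (\<forall>v s t. \<forall>a\<in>Xi atl S p 0. \<forall>b\<in>Xi atl S p 0.
        R v (xadd atl S p (xscale atl S p s a) (xscale atl S p t b)) =
        xadd atl S p (xscale atl S p s (R v a)) (xscale atl S p t (R v b))) \<and>
     (\<forall>v w s t. \<forall>a\<in>Xi atl S p 0.
        R (s *\<^sub>R v + t *\<^sub>R w) a =
        xadd atl S p (xscale atl S p s (R v a)) (xscale atl S p t (R w a))) \<and>
     (\<forall>v w. \<forall>a\<in>Xi atl S p 0.
        R (br v w) a = xadd atl S p (R v (R w a)) (xscale atl S p (-1) (R w (R v a))))"

definition rho :: "('g \<Rightarrow> 'm vf) \<Rightarrow> 'g \<Rightarrow> 'm hform set \<Rightarrow> 'm hform set" where
  "rho act v a = (\<Union>\<mu>\<in>a. qmap atl S p 0 (lie_Phi atl S (act v) \<mu>))"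

definition cochains :: "nat \<Rightarrow> ('g::real_vector list \<Rightarrow> 'm hform set) set" where
  "cochains r = {c \<in> tuples UNIV r \<rightarrow>\<^sub>E Xi atl S p 0.
     (\<forall>vs\<in>tuples UNIV r. \<forall>i<r. \<forall>u w s t.
        c (vs[i := s *\<^sub>R u + t *\<^sub>R w]) =
        xadd atl S p (xscale atl S p s (c (vs[i := u]))) (xscale atl S p t (c (vs[i := w])))) \<and>
     (\<forall>vs\<in>tuples UNIV r. \<forall>j<r. \<forall>i<j. vs ! i = vs ! j \<longrightarrow> c vs = xzero atl S p)}"

definition delta :: "('g::real_vector \<Rightarrow> 'g \<Rightarrow> 'g) \<Rightarrow> ('g \<Rightarrow> 'm hform set \<Rightarrow> 'm hform set) \<Rightarrow>
    nat \<Rightarrow> ('g list \<Rightarrow> 'm hform set) \<Rightarrow> 'g list \<Rightarrow> 'm hform set" where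
  "delta br R r c = (\<lambda>vs\<in>tuples UNIV (Suc r). xadd atl S p
     (xsum atl S p [xscale atl S p ((-1) ^ i) (R (vs ! i) (c (del i vs))). i \<leftarrow> [0..<Suc r]])
     (xsum atl S p [xscale atl S p ((-1) ^ (i + j)) (c (br (vs ! i) (vs ! j) # del i (del j vs))).
        j \<leftarrow> [0..<Suc r], i \<leftarrow> [0..<j]]))"

text \<open>The comparison map \<open>\<Xi>\<^sup>r \<rightarrow> C\<^sup>r(g, \<Xi>\<^sup>0)\<close>.\<close>

definition to_cochain :: "('g \<Rightarrow> 'm vf) \<Rightarrow> nat \<Rightarrow> 'm hform set \<Rightarrow> 'g list \<Rightarrow> 'm hform set" where
  "to_cochain act r \<tau> = (\<lambda>vs\<in>tuples UNIV r. bform atl S p \<tau> (map (\<lambda>v. cls atl S (act v)) vs))"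

end

end

theory Submission
  imports Defs "HOL-Real_Asymp.Real_Asymp"
begin

text \<open>Let \<open>e\<^sub>1, \<dots>, e\<^sub>n\<close> be a basis of \<open>g\<close> and \<open>X\<^sub>i = \<Phi>(e\<^sub>i)\<close>.  Transversal freeness says that the
  \<open>X\<^sub>i\<close> form a global frame complementary to \<open>\<Sigma>\<close>, so \<open>n = q\<close> and the dual frame \<open>\<omega>\<^sup>i\<close> is a global
  smooth basis of \<open>\<C>\<close>.  Hence an element of \<open>\<Phi>\<^sup>r\<^sup>,\<^sup>s\<close> is the same as an alternating family of elements
  of \<open>\<Phi>\<^sup>0\<^sup>,\<^sup>s\<close> indexed by \<open>r\<close>-tuples of basis vectors, namely its values on the \<open>X\<^sub>i\<close>.  Evaluation on
  automorphisms commutes with \<open>d\<^sub>H\<close>, so the same holds for classes modulo \<open>d\<^sub>H\<close>, which is the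
  bijection \<open>\<Xi>\<^sup>r \<cong> C\<^sup>r(g, \<Xi>\<^sup>0)\<close>.

  For an automorphism \<open>\<xi>\<close> the functions \<open>\<omega>\<^sup>i(\<xi>)\<close> are first integrals: \<open>[\<eta>, \<xi>]\<close> and \<open>[\<eta>, X\<^sub>i]\<close> lie in
  \<open>\<B>\<close> for \<open>\<eta> \<in> \<B>\<close>.  The vertical differential is \<open>\<I>\<close>-multilinear and, by Cartan's
  formula and because \<open>p\<close> is the top horizontal degree, it vanishes modulo \<open>d\<^sub>H\<close> when one argument
  is in \<open>\<B>\<close>.  So it is determined by its values on the \<open>X\<^sub>i\<close>, where it is the
  Chevalley--Eilenberg differential; this also shows that \<open>d\<^sub>V\<close> is well defined.\<close>

section \<open>Differential calculus\<close>

text \<open>Tangent vectors are derivations of the globally smooth functions, whereas charts and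
  generators of \<open>S\<close> are local. Hence local formulas are multiplied by bump functions
  before a derivation is applied, and the dual frame is built locally and glued by uniqueness. The
  analysis serves two facts: dim T_x M is at most the dimension of the model space, and the value of
  a horizontal form at x depends only on the values of its arguments at x. Together they make
  horizontal forms of degree p + 1 vanish, which is what reduces Cartan's formula to exactness of
  the Lie derivative along \<B>.

  Lie derivative and differential occur on ordinary forms, horizontally and vertically; one abstract
  calculus covers all three, with Cartan's formula as a recursion for the differential in the
  degree. The vertical instance takes values in \<open>Phi\<close> of bidegree (0, p), not in
  classes, so its identities hold exactly and quotients enter only at the end.

  Sums over the frame run over all r-tuples of indices, not only increasing ones. This is the origin
  of the factors 1/r!, and it allows arbitrary choices of primitives to be antisymmetrised
  afterwards.\<close>

lemma frechet_derivative_eqI: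
  "(f has_derivative f') (at x) \<Longrightarrow> frechet_derivative f (at x) = f'"
  by (rule frechet_derivative_at[symmetric])

text \<open>Openness matters because \<open>Ck_on\<close> uses derivatives in the full space, which
  depend on the values in a whole neighbourhood of the point.\<close>

lemma Ck_on_cong:
  assumes "open U" "\<And>x. x \<in> U \<Longrightarrow> f x = g x"
  shows "Ck_on k U f \<longleftrightarrow> Ck_on k U g"
proof -
  have *: "Ck_on k U g" if "Ck_on k U f" "\<And>x. x \<in> U \<Longrightarrow> f x = g x" for f g :: "'a \<Rightarrow> 'b"
    using that
  proof (induction k arbitrary: f g)
    case 0
    then show ?case by (simp cong: continuous_on_cong)
  next
    case (Suc k)
    have d: "(g has_derivative frechet_derivative f (at x)) (at x)" if "x \<in> U" for x
      using has_derivative_transform_within_open[OF _ assms(1) that]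
        Suc.prems that by (metis Ck_on.simps(2) frechet_derivative_works)
    show ?case
      unfolding Ck_on.simps
    proof (intro conjI ballI allI)
      fix x assume "x \<in> U"
      then show "g differentiable (at x)" using d differentiable_def by blast
    next
      fix v
      show "Ck_on k U (\<lambda>x. frechet_derivative g (at x) v)"
      proof (rule Suc.IH[of "\<lambda>x. frechet_derivative f (at x) v"])
        show "frechet_derivative f (at x) v = frechet_derivative g (at x) v" if "x \<in> U" for x
          using frechet_derivative_eqI[OF d[OF that]] by simp
      qed (use Suc.prems in auto)
    qed
  qed
  show ?thesis using *[of f g] *[of g f] assms(2) by auto
qed

text \<open>Lets the derivative be supplied by an explicit formula, so the inductions below never
  unfold \<open>frechet_derivative\<close> of a compound function.\<close>

lemma Ck_on_SucI:
  assumes "open U" "\<And>x. x \<in> U \<Longrightarrow> (f has_derivative f' x) (at x)"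
    and "\<And>v. Ck_on k U (\<lambda>x. f' x v)"
  shows "Ck_on (Suc k) U f"
  unfolding Ck_on.simps
proof (intro conjI ballI allI)
  show "f differentiable (at x)" if "x \<in> U" for x
    using assms(2) that differentiable_def by blast
  fix v
  show "Ck_on k U (\<lambda>x. frechet_derivative f (at x) v)"
    using assms(3)[of v] Ck_on_cong[OF assms(1), of "\<lambda>x. frechet_derivative f (at x) v" "\<lambda>x. f' x v" k]
      frechet_derivative_eqI[OF assms(2)] by auto
qed

lemma Ck_on_SucD:
  assumes "Ck_on (Suc k) U f"
  shows "\<And>x. x \<in> U \<Longrightarrow> (f has_derivative frechet_derivative f (at x)) (at x)"
    and "\<And>v. Ck_on k U (\<lambda>x. frechet_derivative f (at x) v)"
  using assms by (auto simp: frechet_derivative_works)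

lemma Ck_on_lower: "Ck_on (Suc k) U f \<Longrightarrow> Ck_on k U f"
proof (induction k arbitrary: f)
  case 0
  then show ?case
    by (auto intro!: continuous_at_imp_continuous_on differentiable_imp_continuous_within)
next
  case (Suc k)
  show ?case unfolding Ck_on.simps(2)[of k]
    using Suc.prems Suc.IH by (simp only: Ck_on.simps(2)[of "Suc k"]) blast
qed

lemma Ck_on_subset: "Ck_on k U f \<Longrightarrow> V \<subseteq> U \<Longrightarrow> Ck_on k V f"
  by (induction k arbitrary: f) (auto intro: continuous_on_subset)

lemma Ck_on_local:
  assumes "\<And>x. x \<in> U \<Longrightarrow> \<exists>V. open V \<and> x \<in> V \<and> Ck_on k V f"
  shows "Ck_on k U f"
  using assms
proof (induction k arbitrary: f)
  case 0
  have "continuous (at x within U) f" if x: "x \<in> U" for x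
  proof -
    obtain V where "open V" "x \<in> V" "continuous_on V f" using 0[OF x] by auto
    then have "continuous (at x) f" by (simp add: continuous_on_eq_continuous_at)
    then show ?thesis by (rule continuous_at_imp_continuous_at_within)
  qed
  then show ?case by (simp add: continuous_on_eq_continuous_within)
next
  case (Suc k)
  show ?case unfolding Ck_on.simps(2)
  proof (intro conjI ballI allI)
    show "f differentiable (at x)" if "x \<in> U" for x using Suc.prems[OF that] by auto
    show "Ck_on k U (\<lambda>x. frechet_derivative f (at x) v)" for v
    proof (rule Suc.IH)
      fix x assume "x \<in> U"
      from Suc.prems[OF this] obtain V where "open V" "x \<in> V" "Ck_on (Suc k) V f" by blast
      then show "\<exists>V. open V \<and> x \<in> V \<and> Ck_on k V (\<lambda>x. frechet_derivative f (at x) v)" by auto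
    qed
  qed
qed

lemma Ck_on_const [simp]: "open U \<Longrightarrow> Ck_on k U (\<lambda>x. c)"
proof (induction k arbitrary: c)
  case (Suc k)
  show ?case by (rule Ck_on_SucI[where f' = "\<lambda>x v. 0"]) (use Suc in auto)
qed auto

lemma Ck_on_bounded_linear:
  assumes "open U" "bounded_linear l"
  shows "Ck_on k U f \<Longrightarrow> Ck_on k U (\<lambda>x. l (f x))"
proof (induction k arbitrary: f)
  case 0
  then show ?case using assms(2) by (auto intro: bounded_linear.continuous_on)
next
  case (Suc k)
  show ?case
    by (rule Ck_on_SucI[where f' = "\<lambda>x v. l (frechet_derivative f (at x) v)", OF assms(1)
          bounded_linear.has_derivative[OF assms(2)]])
      (use Ck_on_SucD[OF Suc.prems] Suc.IH in blast)+
qed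

lemma Ck_on_add:
  assumes "open U"
  shows "Ck_on k U f \<Longrightarrow> Ck_on k U g \<Longrightarrow> Ck_on k U (\<lambda>x. f x + g x)"
proof (induction k arbitrary: f g)
  case 0
  then show ?case by (auto intro: continuous_intros)
next
  case (Suc k)
  show ?case
    by (rule Ck_on_SucI[where f' = "\<lambda>x v. frechet_derivative f (at x) v + frechet_derivative g (at x) v", OF assms(1)])
      (use Ck_on_SucD[OF Suc.prems(1)] Ck_on_SucD[OF Suc.prems(2)] Suc.IH in
        \<open>blast intro: has_derivative_add\<close>)+
qed

lemma Ck_on_mult:
  fixes f g :: "'a::real_normed_vector \<Rightarrow> real"
  assumes "open U"
  shows "Ck_on k U f \<Longrightarrow> Ck_on k U g \<Longrightarrow> Ck_on k U (\<lambda>x. f x * g x)"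
proof (induction k arbitrary: f g)
  case 0
  then show ?case by (auto intro: continuous_intros)
next
  case (Suc k)
  show ?case
    by (rule Ck_on_SucI[where f' = "\<lambda>x v. f x * frechet_derivative g (at x) v + frechet_derivative f (at x) v * g x",
          OF assms(1) has_derivative_mult Ck_on_add[OF assms(1) Suc.IH Suc.IH]])
      (use Ck_on_SucD[OF Suc.prems(1)] Ck_on_SucD[OF Suc.prems(2)] Ck_on_lower[OF Suc.prems(1)] Ck_on_lower[OF Suc.prems(2)] in blast)+
qed

lemma Ck_on_sum:
  assumes "open U" "\<And>i. i \<in> I \<Longrightarrow> Ck_on k U (f i)"
  shows "Ck_on k U (\<lambda>x. \<Sum>i\<in>I. f i x)"
  using assms by (induction I rule: infinite_finite_induct) (auto intro!: Ck_on_add)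

text \<open>The derivative of 1/f is - (1/f) f' (1/f), whose factors 1/f are already of class k by
  induction.\<close>

lemma Ck_on_inverse:
  fixes f :: "'a::real_normed_vector \<Rightarrow> real"
  assumes "open U" "\<And>x. x \<in> U \<Longrightarrow> f x \<noteq> 0"
  shows "Ck_on k U f \<Longrightarrow> Ck_on k U (\<lambda>x. inverse (f x))"
proof (induction k)
  case 0
  then show ?case using assms by (auto intro: continuous_intros)
next
  case (Suc k)
  have *: "Ck_on k U (\<lambda>x. inverse (f x))" by (rule Suc.IH[OF Ck_on_lower[OF Suc.prems]])
  show ?case
  proof (rule Ck_on_SucI[where f' = "\<lambda>x v. - 1 * (inverse (f x) * frechet_derivative f (at x) v * inverse (f x))", OF assms(1)])
    show "((\<lambda>x. inverse (f x)) has_derivative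
        (\<lambda>v. - 1 * (inverse (f x) * frechet_derivative f (at x) v * inverse (f x)))) (at x)" if "x \<in> U" for x
      using Deriv.has_derivative_inverse[OF assms(2)[OF that] Ck_on_SucD(1)[OF Suc.prems that]] by simp
    show "Ck_on k U (\<lambda>x. - 1 * (inverse (f x) * frechet_derivative f (at x) v * inverse (f x)))" for v
      by (intro Ck_on_mult * Ck_on_const assms(1) Ck_on_SucD(2)[OF Suc.prems])
  qed
qed

text \<open>Orthonormality is encoded by the expansion of every vector, the form in which it is
  used; the cardinality later bounds dim T_x M. In dimension 0 the basis is empty.\<close>

definition onb :: "'a::real_inner set \<Rightarrow> bool" where
  "onb B \<longleftrightarrow> finite B \<and> card B = dim (UNIV :: 'a set) \<and> (\<forall>x. (\<Sum>b\<in>B. (x \<bullet> b) *\<^sub>R b) = x) \<and> (\<forall>b\<in>B. norm b = 1)"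

lemma onb_exists:
  assumes "finite B0" "span B0 = (UNIV :: 'a::real_inner set)"
  shows "\<exists>B :: 'a set. onb B"
proof -
  obtain C :: "'a set" where C: "finite C" "span C = UNIV" "pairwise orthogonal C"
    using basis_orthogonal[OF assms(1)] unfolding assms(2) by blast
  define B where "B = (\<lambda>c. c /\<^sub>R norm c) ` (C - {0})"
  have fin: "finite B" using C by (simp add: B_def)
  have n: "norm b = 1" if b: "b \<in> B" for b
  proof -
    obtain c where "b = c /\<^sub>R norm c" "c \<in> C - {0}" using b unfolding B_def by (rule imageE)
    then show ?thesis by simp
  qed
  have orth: "b \<bullet> c = 0" if bc: "b \<in> B" "c \<in> B" "b \<noteq> c" for b c
  proof -
    obtain c1 where c1: "b = c1 /\<^sub>R norm c1" "c1 \<in> C - {0}" using bc(1) unfolding B_def by (rule imageE)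
    obtain c2 where c2: "c = c2 /\<^sub>R norm c2" "c2 \<in> C - {0}" using bc(2) unfolding B_def by (rule imageE)
    have "c1 \<noteq> c2" using bc(3) c1 c2 by blast
    then have "c1 \<bullet> c2 = 0" using C(3) c1 c2 unfolding pairwise_def orthogonal_def by blast
    then show ?thesis using c1 c2 by simp
  qed
  have po: "pairwise orthogonal B" using orth by (auto simp: pairwise_def orthogonal_def)
  have "span (C - {0}) \<subseteq> span B"
  proof (rule span_minimal)
    show "C - {0} \<subseteq> span B"
    proof
      fix c assume c: "c \<in> C - {0}"
      then have "norm c *\<^sub>R (c /\<^sub>R norm c) \<in> span B"
        by (intro span_scale span_base) (auto simp: B_def)
      then show "c \<in> span B" using c by simp
    qed
  qed auto
  then have sp: "span B = UNIV" using C(2) by (simp add: span_delete_0 top.extremum_unique)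
  have "0 \<notin> B" using n[of 0] by auto
  then have ind: "independent B" using po pairwise_orthogonal_independent by blast
  have card: "card B = dim (UNIV::'a set)" using dim_eq_card[of B UNIV] ind sp by simp
  have "(\<Sum>b\<in>B. (x \<bullet> b) *\<^sub>R b) = x" for x
  proof -
    have "x \<in> span B" unfolding sp by simp
    then show ?thesis
    proof (induction rule: span_induct_alt)
      case base
      then show ?case by simp
    next
      case (step c b y)
      have "(\<Sum>a\<in>B. (b \<bullet> a) *\<^sub>R a) = (\<Sum>a\<in>B. if a = b then b else 0)"
      proof (rule sum.cong[OF refl])
        fix a assume a: "a \<in> B"
        show "(b \<bullet> a) *\<^sub>R a = (if a = b then b else 0)"
        proof (cases "a = b")
          case True
          have "b \<bullet> b = 1" using n[OF step(1)] by (simp add: norm_eq_1)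
          then show ?thesis using True by simp
        next
          case False
          then have "b \<bullet> a = 0" using orth[OF step(1) a] by simp
          then show ?thesis using False by simp
        qed
      qed
      also have "\<dots> = b" using fin step(1) by simp
      finally have *: "(\<Sum>a\<in>B. (b \<bullet> a) *\<^sub>R a) = b" .
      have "(\<Sum>a\<in>B. ((c *\<^sub>R b + y) \<bullet> a) *\<^sub>R a) = c *\<^sub>R (\<Sum>a\<in>B. (b \<bullet> a) *\<^sub>R a) + (\<Sum>a\<in>B. (y \<bullet> a) *\<^sub>R a)"
        by (simp add: inner_add_left scaleR_add_left sum.distrib scaleR_sum_right)
      then show ?case using * step(2) by simp
    qed
  qed
  then have "onb B" unfolding onb_def using fin card n by simp
  then show ?thesis by (rule exI)
qed

lemma onb_bounded_linear_eq:
  assumes "onb B" "linear l"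
  shows "l x = (\<Sum>b\<in>B. (x \<bullet> b) *\<^sub>R l b)"
proof -
  have "l (\<Sum>b\<in>B. (x \<bullet> b) *\<^sub>R b) = (\<Sum>b\<in>B. (x \<bullet> b) *\<^sub>R l b)"
    by (simp add: linear_sum[OF assms(2)] linear_cmul[OF assms(2)])
  then show ?thesis using assms(1) unfolding onb_def by simp
qed

text \<open>A box of coefficients gives a finite Minkowski sum of compact segments. It is used to
  show that closed balls of the model space are compact.\<close>

lemma compact_coefficient_box:
  fixes C :: "'a::real_normed_vector set"
  assumes "finite C" "K \<ge> 0"
  shows "compact {v. \<exists>c. v = (\<Sum>b\<in>C. c b *\<^sub>R b) \<and> (\<forall>b. \<bar>c b\<bar> \<le> K)}" (is "compact (?T C)")
  using assms(1)
proof (induction C rule: finite_induct)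
  case empty
  have "\<exists>c::'a \<Rightarrow> real. \<forall>b. \<bar>c b\<bar> \<le> K" by (rule exI[of _ "\<lambda>_. 0"]) (use assms(2) in simp)
  then have "?T {} = {0}" by simp
  then show ?case by simp
next
  case (insert b C)
  have eq: "?T (insert b C) = {x + y |x y. x \<in> (\<lambda>t. t *\<^sub>R b) ` {-K..K} \<and> y \<in> ?T C}" (is "_ = ?R")
  proof (intro equalityI subsetI)
    fix z assume "z \<in> ?T (insert b C)"
    then obtain c where c: "z = (\<Sum>b\<in>insert b C. c b *\<^sub>R b)" "\<forall>b. \<bar>c b\<bar> \<le> K" by blast
    have "z = c b *\<^sub>R b + (\<Sum>b\<in>C. c b *\<^sub>R b)" using c(1) insert.hyps by simp
    moreover have "\<bar>c b\<bar> \<le> K" using c(2) by blast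
    then have "c b \<in> {-K..K}" by (simp add: abs_le_iff)
    ultimately show "z \<in> ?R" using c(2) by blast
  next
    fix z assume "z \<in> ?R"
    then obtain t c where c: "z = t *\<^sub>R b + (\<Sum>b\<in>C. c b *\<^sub>R b)" "\<forall>b. \<bar>c b\<bar> \<le> K" "t \<in> {-K..K}"
      by blast
    have "(\<Sum>a\<in>C. (c(b:=t)) a *\<^sub>R a) = (\<Sum>a\<in>C. c a *\<^sub>R a)"
      using insert.hyps by (intro sum.cong) auto
    then have "z = (\<Sum>a\<in>insert b C. (c(b:=t)) a *\<^sub>R a)" using c(1) insert.hyps by simp
    moreover have "\<bar>(c(b:=t)) a\<bar> \<le> K" for a
      using c(2)[rule_format, of a] c(3) by (simp add: abs_le_iff)
    ultimately show "z \<in> ?T (insert b C)" by blast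
  qed
  have "compact ((\<lambda>t. t *\<^sub>R b) ` {-K..K})"
    by (intro compact_continuous_image continuous_intros compact_Icc)
  from compact_sums[OF this insert.IH] show ?case unfolding eq .
qed

lemma onb_compact_cball:
  fixes x0 :: "'a::real_inner"
  assumes B: "onb (B :: 'a set)"
  shows "compact (cball x0 r)"
proof -
  let ?T = "\<lambda>K. {v. \<exists>c. v = (\<Sum>b\<in>B. c b *\<^sub>R b) \<and> (\<forall>b. \<bar>c b\<bar> \<le> K)}"
  have fin: "finite B" using B unfolding onb_def by auto
  have sub: "cball 0 r \<subseteq> ?T (max r 0)" for r
  proof
    fix x :: 'a assume x: "x \<in> cball 0 r"
    \<comment> \<open>The bound in \<open>?T\<close> concerns every index, also those outside
      \<open>B\<close>, so the coefficients are set to 0 there.\<close>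
    have "(\<Sum>b\<in>B. (if b \<in> B then x \<bullet> b else 0) *\<^sub>R b) = (\<Sum>b\<in>B. (x \<bullet> b) *\<^sub>R b)"
      by (intro sum.cong) auto
    also have "\<dots> = x" using B unfolding onb_def by simp
    finally have "x = (\<Sum>b\<in>B. (if b \<in> B then x \<bullet> b else 0) *\<^sub>R b)" by simp
    moreover have "\<bar>x \<bullet> b\<bar> \<le> max r 0" if "b \<in> B" for b
    proof -
      have "norm b = 1" using B that unfolding onb_def by blast
      then have "\<bar>x \<bullet> b\<bar> \<le> norm x" using Cauchy_Schwarz_ineq2[of x b] by simp
      then show ?thesis using x by simp
    qed
    ultimately show "x \<in> ?T (max r 0)"
      by (intro CollectI exI[of _ "\<lambda>b. if b \<in> B then x \<bullet> b else 0"]) auto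
  qed
  have "compact (?T (max r 0) \<inter> cball 0 r)"
    by (intro compact_Int_closed compact_coefficient_box fin) auto
  then have "compact (cball (0::'a) r)"
    using sub[of r] by (simp add: inf.absorb2)
  then have "compact ((+) x0 ` cball 0 r)" by (rule compact_translation)
  then show ?thesis by simp
qed

text \<open>\<open>Ck_on\<close> controls derivatives in fixed directions, but the chain rule
  differentiates \<open>f\<close> in the moving direction dg(v). Expanding dg(v) in the basis leaves
  only partial derivatives of \<open>f\<close> in fixed directions, to which the induction
  applies.\<close>

lemma Ck_on_compose:
  fixes f :: "'b::real_inner \<Rightarrow> real" and g :: "'a::real_normed_vector \<Rightarrow> 'b"
  assumes "onb (B :: 'b set)" "open U" "open V" "g ` U \<subseteq> V"
  shows "Ck_on k V f \<Longrightarrow> Ck_on k U g \<Longrightarrow> Ck_on k U (\<lambda>x. f (g x))"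
proof (induction k arbitrary: f)
  case 0
  then show ?case using assms(4) by (auto intro: continuous_on_compose2)
next
  case (Suc k)
  define f' where "f' x v = (\<Sum>b\<in>B. (frechet_derivative g (at x) v \<bullet> b) * frechet_derivative f (at (g x)) b)" for x v
  show ?case
  proof (rule Ck_on_SucI[where f' = f', OF assms(2)])
    fix x assume x: "x \<in> U"
    have df: "(f has_derivative frechet_derivative f (at (g x))) (at (g x))"
      using Ck_on_SucD(1)[OF Suc.prems(1)] assms(4) x by blast
    have l: "linear (frechet_derivative f (at (g x)))" using df has_derivative_linear by blast
    have "f' x = (\<lambda>v. frechet_derivative f (at (g x)) (frechet_derivative g (at x) v))"
      unfolding f'_def
      by (rule ext) (subst (2) onb_bounded_linear_eq[OF assms(1) l], simp)
    then show "((\<lambda>x. f (g x)) has_derivative f' x) (at x)"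
      using has_derivative_compose[OF Ck_on_SucD(1)[OF Suc.prems(2) x] df] by simp
  next
    fix v
    have "Ck_on k U (\<lambda>x. frechet_derivative g (at x) v \<bullet> b)" for b
      by (rule Ck_on_bounded_linear[OF assms(2) bounded_linear_inner_left]) 
        (use Ck_on_SucD(2)[OF Suc.prems(2)] in blast)
    moreover have "Ck_on k U (\<lambda>x. frechet_derivative f (at (g x)) b)" for b
      by (rule Suc.IH) (use Ck_on_SucD(2)[OF Suc.prems(1)] Ck_on_lower[OF Suc.prems(2)] in blast)+
    ultimately show "Ck_on k U (\<lambda>x. f' x v)"
      unfolding f'_def by (intro Ck_on_sum Ck_on_mult assms(2))
  qed
qed

lemma Ck_on_id:
  assumes "open U" shows "Ck_on k U (\<lambda>x. x)"
proof (cases k)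
  case 0
  then show ?thesis by (auto intro: continuous_intros)
next
  case (Suc n)
  show ?thesis unfolding Suc
    by (rule Ck_on_SucI[where f' = "\<lambda>x v. v", OF assms]) (use assms in \<open>auto intro!: derivative_intros\<close>)
qed

text \<open>The derivative of \<open>t\<^sup>-\<^sup>n exp (-1/t)\<close> is a combination of two functions of the same shape.\<close>

definition flat :: "nat \<Rightarrow> real \<Rightarrow> real" where
  "flat n t = (if t > 0 then (1 / t) ^ n * exp (- (1 / t)) else 0)"

lemma flat_tendsto: "((\<lambda>t. flat n t) \<longlongrightarrow> 0) (at 0)"
proof (rule filterlim_split_at)
  show "(flat n \<longlongrightarrow> 0) (at_left 0)"
    by (rule Lim_transform_eventually[where f = "\<lambda>_. 0"])
      (auto simp: flat_def eventually_at_filter)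
  have "((\<lambda>t::real. (1 / t) ^ n * exp (- (1 / t))) \<longlongrightarrow> 0) (at_right 0)"
    by real_asymp
  then show "(flat n \<longlongrightarrow> 0) (at_right 0)"
    by (rule Lim_transform_eventually) (auto simp: flat_def eventually_at_filter)
qed

lemma flat_deriv: "(flat n has_real_derivative (flat (n + 2) t - n * flat (n + 1) t)) (at t)"
proof -
  consider "t > 0" | "t < 0" | "t = 0" by linarith
  then show ?thesis
  proof cases
    case 1
    have "((\<lambda>t. (1 / t) ^ n * exp (- (1 / t))) has_real_derivative (flat (n + 2) t - n * flat (n + 1) t)) (at t)"
    proof -
      have *: "((\<lambda>t. 1 / t) has_real_derivative - ((1 / t) * (1 / t))) (at t)"
        using 1 by (auto intro!: derivative_eq_intros)
      have "((\<lambda>t. (1 / t) ^ n * exp (- (1 / t))) has_real_derivative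
          (n * (1 / t) ^ (n - 1) * - ((1 / t) * (1 / t)) * exp (- (1 / t)) +
          exp (- (1 / t)) * - (- ((1 / t) * (1 / t))) * (1 / t) ^ n)) (at t)"
        using DERIV_mult[OF DERIV_power[OF *, of n] DERIV_chain2[OF DERIV_exp DERIV_minus[OF *]]]
        by (simp add: mult_ac)
      also have "n * (1 / t) ^ (n - 1) * - ((1 / t) * (1 / t)) * exp (- (1 / t)) +
          exp (- (1 / t)) * - (- ((1 / t) * (1 / t))) * (1 / t) ^ n = flat (n + 2) t - n * flat (n + 1) t"
        using 1 by (cases n) (simp_all add: flat_def power_add power2_eq_square mult_ac del: power_one_over)
      finally show ?thesis .
    qed
    then show ?thesis
      by (rule has_field_derivative_transform_within_open[of _ _ _ "{0<..}"])
        (use 1 in \<open>auto simp: flat_def\<close>)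
  next
    case 2
    have "((\<lambda>t. 0) has_real_derivative (flat (n + 2) t - n * flat (n + 1) t)) (at t)"
      using 2 by (auto simp: flat_def)
    then show ?thesis
      by (rule has_field_derivative_transform_within_open[of _ _ _ "{..<0}"])
        (use 2 in \<open>auto simp: flat_def\<close>)
  next
    case 3
    \<comment> \<open>The difference quotient of \<open>flat n\<close> at 0 is
      \<open>flat (Suc n)\<close>, so the limit is the one just computed.\<close>
    have "((\<lambda>h. (flat n (0 + h) - flat n 0) / h) \<longlongrightarrow> 0) (at 0)"
      by (rule Lim_transform_eventually[OF flat_tendsto[of "Suc n"]])
        (auto simp: flat_def eventually_at_filter field_simps)
    then show ?thesis using 3 by (simp add: DERIV_def flat_def)
  qed
qed

lemma Ck_on_flat: "Ck_on k UNIV (flat n)"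
proof (induction k arbitrary: n)
  case 0
  then show ?case
    by (auto intro!: continuous_at_imp_continuous_on DERIV_isCont flat_deriv)
next
  case (Suc k)
  show ?case
  proof (rule Ck_on_SucI[where f' = "\<lambda>t v. (flat (n + 2) t + (- n) * flat (n + 1) t) * v"])
    show "(flat n has_derivative (\<lambda>v. (flat (n + 2) t + (- n) * flat (n + 1) t) * v)) (at t)" for t
      using flat_deriv[of n t] by (simp add: has_field_derivative_def)
    show "Ck_on k UNIV (\<lambda>x. (flat (n + 2) x + (- n) * flat (n + 1) x) * v)" for v
      by (intro Ck_on_mult Ck_on_add Suc) auto
  qed auto
qed

text \<open>In an orthonormal basis the squared norm is a polynomial in the coordinates, so this is
  a composition of \<open>flat 0\<close> with a smooth function.\<close>

lemma bump_Ck: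
  fixes x0 :: "'a::real_inner"
  assumes "onb (B :: 'a set)"
  shows "Ck_on k UNIV (\<lambda>x. flat 0 (r\<^sup>2 - (norm (x - x0))\<^sup>2))"
proof -
  have R: "onb {1::real}" by (auto simp: onb_def)
  have i: "Ck_on k UNIV (\<lambda>x::'a. x + (- x0))" by (intro Ck_on_add Ck_on_id Ck_on_const) auto
  have c: "Ck_on k UNIV (\<lambda>x. (x + - x0) \<bullet> b)" for b
    by (rule Ck_on_bounded_linear[OF _ bounded_linear_inner_left i]) auto
  have "Ck_on k UNIV (\<lambda>x. \<Sum>b\<in>B. ((x + - x0) \<bullet> b) * ((x + - x0) \<bullet> b))"
    by (intro Ck_on_sum Ck_on_mult c) auto
  moreover have "(norm y)\<^sup>2 = (\<Sum>b\<in>B. (y \<bullet> b) * (y \<bullet> b))" for y :: 'a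
  proof -
    have "y \<bullet> y = y \<bullet> (\<Sum>b\<in>B. (y \<bullet> b) *\<^sub>R b)" using assms unfolding onb_def by simp
    then show ?thesis by (simp add: inner_sum_right power2_norm_eq_inner)
  qed
  ultimately have "Ck_on k UNIV (\<lambda>x. (norm (x + - x0))\<^sup>2)" by simp
  then have "Ck_on k UNIV (\<lambda>x. r\<^sup>2 + (-1) * (norm (x + - x0))\<^sup>2)"
    by (intro Ck_on_add Ck_on_mult Ck_on_const) auto
  then have "Ck_on k UNIV (\<lambda>x. flat 0 (r\<^sup>2 + (-1) * (norm (x + - x0))\<^sup>2))"
    by (intro Ck_on_compose[OF R _ _ _ Ck_on_flat]) auto
  then show ?thesis by simp
qed

section \<open>Differentiation under the integral sign and Hadamard's lemma\<close>

lemma Ck_on_continuous: "Ck_on k U f \<Longrightarrow> continuous_on U f"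
  by (induction k arbitrary: f) (auto dest: Ck_on_lower simp del: Ck_on.simps(2))

text \<open>Each derivative in z pulls out one factor t; the weight \<open>t ^ m\<close> is carried
  in the statement so that the induction on \<open>k\<close> closes.\<close>

lemma param_integral_Ck:
  fixes F :: "'a::real_inner \<Rightarrow> real"
  assumes B: "onb (B :: 'a set)" and W: "open W" "convex W" "y \<in> W" and F: "\<And>k. Ck_on k W F"
  shows "Ck_on k W (\<lambda>z. integral {0..1} (\<lambda>t. t ^ m * F (y + t *\<^sub>R (z - y))))"
  using F
proof (induction k arbitrary: F m)
  case (0 F)
  have seg: "y + t *\<^sub>R (z - y) \<in> W" if "z \<in> W" "t \<in> {0..1}" for z t
    using convexD_alt[OF W(2,3) that(1), of t] that by (simp add: algebra_simps)
  have "continuous_on (W \<times> {0..1}) (\<lambda>(z, t). t ^ m * F (y + t *\<^sub>R (z - y)))"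
    unfolding split_def
    by (intro continuous_on_mult continuous_on_compose2[OF Ck_on_continuous[OF 0[of 0]]] continuous_intros) (use seg in auto)
  then show ?case
    using integral_continuous_on_param[of W 0 "1::real" "\<lambda>z t. t ^ m * F (y + t *\<^sub>R (z - y))"] by simp
next
  case (Suc k F)
  note F = Suc.prems
  have finB: "finite B" and nB: "\<And>b. b \<in> B \<Longrightarrow> norm b = 1" using B by (auto simp: onb_def)
  have seg: "y + t *\<^sub>R (z - y) \<in> W" if "z \<in> W" "t \<in> {0..1}" for z t
    using convexD_alt[OF W(2,3) that(1), of t] that by (simp add: algebra_simps)
  define D where "D b x = frechet_derivative F (at x) b" for b x
  have D: "Ck_on j W (D b)" for b j unfolding D_def using Ck_on_SucD(2)[OF F[of "Suc j"]] by blast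
  have dF: "(F has_derivative (\<lambda>h. \<Sum>b\<in>B. (h \<bullet> b) * D b x)) (at x)" if x: "x \<in> W" for x
  proof -
    have d: "(F has_derivative frechet_derivative F (at x)) (at x)"
      using Ck_on_SucD(1)[OF F[of "Suc 0"] x] .
    have "frechet_derivative F (at x) = (\<lambda>h. \<Sum>b\<in>B. (h \<bullet> b) * D b x)"
      unfolding D_def
      by (rule ext, subst onb_bounded_linear_eq[OF B has_derivative_linear[OF d]]) simp
    then show ?thesis using d by simp
  qed
  define G where "G z = integral {0..1} (\<lambda>t. t ^ m * F (y + t *\<^sub>R (z - y)))" for z
  define H where "H b z = integral {0..1} (\<lambda>t. t ^ Suc m * D b (y + t *\<^sub>R (z - y)))" for b z
  have H: "Ck_on k W (H b)" for b unfolding H_def by (rule Suc.IH[OF D])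
  have int: "(\<lambda>t. t ^ n * f (y + t *\<^sub>R (z - y))) integrable_on {0..1}" if "z \<in> W" "\<And>j. Ck_on j W f" for n f z
    by (intro integrable_continuous_interval continuous_on_mult
        continuous_on_compose2[OF Ck_on_continuous[OF that(2)[of 0]]] continuous_intros) (use seg that in auto)
  have cD: "continuous_on X (\<lambda>x. D b (u x))" if "continuous_on X u" "\<And>x. x \<in> X \<Longrightarrow> u x \<in> W"
    for X :: "('a \<times> real) set" and u b
    by (rule continuous_on_compose2[OF Ck_on_continuous[OF D[of 0]] that(1)]) (use that(2) in auto)
  have "Ck_on (Suc k) W G"
  proof (rule Ck_on_SucI[where f' = "\<lambda>z h. \<Sum>b\<in>B. (h \<bullet> b) * H b z", OF W(1)])
    show "Ck_on k W (\<lambda>z. \<Sum>b\<in>B. (v \<bullet> b) * H b z)" for v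
      by (intro Ck_on_sum Ck_on_mult W Ck_on_const H)
    fix z assume z: "z \<in> W"
    show "(G has_derivative (\<lambda>h. \<Sum>b\<in>B. (h \<bullet> b) * H b z)) (at z)"
      unfolding has_derivative_at_alt
    proof (intro conjI allI impI)
      show "bounded_linear (\<lambda>h. \<Sum>b\<in>B. (h \<bullet> b) * H b z)"
        by (intro bounded_linear_sum bounded_linear_compose[OF bounded_linear_mult_left bounded_linear_inner_left])
      fix e :: real assume e: "e > 0"
      \<comment> \<open>The total change of the partial derivatives between z and z'. It vanishes at
        z' = z, and compactness of the parameter interval makes it small near z uniformly in
        t.\<close>
      define fx where "fx = (\<lambda>(z', t). \<Sum>b\<in>B. \<bar>D b (y + t *\<^sub>R (z' - y)) - D b (y + t *\<^sub>R (z - y))\<bar>)"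
      have "continuous_on (W \<times> {0..1}) fx"
        unfolding fx_def split_def
        by (intro continuous_on_sum continuous_on_rabs continuous_on_diff cD continuous_intros)
          (use seg z in auto)
      then obtain X0 where X0: "z \<in> X0" "open X0"
        "\<forall>x\<in>X0 \<inter> W. \<forall>t\<in>{0..1}. dist (fx (x, t)) (fx (z, t)) \<le> e"
        using continuous_on_prod_compactE[of W "{0..1}" fx z e] z e by auto
      obtain d where d: "d > 0" "ball z d \<subseteq> X0 \<inter> W"
        using openE[of "X0 \<inter> W" z] X0 W z by auto
      show "\<exists>d>0. \<forall>z'. norm (z' - z) < d \<longrightarrow>
          norm (G z' - G z - (\<Sum>b\<in>B. ((z' - z) \<bullet> b) * H b z)) \<le> e * norm (z' - z)"
      proof (intro exI[of _ d] conjI allI impI d(1))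
        fix z' assume z': "norm (z' - z) < d"
        define h where "h = z' - z"
        have zs: "z + s *\<^sub>R h \<in> X0 \<inter> W" if s: "s \<in> {0..1}" for s
        proof -
          have "norm (s *\<^sub>R h) \<le> 1 * norm h" using s by (simp add: mult_left_le_one_le)
          then have "z + s *\<^sub>R h \<in> ball z d" using z' by (simp add: h_def dist_norm)
          then show ?thesis using d by blast
        qed
        have z'W: "z' \<in> W" using zs[of 1] by (simp add: h_def)
        let ?E = "\<lambda>t. t ^ m * F (y + t *\<^sub>R (z' - y)) - t ^ m * F (y + t *\<^sub>R (z - y)) -
          (\<Sum>b\<in>B. (h \<bullet> b) * (t ^ Suc m * D b (y + t *\<^sub>R (z - y))))"
        have E: "norm (?E t) \<le> e * norm h" if t: "t \<in> {0..1}" for t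
        proof -
          \<comment> \<open>For fixed t, the segment joining the two arguments of \<open>F\<close>;
            the mean value theorem along it expresses the error \<open>?E t\<close> by increments of
            the partial derivatives.\<close>
          define w where "w s = y + t *\<^sub>R (z + s *\<^sub>R h - y)" for s
          have wW: "w s \<in> W" if "s \<in> {0..1}" for s
            unfolding w_def using seg[OF _ t] zs[OF that] by blast
          have dw: "((\<lambda>s. F (w s)) has_derivative (\<lambda>u. \<Sum>b\<in>B. ((u *\<^sub>R (t *\<^sub>R h)) \<bullet> b) * D b (w s))) (at s)"
            if "s \<in> {0..1}" for s
          proof -
            have "(w has_derivative (\<lambda>u. u *\<^sub>R (t *\<^sub>R h))) (at s)"
              unfolding w_def by (auto intro!: derivative_eq_intros simp: algebra_simps)
            from has_derivative_compose[OF this dF[OF wW[OF that]]] show ?thesis .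
          qed
          have "\<exists>s\<in>{0<..<1}. F (w 1) - F (w 0) = (\<Sum>b\<in>B. (((1 - 0) *\<^sub>R (t *\<^sub>R h)) \<bullet> b) * D b (w s))"
            by (rule mvt_simple) (use dw in \<open>auto intro: has_derivative_at_withinI\<close>)
          then obtain s where s': "s \<in> {0<..<1}"
            "F (w 1) - F (w 0) = (\<Sum>b\<in>B. (((1 - 0) *\<^sub>R (t *\<^sub>R h)) \<bullet> b) * D b (w s))" by blast
          then have s: "s \<in> {0..1}" "F (w 1) - F (w 0) = (\<Sum>b\<in>B. t * (h \<bullet> b) * D b (w s))"
            by simp_all
          have w0: "w 0 = y + t *\<^sub>R (z - y)" and w1: "w 1 = y + t *\<^sub>R (z' - y)"
            by (simp_all add: w_def h_def)
          have "?E t = t ^ m * (F (w 1) - F (w 0)) - (\<Sum>b\<in>B. (h \<bullet> b) * (t ^ Suc m * D b (w 0)))"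
            by (simp add: w0 w1 right_diff_distrib)
          also have "\<dots> = t ^ Suc m * (\<Sum>b\<in>B. (h \<bullet> b) * (D b (w s) - D b (w 0)))"
            unfolding s(2) by (simp add: sum_distrib_left sum_subtractf[symmetric] algebra_simps)
          finally have "norm (?E t) = t ^ Suc m * \<bar>\<Sum>b\<in>B. (h \<bullet> b) * (D b (w s) - D b (w 0))\<bar>"
            using t by (simp add: abs_mult)
          also have "\<dots> \<le> 1 * (\<Sum>b\<in>B. \<bar>(h \<bullet> b) * (D b (w s) - D b (w 0))\<bar>)"
            using t by (intro mult_mono sum_abs power_le_one) auto
          also have "\<dots> \<le> (\<Sum>b\<in>B. norm h * \<bar>D b (w s) - D b (w 0)\<bar>)"
            unfolding mult_1 abs_mult
          proof (intro sum_mono mult_right_mono)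
            fix b assume "b \<in> B"
            then show "\<bar>h \<bullet> b\<bar> \<le> norm h" using Cauchy_Schwarz_ineq2[of h b] nB by simp
          qed simp
          also have "\<dots> = norm h * fx (z + s *\<^sub>R h, t)"
            by (simp add: fx_def w_def sum_distrib_left)
          also have "\<dots> \<le> norm h * e"
          proof (rule mult_left_mono)
            have "fx (z, t) = 0" by (simp add: fx_def)
            moreover have "dist (fx (z + s *\<^sub>R h, t)) (fx (z, t)) \<le> e"
              using X0(3) zs[OF s(1)] t by blast
            ultimately show "fx (z + s *\<^sub>R h, t) \<le> e" by (simp add: dist_real_def)
          qed simp
          finally show ?thesis by (simp add: mult.commute)
        qed
        have hs: "(?E has_integral G z' - G z - (\<Sum>b\<in>B. (h \<bullet> b) * H b z)) {0..1}"
          unfolding G_def H_def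
          by (intro has_integral_diff has_integral_sum has_integral_mult_right integrable_integral
              int z z'W F D finB)
        have "norm (G z' - G z - (\<Sum>b\<in>B. (h \<bullet> b) * H b z)) \<le> (e * norm h) * measure lborel (cbox 0 (1::real))"
          by (rule has_integral_bound[where f = ?E]) (use e E hs in auto)
        then show "norm (G z' - G z - (\<Sum>b\<in>B. ((z' - z) \<bullet> b) * H b z)) \<le> e * norm (z' - z)"
          by (simp add: h_def)
      qed
    qed
  qed
  then show ?case unfolding G_def .
qed

text \<open>The fundamental theorem of calculus along the segment from y to z; \<open>g b\<close>
  averages the partial derivative in direction b over that segment.\<close>

lemma hadamard:
  fixes f :: "'a::real_inner \<Rightarrow> real"
  assumes B: "onb (B :: 'a set)" and W: "open W" "convex W" "y \<in> W" and f: "\<And>k. Ck_on k W f"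
  obtains g where "\<And>k b. Ck_on k W (g b)" "\<And>b. g b y = frechet_derivative f (at y) b"
    "\<And>z. z \<in> W \<Longrightarrow> f z = f y + (\<Sum>b\<in>B. ((z - y) \<bullet> b) * g b z)"
proof
  have finB: "finite B" using B by (auto simp: onb_def)
  define D where "D b x = frechet_derivative f (at x) b" for b x
  have D: "Ck_on j W (D b)" for b j unfolding D_def using Ck_on_SucD(2)[OF f[of "Suc j"]] by blast
  define g where "g b z = integral {0..1} (\<lambda>t. t ^ 0 * D b (y + t *\<^sub>R (z - y)))" for b z
  show "Ck_on k W (g b)" for k b unfolding g_def by (rule param_integral_Ck[OF B W D])
  show "g b y = frechet_derivative f (at y) b" for b by (simp add: g_def D_def)
  fix z assume z: "z \<in> W"
  have seg: "y + t *\<^sub>R (z - y) \<in> W" if "t \<in> {0..1}" for t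
    using convexD_alt[OF W(2,3) z, of t] that by (simp add: algebra_simps)
  have d: "((\<lambda>t. f (y + t *\<^sub>R (z - y))) has_vector_derivative
      (\<Sum>b\<in>B. ((z - y) \<bullet> b) * D b (y + t *\<^sub>R (z - y)))) (at t within {0..1})" if t: "t \<in> {0..1}" for t
  proof -
    let ?x = "y + t *\<^sub>R (z - y)"
    have df: "(f has_derivative frechet_derivative f (at ?x)) (at ?x)"
      using Ck_on_SucD(1)[OF f[of "Suc 0"] seg[OF t]] .
    have l: "linear (frechet_derivative f (at ?x))" using has_derivative_linear[OF df] .
    have "((\<lambda>t. y + t *\<^sub>R (z - y)) has_derivative (\<lambda>u. u *\<^sub>R (z - y))) (at t)"
      by (auto intro!: derivative_eq_intros)
    from has_derivative_compose[OF this df]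
    have "((\<lambda>t. f (y + t *\<^sub>R (z - y))) has_derivative (\<lambda>u. frechet_derivative f (at ?x) (u *\<^sub>R (z - y)))) (at t)" .
    moreover have "frechet_derivative f (at ?x) (z - y) = (\<Sum>b\<in>B. ((z - y) \<bullet> b) * D b ?x)"
      unfolding D_def by (subst onb_bounded_linear_eq[OF B l]) simp
    ultimately show ?thesis
      unfolding has_vector_derivative_def by (auto simp: linear_cmul[OF l] intro: has_derivative_at_withinI)
  qed
  have "((\<lambda>t. \<Sum>b\<in>B. ((z - y) \<bullet> b) * D b (y + t *\<^sub>R (z - y))) has_integral
      f (y + 1 *\<^sub>R (z - y)) - f (y + 0 *\<^sub>R (z - y))) {0..1}"
    by (rule fundamental_theorem_of_calculus) (use d in auto)
  moreover have "((\<lambda>t. \<Sum>b\<in>B. ((z - y) \<bullet> b) * D b (y + t *\<^sub>R (z - y))) has_integral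
      (\<Sum>b\<in>B. ((z - y) \<bullet> b) * g b z)) {0..1}"
    unfolding g_def
  proof (intro has_integral_sum finB has_integral_mult_right)
    fix b
    have "(\<lambda>t. D b (y + t *\<^sub>R (z - y))) integrable_on {0..1}"
      by (intro integrable_continuous_interval continuous_on_compose2[OF Ck_on_continuous[OF D[of 0]]] continuous_intros)
        (use seg in auto)
    then show "((\<lambda>t. D b (y + t *\<^sub>R (z - y))) has_integral
        integral {0..1} (\<lambda>t. t ^ 0 * D b (y + t *\<^sub>R (z - y)))) {0..1}"
      by (simp add: integrable_integral)
  qed
  ultimately have "f (y + 1 *\<^sub>R (z - y)) - f (y + 0 *\<^sub>R (z - y)) = (\<Sum>b\<in>B. ((z - y) \<bullet> b) * g b z)"
    by (rule has_integral_unique)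
  then show "f z = f y + (\<Sum>b\<in>B. ((z - y) \<bullet> b) * g b z)" by simp
qed

section \<open>Alternating forms and the Chevalley--Eilenberg calculus\<close>

lemma tuples_length: "xs \<in> tuples V r \<Longrightarrow> length xs = r"
  and tuples_nth: "xs \<in> tuples V r \<Longrightarrow> i < r \<Longrightarrow> xs ! i \<in> V"
  and tuples_update: "xs \<in> tuples V r \<Longrightarrow> x \<in> V \<Longrightarrow> xs[i := x] \<in> tuples V r"
  and tuples_Cons: "x # xs \<in> tuples V (Suc r) \<longleftrightarrow> x \<in> V \<and> xs \<in> tuples V r"
  and tuples_0: "xs \<in> tuples V 0 \<longleftrightarrow> xs = []"
  using set_update_subset_insert[of xs i x] by (auto simp: tuples_def)

lemma tuples_SucE:
  assumes "xs \<in> tuples V (Suc r)"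
  obtains x ys where "xs = x # ys" "x \<in> V" "ys \<in> tuples V r"
  using assms by (cases xs) (auto simp: tuples_def)

lemma tuples_map: "xs \<in> tuples V r \<Longrightarrow> (\<And>x. x \<in> V \<Longrightarrow> f x \<in> W) \<Longrightarrow> map f xs \<in> tuples W r"
  by (auto simp: tuples_def)

lemma del_Cons_0 [simp]: "del 0 (x # xs) = xs"
  and del_Cons_Suc [simp]: "del (Suc i) (x # xs) = x # del i xs"
  by (auto simp: del_def)

lemma length_del: "i < length xs \<Longrightarrow> length (del i xs) = length xs - 1"
  by (simp add: del_def)

lemma set_del: "set (del i xs) \<subseteq> set xs"
  by (auto simp: del_def dest: in_set_takeD in_set_dropD)

lemma tuples_del: "xs \<in> tuples V (Suc r) \<Longrightarrow> i < Suc r \<Longrightarrow> del i xs \<in> tuples V r"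
  using set_del[of i xs] by (auto simp: tuples_def length_del)

lemma map_del: "map f (del i xs) = del i (map f xs)"
  by (simp add: del_def take_map drop_map)

text \<open>Only additivity is demanded, because the scalars vary between uses (smooth functions,
  first integrals, real numbers); homogeneity is kept apart.\<close>

definition additive_form :: "'l::ab_group_add set \<Rightarrow> 'n::real_vector set \<Rightarrow> nat \<Rightarrow> ('l list \<Rightarrow> 'n) \<Rightarrow> bool" where
  "additive_form L N r c \<longleftrightarrow> (\<forall>xs\<in>tuples L r. c xs \<in> N) \<and>
     (\<forall>xs\<in>tuples L r. \<forall>i<r. \<forall>x\<in>L. \<forall>y\<in>L. c (xs[i := x + y]) = c (xs[i := x]) + c (xs[i := y]))"

definition alt_form :: "'l::ab_group_add set \<Rightarrow> 'n::real_vector set \<Rightarrow> nat \<Rightarrow> ('l list \<Rightarrow> 'n) \<Rightarrow> bool" where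
  "alt_form L N r c \<longleftrightarrow> additive_form L N r c \<and>
     (\<forall>xs\<in>tuples L r. \<forall>j<r. \<forall>i<j. xs ! i = xs ! j \<longrightarrow> c xs = 0)"

lemma additive_formD:
  assumes "additive_form L N r c" "xs \<in> tuples L r"
  shows "c xs \<in> N"
    and "i < r \<Longrightarrow> x \<in> L \<Longrightarrow> y \<in> L \<Longrightarrow> c (xs[i := x + y]) = c (xs[i := x]) + c (xs[i := y])"
  using assms by (auto simp: additive_form_def)

text \<open>Polarisation. Vanishing is assumed for the one pair i, j only, so the lemma is available
  before full alternation is known.\<close>

lemma additive_form_swap:
  assumes c: "additive_form L N r c" and L: "\<And>x y. x \<in> L \<Longrightarrow> y \<in> L \<Longrightarrow> x + y \<in> L"
    and z: "\<And>xs. xs \<in> tuples L r \<Longrightarrow> xs ! i = xs ! j \<Longrightarrow> c xs = 0"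
    and ij: "i < r" "j < r" "i \<noteq> j" and xs: "xs \<in> tuples L r" and ab: "a \<in> L" "b \<in> L"
  shows "c (xs[i := a, j := b]) = - c (xs[i := b, j := a])"
proof -
  have len: "length xs = r" using xs by (rule tuples_length)
  have t: "xs[i := u, j := v] \<in> tuples L r" if "u \<in> L" "v \<in> L" for u v
    using that xs by (intro tuples_update)
  have 1: "c (xs[i := u, j := v + w]) = c (xs[i := u, j := v]) + c (xs[i := u, j := w])"
    if "u \<in> L" "v \<in> L" "w \<in> L" for u v w
    using additive_formD(2)[OF c tuples_update[OF xs that(1)] ij(2) that(2,3)] .
  have 2: "c (xs[i := v + w, j := u]) = c (xs[i := v, j := u]) + c (xs[i := w, j := u])"
    if "u \<in> L" "v \<in> L" "w \<in> L" for u v w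
    using additive_formD(2)[OF c tuples_update[OF xs that(1), of j] ij(1) that(2,3)] ij(3)
    by (simp add: list_update_swap)
  have 0: "c (xs[i := u, j := u]) = 0" if "u \<in> L" for u
    using z[OF t[OF that that]] ij len by simp
  have "0 = c (xs[i := a + b, j := a + b])" using 0 L ab by simp
  also have "\<dots> = c (xs[i := a, j := a + b]) + c (xs[i := b, j := a + b])"
    using 2 L ab by simp
  also have "\<dots> = c (xs[i := a, j := b]) + c (xs[i := b, j := a])" using 1 0 ab by simp
  finally show ?thesis by (simp add: eq_neg_iff_add_eq_0)
qed

text \<open>Adjacent swaps bring two equal arguments next to each other; the induction is on the
  distance between them. It reduces alternation of the differential to neighbouring
  arguments.\<close>

lemma adjacent_imp_alt_form:
  assumes c: "additive_form L N r c" and L: "\<And>x y. x \<in> L \<Longrightarrow> y \<in> L \<Longrightarrow> x + y \<in> L"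
    and z: "\<And>xs i. xs \<in> tuples L r \<Longrightarrow> Suc i < r \<Longrightarrow> xs ! i = xs ! Suc i \<Longrightarrow> c xs = 0"
  shows "alt_form L N r c"
proof -
  have *: "c xs = 0" if "xs \<in> tuples L r" "i + Suc d < r" "xs ! i = xs ! (i + Suc d)" for xs i d
    using that
  proof (induction d arbitrary: xs)
    case 0
    then show ?case using z by simp
  next
    case (Suc d)
    let ?j = "i + Suc d"
    have len: "length xs = r" using Suc.prems(1) by (rule tuples_length)
    have m: "xs ! ?j \<in> L" "xs ! Suc ?j \<in> L" using Suc.prems by (auto intro: tuples_nth)
    have "c (xs[?j := xs ! ?j, Suc ?j := xs ! Suc ?j]) = - c (xs[?j := xs ! Suc ?j, Suc ?j := xs ! ?j])"
      by (rule additive_form_swap[OF c L]) (use z Suc.prems m in auto)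
    moreover have "c (xs[?j := xs ! Suc ?j, Suc ?j := xs ! ?j]) = 0"
      by (rule Suc.IH) (use Suc.prems m len in \<open>auto intro!: tuples_update simp: nth_list_update\<close>)
    ultimately show ?case by simp
  qed
  have "c xs = 0" if "xs \<in> tuples L r" "j < r" "i < j" "xs ! i = xs ! j" for xs i j
    using *[of xs i "j - Suc i"] that by simp
  then show ?thesis using c by (auto simp: alt_form_def)
qed

lemma alt_form_additive: "alt_form L N r c \<Longrightarrow> additive_form L N r c"
  by (simp add: alt_form_def)

lemma alt_form_zero:
  "alt_form L N r c \<Longrightarrow> xs \<in> tuples L r \<Longrightarrow> i < r \<Longrightarrow> j < r \<Longrightarrow> i \<noteq> j \<Longrightarrow> xs ! i = xs ! j \<Longrightarrow> c xs = 0"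
  unfolding alt_form_def by (metis linorder_neqE_nat)

lemma alt_form_swap:
  assumes c: "alt_form L N r c" and L: "\<And>x y. x \<in> L \<Longrightarrow> y \<in> L \<Longrightarrow> x + y \<in> L"
    and ij: "i < r" "j < r" "i \<noteq> j" and xs: "xs \<in> tuples L r" and ab: "a \<in> L" "b \<in> L"
  shows "c (xs[i := a, j := b]) = - c (xs[i := b, j := a])"
  by (rule additive_form_swap[OF alt_form_additive[OF c] L _ ij xs ab])
    (use alt_form_zero[OF c] ij in auto)

lemma alt_form_contract:
  assumes "alt_form L N (Suc r) c" "x \<in> L"
  shows "alt_form L N r (\<lambda>ys. c (x # ys))"
  unfolding alt_form_def additive_form_def
proof (intro conjI ballI allI impI)
  fix xs assume xs: "xs \<in> tuples L r"
  then have xxs: "x # xs \<in> tuples L (Suc r)" using assms by (simp add: tuples_Cons)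
  then show "c (x # xs) \<in> N" using additive_formD(1)[OF alt_form_additive[OF assms(1)]] by blast
  show "c (x # xs[i := y + z]) = c (x # xs[i := y]) + c (x # xs[i := z])"
    if "i < r" "y \<in> L" "z \<in> L" for i y z
    using additive_formD(2)[OF alt_form_additive[OF assms(1)] xxs, of "Suc i" y z] that by simp
  show "c (x # xs) = 0" if "j < r" "i < j" "xs ! i = xs ! j" for i j
    using alt_form_zero[OF assms(1) xxs, of "Suc i" "Suc j"] that by simp
qed

text \<open>The only place where the sign of a shift of arguments is computed.\<close>

lemma alt_form_move:
  assumes "alt_form L N r c" and L: "\<And>x y. x \<in> L \<Longrightarrow> y \<in> L \<Longrightarrow> x + y \<in> L"
    and "xs \<in> tuples L r" "k < r" "y \<in> L"
  shows "c (xs[k := y]) = (-1) ^ k *\<^sub>R c (y # del k xs)"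
  using assms(1,3,4)
proof (induction k arbitrary: r c xs)
  case 0
  then show ?case by (cases xs) (auto simp: tuples_def)
next
  case (Suc k)
  obtain s where r: "r = Suc s" using Suc.prems(3) by (cases r) auto
  then obtain z zs where xs: "xs = z # zs" "z \<in> L" "zs \<in> tuples L s"
    using Suc.prems(2) by (auto elim: tuples_SucE)
  obtain t where s: "s = Suc t" using Suc.prems(3) r by (cases s) auto
  have d: "del k zs \<in> tuples L t" using xs(3) Suc.prems(3) s r by (auto intro: tuples_del)
  have "c (z # zs[k := y]) = (-1) ^ k *\<^sub>R c (z # y # del k zs)"
    using Suc.IH[OF alt_form_contract[OF Suc.prems(1)[unfolded r] xs(2)] xs(3)] Suc.prems(3) r by simp
  also have "c (z # y # del k zs) = - c (y # z # del k zs)"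
    using alt_form_swap[OF Suc.prems(1) L, of 0 1 "z # z # del k zs" z y] xs(2) d assms(5) s r
    by (simp add: tuples_Cons)
  finally show ?case using xs(1) by simp
qed

lemma alt_form_permute:
  assumes c: "alt_form L N r c" and L: "\<And>x y. x \<in> L \<Longrightarrow> y \<in> L \<Longrightarrow> x + y \<in> L"
    and \<sigma>: "\<sigma> permutes {..<r}" and xs: "xs \<in> tuples L r"
  shows "c (map (\<lambda>k. xs ! \<sigma> k) [0..<r]) = of_int (sign \<sigma>) *\<^sub>R c xs"
proof -
  have "\<forall>xs\<in>tuples L r. c (map (\<lambda>k. xs ! \<sigma> k) [0..<r]) = of_int (sign \<sigma>) *\<^sub>R c xs"
    using \<sigma> finite_lessThan[of r]
  proof (induction rule: permutes_induct)
    case id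
    have "map (\<lambda>k. xs ! k) [0..<r] = xs" if "xs \<in> tuples L r" for xs :: "'a list"
      using tuples_length[OF that] map_nth by blast
    then show ?case by (simp add: sign_id)
  next
    case (swap a b p)
    show ?case
    proof
      fix xs assume xs: "xs \<in> tuples L r"
      let ?ys = "xs[a := xs ! b, b := xs ! a]"
      have ab: "a < r" "b < r" and len: "length xs = r" using swap xs tuples_length by auto
      have m: "xs ! a \<in> L" "xs ! b \<in> L" using xs ab by (auto intro: tuples_nth)
      have ys: "?ys \<in> tuples L r" using xs m by (intro tuples_update)
      have eq: "map (\<lambda>k. xs ! (Transposition.transpose a b \<circ> p) k) [0..<r] = map (\<lambda>k. ?ys ! p k) [0..<r]"
      proof (rule map_cong[OF refl])
        fix k assume "k \<in> set [0..<r]"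
        then have "p k < r" using permutes_in_image[OF swap(4), of k] by simp
        then show "xs ! (Transposition.transpose a b \<circ> p) k = ?ys ! p k"
          using ab len swap(3) by (auto simp: nth_list_update transpose_def)
      qed
      have "c (map (\<lambda>k. xs ! (Transposition.transpose a b \<circ> p) k) [0..<r]) = of_int (sign p) *\<^sub>R c ?ys"
        unfolding eq using swap.IH ys by blast
      also have "c ?ys = - c xs"
        using alt_form_swap[OF c L ab swap(3) xs m(2,1)] by simp
      finally show "c (map (\<lambda>k. xs ! (Transposition.transpose a b \<circ> p) k) [0..<r])
          = of_int (sign (Transposition.transpose a b \<circ> p)) *\<^sub>R c xs"
        using swap permutation_permutes[of p] finite_lessThan
        by (subst sign_compose) (auto simp: sign_swap_id permutation_swap_id)
    qed
  qed
  then show ?thesis using xs by blast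
qed

text \<open>Extension from generators \<open>G\<close> to all of \<open>L\<close>: the slots are
  freed one at a time from the left, the slots from \<open>k\<close> on still holding
  generators.\<close>

lemma tuples_slotwise:
  assumes base: "\<And>xs. xs \<in> tuples G r \<Longrightarrow> P xs"
    and step: "\<And>xs i x. xs \<in> tuples L r \<Longrightarrow> i < r \<Longrightarrow> x \<in> L \<Longrightarrow> (\<And>g. g \<in> G \<Longrightarrow> P (xs[i := g])) \<Longrightarrow> P (xs[i := x])"
    and G: "G \<subseteq> L" and xs: "xs \<in> tuples L r"
  shows "P xs"
proof -
  have "P xs" if "xs \<in> tuples L r" "\<forall>i. k \<le> i \<longrightarrow> i < r \<longrightarrow> xs ! i \<in> G" "k \<le> r" for xs k
    using that
  proof (induction k arbitrary: xs)
    case 0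
    then show ?case by (intro base) (auto simp: tuples_def in_set_conv_nth)
  next
    case (Suc k)
    have len: "length xs = r" using Suc.prems(1) by (rule tuples_length)
    have "P (xs[k := xs ! k])"
    proof (rule step[OF Suc.prems(1)])
      show "k < r" using Suc.prems by simp
      show "xs ! k \<in> L" using Suc.prems by (intro tuples_nth[OF Suc.prems(1)]) simp
      fix g assume g: "g \<in> G"
      show "P (xs[k := g])"
        by (rule Suc.IH) (use Suc.prems g G len in \<open>auto intro!: tuples_update simp: nth_list_update\<close>)
    qed
    then show ?case by simp
  qed
  from this[of xs r] show ?thesis using xs by simp
qed

section \<open>Lie derivative (\<open>cel\<close>) and Chevalley-Eilenberg differential
  (\<open>ced\<close>) of cochains\<close>

definition cel :: "('l \<Rightarrow> 'l \<Rightarrow> 'l) \<Rightarrow> ('l \<Rightarrow> 'n \<Rightarrow> 'n) \<Rightarrow> 'l \<Rightarrow> ('l list \<Rightarrow> 'n::real_vector) \<Rightarrow> 'l list \<Rightarrow> 'n" where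
  "cel br th x c xs = th x (c xs) - (\<Sum>i<length xs. c (xs[i := br x (xs ! i)]))"

definition ced :: "('l \<Rightarrow> 'l \<Rightarrow> 'l) \<Rightarrow> ('l \<Rightarrow> 'n \<Rightarrow> 'n) \<Rightarrow> ('l list \<Rightarrow> 'n::real_vector) \<Rightarrow> 'l list \<Rightarrow> 'n" where
  "ced br th c xs = (\<Sum>i<length xs. (-1) ^ i *\<^sub>R th (xs ! i) (c (del i xs))) +
     (\<Sum>j<length xs. \<Sum>i<j. (-1) ^ (i + j) *\<^sub>R c (br (xs ! i) (xs ! j) # del i (del j xs)))"

text \<open>A Lie ring \<open>A\<close> with an ideal \<open>L\<close> and a module \<open>N\<close>, all of them modules over a ring of
  scalars \<open>R\<close> on which \<open>A\<close> acts by derivations \<open>dr\<close> (a Lie--Rinehart pair).  Horizontally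
  \<open>L = \<B>\<close> and \<open>R\<close> consists of the smooth functions; vertically \<open>L = A\<close> and \<open>R\<close> consists of
  the first integrals.\<close>

locale lie_rinehart =
  fixes A L :: "'l::ab_group_add set" and N :: "'n::real_vector set"
    and br :: "'l \<Rightarrow> 'l \<Rightarrow> 'l" and th :: "'l \<Rightarrow> 'n \<Rightarrow> 'n"
    and R :: "'f set" and sl :: "'f \<Rightarrow> 'l \<Rightarrow> 'l" and sn :: "'f \<Rightarrow> 'n \<Rightarrow> 'n" and dr :: "'l \<Rightarrow> 'f \<Rightarrow> 'f"
  assumes LA: "L \<subseteq> A"
    and L_add: "\<And>x y. x \<in> L \<Longrightarrow> y \<in> L \<Longrightarrow> x + y \<in> L"
    and L_zero: "0 \<in> L"
    and N_subspace: "subspace N"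
    and br_closed: "\<And>x y. x \<in> A \<Longrightarrow> y \<in> L \<Longrightarrow> br x y \<in> L"
    and br_closed_A: "\<And>x y. x \<in> A \<Longrightarrow> y \<in> A \<Longrightarrow> br x y \<in> A"
    and br_add_right: "\<And>x y z. x \<in> A \<Longrightarrow> y \<in> L \<Longrightarrow> z \<in> L \<Longrightarrow> br x (y + z) = br x y + br x z"
    and br_add_left: "\<And>x y z. x \<in> A \<Longrightarrow> y \<in> A \<Longrightarrow> z \<in> L \<Longrightarrow> br (x + y) z = br x z + br y z"
    and br_self: "\<And>x. x \<in> L \<Longrightarrow> br x x = 0"
    and jacobi: "\<And>w x y. w \<in> A \<Longrightarrow> x \<in> A \<Longrightarrow> y \<in> L \<Longrightarrow> br w (br x y) = br (br w x) y + br x (br w y)"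
    and th_closed: "\<And>x n. x \<in> A \<Longrightarrow> n \<in> N \<Longrightarrow> th x n \<in> N"
    and th_add_right: "\<And>x m n. x \<in> A \<Longrightarrow> m \<in> N \<Longrightarrow> n \<in> N \<Longrightarrow> th x (m + n) = th x m + th x n"
    and th_add_left: "\<And>x y n. x \<in> A \<Longrightarrow> y \<in> A \<Longrightarrow> n \<in> N \<Longrightarrow> th (x + y) n = th x n + th y n"
    and th_br: "\<And>x y n. x \<in> A \<Longrightarrow> y \<in> A \<Longrightarrow> n \<in> N \<Longrightarrow> th x (th y n) = th y (th x n) + th (br x y) n"
    and sl_closed: "\<And>f x. f \<in> R \<Longrightarrow> x \<in> L \<Longrightarrow> sl f x \<in> L"
    and dr_closed: "\<And>f x. f \<in> R \<Longrightarrow> x \<in> A \<Longrightarrow> dr x f \<in> R"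
    and sn_add: "\<And>f m n. sn f (m + n) = sn f m + sn f n"
    and br_sl: "\<And>f x y. f \<in> R \<Longrightarrow> x \<in> A \<Longrightarrow> y \<in> L \<Longrightarrow> br x (sl f y) = sl f (br x y) + sl (dr x f) y"
    and th_sl: "\<And>f x n. f \<in> R \<Longrightarrow> x \<in> L \<Longrightarrow> n \<in> N \<Longrightarrow> th (sl f x) n = sn f (th x n)"
    and th_sn: "\<And>f x n. f \<in> R \<Longrightarrow> x \<in> A \<Longrightarrow> n \<in> N \<Longrightarrow> th x (sn f n) = sn f (th x n) + sn (dr x f) n"
begin

abbreviation "lie \<equiv> cel br th"
abbreviation "d \<equiv> ced br th"
abbreviation "alt \<equiv> alt_form L N"

definition hom_form :: "nat \<Rightarrow> ('l list \<Rightarrow> 'n) \<Rightarrow> bool" where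
  "hom_form r c \<longleftrightarrow> (\<forall>xs\<in>tuples L r. \<forall>i<r. \<forall>x\<in>L. \<forall>f\<in>R. c (xs[i := sl f x]) = sn f (c (xs[i := x])))"

lemma alt_D:
  assumes "alt r c" "xs \<in> tuples L r"
  shows "c xs \<in> N"
    and "i < r \<Longrightarrow> x \<in> L \<Longrightarrow> y \<in> L \<Longrightarrow> c (xs[i := x + y]) = c (xs[i := x]) + c (xs[i := y])"
  using additive_formD[OF alt_form_additive[OF assms(1)] assms(2)] .

lemma alt_zero_arg:
  assumes "alt r c" "xs \<in> tuples L r" "i < r" "xs ! i = 0"
  shows "c xs = 0"
  using alt_D(2)[OF assms(1,2,3) L_zero L_zero] list_update_id[of xs i] assms(4) by simp

lemma th_zero: "x \<in> A \<Longrightarrow> th x 0 = 0"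
  using th_add_right[of x 0 0] subspace_0[OF N_subspace] by simp

lemma th_diff:
  assumes "x \<in> A" "m \<in> N" "n \<in> N"
  shows "th x (m - n) = th x m - th x n"
  using th_add_right[OF assms(1) subspace_diff[OF N_subspace assms(2,3)] assms(3)]
  by (simp add: algebra_simps)

lemma th_sum:
  assumes "x \<in> A" "\<And>i. i \<in> I \<Longrightarrow> m i \<in> N"
  shows "th x (\<Sum>i\<in>I. m i) = (\<Sum>i\<in>I. th x (m i))"
  using assms(2)
proof (induction I rule: infinite_finite_induct)
  case (insert i I)
  then show ?case using th_add_right[OF assms(1), of "m i" "sum m I"] subspace_sum[OF N_subspace, of I m] by simp
qed (use th_zero assms(1) in auto)

lemma sn_zero: "sn f 0 = 0"
  using sn_add[of f 0 0] by simp

lemma sn_diff: "sn f (m - n) = sn f m - sn f n"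
  using sn_add[of f "m - n" n] by (simp add: algebra_simps)

lemma sn_sum: "sn f (\<Sum>i\<in>I. m i) = (\<Sum>i\<in>I. sn f (m i))"
  by (induction I rule: infinite_finite_induct) (auto simp: sn_zero sn_add)

lemma sn_neg: "sn f (- m) = - sn f m"
  using sn_diff[of f 0 m] by (simp add: sn_zero)

lemma lie_in_N:
  assumes "additive_form L N r c" "x \<in> A" "xs \<in> tuples L r"
  shows "lie x c xs \<in> N"
  unfolding cel_def tuples_length[OF assms(3)]
proof (intro subspace_diff[OF N_subspace] subspace_sum[OF N_subspace] th_closed assms
    additive_formD(1)[OF assms(1)])
  fix i assume "i \<in> {..<r}"
  then show "xs[i := br x (xs ! i)] \<in> tuples L r"
    using assms by (intro tuples_update br_closed) (auto intro: tuples_nth)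
qed

lemma lie_alt:
  assumes c: "alt r c" and x: "x \<in> A"
  shows "alt r (lie x c)"
  unfolding alt_form_def additive_form_def
proof (intro conjI ballI allI impI)
  fix xs assume xs: "xs \<in> tuples L r"
  have len: "length xs = r" using xs by (rule tuples_length)
  note inN = alt_D(1)[OF c] and add = alt_D(2)[OF c]
  show "lie x c xs \<in> N" using lie_in_N[OF alt_form_additive[OF c] x xs] .
  have brxs: "br x (xs ! k) \<in> L" if "k < r" for k using br_closed[OF x] tuples_nth[OF xs that] .
  {
    fix i y z assume i: "i < r" and yz: "y \<in> L" "z \<in> L"
    have "c ((xs[i := y + z])[k := br x ((xs[i := y + z]) ! k)]) =
        c ((xs[i := y])[k := br x ((xs[i := y]) ! k)]) + c ((xs[i := z])[k := br x ((xs[i := z]) ! k)])"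
      if k: "k < r" for k
    proof (cases "k = i")
      case True
      then show ?thesis using i len add[OF xs i] br_closed[OF x] br_add_right[OF x yz] yz by simp
    next
      case False
      then show ?thesis
        using add[OF tuples_update[OF xs brxs[OF k], of k] i yz] by (simp add: list_update_swap)
    qed
    then have "(\<Sum>k<r. c ((xs[i := y + z])[k := br x ((xs[i := y + z]) ! k)])) =
        (\<Sum>k<r. c ((xs[i := y])[k := br x ((xs[i := y]) ! k)])) +
        (\<Sum>k<r. c ((xs[i := z])[k := br x ((xs[i := z]) ! k)]))"
      unfolding sum.distrib[symmetric] by (intro sum.cong) auto
    moreover have "th x (c (xs[i := y + z])) = th x (c (xs[i := y])) + th x (c (xs[i := z]))"
      using add[OF xs i yz] th_add_right[OF x inN inN] tuples_update[OF xs] yz by simp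
    ultimately show "lie x c (xs[i := y + z]) = lie x c (xs[i := y]) + lie x c (xs[i := z])"
      unfolding cel_def using len by simp
  }
  {
    fix i j assume ij: "j < r" "i < j" "xs ! i = xs ! j"
    then have i: "i < r" by simp
    \<comment> \<open>A bracket in any slot other than i and j leaves two equal arguments in place;
      the two remaining terms cancel by a swap.\<close>
    have "(\<Sum>k<r. c (xs[k := br x (xs ! k)])) = (\<Sum>k\<in>{i,j}. c (xs[k := br x (xs ! k)]))"
    proof (rule sum.mono_neutral_right)
      show "\<forall>k\<in>{..<r} - {i, j}. c (xs[k := br x (xs ! k)]) = 0"
      proof
        fix k assume k: "k \<in> {..<r} - {i, j}"
        then have "xs[k := br x (xs ! k)] \<in> tuples L r" using brxs xs by (auto intro: tuples_update)
        then show "c (xs[k := br x (xs ! k)]) = 0"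
          by (rule alt_form_zero[OF c, of _ i j]) (use k ij in auto)
      qed
    qed (use i ij in auto)
    also have "\<dots> = c (xs[i := br x (xs ! i)]) + c (xs[j := br x (xs ! j)])" using ij by simp
    also have "\<dots> = 0"
    proof -
      have "xs[j := xs ! i] = xs" using ij list_update_id[of xs j] by simp
      then have "xs[i := br x (xs ! i), j := xs ! i] = xs[i := br x (xs ! i)]"
        using ij list_update_swap[of i j xs "br x (xs ! i)" "xs ! i"] by simp
      moreover have "xs[i := xs ! i, j := br x (xs ! i)] = xs[j := br x (xs ! j)]"
        using ij list_update_id[of xs i] by simp
      ultimately show ?thesis
        using alt_form_swap[OF c L_add i ij(1) _ xs brxs[OF i] tuples_nth[OF xs i]] ij by simp
    qed
    finally show "lie x c xs = 0"
      unfolding cel_def using alt_form_zero[OF c xs i ij(1)] ij len th_zero[OF x] by simp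
  }
qed

text \<open>The derivative of the scalar appears twice, once when \<open>x\<close> acts on the value
  and once in the bracket in slot i; the two terms cancel.\<close>

lemma lie_hom:
  assumes c: "alt r c" and h: "hom_form r c" and x: "x \<in> A"
  shows "hom_form r (lie x c)"
  unfolding hom_form_def
proof (intro ballI allI impI)
  fix xs i y f assume xs: "xs \<in> tuples L r" and i: "i < r" and y: "y \<in> L" and f: "f \<in> R"
  have len: "length xs = r" using xs by (rule tuples_length)
  note inN = alt_D(1)[OF c] and add = alt_D(2)[OF c]
  have hom: "c (xs[i := sl f x]) = sn f (c (xs[i := x]))"
    if "xs \<in> tuples L r" "x \<in> L" "f \<in> R" for xs x f
    using h that i unfolding hom_form_def by blast
  have brxs: "br x (xs ! k) \<in> L" if "k < r" for k using br_closed[OF x] tuples_nth[OF xs that] .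
  let ?e = "sn (dr x f) (c (xs[i := y]))"
  have k1: "c ((xs[i := sl f y])[k := br x ((xs[i := sl f y]) ! k)]) =
      sn f (c ((xs[i := y])[k := br x ((xs[i := y]) ! k)])) + (if k = i then ?e else 0)"
    if k: "k < r" for k
  proof (cases "k = i")
    case True
    have "c (xs[i := sl f (br x y) + sl (dr x f) y]) = sn f (c (xs[i := br x y])) + ?e"
      using add[OF xs i] hom xs f y x dr_closed br_closed sl_closed by simp
    then show ?thesis using True i len br_sl[OF f x y] by simp
  next
    case False
    then show ?thesis
      using hom[OF tuples_update[OF xs brxs[OF k], of k] y f] by (simp add: list_update_swap)
  qed
  have "(\<Sum>k<r. c ((xs[i := sl f y])[k := br x ((xs[i := sl f y]) ! k)])) =
      sn f (\<Sum>k<r. c ((xs[i := y])[k := br x ((xs[i := y]) ! k)])) + ?e"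
    using i k1 by (simp add: sum.distrib sn_sum)
  moreover have "th x (c (xs[i := sl f y])) = sn f (th x (c (xs[i := y]))) + ?e"
    using hom[OF xs y f] th_sn[OF f x inN[OF tuples_update[OF xs y]]] by simp
  ultimately show "lie x c (xs[i := sl f y]) = sn f (lie x c (xs[i := y]))"
    unfolding cel_def using len by (simp add: sn_diff)
qed

lemma d_cong:
  assumes "\<And>ys. ys \<in> tuples L r \<Longrightarrow> c ys = c' ys" "xs \<in> tuples L (Suc r)"
  shows "d c xs = d c' xs"
proof -
  have len: "length xs = Suc r" using assms(2) by (rule tuples_length)
  have "c (del i xs) = c' (del i xs)" if "i < Suc r" for i
    using assms tuples_del that by blast
  moreover have "c (br (xs ! i) (xs ! j) # del i (del j xs)) = c' (br (xs ! i) (xs ! j) # del i (del j xs))"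
    if ij: "i < j" "j < Suc r" for i j
  proof -
    obtain s where s: "r = Suc s" using ij by (cases r) auto
    have "del i (del j xs) \<in> tuples L s" using assms(2) ij s by (auto intro!: tuples_del)
    moreover have "br (xs ! i) (xs ! j) \<in> L"
      using tuples_nth[OF assms(2)] ij LA by (intro br_closed) auto
    ultimately show ?thesis using assms(1) s by (simp add: tuples_Cons)
  qed
  ultimately show ?thesis unfolding ced_def len by simp
qed

lemma d_add:
  assumes "\<And>ys. ys \<in> tuples L r \<Longrightarrow> c ys \<in> N" "\<And>ys. ys \<in> tuples L r \<Longrightarrow> c' ys \<in> N" "xs \<in> tuples L (Suc r)"
  shows "d (\<lambda>ys. c ys + c' ys) xs = d c xs + d c' xs"
proof -
  have len: "length xs = Suc r" using assms(3) by (rule tuples_length)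
  have "th (xs ! i) (c (del i xs) + c' (del i xs)) = th (xs ! i) (c (del i xs)) + th (xs ! i) (c' (del i xs))"
    if "i < Suc r" for i
    using assms that LA tuples_nth[OF assms(3)] by (intro th_add_right) (auto intro: tuples_del)
  then show ?thesis
    unfolding ced_def len by (simp add: scaleR_add_right sum.distrib)
qed

lemma d_zero: "xs \<in> tuples L r \<Longrightarrow> d (\<lambda>ys. 0) xs = 0"
proof -
  assume xs: "xs \<in> tuples L r"
  have "th (xs ! i) 0 = 0" if "i < length xs" for i
    using that tuples_nth[OF xs] tuples_length[OF xs] LA by (intro th_zero) auto
  then show ?thesis by (simp add: ced_def)
qed

text \<open>Cartan's formula \<open>i_x d + d i_x = L_x\<close>, read as a recursion for
  \<open>d\<close> in the degree. Alternation, homogeneity and commutation with Lie derivatives are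
  all derived from it by induction instead of from the double sum.\<close>

lemma d_Cons:
  assumes c: "alt r c" and x: "x \<in> L" and xs: "xs \<in> tuples L r"
  shows "d c (x # xs) = lie x c xs - d (\<lambda>ys. c (x # ys)) xs"
proof -
  have len: "length xs = r" using xs by (rule tuples_length)
  have nth: "xs ! i \<in> L" if "i < r" for i using tuples_nth[OF xs that] .
  have brxs: "br x (xs ! k) \<in> L" if "k < r" for k using br_closed nth[OF that] x LA by blast
  \<comment> \<open>Pairs containing \<open>x\<close>: moving the bracket from slot j to the front
    costs (-1)^j, and the shift of the index by one supplies the minus sign.\<close>
  have A: "(-1) ^ Suc j *\<^sub>R c (br x (xs ! j) # del j xs) = - c (xs[j := br x (xs ! j)])" if "j < r" for j
    using alt_form_move[OF c L_add xs that brxs[OF that]] by simp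
  \<comment> \<open>Pairs not containing \<open>x\<close>: the bracket stands before
    \<open>x\<close> and has to be exchanged with it once.\<close>
  have B: "c (br (xs ! i) (xs ! j) # x # del i (del j xs)) = - c (x # br (xs ! i) (xs ! j) # del i (del j xs))"
    if ij: "j < r" "i < j" for i j
  proof -
    obtain s where s: "r = Suc (Suc s)" using ij by (metis less_nat_zero_code not0_implies_Suc less_Suc0)
    have t: "del i (del j xs) \<in> tuples L s" using xs ij s by (auto intro!: tuples_del)
    have b: "br (xs ! i) (xs ! j) \<in> L" using nth ij LA by (intro br_closed) auto
    show ?thesis
      using alt_form_swap[OF c L_add, of 0 1 "x # x # del i (del j xs)" "br (xs ! i) (xs ! j)" x] s t b x
      by (simp add: tuples_Cons)
  qed
  have 1: "(\<Sum>i<Suc r. (-1) ^ i *\<^sub>R th ((x # xs) ! i) (c (del i (x # xs)))) =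
      th x (c xs) - (\<Sum>i<r. (-1) ^ i *\<^sub>R th (xs ! i) (c (x # del i xs)))"
    by (subst sum.lessThan_Suc_shift) (simp add: sum_negf)
  have 2: "(\<Sum>j<Suc r. \<Sum>i<j. (-1) ^ (i + j) *\<^sub>R
      c (br ((x # xs) ! i) ((x # xs) ! j) # del i (del j (x # xs)))) =
      (\<Sum>j<r. - c (xs[j := br x (xs ! j)]) +
        (\<Sum>i<j. - ((-1) ^ (i + j) *\<^sub>R c (x # br (xs ! i) (xs ! j) # del i (del j xs)))))"
    unfolding sum.lessThan_Suc_shift[of _ r] lessThan_0 sum.empty add_0_left
  proof (rule sum.cong[OF refl])
    fix j assume "j \<in> {..<r}"
    then have j: "j < r" by simp
    show "(\<Sum>i<Suc j. (-1) ^ (i + Suc j) *\<^sub>R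
        c (br ((x # xs) ! i) ((x # xs) ! Suc j) # del i (del (Suc j) (x # xs)))) =
        - c (xs[j := br x (xs ! j)]) +
        (\<Sum>i<j. - ((-1) ^ (i + j) *\<^sub>R c (x # br (xs ! i) (xs ! j) # del i (del j xs))))"
      unfolding sum.lessThan_Suc_shift[of _ j]
      using A[OF j] B[OF j] by (simp add: sum_negf)
  qed
  show ?thesis
    unfolding ced_def cel_def length_Cons len 1 2 by (simp add: sum.distrib sum_negf sum_subtractf)
qed

text \<open>The commutation rule \<open>[L_x, i_y] = i_[x,y]\<close>.\<close>

lemma contract_eq:
  "lie x c (y # ys) = lie x (\<lambda>zs. c (y # zs)) ys - c (br x y # ys)"
  unfolding cel_def by (simp add: sum.lessThan_Suc_shift del: sum.lessThan_Suc)

lemma lie_add_left: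
  assumes "alt r c" "xs \<in> tuples L r" "x \<in> A" "y \<in> A"
  shows "lie (x + y) c xs = lie x c xs + lie y c xs"
proof -
  have "c (xs[i := br (x + y) (xs ! i)]) = c (xs[i := br x (xs ! i)]) + c (xs[i := br y (xs ! i)])"
    if i: "i < r" for i
    using alt_D(2)[OF assms(1,2) i, of "br x (xs ! i)" "br y (xs ! i)"] tuples_nth[OF assms(2) i]
      br_closed assms by (simp add: br_add_left)
  then show ?thesis
    unfolding cel_def using th_add_left[OF assms(3,4) alt_D(1)[OF assms(1,2)]] tuples_length[OF assms(2)]
    by (simp add: sum.distrib)
qed

lemma d_single:
  assumes "alt 0 c" "x \<in> L"
  shows "d c [x] = th x (c [])"
  by (simp add: ced_def)

text \<open>By Cartan's formula the slots after the first inherit everything from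
  \<open>lie_alt\<close> and the induction hypothesis, and additivity in the first slot is
  additivity of \<open>L_x\<close> and \<open>i_x\<close> in x. The one remaining case is equality
  of the first two arguments.\<close>

lemma d_alt: "alt r c \<Longrightarrow> alt (Suc r) (d c)"
proof (induction r arbitrary: c)
  case 0
  note c = 0
  have N: "c [] \<in> N" using alt_D(1)[OF c] by (simp add: tuples_0)
  have tl: "th (x + y) (c []) = th x (c []) + th y (c [])" if "x \<in> L" "y \<in> L" for x y
    using th_add_left N LA that by blast
  show ?case
    unfolding alt_form_def additive_form_def
    using d_single[OF c] N th_closed LA tl by (auto elim!: tuples_SucE simp: tuples_0 L_add)
next
  case (Suc r)
  note c = Suc.prems
  have cx: "alt r (\<lambda>ys. c (x # ys))" if "x \<in> L" for x using alt_form_contract[OF c that] .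
  have dx: "alt (Suc r) (d (\<lambda>ys. c (x # ys)))" if "x \<in> L" for x using Suc.IH[OF cx[OF that]] .
  have lx: "alt (Suc r) (lie x c)" if "x \<in> L" for x using lie_alt[OF c] LA that by blast
  show ?case
  proof (rule adjacent_imp_alt_form[OF _ L_add])
    show "additive_form L N (Suc (Suc r)) (d c)"
      unfolding additive_form_def
    proof (intro conjI ballI allI impI)
      fix xs assume "xs \<in> tuples L (Suc (Suc r))"
      then obtain x ys where xs: "xs = x # ys" "x \<in> L" "ys \<in> tuples L (Suc r)" by (rule tuples_SucE)
      show "d c xs \<in> N"
        unfolding xs(1) d_Cons[OF c xs(2,3)]
        using alt_D(1)[OF lx[OF xs(2)] xs(3)] alt_D(1)[OF dx[OF xs(2)] xs(3)] N_subspace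
        by (intro subspace_diff)
      fix i y z assume i: "i < Suc (Suc r)" and yz: "y \<in> L" "z \<in> L"
      show "d c (xs[i := y + z]) = d c (xs[i := y]) + d c (xs[i := z])"
      proof (cases i)
        case 0
        have "d (\<lambda>zs. c ((y + z) # zs)) ys = d (\<lambda>zs. c (y # zs) + c (z # zs)) ys"
        proof (rule d_cong[OF _ xs(3)])
          fix zs assume "zs \<in> tuples L r"
          then have "y # zs \<in> tuples L (Suc r)" using yz by (simp add: tuples_Cons)
          from alt_D(2)[OF c this, of 0 y z] show "c ((y + z) # zs) = c (y # zs) + c (z # zs)"
            using yz by simp
        qed
        also have "\<dots> = d (\<lambda>zs. c (y # zs)) ys + d (\<lambda>zs. c (z # zs)) ys"
          by (rule d_add[OF _ _ xs(3)]) (use alt_D(1)[OF cx] yz in auto)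
        finally show ?thesis
          using 0 xs yz d_Cons[OF c _ xs(3)] L_add lie_add_left[OF c xs(3), of y z] LA by auto
      next
        case (Suc k)
        then show ?thesis
          using d_Cons[OF c xs(2)] tuples_update[OF xs(3)] yz L_add i
            alt_D(2)[OF lx[OF xs(2)] xs(3), of k y z] alt_D(2)[OF dx[OF xs(2)] xs(3), of k y z] xs
          by simp
      qed
    qed
    fix xs i assume xs': "xs \<in> tuples L (Suc (Suc r))" "Suc i < Suc (Suc r)" "xs ! i = xs ! Suc i"
    then obtain x ys where xs: "xs = x # ys" "x \<in> L" "ys \<in> tuples L (Suc r)" by (auto elim: tuples_SucE)
    show "d c xs = 0"
    proof (cases i)
      case 0
      obtain zs where ys: "ys = x # zs" "zs \<in> tuples L r"
        using xs xs'(3) 0 by (auto elim: tuples_SucE)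
      \<comment> \<open>Applying Cartan's formula twice with the same x leaves this term and a
        contraction with [x, x] = 0; the Lie derivatives cancel.\<close>
      have "d (\<lambda>ys. c (x # x # ys)) zs = 0"
      proof (cases r)
        case 0
        then show ?thesis using ys by (simp add: tuples_0 ced_def)
      next
        case (Suc s)
        have "d (\<lambda>ys. c (x # x # ys)) zs = d (\<lambda>ys. 0) zs"
        proof (rule d_cong[of s])
          fix us assume "us \<in> tuples L s"
          then have "x # x # us \<in> tuples L (Suc r)" using xs(2) Suc by (simp add: tuples_Cons)
          from alt_form_zero[OF c this, of 0 1] show "c (x # x # us) = 0" using Suc by simp
        qed (use ys Suc in auto)
        then show ?thesis using d_zero ys by simp
      qed
      moreover have "c (0 # zs) = 0"
        using alt_zero_arg[OF c, of "0 # zs" 0] ys L_zero by (simp add: tuples_Cons)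
      ultimately show ?thesis
        using xs ys d_Cons[OF c xs(2,3)] d_Cons[OF cx[OF xs(2)] xs(2) ys(2)] br_self[OF xs(2)]
          contract_eq[of x c x zs] by simp
    next
      case (Suc k)
      have "lie x c ys = 0" "d (\<lambda>ys. c (x # ys)) ys = 0"
        using alt_form_zero[OF lx[OF xs(2)] xs(3), of k "Suc k"] alt_form_zero[OF dx[OF xs(2)] xs(3), of k "Suc k"]
          Suc xs xs' by auto
      then show ?thesis using xs d_Cons[OF c xs(2,3)] by simp
    qed
  qed
qed

lemma hom_contract:
  assumes "hom_form (Suc r) c" "x \<in> L"
  shows "hom_form r (\<lambda>ys. c (x # ys))"
  unfolding hom_form_def
proof (intro ballI allI impI)
  fix xs i y f assume "xs \<in> tuples L r" "i < r" "y \<in> L" "f \<in> R"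
  moreover from this have "x # xs \<in> tuples L (Suc r)" using assms by (simp add: tuples_Cons)
  ultimately show "c (x # xs[i := sl f y]) = sn f (c (x # xs[i := y]))"
    using assms(1)[unfolded hom_form_def, rule_format, of "x # xs" "Suc i" y f] by simp
qed

text \<open>In the later slots Cartan's formula gives homogeneity. In the first slot its two terms
  need not be homogeneous separately, so that slot is exchanged with the second.\<close>

lemma d_hom: "alt r c \<Longrightarrow> hom_form r c \<Longrightarrow> hom_form (Suc r) (d c)"
proof (induction r arbitrary: c)
  case 0
  have "c [] \<in> N" using alt_D(1)[OF 0(1)] by (simp add: tuples_0)
  then show ?case
    unfolding hom_form_def using d_single[OF 0(1)] th_sl sl_closed
    by (auto elim!: tuples_SucE simp: tuples_0)
next
  case (Suc r)
  note c = Suc.prems(1)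
  have dc: "alt (Suc (Suc r)) (d c)" using d_alt[OF c] .
  have step: "d c (x # ys[k := sl f y]) = sn f (d c (x # ys[k := y]))"
    if x: "x \<in> L" and ys: "ys \<in> tuples L (Suc r)" and k: "k < Suc r" and y: "y \<in> L" and f: "f \<in> R" for x ys k y f
  proof -
    have "hom_form (Suc r) (lie x c)" using lie_hom[OF c Suc.prems(2)] x LA by blast
    moreover have "hom_form (Suc r) (d (\<lambda>ys. c (x # ys)))"
      using Suc.IH[OF alt_form_contract[OF c x] hom_contract[OF Suc.prems(2) x]] .
    ultimately show ?thesis
      using ys k y f d_Cons[OF c x] tuples_update[OF ys] sl_closed
      unfolding hom_form_def by (simp add: sn_diff)
  qed
  show ?case
    unfolding hom_form_def
  proof (intro ballI allI impI)
    fix xs i y f assume xs': "xs \<in> tuples L (Suc (Suc r))" and i: "i < Suc (Suc r)" and y: "y \<in> L" and f: "f \<in> R"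
    obtain x ys where xs: "xs = x # ys" "x \<in> L" "ys \<in> tuples L (Suc r)" using xs' by (rule tuples_SucE)
    obtain z zs where ys: "ys = z # zs" "z \<in> L" "zs \<in> tuples L r" using xs(3) by (rule tuples_SucE)
    show "d c (xs[i := sl f y]) = sn f (d c (xs[i := y]))"
    proof (cases i)
      case 0
      have sw: "d c (w # z # zs) = - d c (z # w # zs)" if "w \<in> L" for w
        using alt_form_swap[OF dc L_add, of 0 1 "z # z # zs" w z] that ys by (simp add: tuples_Cons)
      show ?thesis
        using 0 xs ys y f sl_closed step[OF ys(2) xs(3), of 0 y f] sw by (simp add: sn_neg)
    next
      case (Suc k)
      then show ?thesis using step xs i y f by simp
    qed
  qed
qed

lemma alt_hom_sum:
  assumes c: "alt r c" and h: "hom_form r c" and xs: "xs \<in> tuples L r" and i: "i < r"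
    and K: "\<And>k. k \<in> K \<Longrightarrow> f k \<in> R" "\<And>k. k \<in> K \<Longrightarrow> x k \<in> L"
  shows "(\<Sum>k\<in>K. sl (f k) (x k)) \<in> L \<and>
    c (xs[i := \<Sum>k\<in>K. sl (f k) (x k)]) = (\<Sum>k\<in>K. sn (f k) (c (xs[i := x k])))"
  using K
proof (induction K rule: infinite_finite_induct)
  case (insert k K)
  have k: "sl (f k) (x k) \<in> L" using insert.prems by (intro sl_closed) auto
  have "c (xs[i := sl (f k) (x k)]) = sn (f k) (c (xs[i := x k]))"
    using h xs i insert.prems unfolding hom_form_def by blast
  then show ?case
    using insert L_add[OF k] alt_D(2)[OF c xs i k] by simp
qed (use alt_zero_arg[OF c tuples_update[OF xs L_zero, of i] i] i tuples_length[OF xs] L_zero in simp_all)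

text \<open>Terms with brackets in two different slots are symmetric in x and y and drop out; terms
  with both brackets in one slot are settled by the Jacobi identity.\<close>

lemma lie_commutator:
  assumes c: "alt r c" and x: "x \<in> A" and y: "y \<in> A" and xs: "xs \<in> tuples L r"
  shows "lie x (lie y c) xs = lie y (lie x c) xs + lie (br x y) c xs"
proof -
  have len: "length xs = r" using xs by (rule tuples_length)
  note inN = alt_D(1)[OF c] and add = alt_D(2)[OF c]
  have nth: "xs ! i \<in> L" if "i < r" for i using tuples_nth[OF xs that] .
  define u where "u z k = br z (xs ! k)" for z k
  have uL: "u z k \<in> L" if "k < r" "z \<in> A" for z k unfolding u_def using br_closed nth that by blast
  \<comment> \<open>The terms with \<open>z\<close> acting in one slot and \<open>w\<close> in
    another; exchanging the two summations shows the symmetry.\<close>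
  define S where "S z w = (\<Sum>k<r. \<Sum>l<r. if l = k then 0 else c (xs[k := u z k, l := u w l]))" for z w
  have S: "S x y = S y x"
    unfolding S_def by (subst sum.swap, intro sum.cong refl) (auto simp: list_update_swap)
  have E: "lie z (lie w c) xs = th z (th w (c xs)) - (\<Sum>k<r. th z (c (xs[k := u w k])))
     - (\<Sum>k<r. th w (c (xs[k := u z k]))) + S z w + (\<Sum>k<r. c (xs[k := br w (br z (xs ! k))]))"
    if z: "z \<in> A" and w: "w \<in> A" for z w
  proof -
    have 1: "th z (lie w c xs) = th z (th w (c xs)) - (\<Sum>k<r. th z (c (xs[k := u w k])))"
      unfolding cel_def len u_def[symmetric]
      by (subst th_diff[OF z th_closed[OF w inN[OF xs]]], intro subspace_sum[OF N_subspace] inN tuples_update xs uL w)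
        (auto intro!: th_sum z inN tuples_update xs uL w)
    have 2: "lie w c (xs[k := u z k]) = th w (c (xs[k := u z k])) -
        ((\<Sum>l<r. if l = k then 0 else c (xs[k := u z k, l := u w l])) + c (xs[k := br w (br z (xs ! k))]))"
      if k: "k < r" for k
    proof -
      have "(\<Sum>l<r. c ((xs[k := u z k])[l := br w ((xs[k := u z k]) ! l)])) =
          (\<Sum>l<r. (if l = k then 0 else c (xs[k := u z k, l := u w l])) +
            (if l = k then c (xs[k := br w (br z (xs ! k))]) else 0))"
        using k len by (intro sum.cong) (auto simp: u_def)
      then show ?thesis unfolding cel_def using k len by (simp add: sum.distrib)
    qed
    have "lie z (lie w c) xs = th z (lie w c xs) - (\<Sum>k<r. lie w c (xs[k := u z k]))"
      unfolding cel_def[of br th z "lie w c"] len u_def ..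
    also have "(\<Sum>k<r. lie w c (xs[k := u z k])) = (\<Sum>k<r. th w (c (xs[k := u z k]))) -
        (S z w + (\<Sum>k<r. c (xs[k := br w (br z (xs ! k))])))"
      using 2 by (simp add: S_def sum_subtractf sum.distrib)
    finally show ?thesis using 1 by simp
  qed
  have J: "c (xs[k := br x (br y (xs ! k))]) = c (xs[k := br (br x y) (xs ! k)]) + c (xs[k := br y (br x (xs ! k))])"
    if k: "k < r" for k
    using jacobi[OF x y nth[OF k]] add[OF xs k] br_closed br_closed_A x y nth[OF k] by simp
  have "(\<Sum>k<r. c (xs[k := br x (br y (xs ! k))])) =
      (\<Sum>k<r. c (xs[k := br (br x y) (xs ! k)])) + (\<Sum>k<r. c (xs[k := br y (br x (xs ! k))]))"
    using J by (simp add: sum.distrib)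
  then have "lie x (lie y c) xs - lie y (lie x c) xs =
      th (br x y) (c xs) - (\<Sum>k<r. c (xs[k := br (br x y) (xs ! k)]))"
    unfolding E[OF x y] E[OF y x] S th_br[OF x y inN[OF xs]] by simp
  then show ?thesis
    unfolding cel_def[of br th "br x y"] len by (simp add: algebra_simps)
qed

text \<open>Induction on the degree: contracting both sides with the first argument y and using
  Cartan's formula, the claim follows from the rules for \<open>[L_x, L_y]\<close> and
  \<open>[L_x, i_y]\<close> and the claim for the form \<open>i_y c\<close>.\<close>

lemma lie_d_commute:
  "alt r c \<Longrightarrow> x \<in> A \<Longrightarrow> xs \<in> tuples L (Suc r) \<Longrightarrow> lie x (d c) xs = d (lie x c) xs"
proof (induction r arbitrary: c xs)
  case (0 c)
  obtain y where xs: "xs = [y]" "y \<in> L" using 0(3) by (auto elim!: tuples_SucE simp: tuples_0)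
  have N: "c [] \<in> N" using alt_D(1)[OF 0(1)] by (simp add: tuples_0)
  have "d c [br x y] = th (br x y) (c [])" using d_single[OF 0(1)] br_closed 0 xs by blast
  moreover have "lie x c [] = th x (c [])" by (simp add: cel_def)
  moreover have "lie x (d c) [y] = th x (d c [y]) - d c [br x y]"
    by (simp add: cel_def[of br th x "d c"])
  moreover have "th x (th y (c [])) = th y (th x (c [])) + th (br x y) (c [])"
    using th_br[OF 0(2) _ N, of y] LA xs by blast
  ultimately show ?case
    using xs d_single[OF 0(1) xs(2)] d_single[OF lie_alt[OF 0(1,2)] xs(2)] by simp
next
  case (Suc r)
  note c = Suc.prems(1) and x = Suc.prems(2)
  obtain y ys where xs: "xs = y # ys" "y \<in> L" "ys \<in> tuples L (Suc r)"
    using Suc.prems(3) by (rule tuples_SucE)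
  have yA: "y \<in> A" using xs LA by blast
  let ?z = "br x y"
  have z: "?z \<in> L" using br_closed x xs by blast
  have cy: "alt r (\<lambda>us. c (y # us))" using alt_form_contract[OF c xs(2)] .
  have cz: "alt r (\<lambda>us. c (?z # us))" using alt_form_contract[OF c z] .
  have len: "length ys = Suc r" using xs tuples_length by blast
  have T: "ys[i := br x (ys ! i)] \<in> tuples L (Suc r)" if "i < length ys" for i
    using tuples_update[OF xs(3)] br_closed x tuples_nth[OF xs(3)] that len by simp
  have "lie x (\<lambda>us. d c (y # us)) ys = lie x (\<lambda>us. lie y c us - d (\<lambda>vs. c (y # vs)) us) ys"
    unfolding cel_def[of br th x] by (simp add: d_Cons[OF c xs(2) xs(3)] d_Cons[OF c xs(2) T])
  also have "\<dots> = lie x (lie y c) ys - lie x (d (\<lambda>us. c (y # us))) ys"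
    unfolding cel_def[of br th x]
    using th_diff[OF x alt_D(1)[OF lie_alt[OF c yA] xs(3)] alt_D(1)[OF d_alt[OF cy] xs(3)]]
    by (simp add: sum_subtractf)
  finally have 1: "lie x (d c) xs = lie x (lie y c) ys - lie x (d (\<lambda>us. c (y # us))) ys - (lie ?z c ys - d (\<lambda>us. c (?z # us)) ys)"
    using xs contract_eq[of x "d c" y ys] d_Cons[OF c z xs(3)] by simp
  have 2: "d (lie x c) xs = lie y (lie x c) ys - d (\<lambda>us. lie x c (y # us)) ys"
    using d_Cons[OF lie_alt[OF c x] xs(2,3)] xs(1) by simp
  have "d (lie x (\<lambda>us. c (y # us))) ys = d (\<lambda>us. lie x c (y # us) + c (?z # us)) ys"
    by (rule d_cong[OF _ xs(3)]) (simp add: contract_eq)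
  also have "\<dots> = d (\<lambda>us. lie x c (y # us)) ys + d (\<lambda>us. c (?z # us)) ys"
    by (rule d_add[OF alt_D(1)[OF alt_form_contract[OF lie_alt[OF c x] xs(2)]] alt_D(1)[OF cz] xs(3)])
  finally have 3: "d (lie x (\<lambda>us. c (y # us))) ys = d (\<lambda>us. lie x c (y # us)) ys + d (\<lambda>us. c (?z # us)) ys" .
  show ?case
    unfolding 1 2 lie_commutator[OF c x yA xs(3)] Suc.IH[OF cy x xs(3)] 3 by simp
qed

end

section \<open>Smooth functions, vector fields and forms\<close>

lemma sum_fun_apply: "(\<Sum>i\<in>I. f i) x = (\<Sum>i\<in>I. f i x)"
  by (induction I rule: infinite_finite_induct) auto

lemma scaleR_fun_apply [simp]: "(c *\<^sub>R f) x = c *\<^sub>R f x"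
  by (simp add: scaleR_fun_def)

section \<open>Smooth functions and tangent vectors in charts\<close>

locale smooth_mfd =
  fixes atl :: "('m::{t2_space, second_countable_topology} set \<times> ('m \<Rightarrow> 'e::real_inner)) set"
    and B :: "'e set"
  assumes mfd: "smooth_manifold atl" and B: "onb B"
begin

abbreviation "smf \<equiv> smooth_fn_on atl"
abbreviation "SF \<equiv> smooth_fns atl"

lemma finite_B: "finite B"
  using B by (simp add: onb_def)

lemma smfI:
  assumes "\<And>U \<phi> k. (U, \<phi>) \<in> atl \<Longrightarrow> Ck_on k (\<phi> ` (U \<inter> W)) (\<lambda>x. f (inv_into U \<phi> x))"
  shows "smf W f"
  using assms by (auto simp: smooth_fn_on_def smooth_on_def comp_def)

lemma smfD:
  assumes "smf W f" "(U, \<phi>) \<in> atl"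
  shows "Ck_on k (\<phi> ` (U \<inter> W)) (\<lambda>x. f (inv_into U \<phi> x))"
  using assms by (auto simp: smooth_fn_on_def smooth_on_def comp_def)

lemma chart:
  assumes "(U, \<phi>) \<in> atl"
  shows "open U" "open (\<phi> ` U)" "homeomorphism U (\<phi> ` U) \<phi> (inv_into U \<phi>)"
  using mfd assms unfolding smooth_manifold_def by blast+

lemma chart_inv: "(U, \<phi>) \<in> atl \<Longrightarrow> x \<in> U \<Longrightarrow> inv_into U \<phi> (\<phi> x) = x"
  using homeomorphism_apply1[OF chart(3)] by blast

lemma chart_open:
  assumes c: "(U, \<phi>) \<in> atl" and W: "open W"
  shows "open (\<phi> ` (U \<inter> W))"
proof -
  have "openin (top_of_set (\<phi> ` U)) (\<phi> ` (U \<inter> W))"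
    by (rule homeomorphism_imp_open_map[OF chart(3)[OF c]]) (simp add: openin_open_Int W)
  then show ?thesis using chart(2)[OF c] by (simp add: openin_open_eq)
qed

lemma smf_cong:
  assumes "open W" "\<And>x. x \<in> W \<Longrightarrow> f x = g x" "smf W f"
  shows "smf W g"
proof (rule smfI)
  fix U \<phi> k assume c: "(U, \<phi>) \<in> atl"
  have eq: "f (inv_into U \<phi> x) = g (inv_into U \<phi> x)" if "x \<in> \<phi> ` (U \<inter> W)" for x
    using that chart_inv[OF c] assms(2) by auto
  show "Ck_on k (\<phi> ` (U \<inter> W)) (\<lambda>x. g (inv_into U \<phi> x))"
    by (rule Ck_on_cong[OF chart_open[OF c assms(1)] eq, THEN iffD1]) (auto intro: smfD[OF assms(3) c])
qed

lemma smf_subset: "smf W f \<Longrightarrow> V \<subseteq> W \<Longrightarrow> smf V f"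
  by (rule smfI, rule Ck_on_subset[OF smfD]) auto

lemma smf_local:
  assumes "\<And>x. x \<in> W \<Longrightarrow> \<exists>V. open V \<and> x \<in> V \<and> smf V f"
  shows "smf W f"
proof (intro smfI Ck_on_local)
  fix U \<phi> k y assume c: "(U, \<phi>) \<in> atl" and "y \<in> \<phi> ` (U \<inter> W)"
  then obtain x where x: "y = \<phi> x" "x \<in> U" "x \<in> W" by blast
  obtain V where V: "open V" "x \<in> V" "smf V f" using assms[OF x(3)] by blast
  show "\<exists>V. open V \<and> y \<in> V \<and> Ck_on k V (\<lambda>x. f (inv_into U \<phi> x))"
    using x V(2) by (intro exI[of _ "\<phi> ` (U \<inter> V)"] conjI chart_open[OF c V(1)] smfD[OF V(3) c]) blast
qed

lemma smf_add: "open W \<Longrightarrow> smf W f \<Longrightarrow> smf W g \<Longrightarrow> smf W (f + g)"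
  unfolding plus_fun_def by (rule smfI, rule Ck_on_add[OF chart_open]) (assumption | rule smfD)+

lemma smf_mult: "open W \<Longrightarrow> smf W f \<Longrightarrow> smf W g \<Longrightarrow> smf W (f * g)"
  unfolding times_fun_def by (rule smfI, rule Ck_on_mult[OF chart_open]) (assumption | rule smfD)+

lemma smf_const: "open W \<Longrightarrow> smf W (\<lambda>x. c)"
  by (rule smfI, rule Ck_on_const[OF chart_open])

lemma smf_inverse: "open W \<Longrightarrow> smf W f \<Longrightarrow> (\<And>x. x \<in> W \<Longrightarrow> f x \<noteq> 0) \<Longrightarrow> smf W (\<lambda>x. inverse (f x))"
  by (rule smfI, rule Ck_on_inverse[OF chart_open]) (assumption | rule smfD | auto simp: chart_inv)+

lemma smf_sum: "open W \<Longrightarrow> (\<And>i. i \<in> I \<Longrightarrow> smf W (f i)) \<Longrightarrow> smf W (\<Sum>i\<in>I. f i)"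
proof (induction I rule: infinite_finite_induct)
  case (insert i I)
  have "smf W (f i + sum f I)" by (intro smf_add insert) auto
  then show ?case by (simp only: sum.insert[OF insert.hyps])
qed (auto simp: zero_fun_def intro: smf_const)

lemma smf_scale: "open W \<Longrightarrow> smf W f \<Longrightarrow> smf W (c *\<^sub>R f)"
  using smf_mult[OF _ smf_const[of W c], of f] by (simp add: scaleR_fun_def times_fun_def)

lemma smf_diff: "open W \<Longrightarrow> smf W f \<Longrightarrow> smf W g \<Longrightarrow> smf W (f - g)"
  using smf_add[OF _ _ smf_scale[of W g "-1"], of f] by simp

lemma SF_iff: "f \<in> SF \<longleftrightarrow> smf UNIV f"
  by (simp add: smooth_fns_def)

lemma SF_add: "f \<in> SF \<Longrightarrow> g \<in> SF \<Longrightarrow> f + g \<in> SF"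
  and SF_mult: "f \<in> SF \<Longrightarrow> g \<in> SF \<Longrightarrow> f * g \<in> SF"
  and SF_diff: "f \<in> SF \<Longrightarrow> g \<in> SF \<Longrightarrow> f - g \<in> SF"
  and SF_scale: "f \<in> SF \<Longrightarrow> c *\<^sub>R f \<in> SF"
  and SF_const: "(\<lambda>x. c) \<in> SF"
  and SF_sum: "(\<And>i. i \<in> I \<Longrightarrow> F i \<in> SF) \<Longrightarrow> (\<Sum>i\<in>I. F i) \<in> SF"
  by (auto simp: SF_iff intro: smf_add smf_mult smf_diff smf_scale smf_const smf_sum)

lemma SF_zero: "0 \<in> SF" and SF_one: "1 \<in> SF"
  using SF_const by (auto simp: zero_fun_def one_fun_def)

text \<open>Smoothness in the remaining charts comes from composing with the smooth transition
  maps.\<close>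

lemma smf_chart:
  assumes c: "(U, \<phi>) \<in> atl" and V: "open V" "V \<subseteq> U" and h: "\<And>k. Ck_on k (\<phi> ` V) h"
  shows "smf V (\<lambda>x. h (\<phi> x))"
proof (rule smfI)
  fix U' \<psi> k assume c': "(U', \<psi>) \<in> atl"
  have "smooth_on (\<psi> ` (U' \<inter> U)) (\<phi> \<circ> inv_into U' \<psi>)"
    using mfd c c' unfolding smooth_manifold_def by blast
  then have "Ck_on k (\<psi> ` (U' \<inter> V)) (\<lambda>x. \<phi> (inv_into U' \<psi> x))"
    unfolding smooth_on_def comp_def using V(2) by (auto intro: Ck_on_subset)
  moreover have "open (\<phi> ` V)" using chart_open[OF c V(1)] V(2) by (simp add: inf.absorb2)
  moreover have "(\<lambda>x. \<phi> (inv_into U' \<psi> x)) ` (\<psi> ` (U' \<inter> V)) \<subseteq> \<phi> ` V"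
    using chart_inv[OF c'] by auto
  ultimately show "Ck_on k (\<psi> ` (U' \<inter> V)) (\<lambda>x. h (\<phi> (inv_into U' \<psi> x)))"
    by - (rule Ck_on_compose[OF B chart_open[OF c' V(1)] _ _ h])
qed

lemma tangentD:
  assumes "v \<in> tangent atl x"
  shows "f \<in> SF \<Longrightarrow> g \<in> SF \<Longrightarrow> v (f + g) = v f + v g"
    and "f \<in> SF \<Longrightarrow> v (c *\<^sub>R f) = c * v f"
    and "f \<in> SF \<Longrightarrow> g \<in> SF \<Longrightarrow> v (f * g) = f x * v g + g x * v f"
    and "f \<notin> SF \<Longrightarrow> v f = 0"
  using assms by (auto simp: tangent_def)

lemma tangent_zero: "v \<in> tangent atl x \<Longrightarrow> v 0 = 0"
  using tangentD(1)[of v x 0 0] SF_zero by simp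

lemma tangent_sum: "v \<in> tangent atl x \<Longrightarrow> (\<And>i. i \<in> I \<Longrightarrow> F i \<in> SF) \<Longrightarrow> v (\<Sum>i\<in>I. F i) = (\<Sum>i\<in>I. v (F i))"
proof (induction I rule: infinite_finite_induct)
  case (insert i I)
  then show ?case using tangentD(1)[OF insert.prems(1), of "F i" "\<Sum>i\<in>I. F i"] SF_sum[of I F] by simp
qed (auto simp: tangent_zero)

lemma subspace_tangent: "subspace (tangent atl x)"
  unfolding subspace_def
proof (intro conjI ballI allI)
  show "0 \<in> tangent atl x" by (simp add: tangent_def)
  show "v + w \<in> tangent atl x" if "v \<in> tangent atl x" "w \<in> tangent atl x" for v w
    using that by (auto simp: tangent_def algebra_simps)
  show "c *\<^sub>R v \<in> tangent atl x" if "v \<in> tangent atl x" for v c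
    using that by (auto simp: tangent_def algebra_simps)
qed

end

section \<open>Coordinate discs, cut-off functions and the dimension of tangent spaces\<close>

locale chart_disc = smooth_mfd atl B
  for atl :: "('m::{t2_space, second_countable_topology} set \<times> ('m \<Rightarrow> 'e::real_inner)) set" and B +
  fixes U :: "'m set" and \<phi> :: "'m \<Rightarrow> 'e" and x0 :: 'm and R :: real
  assumes c: "(U, \<phi>) \<in> atl" and x0: "x0 \<in> U" and R: "R > 0" and RU: "ball (\<phi> x0) R \<subseteq> \<phi> ` U"
begin

definition V :: "'m set" where "V = {x \<in> U. \<phi> x \<in> ball (\<phi> x0) R}"

text \<open>A bump function with support of radius R/2, strictly inside the disc of radius R, so
  that its extension by 0 remains smooth.\<close>

definition bb :: "'m \<Rightarrow> real" where
  "bb x = (if x \<in> V then flat 0 ((R / 2)\<^sup>2 - (norm (\<phi> x - \<phi> x0))\<^sup>2) else 0)"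

text \<open>Turns a function of the coordinates into a globally defined one, the only kind to which
  tangent vectors apply.\<close>

definition cut :: "('e \<Rightarrow> real) \<Rightarrow> 'm \<Rightarrow> real" where
  "cut h x = (if x \<in> V then bb x * h (\<phi> x) else 0)"

definition hat :: "('m \<Rightarrow> real) \<Rightarrow> 'e \<Rightarrow> real" where
  "hat f z = f (inv_into U \<phi> z)"

lemma V_open: "open V"
proof -
  have "continuous_on U \<phi>" using chart(3)[OF c] by (rule homeomorphism_cont1)
  then have "open (U \<inter> \<phi> -` ball (\<phi> x0) R)" using chart(1)[OF c] by (intro continuous_open_preimage) auto
  then show ?thesis by (simp add: V_def Collect_conj_eq vimage_def)
qed

lemma V_image: "\<phi> ` V = ball (\<phi> x0) R"
  using RU by (auto simp: V_def)

lemma V_U: "V \<subseteq> U" by (auto simp: V_def)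

lemma x0_V: "x0 \<in> V" using x0 R by (simp add: V_def)

lemma hat_eq: "x \<in> V \<Longrightarrow> hat f (\<phi> x) = f x"
  using V_U chart_inv[OF c] by (auto simp: hat_def)

lemma hat_Ck: "f \<in> SF \<Longrightarrow> Ck_on k (ball (\<phi> x0) R) (hat f)"
  unfolding hat_def SF_iff by (rule Ck_on_subset[OF smfD[OF _ c]]) (use RU in auto)

text \<open>The open sets \<open>V\<close> and the complement of a compact set containing the
  support cover M. That compact set is closed because M is Hausdorff, and outside it the function is
  0.\<close>

lemma cut_smooth:
  assumes h: "\<And>k. Ck_on k (ball (\<phi> x0) R) h"
  shows "cut h \<in> SF"
  unfolding SF_iff
proof (rule smf_local)
  fix x
  let ?K = "inv_into U \<phi> ` cball (\<phi> x0) (R / 2)"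
  have sub: "cball (\<phi> x0) (R / 2) \<subseteq> ball (\<phi> x0) R" using R by auto
  have "compact ?K"
  proof (rule compact_continuous_image)
    have "continuous_on (\<phi> ` U) (inv_into U \<phi>)" using chart(3)[OF c] by (rule homeomorphism_cont2)
    then show "continuous_on (cball (\<phi> x0) (R / 2)) (inv_into U \<phi>)"
      by (rule continuous_on_subset) (use sub RU in blast)
    show "compact (cball (\<phi> x0) (R / 2))" by (rule onb_compact_cball[OF B])
  qed
  then have Kopen: "open (- ?K)" using compact_imp_closed by blast
  have KV: "?K \<subseteq> V"
  proof
    fix y assume "y \<in> ?K"
    then obtain z where z: "y = inv_into U \<phi> z" "z \<in> cball (\<phi> x0) (R / 2)" by blast
    then obtain w where "w \<in> V" "z = \<phi> w" using sub V_image by blast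
    then show "y \<in> V" using z chart_inv[OF c] V_U by auto
  qed
  have zero: "cut h y = 0" if "y \<in> - ?K" for y
  proof (cases "y \<in> V")
    case True
    then have "\<phi> y \<notin> cball (\<phi> x0) (R / 2)"
    proof -
      have "inv_into U \<phi> (\<phi> y) = y" using True chart_inv[OF c, of y] V_U by blast
      then show ?thesis using that imageI[of "\<phi> y" "cball (\<phi> x0) (R / 2)" "inv_into U \<phi>"] by auto
    qed
    then have "R / 2 < norm (\<phi> y - \<phi> x0)" by (simp add: dist_norm norm_minus_commute)
    then have "(R / 2)\<^sup>2 \<le> (norm (\<phi> y - \<phi> x0))\<^sup>2" using R by (intro power_mono) auto
    then show ?thesis by (simp add: cut_def bb_def flat_def)
  qed (simp add: cut_def)
  show "\<exists>W. open W \<and> x \<in> W \<and> smf W (cut h)"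
  proof (cases "x \<in> V")
    case True
    have "Ck_on k (ball (\<phi> x0) R) (\<lambda>z. flat 0 ((R / 2)\<^sup>2 - (norm (z - \<phi> x0))\<^sup>2) * h z)" for k
      by (rule Ck_on_mult[OF open_ball Ck_on_subset[OF bump_Ck[OF B]] h]) auto
    from smf_chart[OF c V_open V_U this[folded V_image]]
    have "smf V (\<lambda>x. flat 0 ((R / 2)\<^sup>2 - (norm (\<phi> x - \<phi> x0))\<^sup>2) * h (\<phi> x))" .
    then have "smf V (cut h)" by (rule smf_cong[OF V_open, rotated]) (simp add: cut_def bb_def)
    then show ?thesis using V_open True by (intro exI[of _ V] conjI)
  next
    case False
    have "smf (- ?K) (cut h)"
      by (rule smf_cong[OF Kopen _ smf_const[OF Kopen, of 0]]) (simp add: zero)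
    moreover have "x \<in> - ?K" using False KV by blast
    ultimately show ?thesis using Kopen by (intro exI[of _ "- ?K"] conjI)
  qed
qed

lemma bb_cut: "bb = cut (\<lambda>z. 1)"
  by (rule ext) (simp add: cut_def bb_def)

lemma bb_SF: "bb \<in> SF"
  unfolding bb_cut by (rule cut_smooth) simp

lemma bb_x0: "bb x0 > 0"
  using x0_V R by (simp add: bb_def flat_def)

lemma bb_V: "bb x \<noteq> 0 \<Longrightarrow> x \<in> V"
  by (auto simp: bb_def split: if_splits)

lemma inner_Ck: "Ck_on k (ball (\<phi> x0) R) (\<lambda>z. z \<bullet> b)"
  by (intro Ck_on_bounded_linear[OF open_ball bounded_linear_inner_left] Ck_on_id open_ball)

definition coord :: "'e \<Rightarrow> 'm \<Rightarrow> real" where "coord b = cut (\<lambda>z. z \<bullet> b)"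

lemma coord_SF: "coord b \<in> SF"
  unfolding coord_def by (rule cut_smooth) (rule inner_Ck)

definition pd :: "'e \<Rightarrow> ('m \<Rightarrow> real) \<Rightarrow> 'e \<Rightarrow> real" where
  "pd b f z = frechet_derivative (hat f) (at z) b"

text \<open>Both sides of Hadamard's expansion are multiplied by the square of the bump function \<open>bb\<close>,
  so that \<open>v\<close> is only applied to globally smooth functions.\<close>

lemma tangent_formula:
  assumes v: "v \<in> tangent atl y" and y: "bb y \<noteq> 0" and f: "f \<in> SF"
  shows "bb y * v f = (\<Sum>b\<in>B. (v (coord b) - (\<phi> y \<bullet> b) * v bb) * pd b f (\<phi> y))"
proof -
  have yV: "y \<in> V" using bb_V[OF y] .
  then have "\<phi> y \<in> ball (\<phi> x0) R" by (simp add: V_def)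
  then obtain g where g: "\<And>k b. Ck_on k (ball (\<phi> x0) R) (g b)"
    "\<And>b. g b (\<phi> y) = frechet_derivative (hat f) (at (\<phi> y)) b"
    "\<And>z. z \<in> ball (\<phi> x0) R \<Longrightarrow> hat f z = hat f (\<phi> y) + (\<Sum>b\<in>B. ((z - \<phi> y) \<bullet> b) * g b z)"
    using hadamard[OF B open_ball convex_ball _ hat_Ck[OF f]] by blast
  \<comment> \<open>In coordinates \<open>u b\<close> is the bump function times the b-component of
    z - phi(y). It vanishes at y, so the product rule leaves only v(u b) times the value of the
    other factor.\<close>
  define u where "u b = coord b + (- (\<phi> y \<bullet> b)) *\<^sub>R bb" for b
  have uS: "u b \<in> SF" for b unfolding u_def by (intro SF_add SF_scale coord_SF bb_SF)
  have gS: "cut (g b) \<in> SF" for b by (rule cut_smooth[OF g(1)])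
  have eq: "(bb * bb) * f = f y *\<^sub>R (bb * bb) + (\<Sum>b\<in>B. u b * cut (g b))"
  proof
    fix x
    show "((bb * bb) * f) x = (f y *\<^sub>R (bb * bb) + (\<Sum>b\<in>B. u b * cut (g b))) x"
    proof (cases "x \<in> V")
      case True
      then have "\<phi> x \<in> ball (\<phi> x0) R" by (simp add: V_def)
      from g(3)[OF this] have fx: "f x = f y + (\<Sum>b\<in>B. ((\<phi> x - \<phi> y) \<bullet> b) * g b (\<phi> x))"
        using hat_eq[OF True] hat_eq[OF yV] by simp
      have "bb x * bb x * f x = f y * (bb x * bb x) + (\<Sum>b\<in>B. (bb x * (\<phi> x \<bullet> b) - (\<phi> y \<bullet> b) * bb x) * (bb x * g b (\<phi> x)))"
        unfolding fx by (simp add: distrib_left sum_distrib_left inner_diff_left algebra_simps)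
      then show ?thesis using True by (simp add: sum_fun_apply u_def coord_def cut_def)
    qed (simp add: sum_fun_apply cut_def bb_def)
  qed
  have bS: "bb * bb \<in> SF" by (intro SF_mult bb_SF)
  have "v ((bb * bb) * f) = (bb y * bb y) * v f + f y * v (bb * bb)"
    using tangentD(3)[OF v bS f] by simp
  moreover have "v (f y *\<^sub>R (bb * bb) + (\<Sum>b\<in>B. u b * cut (g b))) =
      f y * v (bb * bb) + (\<Sum>b\<in>B. v (u b * cut (g b)))"
  proof -
    have S: "(\<Sum>b\<in>B. u b * cut (g b)) \<in> SF" by (intro SF_sum SF_mult uS gS)
    have "v (\<Sum>b\<in>B. u b * cut (g b)) = (\<Sum>b\<in>B. v (u b * cut (g b)))"
      by (rule tangent_sum[OF v]) (intro SF_mult uS gS)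
    then show ?thesis unfolding tangentD(1)[OF v SF_scale[OF bS] S] tangentD(2)[OF v bS] by simp
  qed
  moreover have "v (u b * cut (g b)) = bb y * ((v (coord b) - (\<phi> y \<bullet> b) * v bb) * pd b f (\<phi> y))" for b
  proof -
    have "u b y = 0" using yV by (simp add: u_def coord_def cut_def)
    moreover have "v (u b) = v (coord b) - (\<phi> y \<bullet> b) * v bb"
      unfolding u_def tangentD(1)[OF v coord_SF SF_scale[OF bb_SF]] tangentD(2)[OF v bb_SF] by simp
    moreover have "cut (g b) y = bb y * pd b f (\<phi> y)" using yV g(2) by (simp add: cut_def pd_def)
    ultimately show ?thesis using tangentD(3)[OF v uS gS, of b b] by simp
  qed
  ultimately have "bb y * (bb y * v f) = bb y * (\<Sum>b\<in>B. (v (coord b) - (\<phi> y \<bullet> b) * v bb) * pd b f (\<phi> y))"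
    unfolding eq by (simp add: sum_distrib_left)
  then show ?thesis using y by simp
qed

text \<open>By \<open>tangent_formula\<close> a tangent vector is determined by its components along
  \<open>B\<close>, so an independent set injects linearly into a space with \<open>card B\<close>
  generators.\<close>

lemma tangent_independent_card:
  assumes C: "independent C" "C \<subseteq> tangent atl x0"
  shows "finite C \<and> card C \<le> card B"
proof -
  \<comment> \<open>The components of v, up to the factor \<open>bb x0\<close>. Vectors indexed by
    \<open>B\<close> are encoded as functions that vanish outside \<open>B\<close>, with
    \<open>e b\<close> as unit vectors.\<close>
  define A where "A v = (\<lambda>b. if b \<in> B then v (coord b) - (\<phi> x0 \<bullet> b) * v bb else 0)" for v :: "('m \<Rightarrow> real) \<Rightarrow> real"
  define e where "e b = (\<lambda>c::'e. if c = b then 1 else 0 :: real)" for b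
  have lin: "linear A"
    by (rule linearI) (auto simp: A_def algebra_simps fun_eq_iff)
  have inj: "inj_on A (span C)"
  proof (subst linear_injective_on_subspace_0[OF lin subspace_span], intro ballI impI)
    have sub: "span C \<subseteq> tangent atl x0" by (rule span_minimal[OF C(2) subspace_tangent])
    fix v assume "v \<in> span C" and A0: "A v = 0"
    then have v: "v \<in> tangent atl x0" using sub by blast
    have "v (coord b) - (\<phi> x0 \<bullet> b) * v bb = 0" if "b \<in> B" for b
      using fun_cong[OF A0, of b] that by (simp add: A_def)
    then have "bb x0 * v f = 0" if "f \<in> SF" for f
      using tangent_formula[OF v _ that] bb_x0 by simp
    then have "v f = 0" for f using tangentD(4)[OF v, of f] bb_x0 by (cases "f \<in> SF") auto
    then show "v = 0" by (simp add: fun_eq_iff)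
  qed
  have ind: "independent (A ` C)" by (rule linear_independent_injective_image[OF lin C(1) inj])
  have "A v \<in> span (e ` B)" for v
  proof -
    have "A v = (\<Sum>b\<in>B. A v b *\<^sub>R e b)"
    proof
      fix c show "A v c = (\<Sum>b\<in>B. A v b *\<^sub>R e b) c"
        using finite_B by (cases "c \<in> B")
          (auto simp: sum_fun_apply e_def A_def if_distrib cong: if_cong intro!: sum.neutral[symmetric])
    qed
    also have "\<dots> \<in> span (e ` B)" by (intro span_sum span_scale span_base) auto
    finally show ?thesis .
  qed
  then have "finite (A ` C) \<and> card (A ` C) \<le> card (e ` B)"
    using independent_span_bound[OF finite_imageI[OF finite_B] ind] by blast
  moreover have "inj_on A C" using inj span_superset inj_on_subset by blast
  moreover have "card (e ` B) \<le> card B" using finite_B by (rule card_image_le)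
  ultimately show ?thesis using finite_imageD card_image by fastforce
qed

text \<open>The coordinate field in direction b multiplied by the bump function, hence a global
  vector field; it is 0 on non-smooth functions by convention.\<close>

definition pvf :: "'e \<Rightarrow> 'm vf" where
  "pvf b = (\<lambda>f. if f \<in> SF then cut (pd b f) else 0)"

lemma pd_Ck: "f \<in> SF \<Longrightarrow> Ck_on k (ball (\<phi> x0) R) (pd b f)"
  unfolding pd_def using Ck_on_SucD(2)[OF hat_Ck, of f k b] by blast

lemma hat_deriv:
  assumes "f \<in> SF" "z \<in> ball (\<phi> x0) R"
  shows "(hat f has_derivative (\<lambda>b. pd b f z)) (at z)"
  using Ck_on_SucD(1)[OF hat_Ck[OF assms(1), of "Suc 0"] assms(2)] by (simp add: pd_def)

lemma pd_eqI:
  assumes "(hat f has_derivative D) (at z)"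
  shows "pd b f z = D b"
  unfolding pd_def using frechet_derivative_eqI[OF assms] by simp

lemma pvf_vfields: "pvf b \<in> vfields atl"
  unfolding vfields_def
proof (intro CollectI conjI allI ballI)
  show "pvf b f \<in> SF" if "f \<in> SF" for f
    using that cut_smooth[OF pd_Ck[OF that]] by (simp add: pvf_def)
  fix x
  have add: "cut (pd b (f + g)) x = cut (pd b f) x + cut (pd b g) x"
    and mult: "cut (pd b (f * g)) x = f x * cut (pd b g) x + g x * cut (pd b f) x"
    and scale: "cut (pd b (c *\<^sub>R f)) x = c * cut (pd b f) x" if f: "f \<in> SF" and g: "g \<in> SF" for f g c
  proof -
    have 1: "x \<in> V \<Longrightarrow> pd b (f + g) (\<phi> x) = pd b f (\<phi> x) + pd b g (\<phi> x)"
      by (rule pd_eqI, unfold hat_def plus_fun_apply, fold hat_def)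
        (intro has_derivative_add hat_deriv f g, auto simp: V_def)
    have 2: "x \<in> V \<Longrightarrow> pd b (f * g) (\<phi> x) = hat f (\<phi> x) * pd b g (\<phi> x) + pd b f (\<phi> x) * hat g (\<phi> x)"
      by (rule pd_eqI, unfold hat_def times_fun_apply, fold hat_def)
        (intro has_derivative_mult hat_deriv f g, auto simp: V_def)
    have 3: "x \<in> V \<Longrightarrow> pd b (c *\<^sub>R f) (\<phi> x) = c *\<^sub>R pd b f (\<phi> x)"
      by (rule pd_eqI, unfold hat_def scaleR_fun_apply, fold hat_def)
        (intro has_derivative_scaleR_right hat_deriv f, auto simp: V_def)
    show "cut (pd b (f + g)) x = cut (pd b f) x + cut (pd b g) x"
      using 1 by (simp add: cut_def distrib_left)
    show "cut (pd b (f * g)) x = f x * cut (pd b g) x + g x * cut (pd b f) x"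
      using 2 hat_eq[of x] by (simp add: cut_def algebra_simps)
    show "cut (pd b (c *\<^sub>R f)) x = c * cut (pd b f) x"
      using 3 by (simp add: cut_def)
  qed
  show "vf_at (pvf b) x \<in> tangent atl x"
    unfolding tangent_def vf_at_def pvf_def
    using add mult scale SF_add SF_mult SF_scale by auto
qed

text \<open>The three factors \<open>bb\<close>: one comes from \<open>tangent_formula\<close>, one
  turns the coordinate into the global function \<open>coord b\<close>, and one is contained in
  \<open>pvf b\<close>.\<close>

lemma vfield_local_frame:
  assumes X: "X \<in> vfields atl"
  shows "fmul (bb * bb * bb) X = (\<Sum>b\<in>B. fmul (bb * X (coord b) - coord b * X bb) (pvf b))"
proof (intro ext)
  fix f x
  have v: "vf_at X x \<in> tangent atl x" using X by (simp add: vfields_def)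
  have va: "vf_at X x g = X g x" for g by (simp add: vf_at_def)
  show "fmul (bb * bb * bb) X f x = (\<Sum>b\<in>B. fmul (bb * X (coord b) - coord b * X bb) (pvf b)) f x"
  proof (cases "f \<in> SF \<and> bb x \<noteq> 0")
    case True
    then have f: "f \<in> SF" and bx: "bb x \<noteq> 0" and xV: "x \<in> V" using bb_V by auto
    have "bb x * bb x * (bb x * X f x) =
        bb x * bb x * (\<Sum>b\<in>B. (X (coord b) x - (\<phi> x \<bullet> b) * X bb x) * pd b f (\<phi> x))"
      using tangent_formula[OF v bx f] by (simp add: va)
    then show ?thesis
      using f xV by (simp add: fmul_def sum_fun_apply pvf_def cut_def coord_def sum_distrib_left algebra_simps)
  next
    case False
    have "pvf b f x = 0" for b
    proof (cases "f \<in> SF")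
      case True
      then have "bb x = 0" using False by simp
      then show ?thesis unfolding pvf_def cut_def by simp
    next
      case False
      then show ?thesis unfolding pvf_def by simp
    qed
    moreover have "bb x * X f x = 0"
    proof (cases "f \<in> SF")
      case True
      then have "bb x = 0" using False by simp
      then show ?thesis by simp
    next
      case False
      then show ?thesis using tangentD(4)[OF v, of f] by (simp add: va)
    qed
    ultimately show ?thesis by (simp add: fmul_def sum_fun_apply)
  qed
qed

end

context smooth_mfd
begin

lemma chart_disc_exists: "\<exists>U \<phi> R. chart_disc atl B U \<phi> x R"
proof -
  have "(\<Union>(U, \<phi>)\<in>atl. U) = UNIV" using mfd by (simp add: smooth_manifold_def)
  then have "x \<in> (\<Union>(U, \<phi>)\<in>atl. U)" by (simp only: UNIV_I)
  then obtain k where k: "k \<in> atl" "x \<in> (case k of (U, \<phi>) \<Rightarrow> U)" by (rule UN_E)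
  obtain U \<phi> where c: "(U, \<phi>) \<in> atl" "x \<in> U" using k by (cases k) simp
  obtain R where "R > 0" "ball (\<phi> x) R \<subseteq> \<phi> ` U"
    using openE[OF chart(2)[OF c(1)], of "\<phi> x"] c(2) by blast
  then have "chart_disc atl B U \<phi> x R" using c by unfold_locales auto
  then show ?thesis by blast
qed

lemma tangent_independent_bound:
  assumes "independent C" "C \<subseteq> tangent atl x"
  shows "finite C \<and> card C \<le> dim (UNIV :: 'e set)"
proof -
  obtain U \<phi> R where "chart_disc atl B U \<phi> x R" using chart_disc_exists by blast
  then interpret chart_disc atl B U \<phi> x R .
  show ?thesis using tangent_independent_card[OF assms] B by (simp add: onb_def)
qed

text \<open>The device behind tensoriality: up to a factor that is nonzero at x, a field vanishing
  at x is a combination of global fields whose coefficients vanish at x. Factor and fields depend on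
  x but not on the field decomposed.\<close>

lemma vfield_decomposition:
  "\<exists>c Y. c \<in> SF \<and> c x \<noteq> 0 \<and> (\<forall>b. Y b \<in> vfields atl) \<and>
    (\<forall>X\<in>vfields atl. \<exists>a. (\<forall>b. a b \<in> SF) \<and> fmul c X = (\<Sum>b\<in>B. fmul (a b) (Y b)) \<and>
      (vf_at X x = 0 \<longrightarrow> (\<forall>b. a b x = 0)))"
proof -
  obtain U \<phi> R where "chart_disc atl B U \<phi> x R" using chart_disc_exists by blast
  then interpret chart_disc atl B U \<phi> x R .
  show ?thesis
  proof (intro exI[of _ "bb * bb * bb"] exI[of _ pvf] conjI allI ballI)
    show "bb * bb * bb \<in> SF" by (intro SF_mult bb_SF)
    show "(bb * bb * bb) x \<noteq> 0" using bb_x0 by simp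
    show "pvf b \<in> vfields atl" for b by (rule pvf_vfields)
    fix X assume X: "X \<in> vfields atl"
    have XS: "X f \<in> SF" if "f \<in> SF" for f using X that by (simp add: vfields_def)
    show "\<exists>a. (\<forall>b. a b \<in> SF) \<and> fmul (bb * bb * bb) X = (\<Sum>b\<in>B. fmul (a b) (pvf b)) \<and>
        (vf_at X x = 0 \<longrightarrow> (\<forall>b. a b x = 0))"
    proof (intro exI[of _ "\<lambda>b. bb * X (coord b) - coord b * X bb"] conjI allI impI)
      show "bb * X (coord b) - coord b * X bb \<in> SF" for b
        by (intro SF_diff SF_mult XS bb_SF coord_SF)
      show "(bb * X (coord b) - coord b * X bb) x = 0" if "vf_at X x = 0" for b
        using fun_cong[OF that, of "coord b"] fun_cong[OF that, of bb] by (simp add: vf_at_def)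
    qed (rule vfield_local_frame[OF X])
  qed
qed

end

lemma alt_form_cong:
  assumes c: "alt_form L N r c" and L: "\<And>x y. x \<in> L \<Longrightarrow> y \<in> L \<Longrightarrow> x + y \<in> L"
    and eq: "\<And>xs. xs \<in> tuples L r \<Longrightarrow> c xs = c' xs"
  shows "alt_form L N r c'"
  unfolding alt_form_def additive_form_def
proof (intro conjI ballI allI impI)
  fix xs assume xs: "xs \<in> tuples L r"
  show "c' xs \<in> N" using additive_formD(1)[OF alt_form_additive[OF c] xs] eq[OF xs] by simp
  show "c' (xs[i := x + y]) = c' (xs[i := x]) + c' (xs[i := y])" if "i < r" "x \<in> L" "y \<in> L" for i x y
    using additive_formD(2)[OF alt_form_additive[OF c] xs that] eq[OF tuples_update[OF xs]] L that by simp
  show "c' xs = 0" if "j < r" "i < j" "xs ! i = xs ! j" for i j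
    using alt_form_zero[OF c xs, of i j] that eq[OF xs] by simp
qed

lemma (in lie_rinehart) hom_form_cong:
  assumes "hom_form r c" "\<And>xs. xs \<in> tuples L r \<Longrightarrow> c xs = c' xs"
  shows "hom_form r c'"
  unfolding hom_form_def
proof (intro ballI allI impI)
  fix xs i x f assume a: "xs \<in> tuples L r" "i < r" "x \<in> L" "f \<in> R"
  then show "c' (xs[i := sl f x]) = sn f (c' (xs[i := x]))"
    using assms(1) assms(2)[OF tuples_update[OF a(1) sl_closed[OF a(4,3)], of i]]
      assms(2)[OF tuples_update[OF a(1,3), of i]] unfolding hom_form_def by simp
qed

section \<open>Vector fields and differential forms\<close>

context smooth_mfd
begin

abbreviation "VF \<equiv> vfields atl"

lemma vfD:
  assumes "X \<in> VF"
  shows vf_SF: "X f \<in> SF"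
    and vf_add: "f \<in> SF \<Longrightarrow> g \<in> SF \<Longrightarrow> X (f + g) = X f + X g"
    and vf_scale: "f \<in> SF \<Longrightarrow> X (c *\<^sub>R f) = c *\<^sub>R X f"
    and vf_mult: "f \<in> SF \<Longrightarrow> g \<in> SF \<Longrightarrow> X (f * g) = f * X g + g * X f"
    and vf_out: "f \<notin> SF \<Longrightarrow> X f = 0"
    and vf_zero: "X 0 = 0"
    and vf_diff: "f \<in> SF \<Longrightarrow> g \<in> SF \<Longrightarrow> X (f - g) = X f - X g"
proof -
  have t: "vf_at X x \<in> tangent atl x" for x using assms by (simp add: vfields_def)
  have e: "vf_at X x f = X f x" for x f by (simp add: vf_at_def)
  show add: "X (f + g) = X f + X g" if "f \<in> SF" "g \<in> SF" for f g
    using tangentD(1)[OF t that] by (simp add: e fun_eq_iff)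
  show scale: "X (c *\<^sub>R f) = c *\<^sub>R X f" if "f \<in> SF" for f c
    using tangentD(2)[OF t that] by (simp add: e fun_eq_iff)
  show "X (f * g) = f * X g + g * X f" if "f \<in> SF" "g \<in> SF"
    using tangentD(3)[OF t that] by (simp add: e fun_eq_iff)
  show out: "X f = 0" if "f \<notin> SF" for f
    using tangentD(4)[OF t that] by (simp add: e fun_eq_iff)
  show "X 0 = 0" using tangent_zero[OF t] by (simp add: e fun_eq_iff)
  show "X f \<in> SF"
    using assms out SF_zero by (cases "f \<in> SF") (auto simp: vfields_def)
  show "X (f - g) = X f - X g" if "f \<in> SF" "g \<in> SF"
    using add[OF that(1) SF_scale[OF that(2)], of "-1"] scale[OF that(2), of "-1"] by simp
qed

lemma vfI:
  assumes "\<And>f. f \<in> SF \<Longrightarrow> X f \<in> SF"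
    and "\<And>f g. f \<in> SF \<Longrightarrow> g \<in> SF \<Longrightarrow> X (f + g) = X f + X g"
    and "\<And>c f. f \<in> SF \<Longrightarrow> X (c *\<^sub>R f) = c *\<^sub>R X f"
    and "\<And>f g. f \<in> SF \<Longrightarrow> g \<in> SF \<Longrightarrow> X (f * g) = f * X g + g * X f"
    and "\<And>f. f \<notin> SF \<Longrightarrow> X f = 0"
  shows "X \<in> VF"
  using assms by (simp add: vfields_def tangent_def vf_at_def)

lemma VF_add: assumes "X \<in> VF" "Y \<in> VF" shows "X + Y \<in> VF"
proof (rule vfI)
  show "(X + Y) f \<in> SF" for f using SF_add[OF vf_SF[OF assms(1)] vf_SF[OF assms(2)], of f f] by simp
qed (use assms in \<open>simp_all add: vf_add vf_scale vf_mult vf_out fun_eq_iff algebra_simps\<close>)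

lemma VF_zero: "0 \<in> VF"
  by (rule vfI) (simp_all add: SF_zero)

lemma fmul_apply: "fmul f X g = f * X g"
  by (simp add: fmul_def)

lemma VF_fmul: assumes "X \<in> VF" "f \<in> SF" shows "fmul f X \<in> VF"
proof (rule vfI)
  show "fmul f X g \<in> SF" for g using assms by (simp add: fmul_apply SF_mult vf_SF)
qed (use assms in \<open>simp_all add: fmul_apply vf_add vf_scale vf_mult vf_out fun_eq_iff algebra_simps\<close>)

lemma fmul_const: "fmul (\<lambda>x. c) X = c *\<^sub>R X"
  by (simp add: fmul_def fun_eq_iff)

lemma VF_scale: "X \<in> VF \<Longrightarrow> c *\<^sub>R X \<in> VF"
  using VF_fmul[OF _ SF_const[of c], of X] by (simp add: fmul_const)

lemma VF_diff: "X \<in> VF \<Longrightarrow> Y \<in> VF \<Longrightarrow> X - Y \<in> VF"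
  using VF_add[OF _ VF_scale[of Y "-1"], of X] by simp

lemma VF_sum: "(\<And>i. i \<in> I \<Longrightarrow> X i \<in> VF) \<Longrightarrow> (\<Sum>i\<in>I. X i) \<in> VF"
proof (induction I rule: infinite_finite_induct)
  case (insert i I)
  then have "X i + (\<Sum>i\<in>I. X i) \<in> VF" by (intro VF_add) auto
  then show ?case by (simp only: sum.insert[OF insert.hyps])
qed (simp_all add: VF_zero)

lemma vbr_apply: "vbr X Y f = X (Y f) - Y (X f)"
  by (simp add: vbr_def)

lemma VF_vbr: assumes X: "X \<in> VF" and Y: "Y \<in> VF" shows "vbr X Y \<in> VF"
proof (rule vfI)
  note s = vf_SF[OF X] vf_SF[OF Y] SF_add SF_mult SF_scale
  show "vbr X Y f \<in> SF" for f unfolding vbr_apply by (intro SF_diff s)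
  fix f g c assume f: "f \<in> SF"
  show "vbr X Y (c *\<^sub>R f) = c *\<^sub>R vbr X Y f"
    by (rule ext) (simp add: vbr_apply f s vf_scale[OF X] vf_scale[OF Y] algebra_simps)
  assume g: "g \<in> SF"
  show "vbr X Y (f + g) = vbr X Y f + vbr X Y g"
    by (rule ext) (simp add: vbr_apply f g s vf_add[OF X] vf_add[OF Y])
  show "vbr X Y (f * g) = f * vbr X Y g + g * vbr X Y f"
    by (rule ext) (simp add: vbr_apply f g s vf_add[OF X] vf_add[OF Y] vf_mult[OF X] vf_mult[OF Y] algebra_simps)
next
  fix f assume "f \<notin> SF"
  then show "vbr X Y f = 0" by (simp add: vbr_apply vf_out[OF X] vf_out[OF Y] vf_zero[OF X] vf_zero[OF Y])
qed

lemma vbr_self: "vbr X X = 0"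
  by (simp add: vbr_def fun_eq_iff)

lemma vbr_add_right:
  assumes "X \<in> VF" "Y \<in> VF" "Z \<in> VF" shows "vbr X (Y + Z) = vbr X Y + vbr X Z"
  by (rule ext, rule ext) (use assms in \<open>simp add: vbr_apply vf_add vf_SF\<close>)

lemma vbr_add_left:
  assumes "X \<in> VF" "Y \<in> VF" "Z \<in> VF" shows "vbr (X + Y) Z = vbr X Z + vbr Y Z"
  by (rule ext, rule ext) (use assms in \<open>simp add: vbr_apply vf_add vf_SF\<close>)

lemma vbr_fmul:
  assumes X: "X \<in> VF" and Y: "Y \<in> VF" and f: "f \<in> SF"
  shows "vbr X (fmul f Y) = fmul f (vbr X Y) + fmul (X f) Y"
  by (rule ext, rule ext) (simp add: vbr_apply fmul_apply vf_mult[OF X f vf_SF[OF Y]] algebra_simps)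

lemma vbr_fmul_left:
  assumes X: "X \<in> VF" and Y: "Y \<in> VF" and f: "f \<in> SF"
  shows "vbr (fmul f X) Y = fmul f (vbr X Y) - fmul (Y f) X"
  by (rule ext, rule ext) (simp add: vbr_apply fmul_apply vf_mult[OF Y f vf_SF[OF X]] algebra_simps)

lemma vbr_jacobi:
  assumes W: "W \<in> VF" and X: "X \<in> VF" and Y: "Y \<in> VF"
  shows "vbr W (vbr X Y) = vbr (vbr W X) Y + vbr X (vbr W Y)"
  by (rule ext, rule ext) (simp add: vbr_apply vf_diff[OF W] vf_diff[OF X] vf_diff[OF Y] vf_SF[OF W] vf_SF[OF X] vf_SF[OF Y])

lemma subspace_SF: "subspace SF"
  unfolding subspace_def by (simp add: SF_zero SF_add SF_scale)

lemma fmul_add_right: "fmul f (X + Y) = fmul f X + fmul f Y"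
  by (simp add: fmul_def fun_eq_iff algebra_simps)

lemma fmul_add_left: "fmul (f + g) X = fmul f X + fmul g X"
  by (simp add: fmul_def fun_eq_iff algebra_simps)

text \<open>First instance of the calculus: vector fields acting on functions. Cochains are
  differential forms and \<open>func.lie\<close> is their Lie derivative.\<close>

sublocale func: lie_rinehart VF VF SF vbr "\<lambda>X f. X f" SF fmul "(*)" "\<lambda>X f. X f"
proof
  show "X (Y f) = Y (X f) + vbr X Y f" for X Y f by (simp add: vbr_apply)
  show "X (f * g) = f * X g + X f * g" if "f \<in> SF" "X \<in> VF" "g \<in> SF" for f g X
    using vf_mult[OF that(2,1,3)] by (simp add: mult.commute)
  show "vbr W (vbr X Y) = vbr (vbr W X) Y + vbr X (vbr W Y)" if "W \<in> VF" "X \<in> VF" "Y \<in> VF" for W X Y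
    by (rule vbr_jacobi[OF that])
  show "vbr X (fmul f Y) = fmul f (vbr X Y) + fmul (X f) Y" if "f \<in> SF" "X \<in> VF" "Y \<in> VF" for f X Y
    by (rule vbr_fmul[OF that(2,3,1)])
  show "X f \<in> SF" if "X \<in> VF" for X f by (rule vf_SF[OF that])
  show "X f \<in> SF" if "f \<in> SF" "X \<in> VF" for X f by (rule vf_SF[OF that(2)])
  show "X (f + g) = X f + X g" if "X \<in> VF" "f \<in> SF" "g \<in> SF" for X f g by (rule vf_add[OF that])
  show "fmul f X \<in> VF" if "f \<in> SF" "X \<in> VF" for f X by (rule VF_fmul[OF that(2,1)])
  show "(X + Y) f = X f + Y f" for X Y :: "'m vf" and f by simp
  show "f * (g + h) = f * g + f * h" for f g h :: "'m \<Rightarrow> real" by (rule distrib_left)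
qed (rule subset_refl VF_add VF_zero subspace_SF VF_vbr vbr_add_right vbr_add_left vbr_self fmul_apply | assumption)+

lemma lie_form_cel:
  "lie_form atl \<xi> \<omega> Xs = (if set Xs \<subseteq> VF then func.lie \<xi> \<omega> Xs else 0)"
  by (simp add: lie_form_def cel_def)

definition forms :: "nat \<Rightarrow> 'm form set" where
  "forms r = {\<omega>. (\<forall>Xs. Xs \<notin> tuples VF r \<longrightarrow> \<omega> Xs = 0) \<and> func.alt r \<omega> \<and> func.hom_form r \<omega>}"

lemma formsD:
  assumes "\<omega> \<in> forms r"
  shows "Xs \<notin> tuples VF r \<Longrightarrow> \<omega> Xs = 0" "func.alt r \<omega>" "func.hom_form r \<omega>"
  using assms by (auto simp: forms_def)

lemma forms_add: assumes "\<omega> \<in> forms r" "\<omega>' \<in> forms r" shows "\<omega> + \<omega>' \<in> forms r"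
  using assms SF_add unfolding forms_def alt_form_def additive_form_def func.hom_form_def
  by (auto simp: distrib_left)

lemma forms_zero: "0 \<in> forms r"
  unfolding forms_def alt_form_def additive_form_def func.hom_form_def
  by (auto simp: SF_zero)

lemma forms_fmul: assumes "\<omega> \<in> forms r" "f \<in> SF" shows "fmul f \<omega> \<in> forms r"
  using assms SF_mult unfolding forms_def alt_form_def additive_form_def func.hom_form_def
  by (auto simp: distrib_left fmul_def mult_ac)

lemma forms_lie:
  assumes \<omega>: "\<omega> \<in> forms r" and \<xi>: "\<xi> \<in> VF"
  shows "lie_form atl \<xi> \<omega> \<in> forms r"
proof -
  have eq: "lie_form atl \<xi> \<omega> Xs = func.lie \<xi> \<omega> Xs" if "Xs \<in> tuples VF r" for Xs
    using that by (simp add: lie_form_cel tuples_def)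
  have 1: "lie_form atl \<xi> \<omega> Xs = 0" if "Xs \<notin> tuples VF r" for Xs
  proof (cases "set Xs \<subseteq> VF")
    case True
    then have "length Xs \<noteq> r" using that by (simp add: tuples_def)
    then have "\<omega> Xs = 0" "\<And>i Y. \<omega> (Xs[i := Y]) = 0"
      using formsD(1)[OF \<omega>] by (simp_all add: tuples_def)
    then show ?thesis using True by (simp add: lie_form_def vf_zero[OF \<xi>])
  qed (simp add: lie_form_def)
  have 2: "func.alt r (lie_form atl \<xi> \<omega>)"
    by (rule alt_form_cong[OF func.lie_alt[OF formsD(2)[OF \<omega>] \<xi>] VF_add]) (simp_all add: eq)
  have 3: "func.hom_form r (lie_form atl \<xi> \<omega>)"
    by (rule func.hom_form_cong[OF func.lie_hom[OF formsD(2,3)[OF \<omega>] \<xi>]]) (simp add: eq)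
  show ?thesis using 1 2 3 by (simp add: forms_def)
qed

section \<open>Pairings and wedge products\<close>

lemma pair_vf:
  assumes s: "smooth_covecs_on atl UNIV s"
  shows "X \<in> VF \<Longrightarrow> pair s X \<in> SF"
    and "X \<in> VF \<Longrightarrow> Y \<in> VF \<Longrightarrow> pair s (X + Y) = pair s X + pair s Y"
    and "X \<in> VF \<Longrightarrow> f \<in> SF \<Longrightarrow> pair s (fmul f X) = f * pair s X"
proof -
  have c: "s x \<in> cotangent atl x" for x using s by (simp add: smooth_covecs_on_def)
  show "X \<in> VF \<Longrightarrow> pair s X \<in> SF" using s by (simp add: smooth_covecs_on_def SF_iff)
  show "pair s (X + Y) = pair s X + pair s Y" if "X \<in> VF" "Y \<in> VF"
  proof
    fix x
    have "vf_at (X + Y) x = vf_at X x + vf_at Y x" by (simp add: vf_at_def fun_eq_iff)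
    moreover have "vf_at X x \<in> tangent atl x" "vf_at Y x \<in> tangent atl x" using that by (auto simp: vfields_def)
    ultimately show "pair s (X + Y) x = (pair s X + pair s Y) x"
      using c[of x] by (simp add: pair_def cotangent_def)
  qed
  show "pair s (fmul f X) = f * pair s X" if "X \<in> VF" "f \<in> SF"
  proof
    fix x
    have "vf_at (fmul f X) x = f x *\<^sub>R vf_at X x" by (simp add: vf_at_def fmul_def fun_eq_iff)
    moreover have "vf_at X x \<in> tangent atl x" using that by (auto simp: vfields_def)
    ultimately show "pair s (fmul f X) x = (f * pair s X) x"
      using c[of x] by (simp add: pair_def cotangent_def)
  qed
qed

text \<open>A determinant equals that of the transpose. With the permutation on the forms, the entry
  \<open>Xs ! i\<close> occurs exactly once in each product, as needed for replacing a single
  argument.\<close>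

lemma wedge_eq:
  assumes "Xs \<in> tuples VF (length \<omega>s)"
  shows "wedge atl \<omega>s Xs = (\<Sum>\<sigma> | \<sigma> permutes {..<length \<omega>s}.
    (\<lambda>_. of_int (sign \<sigma>)) * (\<Prod>i<length \<omega>s. (\<omega>s ! \<sigma> i) [Xs ! i]))"
proof
  fix x
  let ?r = "length \<omega>s"
  have pe: "(\<Prod>i\<in>I. F i) x = (\<Prod>i\<in>I. F i x)" for I :: "nat set" and F :: "nat \<Rightarrow> 'm \<Rightarrow> real"
    by (induction I rule: infinite_finite_induct) auto
  have "wedge atl \<omega>s Xs x = (\<Sum>\<sigma> | \<sigma> permutes {..<?r}. of_int (sign \<sigma>) * (\<Prod>i<?r. (\<omega>s ! i) [Xs ! \<sigma> i] x))"
    using assms by (simp add: wedge_def)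
  also have "\<dots> = (\<Sum>\<sigma> | \<sigma> permutes {..<?r}. of_int (sign (inv \<sigma>)) * (\<Prod>i<?r. (\<omega>s ! i) [Xs ! inv \<sigma> i] x))"
    by (rule sum_permutations_inverse)
  also have "\<dots> = (\<Sum>\<sigma> | \<sigma> permutes {..<?r}. of_int (sign \<sigma>) * (\<Prod>i<?r. (\<omega>s ! \<sigma> i) [Xs ! i] x))"
  proof (rule sum.cong[OF refl])
    fix \<sigma> assume "\<sigma> \<in> {\<sigma>. \<sigma> permutes {..<?r}}"
    then have \<sigma>: "\<sigma> permutes {..<?r}" by simp
    have "sign (inv \<sigma>) = sign \<sigma>" using sign_inverse permutation_permutes \<sigma> finite_lessThan by blast
    moreover have "(\<Prod>i<?r. (\<omega>s ! i) [Xs ! inv \<sigma> i] x) = (\<Prod>i<?r. (\<omega>s ! \<sigma> i) [Xs ! inv \<sigma> (\<sigma> i)] x)"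
      by (subst prod.permute[OF \<sigma>]) (simp add: comp_def)
    moreover have "\<And>i. inv \<sigma> (\<sigma> i) = i" using permutes_inverses(2)[OF \<sigma>] .
    ultimately show "of_int (sign (inv \<sigma>)) * (\<Prod>i<?r. (\<omega>s ! i) [Xs ! inv \<sigma> i] x) =
        of_int (sign \<sigma>) * (\<Prod>i<?r. (\<omega>s ! \<sigma> i) [Xs ! i] x)" by simp
  qed
  finally show "wedge atl \<omega>s Xs x = (\<Sum>\<sigma> | \<sigma> permutes {..<?r}.
      (\<lambda>_. of_int (sign \<sigma>)) * (\<Prod>i<?r. (\<omega>s ! \<sigma> i) [Xs ! i])) x"
    by (simp add: sum_fun_apply pe)
qed

lemma prod_list_update:
  assumes "k < r" "length Xs = r"
  shows "(\<Prod>i<r. h i ((Xs[k := Y]) ! i)) = h k Y * (\<Prod>i\<in>{..<r} - {k}. h i (Xs ! i :: 'c) :: 'd :: comm_monoid_mult)"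
proof -
  have "(\<Prod>i<r. h i ((Xs[k := Y]) ! i)) = h k ((Xs[k := Y]) ! k) * (\<Prod>i\<in>{..<r} - {k}. h i ((Xs[k := Y]) ! i))"
    using assms by (intro prod.remove) auto
  also have "(\<Prod>i\<in>{..<r} - {k}. h i ((Xs[k := Y]) ! i)) = (\<Prod>i\<in>{..<r} - {k}. h i (Xs ! i))"
    by (intro prod.cong) auto
  finally show ?thesis using assms by simp
qed

lemma wedge_forms:
  assumes \<omega>s: "\<omega>s \<in> tuples (one_form atl ` {s. smooth_covecs_on atl UNIV s}) r"
  shows "wedge atl \<omega>s \<in> forms r"
proof -
  have len: "length \<omega>s = r" using \<omega>s by (rule tuples_length)
  have ofm: "\<exists>s. smooth_covecs_on atl UNIV s \<and> \<omega>s ! i = one_form atl s" if "i < r" for i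
    using tuples_nth[OF \<omega>s that] by auto
  have o1: "(\<omega>s ! i) [X] \<in> SF" "(\<omega>s ! i) [X + Y] = (\<omega>s ! i) [X] + (\<omega>s ! i) [Y]"
    "(\<omega>s ! i) [fmul f X] = f * (\<omega>s ! i) [X]"
    if a: "i < r" "X \<in> VF" "Y \<in> VF" "f \<in> SF" for i X Y f
  proof -
    obtain s where s: "smooth_covecs_on atl UNIV s" "\<omega>s ! i = one_form atl s" using ofm[OF a(1)] by blast
    have e: "(\<omega>s ! i) [Z] = pair s Z" if "Z \<in> VF" for Z using that s(2) by (simp add: one_form_def tuples_def)
    show "(\<omega>s ! i) [X] \<in> SF" "(\<omega>s ! i) [X + Y] = (\<omega>s ! i) [X] + (\<omega>s ! i) [Y]"
      "(\<omega>s ! i) [fmul f X] = f * (\<omega>s ! i) [X]"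
      using e pair_vf[OF s(1)] a VF_add VF_fmul by simp_all
  qed
  let ?P = "{\<sigma>. \<sigma> permutes {..<r}}"
  let ?s = "\<lambda>\<sigma> x. real_of_int (sign \<sigma>)"
  have \<sigma>r: "\<sigma> i < r" if "\<sigma> \<in> ?P" "i < r" for \<sigma> i
    using permutes_in_image[of \<sigma> "{..<r}" i] that by simp
  have w: "wedge atl \<omega>s Xs = (\<Sum>\<sigma>\<in>?P. ?s \<sigma> * (\<Prod>i<r. (\<omega>s ! \<sigma> i) [Xs ! i]))" if "Xs \<in> tuples VF r" for Xs
    using wedge_eq[of Xs \<omega>s] that len by simp
  have w1: "wedge atl \<omega>s (Xs[k := Y]) = (\<Sum>\<sigma>\<in>?P. ?s \<sigma> * ((\<omega>s ! \<sigma> k) [Y] * (\<Prod>i\<in>{..<r} - {k}. (\<omega>s ! \<sigma> i) [Xs ! i])))"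
    if "Xs \<in> tuples VF r" "k < r" "Y \<in> VF" for Xs k Y
    unfolding w[OF tuples_update[OF that(1,3)]]
    by (intro sum.cong refl, subst prod_list_update[where h = "\<lambda>i Z. (\<omega>s ! \<sigma> i) [Z]" for \<sigma>])
      (use that tuples_length in auto)
  have prodS: "(\<Prod>i\<in>I. F i) \<in> SF" if "\<And>i. i \<in> I \<Longrightarrow> F i \<in> SF" for I and F :: "nat \<Rightarrow> 'm \<Rightarrow> real"
    using that
  proof (induction I rule: infinite_finite_induct)
    case (insert i I)
    have "F i * prod F I \<in> SF" by (intro SF_mult insert) auto
    then show ?case by (simp only: prod.insert[OF insert.hyps])
  next
    case (infinite I)
    show ?case unfolding prod.infinite[OF infinite.hyps(1)] by (rule SF_one)
  next
    case empty
    show ?case unfolding prod.empty by (rule SF_one)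
  qed
  have "func.alt r (wedge atl \<omega>s)"
    unfolding alt_form_def additive_form_def
  proof (intro conjI ballI allI impI)
    fix Xs assume Xs: "Xs \<in> tuples VF r"
    show "wedge atl \<omega>s Xs \<in> SF"
      unfolding w[OF Xs]
    proof (intro SF_sum SF_mult SF_const prodS)
      fix \<sigma> i assume "\<sigma> \<in> ?P" "i \<in> {..<r}"
      then show "(\<omega>s ! \<sigma> i) [Xs ! i] \<in> SF"
        using o1(1)[OF \<sigma>r tuples_nth[OF Xs] VF_zero SF_zero] by simp
    qed
    show "wedge atl \<omega>s (Xs[i := X + Y]) = wedge atl \<omega>s (Xs[i := X]) + wedge atl \<omega>s (Xs[i := Y])"
      if i: "i < r" and XY: "X \<in> VF" "Y \<in> VF" for i X Y
      unfolding w1[OF Xs i XY(1)] w1[OF Xs i XY(2)] w1[OF Xs i VF_add[OF XY]] sum.distrib[symmetric]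
      by (intro sum.cong refl, subst o1(2)[OF \<sigma>r[OF _ i] XY SF_zero]) (auto simp: algebra_simps)
    fix i j assume ij: "j < r" "i < j" "Xs ! i = Xs ! j"
    let ?\<tau> = "Transposition.transpose i j"
    have \<tau>: "?\<tau> permutes {..<r}" using ij by (intro permutes_swap_id) auto
    \<comment> \<open>Composing the permutations with the transposition of i and j flips the sign
      but not the product, since the two arguments agree; so the value equals its own
      negative.\<close>
    have "wedge atl \<omega>s Xs = (\<Sum>\<sigma>\<in>?P. ?s (\<sigma> \<circ> ?\<tau>) * (\<Prod>k<r. (\<omega>s ! (\<sigma> \<circ> ?\<tau>) k) [Xs ! k]))"
      unfolding w[OF Xs] by (rule sum_permutations_compose_right[OF \<tau>])
    also have "\<dots> = (\<Sum>\<sigma>\<in>?P. - (?s \<sigma> * (\<Prod>k<r. (\<omega>s ! \<sigma> k) [Xs ! k])))"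
    proof (rule sum.cong[OF refl])
      fix \<sigma> assume "\<sigma> \<in> ?P"
      then have \<sigma>: "\<sigma> permutes {..<r}" by simp
      have "permutation \<sigma>" "permutation ?\<tau>" using \<sigma> \<tau> permutation_permutes finite_lessThan by blast+
      then have "sign (\<sigma> \<circ> ?\<tau>) = - sign \<sigma>"
        using ij by (simp add: sign_compose sign_swap_id)
      moreover have "(\<Prod>k<r. (\<omega>s ! (\<sigma> \<circ> ?\<tau>) k) [Xs ! k]) = (\<Prod>k<r. (\<omega>s ! (\<sigma> \<circ> ?\<tau>) (?\<tau> k)) [Xs ! ?\<tau> k])"
        by (subst prod.permute[OF \<tau>]) (simp add: comp_def)
      moreover have "\<dots> = (\<Prod>k<r. (\<omega>s ! \<sigma> k) [Xs ! k])"
        by (intro prod.cong refl) (use ij in \<open>auto simp: Transposition.transpose_def\<close>)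
      ultimately show "?s (\<sigma> \<circ> ?\<tau>) * (\<Prod>k<r. (\<omega>s ! (\<sigma> \<circ> ?\<tau>) k) [Xs ! k]) = - (?s \<sigma> * (\<Prod>k<r. (\<omega>s ! \<sigma> k) [Xs ! k]))"
        by (simp add: fun_eq_iff)
    qed
    also have "\<dots> = - wedge atl \<omega>s Xs" unfolding w[OF Xs] by (simp add: sum_negf)
    finally have "wedge atl \<omega>s Xs x = - wedge atl \<omega>s Xs x" for x by (metis fun_Compl_def)
    then show "wedge atl \<omega>s Xs = 0" by (simp add: fun_eq_iff)
  qed
  moreover have "func.hom_form r (wedge atl \<omega>s)"
    unfolding func.hom_form_def
  proof (intro ballI allI impI)
    fix Xs i X f assume a: "Xs \<in> tuples VF r" "i < r" "X \<in> VF" "f \<in> SF"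
    show "wedge atl \<omega>s (Xs[i := fmul f X]) = f * wedge atl \<omega>s (Xs[i := X])"
      unfolding w1[OF a(1-3)] w1[OF a(1,2) VF_fmul[OF a(3,4)]] sum_distrib_left
      by (intro sum.cong refl, subst o1(3)[OF \<sigma>r[OF _ a(2)] a(3) VF_zero a(4)]) (auto simp: algebra_simps)
  qed
  ultimately show ?thesis by (simp add: forms_def wedge_def len)
qed

lemma wedge_zero_arg:
  assumes "\<And>\<omega>. \<omega> \<in> set \<omega>s \<Longrightarrow> \<omega> [X] = 0" "Xs \<in> tuples VF (length \<omega>s)" "X \<in> set Xs"
  shows "wedge atl \<omega>s Xs = 0"
  unfolding wedge_eq[OF assms(2)]
proof (rule sum.neutral, rule ballI)
  fix \<sigma> assume "\<sigma> \<in> {\<sigma>. \<sigma> permutes {..<length \<omega>s}}"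
  then have \<sigma>: "\<sigma> permutes {..<length \<omega>s}" by simp
  obtain k where k: "k < length \<omega>s" "Xs ! k = X"
    using assms(3) tuples_length[OF assms(2)] by (metis in_set_conv_nth)
  have "\<sigma> k < length \<omega>s" using permutes_in_image[OF \<sigma>, of k] k by simp
  then have z: "(\<omega>s ! \<sigma> k) [Xs ! k] = 0" unfolding k(2) by (intro assms(1) nth_mem)
  have "(\<Prod>i<length \<omega>s. (\<omega>s ! \<sigma> i) [Xs ! i]) = (\<omega>s ! \<sigma> k) [Xs ! k] *
      (\<Prod>i\<in>{..<length \<omega>s} - {k}. (\<omega>s ! \<sigma> i) [Xs ! i])"
    by (rule prod.remove) (use k in auto)
  then have "(\<Prod>i<length \<omega>s. (\<omega>s ! \<sigma> i) [Xs ! i]) = 0" by (simp only: z mult_zero_left)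
  then show "(\<lambda>_. of_int (sign \<sigma>)) * (\<Prod>i<length \<omega>s. (\<omega>s ! \<sigma> i) [Xs ! i]) = 0" by (simp only: mult_zero_right)
qed

end

section \<open>The dual frame of a transversally free action\<close>

text \<open>As simplification rules these would be applied extensionally, turning sums of functions into
  abstractions.\<close>

declare plus_fun_apply [simp del] zero_fun_apply [simp del] times_fun_apply [simp del]
  one_fun_apply [simp del] scaleR_fun_apply [simp del] minus_apply [simp del] uminus_apply [simp del]

lemmas fun_apply = plus_fun_apply zero_fun_apply times_fun_apply one_fun_apply scaleR_fun_apply
  minus_apply uminus_apply sum_fun_apply

lemma family_independent:
  fixes G :: "'i \<Rightarrow> 'a::real_vector"
  assumes I: "finite I" and z: "\<And>c i. (\<Sum>i\<in>I. c i *\<^sub>R G i) = 0 \<Longrightarrow> i \<in> I \<Longrightarrow> c i = 0"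
  shows "inj_on G I" "independent (G ` I)"
proof -
  show inj: "inj_on G I"
  proof (rule inj_onI, rule ccontr)
    fix i j assume ij: "i \<in> I" "j \<in> I" "G i = G j" "i \<noteq> j"
    \<comment> \<open>Two equal members of the family satisfy the relation with coefficients 1 and
      -1.\<close>
    define c where "c k = (if k = i then 1 else 0) - (if k = j then 1 else 0 :: real)" for k
    have "(\<Sum>k\<in>I. c k *\<^sub>R G k) = (\<Sum>k\<in>I. (if k = i then G i else 0)) - (\<Sum>k\<in>I. (if k = j then G j else 0))"
      unfolding sum_subtractf[symmetric] c_def by (intro sum.cong refl) (auto simp: scaleR_left_diff_distrib)
    also have "\<dots> = 0" using ij I by simp
    finally have "c i = 0" using z ij by blast
    then show False using ij by (simp add: c_def)
  qed
  show "independent (G ` I)"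
  proof (rule independent_if_scalars_zero)
    fix f x assume "(\<Sum>x\<in>G ` I. f x *\<^sub>R x) = 0" "x \<in> G ` I"
    moreover from this obtain i where "i \<in> I" "x = G i" by blast
    ultimately show "f x = 0" using z[of "\<lambda>i. f (G i)" i] by (simp add: sum.reindex[OF inj])
  qed (use I in simp)
qed

lemma vf_at_simps:
  "vf_at (X + Y) x = vf_at X x + vf_at Y x"
  "vf_at (X - Y) x = vf_at X x - vf_at Y x"
  "vf_at (c *\<^sub>R X) x = c *\<^sub>R vf_at X x"
  "vf_at (fmul f X) x = f x *\<^sub>R vf_at X x"
  "vf_at 0 x = 0"
  by (auto simp: vf_at_def fmul_def fun_eq_iff fun_apply)

lemma vf_at_sum: "vf_at (\<Sum>i\<in>I. X i) x = (\<Sum>i\<in>I. vf_at (X i) x)"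
  by (auto simp: vf_at_def fun_eq_iff fun_apply)

context smooth_mfd
begin

section \<open>Covectors and their smooth local sections\<close>

lemma VF_tangent: "X \<in> VF \<Longrightarrow> vf_at X x \<in> tangent atl x"
  by (simp add: vfields_def)

lemma cotD:
  assumes "\<alpha> \<in> cotangent atl x"
  shows cot_add: "v \<in> tangent atl x \<Longrightarrow> w \<in> tangent atl x \<Longrightarrow> \<alpha> (v + w) = \<alpha> v + \<alpha> w"
    and cot_scale: "v \<in> tangent atl x \<Longrightarrow> \<alpha> (c *\<^sub>R v) = c * \<alpha> v"
    and cot_out: "v \<notin> tangent atl x \<Longrightarrow> \<alpha> v = 0"
    and cot_zero: "\<alpha> 0 = 0"
proof -
  show s: "\<alpha> (c *\<^sub>R v) = c * \<alpha> v" if "v \<in> tangent atl x" for v c using assms that by (simp add: cotangent_def)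
  show "\<alpha> 0 = 0" using s[OF subspace_0[OF subspace_tangent], of 0] by simp
qed (use assms in \<open>simp_all add: cotangent_def\<close>)

lemma cot_sum:
  assumes \<alpha>: "\<alpha> \<in> cotangent atl x" and v: "\<And>i. i \<in> I \<Longrightarrow> v i \<in> tangent atl x"
  shows "\<alpha> (\<Sum>i\<in>I. c i *\<^sub>R v i) = (\<Sum>i\<in>I. c i * \<alpha> (v i))"
  using v
proof (induction I rule: infinite_finite_induct)
  case (insert i I)
  have "\<alpha> (c i *\<^sub>R v i + (\<Sum>i\<in>I. c i *\<^sub>R v i)) = \<alpha> (c i *\<^sub>R v i) + \<alpha> (\<Sum>i\<in>I. c i *\<^sub>R v i)"
    by (intro cot_add[OF \<alpha>] subspace_scale[OF subspace_tangent] subspace_sum[OF subspace_tangent])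
      (use insert.prems in auto)
  then show ?case using insert cot_scale[OF \<alpha>] by simp
qed (simp_all add: cot_zero[OF \<alpha>])

lemma subspace_cotangent: "subspace (cotangent atl x)"
  unfolding subspace_def by (auto simp: cotangent_def algebra_simps fun_apply)

lemma smooth_covecs_add:
  assumes "open W" "smooth_covecs_on atl W s" "smooth_covecs_on atl W s'"
  shows "smooth_covecs_on atl W (\<lambda>y. s y + s' y)"
proof -
  have "pair (\<lambda>y. s y + s' y) X = pair s X + pair s' X" for X by (simp add: pair_def fun_eq_iff fun_apply)
  then show ?thesis
    using assms smf_add[OF assms(1)] subspace_add[OF subspace_cotangent]
    by (simp add: smooth_covecs_on_def)
qed

lemma smooth_covecs_mult:
  assumes "open W" "smf W f" "smooth_covecs_on atl W s"
  shows "smooth_covecs_on atl W (\<lambda>y. f y *\<^sub>R s y)"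
proof -
  have "pair (\<lambda>y. f y *\<^sub>R s y) X = f * pair s X" for X by (simp add: pair_def fun_eq_iff fun_apply)
  then show ?thesis
    using assms smf_mult[OF assms(1,2)] subspace_scale[OF subspace_cotangent]
    by (simp add: smooth_covecs_on_def)
qed

lemma smooth_covecs_sum:
  assumes "open W" "\<And>j. j < (k::nat) \<Longrightarrow> smooth_covecs_on atl W (s j)"
  shows "smooth_covecs_on atl W (\<lambda>y. \<Sum>j<k. s j y)"
  using assms(2)
proof (induction k)
  case 0
  have "pair (\<lambda>y. 0) X = (\<lambda>y. 0)" for X :: "'m vf" by (simp add: pair_def fun_apply)
  then show ?case using smf_const[OF assms(1), of 0] subspace_0[OF subspace_cotangent]
    by (simp add: smooth_covecs_on_def)
next
  case (Suc k)
  then show ?case using smooth_covecs_add[OF assms(1), of "\<lambda>y. \<Sum>j<k. s j y" "s k"] by simp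
qed

lemma smooth_covecs_subset: "smooth_covecs_on atl W s \<Longrightarrow> V \<subseteq> W \<Longrightarrow> smooth_covecs_on atl V s"
  unfolding smooth_covecs_on_def using smf_subset by blast

lemma smf_open_nonzero:
  assumes W: "open W" and f: "smf W f"
  shows "open {y \<in> W. f y \<noteq> 0}"
proof -
  have "isCont f x" if x: "x \<in> W" for x
  proof -
    obtain U \<phi> R where "chart_disc atl B U \<phi> x R" using chart_disc_exists by blast
    then interpret chart_disc atl B U \<phi> x R .
    have o: "open (U \<inter> W)" using chart(1)[OF c] W by blast
    have "continuous_on (\<phi> ` (U \<inter> W)) (\<lambda>z. f (inv_into U \<phi> z))"
      by (rule Ck_on_continuous[OF smfD[OF f c, of 0]])
    moreover have "continuous_on (U \<inter> W) \<phi>"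
      using homeomorphism_cont1[OF chart(3)[OF c]] by (rule continuous_on_subset) simp
    ultimately have "continuous_on (U \<inter> W) (\<lambda>y. f (inv_into U \<phi> (\<phi> y)))"
      by (rule continuous_on_compose2) simp
    then have "continuous_on (U \<inter> W) f"
      by (rule continuous_on_eq) (simp add: chart_inv[OF c])
    then show ?thesis using o x x0 by (simp add: continuous_on_eq_continuous_at)
  qed
  then have "continuous_on W f" by (intro continuous_at_imp_continuous_on ballI)
  then have "open (W \<inter> f -` (- {0}))" using W by (intro continuous_open_preimage) auto
  moreover have "W \<inter> f -` (- {0}) = {y \<in> W. f y \<noteq> 0}" by auto
  ultimately show ?thesis by simp
qed

end

text \<open>\<open>e\<close> enumerates a basis of the Lie algebra, so \<open>n\<close> is its
  dimension; the equality with the rank q is derived in \<open>n_eq_q\<close>.\<close>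

locale pfaffian_action = smooth_mfd atl B
  for atl :: "('m::{t2_space, second_countable_topology} set \<times> ('m \<Rightarrow> 'e::real_inner)) set" and B +
  fixes S :: "'m \<Rightarrow> 'm covec set" and br :: "'g::real_vector \<Rightarrow> 'g \<Rightarrow> 'g" and act :: "'g \<Rightarrow> 'm vf"
    and e :: "nat \<Rightarrow> 'g" and n p q :: nat
  assumes pf: "pfaffian_system atl q S" and pq: "p + q = dim (UNIV :: 'e set)"
    and integ: "integrable_system atl S" and fla: "findim_lie_algebra br"
    and ia: "infinitesimal_action atl br act" and aut: "\<And>v. act v \<in> auts atl S"
    and tf: "transversally_free atl S act"
    and e: "inj_on e {..<n}" "independent (e ` {..<n})" "span (e ` {..<n}) = UNIV"
begin

abbreviation "XX i \<equiv> act (e i)"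
abbreviation "xx i y \<equiv> vf_at (act (e i)) y"
abbreviation "BB \<equiv> Bsec atl S"

lemma act_linear: "linear act"
  and act_VF: "act v \<in> VF"
  and act_br: "act (br v w) = vbr (act v) (act w)"
  using ia by (auto simp: infinitesimal_action_def)

lemma g_expand: "\<exists>c. v = (\<Sum>i<n. c i *\<^sub>R e i)"
proof -
  let ?E = "e ` {..<n}"
  have "v = (\<Sum>b\<in>?E. representation ?E v b *\<^sub>R b)"
    using sum_representation_eq[OF e(2), of v ?E] e(3) by simp
  also have "\<dots> = (\<Sum>i<n. representation ?E v (e i) *\<^sub>R e i)" by (simp add: sum.reindex[OF e(1)])
  finally show ?thesis by (rule exI[of _ "\<lambda>i. representation ?E v (e i)"])
qed

lemma act_sum: "act (\<Sum>i\<in>I. c i *\<^sub>R v i) = (\<Sum>i\<in>I. c i *\<^sub>R act (v i))"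
  by (simp add: linear_sum[OF act_linear] linear_cmul[OF act_linear])

lemma xx_tangent: "xx i y \<in> tangent atl y"
  by (rule VF_tangent[OF act_VF])

lemma orbit_expand: "w \<in> orbit_space act y \<longleftrightarrow> (\<exists>c. w = (\<Sum>i<n. c i *\<^sub>R xx i y))"
proof
  assume "w \<in> orbit_space act y"
  then obtain v where v: "w = vf_at (act v) y" by (auto simp: orbit_space_def)
  obtain c where c: "v = (\<Sum>i<n. c i *\<^sub>R e i)" using g_expand by blast
  have "w = (\<Sum>i<n. c i *\<^sub>R xx i y)" unfolding v c act_sum vf_at_sum vf_at_simps ..
  then show "\<exists>c. w = (\<Sum>i<n. c i *\<^sub>R xx i y)" by (rule exI[of _ c])
next
  assume "\<exists>c. w = (\<Sum>i<n. c i *\<^sub>R xx i y)"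
  then obtain c where c: "w = (\<Sum>i<n. c i *\<^sub>R xx i y)" by blast
  have "w = vf_at (act (\<Sum>i<n. c i *\<^sub>R e i)) y" unfolding c act_sum vf_at_sum vf_at_simps ..
  then show "w \<in> orbit_space act y" by (auto simp: orbit_space_def)
qed

lemma dim_g: "dim (UNIV :: 'g set) = n"
  using dim_eq_card[of "e ` {..<n}" UNIV] e card_image[OF e(1)] by simp

text \<open>A nontrivial relation would let n - 1 of the vectors span the orbit space, whose
  dimension is dim g = n by transversal freeness.\<close>

lemma orbit_independent:
  assumes z: "(\<Sum>i<n. c i *\<^sub>R xx i y) = 0" and k: "k < n"
  shows "c k = 0"
proof (rule ccontr)
  assume ck: "c k \<noteq> 0"
  let ?W = "(\<lambda>i. xx i y) ` ({..<n} - {k})"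
  have "(\<Sum>i<n. c i *\<^sub>R xx i y) = c k *\<^sub>R xx k y + (\<Sum>i\<in>{..<n} - {k}. c i *\<^sub>R xx i y)"
    using k by (intro sum.remove) auto
  then have "c k *\<^sub>R xx k y = - (\<Sum>i\<in>{..<n} - {k}. c i *\<^sub>R xx i y)" using z by (simp add: eq_neg_iff_add_eq_0)
  moreover have "(\<Sum>i\<in>{..<n} - {k}. c i *\<^sub>R xx i y) \<in> span ?W"
    by (intro span_sum span_scale span_base) auto
  ultimately have "c k *\<^sub>R xx k y \<in> span ?W" by (simp add: span_neg)
  then have "inverse (c k) *\<^sub>R (c k *\<^sub>R xx k y) \<in> span ?W" by (rule span_scale)
  then have kW: "xx k y \<in> span ?W" using ck by simp
  have xW: "xx i y \<in> span ?W" if "i < n" for i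
    using that kW by (cases "i = k") (auto intro: span_base)
  have "orbit_space act y \<subseteq> span ?W"
  proof
    fix w assume "w \<in> orbit_space act y"
    then obtain c where c: "w = (\<Sum>i<n. c i *\<^sub>R xx i y)" unfolding orbit_expand by blast
    show "w \<in> span ?W" unfolding c by (intro span_sum span_scale xW) simp
  qed
  then have "dim (orbit_space act y) \<le> card ?W" by (rule dim_le_card) simp
  also have "\<dots> \<le> card ({..<n} - {k})" by (rule card_image_le) simp
  also have "\<dots> < n" using k by simp
  finally show False using tf dim_g by (auto simp: transversally_free_def)
qed

lemma subspace_orbit: "subspace (orbit_space act y)"
proof -
  have "linear (\<lambda>v. vf_at (act v) y)"
    by (rule linearI) (simp_all add: linear_add[OF act_linear] linear_cmul[OF act_linear] vf_at_simps)
  then show ?thesis unfolding orbit_space_def by (rule linear_subspace_image) simp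
qed

lemma pf_local:
  obtains W \<sigma> where "open W" "y \<in> W" "\<forall>i<q. smooth_covecs_on atl W (\<sigma> i)"
    "\<forall>y\<in>W. inj_on (\<lambda>i. \<sigma> i y) {..<q} \<and> independent ((\<lambda>i. \<sigma> i y) ` {..<q}) \<and> S y = span ((\<lambda>i. \<sigma> i y) ` {..<q})"
proof -
  from pf[unfolded pfaffian_system_def, rule_format, of y] show thesis
    by (elim exE conjE) (rule that)
qed

lemma S_cot: "subspace (S y)" "S y \<subseteq> cotangent atl y"
proof -
  obtain W \<sigma> where W: "open W" "y \<in> W" "\<forall>i<q. smooth_covecs_on atl W (\<sigma> i)"
    "\<forall>y\<in>W. inj_on (\<lambda>i. \<sigma> i y) {..<q} \<and> independent ((\<lambda>i. \<sigma> i y) ` {..<q}) \<and> S y = span ((\<lambda>i. \<sigma> i y) ` {..<q})"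
    by (rule pf_local)
  then have s: "S y = span ((\<lambda>i. \<sigma> i y) ` {..<q})" by blast
  show "subspace (S y)" unfolding s by (rule subspace_span)
  show "S y \<subseteq> cotangent atl y" unfolding s
    by (rule span_minimal[OF _ subspace_cotangent]) (use W in \<open>auto simp: smooth_covecs_on_def\<close>)
qed

lemma tangent_split:
  assumes "v \<in> tangent atl y"
  obtains u c where "u \<in> annih atl S y" "v = u + (\<Sum>i<n. c i *\<^sub>R xx i y)"
proof -
  have "v \<in> {u + w |u w. u \<in> annih atl S y \<and> w \<in> orbit_space act y}"
    using assms tf unfolding transversally_free_def by blast
  then show ?thesis using that unfolding orbit_expand by blast
qed

lemma annih_orbit: "u \<in> annih atl S y \<Longrightarrow> u \<in> orbit_space act y \<Longrightarrow> u = 0"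
  using tf unfolding transversally_free_def by blast

lemma annihD: "u \<in> annih atl S y \<Longrightarrow> u \<in> tangent atl y" "u \<in> annih atl S y \<Longrightarrow> \<alpha> \<in> S y \<Longrightarrow> \<alpha> u = 0"
  by (auto simp: annih_def)

lemma subspace_annih: "subspace (annih atl S y)"
  unfolding subspace_def
proof (intro conjI ballI allI)
  have c: "\<alpha> \<in> cotangent atl y" if "\<alpha> \<in> S y" for \<alpha> using S_cot that by blast
  note t = subspace_tangent[of y]
  show "0 \<in> annih atl S y" using subspace_0[OF t] cot_zero[OF c] by (simp add: annih_def)
  show "u + v \<in> annih atl S y" if "u \<in> annih atl S y" "v \<in> annih atl S y" for u v
    using that subspace_add[OF t] by (auto simp: annih_def cot_add[OF c])
  show "r *\<^sub>R u \<in> annih atl S y" if "u \<in> annih atl S y" for r u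
    using that subspace_scale[OF t] by (auto simp: annih_def cot_scale[OF c])
qed

text \<open>Elements of \<open>S y\<close> vanish on the annihilator, and the frame spans a
  complement of it in the tangent space.\<close>

lemma S_eqI:
  assumes \<alpha>: "\<alpha> \<in> S y" and \<beta>: "\<beta> \<in> S y" and eq: "\<And>j. j < n \<Longrightarrow> \<alpha> (xx j y) = \<beta> (xx j y)"
  shows "\<alpha> = \<beta>"
proof
  fix v
  have c: "\<alpha> \<in> cotangent atl y" "\<beta> \<in> cotangent atl y" using S_cot \<alpha> \<beta> by blast+
  show "\<alpha> v = \<beta> v"
  proof (cases "v \<in> tangent atl y")
    case True
    obtain u a where ua: "u \<in> annih atl S y" "v = u + (\<Sum>i<n. a i *\<^sub>R xx i y)" by (rule tangent_split[OF True])
    have t: "(\<Sum>i<n. a i *\<^sub>R xx i y) \<in> tangent atl y"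
      by (intro subspace_sum[OF subspace_tangent] subspace_scale[OF subspace_tangent] xx_tangent)
    have val: "\<gamma> v = (\<Sum>i<n. a i * \<gamma> (xx i y))" if \<gamma>: "\<gamma> \<in> S y" for \<gamma>
    proof -
      have c: "\<gamma> \<in> cotangent atl y" using \<gamma> S_cot by blast
      have "\<gamma> v = \<gamma> u + \<gamma> (\<Sum>i<n. a i *\<^sub>R xx i y)" unfolding ua(2) by (rule cot_add[OF c annihD(1)[OF ua(1)] t])
      also have "\<gamma> (\<Sum>i<n. a i *\<^sub>R xx i y) = (\<Sum>i<n. a i * \<gamma> (xx i y))" by (rule cot_sum[OF c xx_tangent])
      finally show ?thesis using annihD(2)[OF ua(1) \<gamma>] by simp
    qed
    have "(\<Sum>i<n. a i * \<alpha> (xx i y)) = (\<Sum>i<n. a i * \<beta> (xx i y))" by (intro sum.cong refl) (simp add: eq)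
    then show ?thesis unfolding val[OF \<alpha>] val[OF \<beta>] .
  qed (simp add: cot_out[OF c(1)] cot_out[OF c(2)])
qed

text \<open>Gaussian elimination with smooth coefficients, one frame field at a time: among the
  local generators of \<open>S\<close>, corrected to vanish on the earlier fields, some one is
  nonzero on the next field at x and serves as pivot on a smaller neighbourhood.\<close>

lemma local_dual:
  "k \<le> n \<Longrightarrow> \<exists>W \<tau>. open W \<and> x \<in> W \<and> (\<forall>i<k. smooth_covecs_on atl W (\<tau> i)) \<and> (\<forall>i<k. \<forall>y\<in>W. \<tau> i y \<in> S y) \<and>
    (\<forall>i<k. \<forall>j<k. \<forall>y\<in>W. \<tau> i y (xx j y) = (if i = j then 1 else 0))"
proof (induction k)
  case 0
  show ?case by (intro exI[of _ UNIV]) auto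
next
  case (Suc k)
  have "\<exists>W \<tau>. open W \<and> x \<in> W \<and> (\<forall>i<k. smooth_covecs_on atl W (\<tau> i)) \<and> (\<forall>i<k. \<forall>y\<in>W. \<tau> i y \<in> S y) \<and>
    (\<forall>i<k. \<forall>j<k. \<forall>y\<in>W. \<tau> i y (xx j y) = (if i = j then 1 else 0))"
    using Suc by simp
  then obtain W1 \<tau> where W1: "open W1" "x \<in> W1" and H: "\<forall>i<k. smooth_covecs_on atl W1 (\<tau> i)"
    "\<forall>i<k. \<forall>y\<in>W1. \<tau> i y \<in> S y" "\<forall>i<k. \<forall>j<k. \<forall>y\<in>W1. \<tau> i y (xx j y) = (if i = j then 1 else 0)"
    by (elim exE conjE) (rule that)
  have \<tau>s: "\<And>i. i < k \<Longrightarrow> smooth_covecs_on atl W1 (\<tau> i)"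
    and \<tau>S: "\<And>i y. i < k \<Longrightarrow> y \<in> W1 \<Longrightarrow> \<tau> i y \<in> S y"
    and \<tau>d: "\<And>i j y. i < k \<Longrightarrow> j < k \<Longrightarrow> y \<in> W1 \<Longrightarrow> \<tau> i y (xx j y) = (if i = j then 1 else 0)"
    using H by blast+
  have kn: "k < n" using Suc.prems by simp
  obtain W0 \<sigma> where W0: "open W0" "x \<in> W0" and \<sigma>: "\<forall>i<q. smooth_covecs_on atl W0 (\<sigma> i)"
    "\<forall>y\<in>W0. inj_on (\<lambda>i. \<sigma> i y) {..<q} \<and> independent ((\<lambda>i. \<sigma> i y) ` {..<q}) \<and> S y = span ((\<lambda>i. \<sigma> i y) ` {..<q})"
    by (rule pf_local[of x])
  have \<sigma>span: "S y = span ((\<lambda>i. \<sigma> i y) ` {..<q})" if "y \<in> W0" for y using \<sigma>(2) that by blast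
  have \<sigma>S: "\<sigma> m y \<in> S y" if "y \<in> W0" "m < q" for m y
    unfolding \<sigma>span[OF that(1)] using that(2) by (intro span_base) auto
  let ?W = "W0 \<inter> W1"
  have oW: "open ?W" using W0 W1 by blast
  \<comment> \<open>The generator \<open>\<sigma> m\<close> with its components along the earlier
    dual covectors removed, so that it vanishes on the earlier frame fields.\<close>
  define \<rho> where "\<rho> m y = \<sigma> m y + (\<Sum>j<k. (- \<sigma> m y (xx j y)) *\<^sub>R \<tau> j y)" for m y
  have pair_smf: "smf W (\<lambda>y. s y (xx j y))" if "smooth_covecs_on atl W s" for s W j
    using that act_VF[of "e j"] by (auto simp: smooth_covecs_on_def pair_def)
  have neg_smf: "smf V (\<lambda>y. - f y)" if "open V" "smf V f" for V f
    using smf_scale[OF that, of "-1"] by (simp add: scaleR_fun_def)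
  have \<rho>s: "smooth_covecs_on atl ?W (\<rho> m)" if m: "m < q" for m
    unfolding \<rho>_def
  proof (intro smooth_covecs_add smooth_covecs_sum smooth_covecs_mult oW neg_smf pair_smf)
    show "smooth_covecs_on atl ?W (\<sigma> m)" using \<sigma>(1) m smooth_covecs_subset by blast
    then show "smooth_covecs_on atl ?W (\<sigma> m)" .
    show "smooth_covecs_on atl ?W (\<tau> j)" if "j < k" for j using smooth_covecs_subset[OF \<tau>s[OF that]] by simp
  qed
  have \<rho>S: "\<rho> m y \<in> S y" if "m < q" "y \<in> ?W" for m y
    unfolding \<rho>_def using that \<sigma>S \<tau>S S_cot(1)[of y]
    by (intro subspace_add subspace_sum subspace_scale) auto
  have \<rho>v: "\<rho> m y v = \<sigma> m y v - (\<Sum>j<k. \<sigma> m y (xx j y) * \<tau> j y v)" for m y v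
    by (simp add: \<rho>_def fun_apply sum_negf)
  have \<rho>0: "\<rho> m y (xx j y) = 0" if "j < k" "y \<in> ?W" for m y j
  proof -
    have "(\<Sum>i<k. \<sigma> m y (xx i y) * \<tau> i y (xx j y)) = (\<Sum>i<k. if i = j then \<sigma> m y (xx j y) else 0)"
      using that by (intro sum.cong refl) (simp add: \<tau>d)
    then show ?thesis unfolding \<rho>v using that by simp
  qed
  have "\<exists>m<q. \<rho> m x (xx k x) \<noteq> 0"
  proof (rule ccontr)
    assume "\<not> (\<exists>m<q. \<rho> m x (xx k x) \<noteq> 0)"
    then have no: "\<sigma> m x (xx k x) = (\<Sum>j<k. \<sigma> m x (xx j x) * \<tau> j x (xx k x))" if "m < q" for m
      using that \<rho>v[of m x "xx k x"] by simp
    \<comment> \<open>If no pivot existed, the k-th frame vector minus its components along the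
      earlier ones would be annihilated by all generators, hence lie both in the annihilator and in
      the orbit space. Its coefficient 1 at k contradicts independence.\<close>
    define c where "c i = (if i < k then - \<tau> i x (xx k x) else if i = k then 1 else 0)" for i
    define w where "w = (\<Sum>i<n. c i *\<^sub>R xx i x)"
    have wt: "w \<in> tangent atl x" unfolding w_def
      by (intro subspace_sum[OF subspace_tangent] subspace_scale[OF subspace_tangent] xx_tangent)
    have \<sigma>w: "\<sigma> m x w = 0" if m: "m < q" for m
    proof -
      have "\<sigma> m x \<in> cotangent atl x" using \<sigma>S[OF W0(2) m] S_cot by blast
      then have "\<sigma> m x w = (\<Sum>i<n. c i * \<sigma> m x (xx i x))" unfolding w_def by (rule cot_sum) (rule xx_tangent)
      also have "\<dots> = (\<Sum>i<Suc k. c i * \<sigma> m x (xx i x))"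
        by (rule sum.mono_neutral_right) (use kn in \<open>auto simp: c_def\<close>)
      also have "\<dots> = (\<Sum>i<k. - (\<sigma> m x (xx i x) * \<tau> i x (xx k x))) + \<sigma> m x (xx k x)"
        by (simp add: c_def mult.commute)
      finally show ?thesis using no[OF m] by (simp add: sum_negf)
    qed
    have "w \<in> annih atl S x"
      unfolding annih_def
    proof (intro CollectI conjI wt ballI)
      fix \<alpha> assume "\<alpha> \<in> S x"
      then have "\<alpha> \<in> span ((\<lambda>i. \<sigma> i x) ` {..<q})" using \<sigma>span[OF W0(2)] by simp
      then show "\<alpha> w = 0"
        by (induction rule: span_induct_alt) (auto simp: \<sigma>w fun_apply)
    qed
    moreover have "w \<in> orbit_space act x" unfolding orbit_expand w_def by blast
    ultimately have "w = 0" by (rule annih_orbit)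
    then have "c k = 0" using orbit_independent kn unfolding w_def by blast
    then show False by (simp add: c_def)
  qed
  then obtain m where m: "m < q" "\<rho> m x (xx k x) \<noteq> 0" by blast
  define f where "f y = \<rho> m y (xx k y)" for y
  have fs: "smf ?W f" unfolding f_def by (rule pair_smf[OF \<rho>s[OF m(1)]])
  define V where "V = {y \<in> ?W. f y \<noteq> 0}"
  have V: "open V" unfolding V_def by (rule smf_open_nonzero[OF oW fs])
  have VW: "V \<subseteq> ?W" and fV: "\<And>y. y \<in> V \<Longrightarrow> f y \<noteq> 0" and xV: "x \<in> V"
    using W0 W1 m by (auto simp: V_def f_def)
  define t where "t y = inverse (f y) *\<^sub>R \<rho> m y" for y
  have ts: "smooth_covecs_on atl V t"
    unfolding t_def by (rule smooth_covecs_mult[OF V smf_inverse[OF V smf_subset[OF fs VW] fV] smooth_covecs_subset[OF \<rho>s[OF m(1)] VW]])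
  have tS: "t y \<in> S y" if "y \<in> V" for y
    unfolding t_def using \<rho>S[OF m(1)] VW that by (intro subspace_scale[OF S_cot(1)]) blast
  have t0: "t y (xx j y) = 0" if "y \<in> V" "j < k" for y j using \<rho>0[OF that(2)] VW that(1) by (auto simp: t_def fun_apply)
  have t1: "t y (xx k y) = 1" if "y \<in> V" for y using fV[OF that] by (simp add: t_def f_def fun_apply)
  \<comment> \<open>The old covectors are made to vanish on the new frame field; since
    \<open>t\<close> vanishes on the earlier fields, their earlier values are unchanged.\<close>
  define \<tau>' where "\<tau>' i = (if i = k then t else (\<lambda>y. \<tau> i y + (- \<tau> i y (xx k y)) *\<^sub>R t y))" for i
  have \<tau>V: "smooth_covecs_on atl V (\<tau> i)" if "i < k" for i using smooth_covecs_subset[OF \<tau>s[OF that]] VW by blast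
  show ?case
  proof (intro exI[of _ V] exI[of _ \<tau>'] conjI allI impI ballI V xV)
    fix i assume i: "i < Suc k"
    show "smooth_covecs_on atl V (\<tau>' i)"
    proof (cases "i = k")
      case False
      then have ik: "i < k" using i by simp
      have "smooth_covecs_on atl V (\<lambda>y. \<tau> i y + (- \<tau> i y (xx k y)) *\<^sub>R t y)"
        by (rule smooth_covecs_add[OF V \<tau>V[OF ik] smooth_covecs_mult[OF V neg_smf[OF V pair_smf[OF \<tau>V[OF ik]]] ts]])
      then show ?thesis using False by (simp add: \<tau>'_def)
    qed (simp add: \<tau>'_def ts)
    fix y assume y: "y \<in> V"
    show "\<tau>' i y \<in> S y"
      using i tS[OF y] \<tau>S[of i y] y VW S_cot(1)[of y]
      by (auto simp: \<tau>'_def intro!: subspace_diff subspace_scale)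
    fix j assume j: "j < Suc k"
    show "\<tau>' i y (xx j y) = (if i = j then 1 else 0)"
      using i j \<tau>d[of i j y] t0[OF y, of j] t1[OF y] y VW by (auto simp: \<tau>'_def less_Suc_eq fun_apply)
  qed
qed

text \<open>A definite description, so that the local dual covectors glue: by \<open>S_eqI\<close>
  each of them is the value described here.\<close>

definition om :: "nat \<Rightarrow> 'm \<Rightarrow> 'm covec" where
  "om i y = (THE \<alpha>. \<alpha> \<in> S y \<and> (\<forall>j<n. \<alpha> (xx j y) = (if i = j then 1 else 0)))"

lemma om_eqI:
  assumes "\<alpha> \<in> S y" "\<And>j. j < n \<Longrightarrow> \<alpha> (xx j y) = (if i = j then 1 else 0)"
  shows "om i y = \<alpha>"
  unfolding om_def by (rule the_equality) (use assms S_eqI in auto)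

lemma om_local:
  assumes i: "i < n"
  obtains W \<tau> where "open W" "x \<in> W" "smooth_covecs_on atl W \<tau>" "\<forall>y\<in>W. om i y = \<tau> y"
    "om i x \<in> S x" "\<forall>j<n. om i x (xx j x) = (if i = j then 1 else 0)"
proof -
  obtain W \<tau> where W: "open W" "x \<in> W" "\<forall>i<n. smooth_covecs_on atl W (\<tau> i)" "\<forall>i<n. \<forall>y\<in>W. \<tau> i y \<in> S y"
    "\<forall>i<n. \<forall>j<n. \<forall>y\<in>W. \<tau> i y (xx j y) = (if i = j then 1 else 0)"
    using local_dual[OF order_refl, of x] by (elim exE conjE) (rule that)
  have om: "om i y = \<tau> i y" if "y \<in> W" for y
    by (rule om_eqI) (use W(4,5) i that in auto)
  show thesis
  proof (rule that)
    show "smooth_covecs_on atl W (\<tau> i)" using W(3) i by blast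
    show "om i x \<in> S x" "\<forall>j<n. om i x (xx j x) = (if i = j then 1 else 0)"
      unfolding om[OF W(2)] using W(2,4,5) i by blast+
  qed (use W om in auto)
qed

lemma om_S: "i < n \<Longrightarrow> om i y \<in> S y"
  by (erule om_local[of i y])

lemma om_dual: "i < n \<Longrightarrow> j < n \<Longrightarrow> om i y (xx j y) = (if i = j then 1 else 0)"
  by (erule om_local[of i y]) blast

lemma om_smooth:
  assumes i: "i < n" shows "smooth_covecs_on atl UNIV (om i)"
  unfolding smooth_covecs_on_def
proof (intro conjI ballI)
  show "om i x \<in> cotangent atl x" for x using om_S[OF i] S_cot by blast
  fix X assume X: "X \<in> VF"
  show "smf UNIV (pair (om i) X)"
  proof (rule smf_local)
    fix x
    obtain W \<tau> where W: "open W" "x \<in> W" "smooth_covecs_on atl W \<tau>" "\<forall>y\<in>W. om i y = \<tau> y"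
      by (rule om_local[OF i, of x]) (rule that)
    have "smf W (pair \<tau> X)" using W(3) X by (simp add: smooth_covecs_on_def)
    then have "smf W (pair (om i) X)" by (rule smf_cong[OF W(1), rotated]) (simp add: pair_def W(4))
    then show "\<exists>W. open W \<and> x \<in> W \<and> smf W (pair (om i) X)" using W(1,2) by (intro exI[of _ W] conjI)
  qed
qed

lemma S_expand:
  assumes "\<alpha> \<in> S y" shows "\<alpha> = (\<Sum>j<n. \<alpha> (xx j y) *\<^sub>R om j y)"
proof (rule S_eqI[OF assms])
  show "(\<Sum>j<n. \<alpha> (xx j y) *\<^sub>R om j y) \<in> S y"
    by (intro subspace_sum subspace_scale S_cot om_S) simp
  fix k assume k: "k < n"
  have "(\<Sum>j<n. \<alpha> (xx j y) * om j y (xx k y)) = (\<Sum>j<n. if j = k then \<alpha> (xx k y) else 0)"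
    by (intro sum.cong refl) (auto simp: om_dual k)
  then show "\<alpha> (xx k y) = (\<Sum>j<n. \<alpha> (xx j y) *\<^sub>R om j y) (xx k y)"
    using k by (simp add: fun_apply)
qed

text \<open>The fibre \<open>S y\<close> has a basis of q generators from the Pfaffian system and
  the dual basis of n covectors.\<close>

lemma n_eq_q: "n = q"
proof -
  \<comment> \<open>Any point will do; one exists because types are nonempty.\<close>
  fix y :: 'm
  obtain W \<sigma> where W: "open W" "y \<in> W" "\<forall>i<q. smooth_covecs_on atl W (\<sigma> i)"
    "\<forall>y\<in>W. inj_on (\<lambda>i. \<sigma> i y) {..<q} \<and> independent ((\<lambda>i. \<sigma> i y) ` {..<q}) \<and> S y = span ((\<lambda>i. \<sigma> i y) ` {..<q})"
    by (rule pf_local)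
  then have "inj_on (\<lambda>i. \<sigma> i y) {..<q}" "independent ((\<lambda>i. \<sigma> i y) ` {..<q})"
    "S y = span ((\<lambda>i. \<sigma> i y) ` {..<q})" by blast+
  then have q: "dim (S y) = q"
    using dim_span_eq_card_independent[of "(\<lambda>i. \<sigma> i y) ` {..<q}"] card_image[of "\<lambda>i. \<sigma> i y" "{..<q}"] by auto
  have f: "c i = 0" if z: "(\<Sum>i<n. c i *\<^sub>R om i y) = 0" and i: "i \<in> {..<n}" for c i
  proof -
    have "0 = (\<Sum>j<n. c j *\<^sub>R om j y) (xx i y)" unfolding z by (simp add: fun_apply)
    also have "\<dots> = (\<Sum>j<n. if j = i then c i else 0)"
      unfolding sum_fun_apply by (intro sum.cong refl) (use i in \<open>auto simp: om_dual fun_apply\<close>)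
    also have "\<dots> = c i" using i by simp
    finally show ?thesis by simp
  qed
  have fam: "inj_on (\<lambda>i. om i y) {..<n}" "independent ((\<lambda>i. om i y) ` {..<n})"
    by (rule family_independent, simp, erule (1) f)+
  have "S y = span ((\<lambda>i. om i y) ` {..<n})"
  proof
    show "S y \<subseteq> span ((\<lambda>i. om i y) ` {..<n})"
    proof
      fix \<alpha> assume a: "\<alpha> \<in> S y"
      have "(\<Sum>j<n. \<alpha> (xx j y) *\<^sub>R om j y) \<in> span ((\<lambda>i. om i y) ` {..<n})"
        by (intro span_sum span_scale span_base) auto
      then show "\<alpha> \<in> span ((\<lambda>i. om i y) ` {..<n})" by (simp only: S_expand[OF a, symmetric])
    qed
    show "span ((\<lambda>i. om i y) ` {..<n}) \<subseteq> S y"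
      by (rule span_minimal) (use om_S S_cot in auto)
  qed
  then have "dim (S y) = n"
    using dim_span_eq_card_independent[OF fam(2)] card_image[OF fam(1)] by simp
  then show ?thesis using q by simp
qed

text \<open>Otherwise p + 1 independent vectors of the annihilator together with the n = q frame
  vectors would be independent, exceeding the bound p + q for the tangent space.\<close>

lemma annih_dependent:
  assumes vs: "\<And>j. j \<le> p \<Longrightarrow> vs j \<in> annih atl S y"
  shows "\<exists>k\<le>p. \<exists>c. vs k = (\<Sum>j\<in>{..p} - {k}. c j *\<^sub>R vs j)"
proof (rule ccontr)
  assume no: "\<not> ?thesis"
  define G where "G = case_sum vs (\<lambda>i. xx i y)"
  let ?I = "{..p} <+> {..<n}"
  have z: "c i = 0" if s: "(\<Sum>i\<in>?I. c i *\<^sub>R G i) = 0" and i: "i \<in> ?I" for c i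
  proof -
    let ?a = "\<Sum>j\<le>p. c (Inl j) *\<^sub>R vs j" and ?o = "\<Sum>i<n. c (Inr i) *\<^sub>R xx i y"
    have sum0: "?a + ?o = 0" using s by (simp add: sum.Plus G_def)
    have a: "?a \<in> annih atl S y" by (intro subspace_sum[OF subspace_annih] subspace_scale[OF subspace_annih] vs) simp
    have o: "?o \<in> orbit_space act y" unfolding orbit_expand by (intro exI[of _ "\<lambda>i. c (Inr i)"] refl)
    have "?a = - ?o" using sum0 by (simp add: eq_neg_iff_add_eq_0)
    then have "?a \<in> orbit_space act y" using subspace_neg[OF subspace_orbit o] by simp
    then have a0: "?a = 0" using annih_orbit[OF a] by blast
    then have o0: "?o = 0" using sum0 by simp
    show ?thesis
    proof (cases i)
      case (Inr j)
      then show ?thesis using orbit_independent[OF o0, of j] i by auto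
    next
      case (Inl k)
      then have k: "k \<le> p" using i by auto
      show ?thesis
      proof (rule ccontr)
        assume "c i \<noteq> 0"
        then have ck: "c (Inl k) \<noteq> 0" using Inl by simp
        have "?a = c (Inl k) *\<^sub>R vs k + (\<Sum>j\<in>{..p} - {k}. c (Inl j) *\<^sub>R vs j)"
          using k by (intro sum.remove) auto
        then have "c (Inl k) *\<^sub>R vs k = - (\<Sum>j\<in>{..p} - {k}. c (Inl j) *\<^sub>R vs j)"
          using a0 by (simp add: eq_neg_iff_add_eq_0)
        then have "inverse (c (Inl k)) *\<^sub>R (c (Inl k) *\<^sub>R vs k) =
            (\<Sum>j\<in>{..p} - {k}. (- inverse (c (Inl k)) * c (Inl j)) *\<^sub>R vs j)"
          by (simp add: scaleR_sum_right sum_negf)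
        then have "vs k = (\<Sum>j\<in>{..p} - {k}. (- inverse (c (Inl k)) * c (Inl j)) *\<^sub>R vs j)"
          using ck by simp
        then have "\<exists>k\<le>p. \<exists>c. vs k = (\<Sum>j\<in>{..p} - {k}. c j *\<^sub>R vs j)"
          by (intro exI[of _ k] conjI k exI[of _ "\<lambda>j. - inverse (c (Inl k)) * c (Inl j)"])
        then show False using no by (rule notE[rotated])
      qed
    qed
  qed
  have fam: "inj_on G ?I" "independent (G ` ?I)"
    by (rule family_independent, simp, erule (1) z)+
  have "G ` ?I \<subseteq> tangent atl y"
    using annihD(1)[OF vs] xx_tangent by (auto simp: G_def)
  then have "card (G ` ?I) \<le> p + n"
    using tangent_independent_bound[OF fam(2)] pq n_eq_q by simp
  moreover have "card (G ` ?I) = Suc p + n" using card_image[OF fam(1)] by (simp add: card_Plus)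
  ultimately show False by simp
qed

end

lemma (in lie_rinehart) lie_cong:
  assumes "\<And>ys. ys \<in> tuples L r \<Longrightarrow> c ys = c' ys" "x \<in> A" "xs \<in> tuples L r"
  shows "lie x c xs = lie x c' xs"
proof -
  have len: "length xs = r" using assms(3) by (rule tuples_length)
  have "c (xs[i := br x (xs ! i)]) = c' (xs[i := br x (xs ! i)])" if "i < r" for i
    by (intro assms(1) tuples_update[OF assms(3)] br_closed[OF assms(2)] tuples_nth[OF assms(3) that])
  then show ?thesis unfolding cel_def len using assms(1)[OF assms(3)] by simp
qed

context smooth_mfd
begin

lemma forms_SF: "\<omega> \<in> forms r \<Longrightarrow> \<omega> Xs \<in> SF"
  using func.alt_D(1)[OF formsD(2), of \<omega> r Xs] formsD(1)[of \<omega> r Xs] SF_zero by (cases "Xs \<in> tuples VF r") auto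

lemma forms_eqI:
  assumes "\<omega> \<in> forms r" "\<omega>' \<in> forms r" "\<And>Xs. Xs \<in> tuples VF r \<Longrightarrow> \<omega> Xs = \<omega>' Xs"
  shows "\<omega> = \<omega>'"
proof
  show "\<omega> Xs = \<omega>' Xs" for Xs
    using assms(3) formsD(1)[OF assms(1)] formsD(1)[OF assms(2)] by (cases "Xs \<in> tuples VF r") auto
qed

lemma lie_form_tuples: "Xs \<in> tuples VF r \<Longrightarrow> lie_form atl \<xi> \<omega> Xs = func.lie \<xi> \<omega> Xs"
  by (simp add: lie_form_cel tuples_def)

lemma lie_form_add:
  assumes "\<xi> \<in> VF" "\<omega> \<in> forms r" "\<omega>' \<in> forms r"
  shows "lie_form atl \<xi> (\<omega> + \<omega>') = lie_form atl \<xi> \<omega> + lie_form atl \<xi> \<omega>'"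
proof (rule forms_eqI[of _ r])
  fix Xs assume Xs: "Xs \<in> tuples VF r"
  show "lie_form atl \<xi> (\<omega> + \<omega>') Xs = (lie_form atl \<xi> \<omega> + lie_form atl \<xi> \<omega>') Xs"
    unfolding plus_fun_apply[of "lie_form atl \<xi> \<omega>"] lie_form_tuples[OF Xs] cel_def
    by (simp add: plus_fun_apply[of \<omega> \<omega>'] vf_add[OF assms(1) forms_SF forms_SF, OF assms(2,3)] sum.distrib)
qed (intro forms_lie forms_add assms)+

lemma lie_form_add_left:
  assumes "\<xi> \<in> VF" "\<zeta> \<in> VF" "\<omega> \<in> forms r"
  shows "lie_form atl (\<xi> + \<zeta>) \<omega> = lie_form atl \<xi> \<omega> + lie_form atl \<zeta> \<omega>"
proof (rule forms_eqI[of _ r])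
  fix Xs assume Xs: "Xs \<in> tuples VF r"
  show "lie_form atl (\<xi> + \<zeta>) \<omega> Xs = (lie_form atl \<xi> \<omega> + lie_form atl \<zeta> \<omega>) Xs"
    unfolding plus_fun_apply[of "lie_form atl \<xi> \<omega>"] lie_form_tuples[OF Xs]
    by (rule func.lie_add_left[OF formsD(2)[OF assms(3)] Xs assms(1,2)])
qed (intro forms_lie forms_add assms VF_add)+

lemma lie_form_br:
  assumes "\<xi> \<in> VF" "\<zeta> \<in> VF" "\<omega> \<in> forms r"
  shows "lie_form atl \<xi> (lie_form atl \<zeta> \<omega>) = lie_form atl \<zeta> (lie_form atl \<xi> \<omega>) + lie_form atl (vbr \<xi> \<zeta>) \<omega>"
proof (rule forms_eqI[of _ r])
  fix Xs assume Xs: "Xs \<in> tuples VF r"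
  show "lie_form atl \<xi> (lie_form atl \<zeta> \<omega>) Xs =
      (lie_form atl \<zeta> (lie_form atl \<xi> \<omega>) + lie_form atl (vbr \<xi> \<zeta>) \<omega>) Xs"
    unfolding plus_fun_apply[of "lie_form atl \<zeta> (lie_form atl \<xi> \<omega>)"] lie_form_tuples[OF Xs]
  proof -
    have "func.lie \<xi> (lie_form atl \<zeta> \<omega>) Xs = func.lie \<xi> (func.lie \<zeta> \<omega>) Xs"
      by (rule func.lie_cong[OF _ assms(1) Xs]) (rule lie_form_tuples)
    moreover have "func.lie \<zeta> (lie_form atl \<xi> \<omega>) Xs = func.lie \<zeta> (func.lie \<xi> \<omega>) Xs"
      by (rule func.lie_cong[OF _ assms(2) Xs]) (rule lie_form_tuples)
    ultimately show "func.lie \<xi> (lie_form atl \<zeta> \<omega>) Xs = func.lie \<zeta> (lie_form atl \<xi> \<omega>) Xs + func.lie (vbr \<xi> \<zeta>) \<omega> Xs"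
      using func.lie_commutator[OF formsD(2)[OF assms(3)] assms(1,2) Xs] by simp
  qed
qed (intro forms_lie forms_add assms VF_vbr)+

lemma lie_form_fmul:
  assumes "f \<in> SF" "\<xi> \<in> VF" "\<omega> \<in> forms r"
  shows "lie_form atl \<xi> (fmul f \<omega>) = fmul f (lie_form atl \<xi> \<omega>) + fmul (\<xi> f) \<omega>"
proof (rule forms_eqI[of _ r])
  fix Xs assume Xs: "Xs \<in> tuples VF r"
  show "lie_form atl \<xi> (fmul f \<omega>) Xs = (fmul f (lie_form atl \<xi> \<omega>) + fmul (\<xi> f) \<omega>) Xs"
    unfolding plus_fun_apply[of "fmul f (lie_form atl \<xi> \<omega>)"] fmul_apply lie_form_tuples[OF Xs] cel_def
    by (simp add: vf_mult[OF assms(2,1) forms_SF[OF assms(3)]] right_diff_distrib sum_distrib_left mult.commute)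
qed (intro forms_lie forms_add forms_fmul assms vf_SF)+

end

lemma UN_equal: "A \<noteq> {} \<Longrightarrow> (\<And>x. x \<in> A \<Longrightarrow> f x = c) \<Longrightarrow> (\<Union>x\<in>A. f x) = c"
  by auto

lemma alt_form_subset:
  assumes "alt_form L N r c" "L' \<subseteq> L"
  shows "alt_form L' N r c"
proof -
  have "tuples L' r \<subseteq> tuples L r" using assms(2) by (auto simp: tuples_def)
  then show ?thesis
    using assms unfolding alt_form_def additive_form_def by (meson subsetD)
qed

lemma listset_iff: "Ys \<in> listset As \<longleftrightarrow> length Ys = length As \<and> (\<forall>i<length As. Ys ! i \<in> As ! i)"
proof (induction As arbitrary: Ys)
  case (Cons A As)
  show ?case
  proof (cases Ys)
    case (Cons y ys)
    then show ?thesis using Cons.IH by (auto simp: set_Cons_def nth_Cons split: nat.splits)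
  qed (simp add: set_Cons_def)
qed simp

text \<open>Extend a basis of \<open>W\<close> to the whole space and send the part in
  \<open>W\<close> to 0. This provides representatives modulo \<open>W\<close> that depend linearly
  on the class.\<close>

lemma subspace_projection_exists:
  fixes W :: "'a::real_vector set"
  assumes W: "subspace W"
  obtains \<pi> :: "'a \<Rightarrow> 'a" where "linear \<pi>" "\<And>x. x - \<pi> x \<in> W" "\<And>x. x \<in> W \<Longrightarrow> \<pi> x = 0"
proof -
  obtain C where C: "C \<subseteq> W" "independent C" "W \<subseteq> span C" by (rule maximal_independent_subset)
  let ?C' = "extend_basis C"
  have C': "independent ?C'" "C \<subseteq> ?C'" "span ?C' = UNIV"
    using independent_extend_basis[OF C(2)] extend_basis_superset[OF C(2)] span_extend_basis[OF C(2)] by auto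
  obtain \<pi> where \<pi>: "linear \<pi>" "\<forall>x\<in>?C'. \<pi> x = (if x \<in> C then 0 else x)"
    using linear_independent_extend[OF C'(1), of "\<lambda>x. if x \<in> C then 0 else x"] by blast
  have "x - \<pi> x \<in> W" for x
  proof -
    have "x \<in> span ?C'" unfolding C'(3) by simp
    then show ?thesis
    proof (induction rule: span_induct_alt)
      case base
      then show ?case using linear_0[OF \<pi>(1)] subspace_0[OF W] by simp
    next
      case (step c b y)
      have "b - \<pi> b \<in> W" using \<pi>(2) step(1) C(1) subspace_0[OF W] by auto
      then have "c *\<^sub>R (b - \<pi> b) + (y - \<pi> y) \<in> W" using step(2) by (intro subspace_add[OF W] subspace_scale[OF W])
      then show ?case by (simp add: linear_add[OF \<pi>(1)] linear_cmul[OF \<pi>(1)] algebra_simps)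
    qed
  qed
  moreover have "\<pi> x = 0" if "x \<in> W" for x
    by (rule linear_eq_0_on_span[OF \<pi>(1), of C]) (use \<pi>(2) C C'(2) that in auto)
  ultimately show ?thesis using that \<pi>(1) by blast
qed

section \<open>Automorphisms and annihilating forms\<close>

context pfaffian_action
begin

lemma BB_VF: "\<eta> \<in> BB \<Longrightarrow> \<eta> \<in> VF"
  by (simp add: Bsec_def)

lemma BB_iff: "\<eta> \<in> BB \<longleftrightarrow> \<eta> \<in> VF \<and> (\<forall>x. vf_at \<eta> x \<in> annih atl S x)"
  by (simp add: Bsec_def)

lemma BB_add: "X \<in> BB \<Longrightarrow> Y \<in> BB \<Longrightarrow> X + Y \<in> BB"
  by (simp add: BB_iff VF_add vf_at_simps subspace_add[OF subspace_annih])

lemma BB_diff: "X \<in> BB \<Longrightarrow> Y \<in> BB \<Longrightarrow> X - Y \<in> BB"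
  by (simp add: BB_iff VF_diff vf_at_simps subspace_diff[OF subspace_annih])

lemma BB_zero: "0 \<in> BB"
  by (simp add: BB_iff VF_zero vf_at_simps subspace_0[OF subspace_annih])

lemma BB_fmul: "f \<in> SF \<Longrightarrow> X \<in> BB \<Longrightarrow> fmul f X \<in> BB"
  by (simp add: BB_iff VF_fmul vf_at_simps subspace_scale[OF subspace_annih])

lemma BB_vbr: "X \<in> BB \<Longrightarrow> Y \<in> BB \<Longrightarrow> vbr X Y \<in> BB"
  using integ by (simp add: integrable_system_def)

lemma Csec_BB: "\<omega> \<in> Csec atl S \<Longrightarrow> \<eta> \<in> BB \<Longrightarrow> \<omega> [\<eta>] = 0"
  by (auto simp: Csec_def one_form_def BB_iff annih_def pair_def fun_eq_iff fun_apply)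

definition wf :: "nat \<Rightarrow> 'm form" where "wf i = one_form atl (om i)"

lemma wf_Csec: "i < n \<Longrightarrow> wf i \<in> Csec atl S"
  unfolding wf_def Csec_def using om_smooth om_S by blast

lemma wf_apply: "Z \<in> VF \<Longrightarrow> wf i [Z] = pair (om i) Z"
  by (simp add: wf_def one_form_def tuples_def)

lemma om_add: "i < n \<Longrightarrow> v \<in> tangent atl x \<Longrightarrow> w \<in> tangent atl x \<Longrightarrow> om i x (v + w) = om i x v + om i x w"
  using cot_add S_cot om_S by blast

text \<open>Projection onto the annihilator along the orbit directions, at the level of global
  vector fields.\<close>

definition horizontal_part :: "'m vf \<Rightarrow> 'm vf" where
  "horizontal_part Z = Z - (\<Sum>i<n. fmul (pair (om i) Z) (XX i))"

lemma horizontal_part_BB: assumes Z: "Z \<in> VF" shows "horizontal_part Z \<in> BB"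
  unfolding BB_iff
proof (intro conjI allI)
  show "horizontal_part Z \<in> VF"
    unfolding horizontal_part_def by (intro VF_diff VF_sum VF_fmul act_VF pair_vf(1)[OF om_smooth] Z) simp
  fix x
  obtain u c where u: "u \<in> annih atl S x" "vf_at Z x = u + (\<Sum>i<n. c i *\<^sub>R xx i x)"
    by (rule tangent_split[OF VF_tangent[OF Z]])
  have t: "(\<Sum>i<n. c i *\<^sub>R xx i x) \<in> tangent atl x"
    by (intro subspace_sum[OF subspace_tangent] subspace_scale[OF subspace_tangent] xx_tangent)
  have "pair (om j) Z x = c j" if j: "j < n" for j
  proof -
    have "om j x \<in> cotangent atl x" using om_S[OF j] S_cot by blast
    then have "om j x (\<Sum>i<n. c i *\<^sub>R xx i x) = (\<Sum>i<n. c i * om j x (xx i x))" by (rule cot_sum[OF _ xx_tangent])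
    also have "\<dots> = (\<Sum>i<n. if i = j then c j else 0)" by (intro sum.cong refl) (auto simp: om_dual j)
    finally have "om j x (\<Sum>i<n. c i *\<^sub>R xx i x) = c j" using j by simp
    then show ?thesis
      using om_add[OF j annihD(1)[OF u(1)] t] annihD(2)[OF u(1) om_S[OF j]] by (simp add: pair_def u(2))
  qed
  then have "vf_at (horizontal_part Z) x = u"
    unfolding horizontal_part_def vf_at_simps vf_at_sum u(2) by simp
  then show "vf_at (horizontal_part Z) x \<in> annih atl S x" using u by simp
qed

lemma VF_split: "Z = (\<Sum>i<n. fmul (pair (om i) Z) (XX i)) + horizontal_part Z"
  by (simp add: horizontal_part_def)

lemma BB_I:
  assumes Z: "Z \<in> VF" and z: "\<And>i. i < n \<Longrightarrow> pair (om i) Z = 0"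
  shows "Z \<in> BB"
proof -
  have "horizontal_part Z = Z" unfolding horizontal_part_def using z by (simp add: fmul_def fun_eq_iff fun_apply)
  then show ?thesis using horizontal_part_BB[OF Z] by simp
qed

text \<open>Automorphisms described by brackets with \<B>, from which closure under brackets follows
  by the Jacobi identity; \<open>auts_AA\<close> places every element of \<open>auts\<close>
  here.\<close>

definition AA :: "'m vf set" where "AA = {\<xi> \<in> VF. \<forall>\<eta>\<in>BB. vbr \<xi> \<eta> \<in> BB}"

lemma auts_AA: assumes \<xi>: "\<xi> \<in> auts atl S" shows "\<xi> \<in> AA"
  unfolding AA_def
proof (intro CollectI conjI ballI)
  show V: "\<xi> \<in> VF" using \<xi> by (simp add: auts_def)
  fix \<eta> assume \<eta>: "\<eta> \<in> BB"
  show "vbr \<xi> \<eta> \<in> BB"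
  proof (rule BB_I)
    show b: "vbr \<xi> \<eta> \<in> VF" by (rule VF_vbr[OF V BB_VF[OF \<eta>]])
    fix i assume i: "i < n"
    have "lie_form atl \<xi> (wf i) \<in> Csec atl S" using \<xi> wf_Csec[OF i] by (auto simp: auts_def)
    then have "lie_form atl \<xi> (wf i) [\<eta>] = 0" using Csec_BB \<eta> by blast
    moreover have "lie_form atl \<xi> (wf i) [\<eta>] = \<xi> (wf i [\<eta>]) - wf i [vbr \<xi> \<eta>]"
      using BB_VF[OF \<eta>] by (simp add: lie_form_def)
    moreover have "wf i [\<eta>] = 0" by (rule Csec_BB[OF wf_Csec[OF i] \<eta>])
    ultimately show "pair (om i) (vbr \<xi> \<eta>) = 0" using vf_zero[OF V] wf_apply[OF b] by simp
  qed
qed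

lemma act_AA: "act v \<in> AA" by (rule auts_AA[OF aut])

lemma AA_VF: "\<xi> \<in> AA \<Longrightarrow> \<xi> \<in> VF" by (simp add: AA_def)

lemma AA_BB: "\<xi> \<in> AA \<Longrightarrow> \<eta> \<in> BB \<Longrightarrow> vbr \<xi> \<eta> \<in> BB" by (simp add: AA_def)

lemma BB_AA: "BB \<subseteq> AA"
  by (auto simp: AA_def BB_VF BB_vbr)

lemma AA_add: "X \<in> AA \<Longrightarrow> Y \<in> AA \<Longrightarrow> X + Y \<in> AA"
  by (simp add: AA_def VF_add vbr_add_left BB_VF BB_add)

lemma AA_zero: "0 \<in> AA"
  using BB_AA BB_zero by blast

lemma AA_vbr: assumes "X \<in> AA" "Y \<in> AA" shows "vbr X Y \<in> AA"
  unfolding AA_def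
proof (intro CollectI conjI ballI)
  show "vbr X Y \<in> VF" using assms by (intro VF_vbr AA_VF)
  fix \<eta> assume \<eta>: "\<eta> \<in> BB"
  have "vbr (vbr X Y) \<eta> = vbr X (vbr Y \<eta>) - vbr Y (vbr X \<eta>)"
    using vbr_jacobi[OF AA_VF[OF assms(1)] AA_VF[OF assms(2)] BB_VF[OF \<eta>]] by simp
  then show "vbr (vbr X Y) \<eta> \<in> BB" using assms \<eta> by (simp add: BB_diff AA_BB)
qed

text \<open>An intrinsic description of the exterior power of \<C>, without reference to
  decomposable forms; \<open>extC_BF\<close> proves the two equal.\<close>

definition BF :: "nat \<Rightarrow> 'm form set" where
  "BF r = {\<omega> \<in> forms r. \<forall>Xs\<in>tuples VF r. \<forall>X\<in>set Xs. X \<in> BB \<longrightarrow> \<omega> Xs = 0}"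

lemma BF_forms: "\<omega> \<in> BF r \<Longrightarrow> \<omega> \<in> forms r" by (simp add: BF_def)

lemma BF_BB: "\<omega> \<in> BF r \<Longrightarrow> Xs \<in> tuples VF r \<Longrightarrow> X \<in> set Xs \<Longrightarrow> X \<in> BB \<Longrightarrow> \<omega> Xs = 0"
  by (auto simp: BF_def)

lemma BF_add: "\<omega> \<in> BF r \<Longrightarrow> \<omega>' \<in> BF r \<Longrightarrow> \<omega> + \<omega>' \<in> BF r"
  by (auto simp: BF_def forms_add fun_apply)

lemma BF_fmul: "\<omega> \<in> BF r \<Longrightarrow> f \<in> SF \<Longrightarrow> fmul f \<omega> \<in> BF r"
  by (auto simp: BF_def forms_fmul fmul_apply)

lemma BF_scale: "\<omega> \<in> BF r \<Longrightarrow> c *\<^sub>R \<omega> \<in> BF r"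
  using BF_fmul[OF _ SF_const[of c]] by (simp add: fmul_const)

lemma BF_zero: "0 \<in> BF r"
  by (simp add: BF_def forms_zero fun_apply)

lemma BF_subspace: "subspace (BF r)"
  unfolding subspace_def by (simp add: BF_zero BF_add BF_scale)

text \<open>Bracketing with an automorphism keeps an argument in \<B> inside \<B>, so every term
  still has a vanishing argument.\<close>

lemma BF_lie: assumes \<xi>: "\<xi> \<in> AA" and \<omega>: "\<omega> \<in> BF r" shows "lie_form atl \<xi> \<omega> \<in> BF r"
  unfolding BF_def
proof (intro CollectI conjI ballI impI)
  show "lie_form atl \<xi> \<omega> \<in> forms r" by (rule forms_lie[OF BF_forms[OF \<omega>] AA_VF[OF \<xi>]])
  fix Xs X assume Xs: "Xs \<in> tuples VF r" and X: "X \<in> set Xs" "X \<in> BB"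
  have len: "length Xs = r" using Xs by (rule tuples_length)
  obtain k where k: "k < r" "Xs ! k = X" using X(1) len by (auto simp: in_set_conv_nth)
  have "\<omega> (Xs[i := vbr \<xi> (Xs ! i)]) = 0" if i: "i < r" for i
  proof -
    let ?Ys = "Xs[i := vbr \<xi> (Xs ! i)]"
    have t: "?Ys \<in> tuples VF r"
      by (intro tuples_update[OF Xs] VF_vbr AA_VF[OF \<xi>] tuples_nth[OF Xs i])
    have "?Ys ! k \<in> BB" using k X(2) AA_BB[OF \<xi>] len by (cases "i = k") simp_all
    moreover have "?Ys ! k \<in> set ?Ys" using k len by (intro nth_mem) simp
    ultimately show ?thesis by (intro BF_BB[OF \<omega> t])
  qed
  then show "lie_form atl \<xi> \<omega> Xs = 0"
    unfolding lie_form_tuples[OF Xs] cel_def using BF_BB[OF \<omega> Xs X] len vf_zero[OF AA_VF[OF \<xi>]] by simp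
qed

text \<open>In general \<open>L_(f eta) omega\<close> differs from \<open>f L_eta omega\<close> by
  df wedge \<open>i_eta omega\<close>, and this contraction is 0 here. In the proof it appears as
  the argument \<open>(Z f) eta\<close>, which lies in \<B>.\<close>

lemma lie_form_sl:
  assumes f: "f \<in> SF" and \<eta>: "\<eta> \<in> BB" and \<omega>: "\<omega> \<in> BF r"
  shows "lie_form atl (fmul f \<eta>) \<omega> = fmul f (lie_form atl \<eta> \<omega>)"
proof (rule forms_eqI[of _ r])
  note F = BF_forms[OF \<omega>]
  show "lie_form atl (fmul f \<eta>) \<omega> \<in> forms r" "fmul f (lie_form atl \<eta> \<omega>) \<in> forms r"
    by (intro forms_lie forms_fmul F f VF_fmul BB_VF \<eta>)+
  fix Xs assume Xs: "Xs \<in> tuples VF r"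
  have len: "length Xs = r" using Xs by (rule tuples_length)
  have "\<omega> (Xs[i := vbr (fmul f \<eta>) (Xs ! i)]) = f * \<omega> (Xs[i := vbr \<eta> (Xs ! i)])" if i: "i < r" for i
  proof -
    have X: "Xs ! i \<in> VF" by (rule tuples_nth[OF Xs i])
    let ?a = "vbr (fmul f \<eta>) (Xs ! i)" and ?b = "fmul ((Xs ! i) f) \<eta>"
    have b: "?b \<in> BB" by (intro BB_fmul vf_SF[OF X] \<eta>)
    have a: "?a \<in> VF" by (intro VF_vbr VF_fmul BB_VF \<eta> f X)
    have "?b \<in> set (Xs[i := ?b])" using i len by (simp add: set_update_memI)
    then have "\<omega> (Xs[i := ?b]) = 0" by (rule BF_BB[OF \<omega> tuples_update[OF Xs BB_VF[OF b]] _ b])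
    then have "\<omega> (Xs[i := ?a + ?b]) = \<omega> (Xs[i := ?a])"
      using func.alt_D(2)[OF formsD(2)[OF F] Xs i a BB_VF[OF b]] by simp
    moreover have "?a + ?b = fmul f (vbr \<eta> (Xs ! i))"
      using vbr_fmul_left[OF BB_VF[OF \<eta>] X f] by simp
    moreover have "\<omega> (Xs[i := fmul f (vbr \<eta> (Xs ! i))]) = f * \<omega> (Xs[i := vbr \<eta> (Xs ! i)])"
      using formsD(3)[OF F] Xs i f VF_vbr[OF BB_VF[OF \<eta>] X] unfolding func.hom_form_def by blast
    ultimately show ?thesis by simp
  qed
  then show "lie_form atl (fmul f \<eta>) \<omega> Xs = fmul f (lie_form atl \<eta> \<omega>) Xs"
    unfolding fmul_apply[of f "lie_form atl \<eta> \<omega>"] lie_form_tuples[OF Xs] cel_def len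
    by (simp add: fmul_apply right_diff_distrib sum_distrib_left)
qed

text \<open>Second instance: automorphisms acting on cochains over the ideal \<B> with values in
  annihilating forms. Here \<open>hor.d\<close> is the formula of \<open>dH\<close>.\<close>

sublocale hor: lie_rinehart AA BB "BF r" vbr "lie_form atl" SF fmul fmul "\<lambda>X f. X f" for r
proof
  show "BB \<subseteq> AA" by (rule BB_AA)
  show "X + Y \<in> BB" if "X \<in> BB" "Y \<in> BB" for X Y by (rule BB_add[OF that])
  show "0 \<in> BB" by (rule BB_zero)
  show "subspace (BF r)" by (rule BF_subspace)
  show "vbr X Y \<in> BB" if "X \<in> AA" "Y \<in> BB" for X Y by (rule AA_BB[OF that])
  show "vbr X Y \<in> AA" if "X \<in> AA" "Y \<in> AA" for X Y by (rule AA_vbr[OF that])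
  show "vbr X (Y + Z) = vbr X Y + vbr X Z" if "X \<in> AA" "Y \<in> BB" "Z \<in> BB" for X Y Z
    by (rule vbr_add_right[OF AA_VF[OF that(1)] BB_VF[OF that(2)] BB_VF[OF that(3)]])
  show "vbr (X + Y) Z = vbr X Z + vbr Y Z" if "X \<in> AA" "Y \<in> AA" "Z \<in> BB" for X Y Z
    by (rule vbr_add_left[OF AA_VF[OF that(1)] AA_VF[OF that(2)] BB_VF[OF that(3)]])
  show "vbr X X = 0" if "X \<in> BB" for X :: "'m vf" by (rule vbr_self)
  show "vbr W (vbr X Y) = vbr (vbr W X) Y + vbr X (vbr W Y)" if "W \<in> AA" "X \<in> AA" "Y \<in> BB" for W X Y
    by (rule vbr_jacobi[OF AA_VF[OF that(1)] AA_VF[OF that(2)] BB_VF[OF that(3)]])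
  show "lie_form atl X \<omega> \<in> BF r" if "X \<in> AA" "\<omega> \<in> BF r" for X \<omega> by (rule BF_lie[OF that])
  show "lie_form atl X (\<omega> + \<omega>') = lie_form atl X \<omega> + lie_form atl X \<omega>'" if "X \<in> AA" "\<omega> \<in> BF r" "\<omega>' \<in> BF r" for X \<omega> \<omega>'
    by (rule lie_form_add[OF AA_VF[OF that(1)] BF_forms[OF that(2)] BF_forms[OF that(3)]])
  show "lie_form atl (X + Y) \<omega> = lie_form atl X \<omega> + lie_form atl Y \<omega>" if "X \<in> AA" "Y \<in> AA" "\<omega> \<in> BF r" for X Y \<omega>
    by (rule lie_form_add_left[OF AA_VF[OF that(1)] AA_VF[OF that(2)] BF_forms[OF that(3)]])
  show "lie_form atl X (lie_form atl Y \<omega>) = lie_form atl Y (lie_form atl X \<omega>) + lie_form atl (vbr X Y) \<omega>"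
    if "X \<in> AA" "Y \<in> AA" "\<omega> \<in> BF r" for X Y \<omega>
    by (rule lie_form_br[OF AA_VF[OF that(1)] AA_VF[OF that(2)] BF_forms[OF that(3)]])
  show "fmul f X \<in> BB" if "f \<in> SF" "X \<in> BB" for f X by (rule BB_fmul[OF that])
  show "X f \<in> SF" if "f \<in> SF" "X \<in> AA" for f X by (rule vf_SF[OF AA_VF[OF that(2)]])
  show "fmul f (\<omega> + \<omega>') = fmul f \<omega> + fmul f \<omega>'" for f and \<omega> \<omega>' :: "'m form" by (rule fmul_add_right)
  show "vbr X (fmul f Y) = fmul f (vbr X Y) + fmul (X f) Y" if "f \<in> SF" "X \<in> AA" "Y \<in> BB" for f X Y
    by (rule vbr_fmul[OF AA_VF[OF that(2)] BB_VF[OF that(3)] that(1)])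
  show "lie_form atl (fmul f X) \<omega> = fmul f (lie_form atl X \<omega>)" if "f \<in> SF" "X \<in> BB" "\<omega> \<in> BF r" for f X \<omega>
    by (rule lie_form_sl[OF that])
  show "lie_form atl X (fmul f \<omega>) = fmul f (lie_form atl X \<omega>) + fmul (X f) \<omega>" if "f \<in> SF" "X \<in> AA" "\<omega> \<in> BF r" for f X \<omega>
    by (rule lie_form_fmul[OF that(1) AA_VF[OF that(2)] BF_forms[OF that(3)]])
qed

text \<open>Slot by slot, a field is split into a combination of frame fields and a horizontal part;
  the latter contributes 0.\<close>

lemma BF_eq_0_on_frame:
  assumes \<omega>: "\<omega> \<in> BF r" and z: "\<And>J. J \<in> tuples {..<n} r \<Longrightarrow> \<omega> (map XX J) = 0"
  shows "\<omega> = 0"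
proof (rule forms_eqI[OF BF_forms[OF \<omega>] forms_zero])
  note F = BF_forms[OF \<omega>]
  fix Xs assume Xs: "Xs \<in> tuples VF r"
  have "\<omega> Xs = 0"
  proof (rule tuples_slotwise[where P = "\<lambda>Xs. \<omega> Xs = 0" and G = "XX ` {..<n}" and L = VF, OF _ _ _ Xs])
    fix Xs assume "Xs \<in> tuples (XX ` {..<n}) r"
    then have "set Xs \<subseteq> XX ` {..<n}" "length Xs = r" by (auto simp: tuples_def)
    then have "Xs \<in> map XX ` lists {..<n}" unfolding lists_image[symmetric] by auto
    then obtain J where "Xs = map XX J" "J \<in> lists {..<n}" by (rule imageE)
    then have "set J \<subseteq> {..<n}" "Xs = map XX J" by auto
    then show "\<omega> Xs = 0" using z[of J] \<open>length Xs = r\<close> by (simp add: tuples_def)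
  next
    fix Xs i Z assume Xs: "Xs \<in> tuples VF r" and i: "i < r" and Z: "Z \<in> VF"
      and h: "\<And>g. g \<in> XX ` {..<n} \<Longrightarrow> \<omega> (Xs[i := g]) = 0"
    let ?s = "\<Sum>k<n. fmul (pair (om k) Z) (XX k)"
    have s: "?s \<in> VF \<and> \<omega> (Xs[i := ?s]) = (\<Sum>k<n. pair (om k) Z * \<omega> (Xs[i := XX k]))"
      by (rule func.alt_hom_sum[OF formsD(2,3)[OF F] Xs i])
        (use pair_vf(1)[OF om_smooth Z] act_VF in auto)
    have b: "horizontal_part Z \<in> BB" by (rule horizontal_part_BB[OF Z])
    have "horizontal_part Z \<in> set (Xs[i := horizontal_part Z])" using i tuples_length[OF Xs] by (simp add: set_update_memI)
    then have "\<omega> (Xs[i := horizontal_part Z]) = 0" by (rule BF_BB[OF \<omega> tuples_update[OF Xs BB_VF[OF b]] _ b])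
    moreover have "\<omega> (Xs[i := ?s]) = 0" using s h by simp
    ultimately have "\<omega> (Xs[i := ?s + horizontal_part Z]) = 0"
      using func.alt_D(2)[OF formsD(2)[OF F] Xs i _ BB_VF[OF b], of ?s] s by simp
    then show "\<omega> (Xs[i := Z]) = 0" unfolding VF_split[of Z, symmetric] .
  qed (use act_VF in blast)
  then show "\<omega> Xs = 0 Xs" by (simp add: fun_apply)
qed

section \<open>Expansion of annihilating forms in the dual frame\<close>

definition permute_args :: "(nat \<Rightarrow> nat) \<Rightarrow> 'k list \<Rightarrow> 'k list" where
  "permute_args \<sigma> J = map (\<lambda>k. J ! \<sigma> k) [0..<length J]"

lemma permute_args_tuples: "J \<in> tuples V r \<Longrightarrow> \<sigma> permutes {..<r} \<Longrightarrow> permute_args \<sigma> J \<in> tuples V r"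
  unfolding tuples_def permute_args_def using permutes_in_image[of \<sigma> "{..<r}"] by auto

lemma wedge_XX:
  assumes I: "I \<in> tuples {..<n} r" and J: "J \<in> tuples {..<n} r"
  shows "wedge atl (map wf I) (map XX J) x = (\<Sum>\<sigma> | \<sigma> permutes {..<r}. of_int (sign \<sigma>) * (if I = permute_args \<sigma> J then 1 else 0))"
proof -
  have len: "length I = r" "length J = r" using I J by (auto intro: tuples_length)
  have t: "map XX J \<in> tuples VF r" by (rule tuples_map[OF J]) (rule act_VF)
  have "wedge atl (map wf I) (map XX J) x = (\<Sum>\<sigma> | \<sigma> permutes {..<r}. of_int (sign \<sigma>) *
      (\<Prod>i<r. ((map wf I) ! i) [(map XX J) ! \<sigma> i] x))"
    using t len by (simp add: wedge_def)
  also have "\<dots> = (\<Sum>\<sigma> | \<sigma> permutes {..<r}. of_int (sign \<sigma>) * (if I = permute_args \<sigma> J then 1 else 0))"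
  proof (rule sum.cong[OF refl])
    fix \<sigma> assume "\<sigma> \<in> {\<sigma>. \<sigma> permutes {..<r}}"
    then have \<sigma>: "\<sigma> i < r" if "i < r" for i using permutes_in_image[of \<sigma> "{..<r}" i] that by simp
    have f: "((map wf I) ! i) [(map XX J) ! \<sigma> i] x = (if I ! i = J ! \<sigma> i then 1 else 0)" if i: "i < r" for i
      using om_dual[of "I ! i" "J ! \<sigma> i" x] tuples_nth[OF I i] tuples_nth[OF J \<sigma>[OF i]] len i \<sigma>[OF i]
      by (simp add: wf_apply act_VF pair_def)
    have "(\<Prod>i<r. ((map wf I) ! i) [(map XX J) ! \<sigma> i] x) = (\<Prod>i<r. if I ! i = J ! \<sigma> i then 1 else 0)"
      by (intro prod.cong refl f) simp
    also have "\<dots> = (if \<forall>i<r. I ! i = J ! \<sigma> i then 1 else 0)" by (auto intro: prod.neutral)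
    also have "(\<forall>i<r. I ! i = J ! \<sigma> i) \<longleftrightarrow> I = permute_args \<sigma> J"
      using len by (auto simp: permute_args_def list_eq_iff_nth_eq)
    finally show "of_int (sign \<sigma>) * (\<Prod>i<r. ((map wf I) ! i) [(map XX J) ! \<sigma> i] x) =
        of_int (sign \<sigma>) * (if I = permute_args \<sigma> J then 1 else 0)" by simp
  qed
  finally show ?thesis .
qed

lemma finite_tuples: "finite (tuples {..<n} r)"
proof -
  have "tuples {..<n} r = {xs. set xs \<subseteq> {..<n} \<and> length xs = r}" by (auto simp: tuples_def)
  then show ?thesis using finite_lists_length_eq[of "{..<n}" r] by simp
qed

text \<open>Pairing a family of coefficients with the products of dual covectors antisymmetrises it
  in its indices.\<close>

lemma wedge_XX_sum:
  fixes \<nu> :: "nat list \<Rightarrow> 'a::real_vector"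
  assumes J: "J \<in> tuples {..<n} r"
  shows "(\<Sum>I\<in>tuples {..<n} r. wedge atl (map wf I) (map XX J) x *\<^sub>R \<nu> I) =
    (\<Sum>\<sigma> | \<sigma> permutes {..<r}. of_int (sign \<sigma>) *\<^sub>R \<nu> (permute_args \<sigma> J))"
proof -
  have "(\<Sum>I\<in>tuples {..<n} r. wedge atl (map wf I) (map XX J) x *\<^sub>R \<nu> I) =
      (\<Sum>I\<in>tuples {..<n} r. \<Sum>\<sigma> | \<sigma> permutes {..<r}. if I = permute_args \<sigma> J then of_int (sign \<sigma>) *\<^sub>R \<nu> I else 0)"
    by (intro sum.cong refl, subst wedge_XX[OF _ J], simp, unfold scaleR_sum_left) (intro sum.cong refl, simp)
  also have "\<dots> = (\<Sum>\<sigma> | \<sigma> permutes {..<r}. \<Sum>I\<in>tuples {..<n} r. if I = permute_args \<sigma> J then of_int (sign \<sigma>) *\<^sub>R \<nu> I else 0)"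
    by (rule sum.swap)
  also have "\<dots> = (\<Sum>\<sigma> | \<sigma> permutes {..<r}. of_int (sign \<sigma>) *\<^sub>R \<nu> (permute_args \<sigma> J))"
    using finite_tuples permute_args_tuples[OF J] by (intro sum.cong refl) simp
  finally show ?thesis .
qed

text \<open>For alternating \<open>c\<close> the sign of the permutation occurs twice and cancels,
  so all r! summands agree; hence the normalisation by \<open>inverse (fact r)\<close>.\<close>

lemma signed_sum_alt:
  fixes c :: "'l::ab_group_add list \<Rightarrow> 'a::real_vector"
  assumes c: "alt_form L N r c" and L: "\<And>x y. x \<in> L \<Longrightarrow> y \<in> L \<Longrightarrow> x + y \<in> L" and J: "map z J \<in> tuples L r"
  shows "(\<Sum>\<sigma> | \<sigma> permutes {..<r}. of_int (sign \<sigma>) *\<^sub>R (inverse (fact r) *\<^sub>R c (map z (permute_args \<sigma> J)))) = c (map z J)"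
proof -
  have len: "length J = r" using tuples_length[OF J] by simp
  have "of_int (sign \<sigma>) *\<^sub>R (inverse (fact r) *\<^sub>R c (map z (permute_args \<sigma> J))) = inverse (fact r) *\<^sub>R c (map z J)"
    if "\<sigma> \<in> {\<sigma>. \<sigma> permutes {..<r}}" for \<sigma>
  proof -
    have \<sigma>: "\<sigma> permutes {..<r}" using that by simp
    have "map z (permute_args \<sigma> J) = map (\<lambda>k. map z J ! \<sigma> k) [0..<r]"
      using permutes_in_image[OF \<sigma>] len by (simp add: permute_args_def)
    then have 1: "c (map z (permute_args \<sigma> J)) = of_int (sign \<sigma>) *\<^sub>R c (map z J)"
      using alt_form_permute[OF c L \<sigma> J] by simp
    have 2: "of_int (sign \<sigma>) * of_int (sign \<sigma>) = (1::real)"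
      by (cases \<sigma> rule: sign_cases) auto
    have "of_int (sign \<sigma>) *\<^sub>R (inverse (fact r) *\<^sub>R (of_int (sign \<sigma>) *\<^sub>R c (map z J))) =
        inverse (fact r) *\<^sub>R ((of_int (sign \<sigma>) * of_int (sign \<sigma>)) *\<^sub>R c (map z J))"
      unfolding scaleR_scaleR by (rule arg_cong[where f = "\<lambda>t. t *\<^sub>R c (map z J)"]) (rule mult.left_commute)
    then show ?thesis unfolding 1 2 by simp
  qed
  then have "(\<Sum>\<sigma> | \<sigma> permutes {..<r}. of_int (sign \<sigma>) *\<^sub>R (inverse (fact r) *\<^sub>R c (map z (permute_args \<sigma> J)))) =
      (\<Sum>\<sigma> | \<sigma> permutes {..<r}. inverse (fact r) *\<^sub>R c (map z J))" by (rule sum.cong[OF refl])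
  also have "\<dots> = c (map z J)" using card_permutations[of "{..<r}" r] by (simp add: scaleR_sum_left[symmetric])
  finally show ?thesis .
qed

lemma wedge_wf_BF:
  assumes I: "\<omega>s \<in> tuples (Csec atl S) r"
  shows "wedge atl \<omega>s \<in> BF r"
  unfolding BF_def
proof (intro CollectI conjI ballI impI)
  have len: "length \<omega>s = r" using I by (rule tuples_length)
  show "wedge atl \<omega>s \<in> forms r"
    by (rule wedge_forms) (use I in \<open>auto simp: tuples_def Csec_def\<close>)
  fix Xs X assume Xs: "Xs \<in> tuples VF r" "X \<in> set Xs" "X \<in> BB"
  show "wedge atl \<omega>s Xs = 0"
    by (rule wedge_zero_arg[of _ X]) (use Xs I len Csec_BB in \<open>auto simp: tuples_def\<close>)
qed

lemma BF_sum: "(\<And>i. i \<in> I \<Longrightarrow> \<omega> i \<in> BF r) \<Longrightarrow> (\<Sum>i\<in>I. \<omega> i) \<in> BF r"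
  by (rule subspace_sum[OF BF_subspace])

lemma extC_wf_sum:
  assumes "\<And>I. I \<in> tuples {..<n} r \<Longrightarrow> f I \<in> SF"
  shows "(\<Sum>I\<in>tuples {..<n} r. fmul (f I) (wedge atl (map wf I))) \<in> extC atl S r"
proof -
  let ?T = "tuples {..<n} r"
  obtain h where h: "bij_betw h {0..<card ?T} ?T" using ex_bij_betw_nat_finite[OF finite_tuples] by blast
  have "(\<Sum>I\<in>?T. fmul (f I) (wedge atl (map wf I))) = (\<Sum>k<card ?T. fmul (f (h k)) (wedge atl (map wf (h k))))"
    using sum.reindex_bij_betw[OF h, of "\<lambda>I. fmul (f I) (wedge atl (map wf I))"] by (simp add: atLeast0LessThan)
  moreover have "h k \<in> ?T" if "k < card ?T" for k using h that by (auto simp: bij_betw_def)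
  moreover have "map wf I \<in> tuples (Csec atl S) r" if "I \<in> ?T" for I
    by (rule tuples_map[OF that]) (simp add: wf_Csec)
  ultimately show ?thesis
    unfolding extC_def using assms
    by (intro CollectI exI[of _ "card ?T"] exI[of _ "\<lambda>k. f (h k)"] exI[of _ "\<lambda>k. map wf (h k)"]) simp
qed

text \<open>An annihilating form agrees on the frame with 1/r! times the sum of its frame values
  against products of dual covectors, and frame values determine it.\<close>

lemma extC_BF: "extC atl S r = BF r"
proof
  show "extC atl S r \<subseteq> BF r"
    by (auto simp: extC_def intro!: BF_sum BF_fmul wedge_wf_BF)
  show "BF r \<subseteq> extC atl S r"
  proof
    fix \<omega> assume \<omega>: "\<omega> \<in> BF r"
    let ?T = "tuples {..<n} r"
    have S: "inverse (fact r) *\<^sub>R \<omega> (map XX I) \<in> SF" for I by (intro SF_scale forms_SF[OF BF_forms[OF \<omega>]])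
    let ?\<omega> = "\<Sum>I\<in>?T. fmul (inverse (fact r) *\<^sub>R \<omega> (map XX I)) (wedge atl (map wf I))"
    have 1: "?\<omega> \<in> BF r"
      by (intro BF_sum BF_fmul S wedge_wf_BF tuples_map[of _ "{..<n}"] wf_Csec) auto
    have "\<omega> - ?\<omega> = 0"
    proof (rule BF_eq_0_on_frame)
      show "\<omega> - ?\<omega> \<in> BF r" by (rule subspace_diff[OF BF_subspace \<omega> 1])
      fix J assume J: "J \<in> ?T"
      have t: "map XX J \<in> tuples VF r" by (rule tuples_map[OF J]) (rule act_VF)
      have "?\<omega> (map XX J) x = \<omega> (map XX J) x" for x
      proof -
        have "?\<omega> (map XX J) x = (\<Sum>I\<in>?T. wedge atl (map wf I) (map XX J) x *\<^sub>R (inverse (fact r) *\<^sub>R \<omega> (map XX I))) x"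
          by (simp add: fun_apply fmul_apply mult_ac)
        also have "(\<Sum>I\<in>?T. wedge atl (map wf I) (map XX J) x *\<^sub>R (inverse (fact r) *\<^sub>R \<omega> (map XX I))) =
            (\<Sum>\<sigma> | \<sigma> permutes {..<r}. of_int (sign \<sigma>) *\<^sub>R (inverse (fact r) *\<^sub>R \<omega> (map XX (permute_args \<sigma> J))))"
          by (rule wedge_XX_sum[OF J])
        also have "\<dots> = \<omega> (map XX J)"
          by (rule signed_sum_alt[OF formsD(2)[OF BF_forms[OF \<omega>]] VF_add t])
        finally show ?thesis .
      qed
      then show "(\<omega> - ?\<omega>) (map XX J) = 0" by (simp add: fun_apply fun_eq_iff)
    qed
    then have "\<omega> = ?\<omega>" by simp
    then show "\<omega> \<in> extC atl S r" using extC_wf_sum[of r "\<lambda>I. inverse (fact r) *\<^sub>R \<omega> (map XX I)"] S by simp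
  qed
qed

text \<open>Tensoriality: \<open>vfield_decomposition\<close> writes the argument, up to a factor
  nonzero at x, with coefficients vanishing at x. Its fields need not lie in \<B>, where
  \<open>\<nu>\<close> is linear, and must first be replaced by their horizontal parts.\<close>

lemma point_zero:
  assumes \<nu>: "hor.alt r s \<nu>" "hor.hom_form s \<nu>" and \<eta>s: "\<eta>s \<in> tuples BB s" and k: "k < s"
    and z: "vf_at (\<eta>s ! k) x = 0"
  shows "\<nu> \<eta>s Zs x = 0"
proof -
  let ?\<eta> = "\<eta>s ! k"
  have \<eta>: "?\<eta> \<in> BB" by (rule tuples_nth[OF \<eta>s k])
  obtain c Y where c: "c \<in> SF" "c x \<noteq> 0" and Y: "\<forall>b. Y b \<in> VF"
    and dec: "\<forall>X\<in>VF. \<exists>a. (\<forall>b. a b \<in> SF) \<and> fmul c X = (\<Sum>b\<in>B. fmul (a b) (Y b)) \<and>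
      (vf_at X x = 0 \<longrightarrow> (\<forall>b. a b x = 0))"
    using vfield_decomposition[of x] by (elim exE conjE) (rule that)
  have "\<exists>a. (\<forall>b. a b \<in> SF) \<and> fmul c ?\<eta> = (\<Sum>b\<in>B. fmul (a b) (Y b)) \<and> (\<forall>b. a b x = 0)"
    using dec[rule_format, OF BB_VF[OF \<eta>]] z by simp
  then obtain a where a: "\<forall>b. a b \<in> SF" and eq: "fmul c ?\<eta> = (\<Sum>b\<in>B. fmul (a b) (Y b))" and a0: "\<forall>b. a b x = 0"
    by (elim exE conjE) (rule that)
  \<comment> \<open>The error of that replacement. It points along the orbits, yet it is a
    difference of members of \<B>; transversality makes it 0.\<close>
  let ?D = "\<Sum>b\<in>B. fmul (a b) (Y b - horizontal_part (Y b))"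
  have hs: "(\<Sum>b\<in>B. fmul (a b) (horizontal_part (Y b))) \<in> BB \<and>
      \<nu> (\<eta>s[k := \<Sum>b\<in>B. fmul (a b) (horizontal_part (Y b))]) = (\<Sum>b\<in>B. fmul (a b) (\<nu> (\<eta>s[k := horizontal_part (Y b)])))"
    by (rule hor.alt_hom_sum[OF \<nu> \<eta>s k]) (use a horizontal_part_BB Y in auto)
  have D: "?D = fmul c ?\<eta> - (\<Sum>b\<in>B. fmul (a b) (horizontal_part (Y b)))"
    unfolding eq sum_subtractf[symmetric] by (simp add: fmul_def fun_eq_iff fun_apply algebra_simps)
  then have DB: "?D \<in> BB" using BB_diff[OF BB_fmul[OF c(1) \<eta>]] hs by simp
  have "?D f y = 0" for f y
  proof -
    have "vf_at (Y b - horizontal_part (Y b)) y \<in> orbit_space act y" for b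
      unfolding horizontal_part_def orbit_expand
      by (rule exI[of _ "\<lambda>i. pair (om i) (Y b) y"]) (simp add: vf_at_sum vf_at_simps)
    then have "vf_at ?D y \<in> orbit_space act y"
      unfolding vf_at_sum vf_at_simps(4) by (intro subspace_sum[OF subspace_orbit] subspace_scale[OF subspace_orbit])
    moreover have "vf_at ?D y \<in> annih atl S y" using DB by (simp add: BB_iff)
    ultimately have "vf_at ?D y = 0" by (intro annih_orbit)
    then have "vf_at ?D y f = 0" by (simp only: zero_fun_apply)
    then show ?thesis by (simp only: vf_at_def)
  qed
  then have "?D = 0" by (simp add: fun_eq_iff fun_apply)
  then have "fmul c ?\<eta> = (\<Sum>b\<in>B. fmul (a b) (horizontal_part (Y b)))" using D by simp
  then have "\<nu> (\<eta>s[k := fmul c ?\<eta>]) = (\<Sum>b\<in>B. fmul (a b) (\<nu> (\<eta>s[k := horizontal_part (Y b)])))" using hs by simp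
  moreover have "\<nu> (\<eta>s[k := fmul c ?\<eta>]) = fmul c (\<nu> (\<eta>s[k := ?\<eta>]))"
    using \<nu>(2) \<eta>s k \<eta> c(1) unfolding hor.hom_form_def by blast
  ultimately have "fmul c (\<nu> \<eta>s) Zs x = (\<Sum>b\<in>B. fmul (a b) (\<nu> (\<eta>s[k := horizontal_part (Y b)]))) Zs x" by simp
  then have "c x * \<nu> \<eta>s Zs x = 0" by (simp add: fmul_apply fun_apply a0)
  then show ?thesis using c(2) by simp
qed

text \<open>At each point p + 1 vectors of the annihilator are dependent, so subtracting a
  combination of the other arguments from one of them makes it vanish there, and
  \<open>point_zero\<close> applies.\<close>

lemma top_degree_zero:
  assumes \<nu>: "hor.alt r (Suc p) \<nu>" "hor.hom_form (Suc p) \<nu>" and \<eta>s: "\<eta>s \<in> tuples BB (Suc p)"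
  shows "\<nu> \<eta>s = 0"
proof -
  have "\<nu> \<eta>s Zs x = 0" for Zs x
  proof -
    have len: "length \<eta>s = Suc p" using \<eta>s by (rule tuples_length)
    have nth: "\<eta>s ! j \<in> BB" if "j \<le> p" for j using tuples_nth[OF \<eta>s] that by simp
    have "\<exists>k\<le>p. \<exists>c. vf_at (\<eta>s ! k) x = (\<Sum>j\<in>{..p} - {k}. c j *\<^sub>R vf_at (\<eta>s ! j) x)"
      by (rule annih_dependent[of "\<lambda>j. vf_at (\<eta>s ! j) x" x]) (use nth in \<open>simp add: BB_iff\<close>)
    then obtain k c where k: "k \<le> p" and kc: "vf_at (\<eta>s ! k) x = (\<Sum>j\<in>{..p} - {k}. c j *\<^sub>R vf_at (\<eta>s ! j) x)"
      by (elim exE conjE) (rule that)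
    \<comment> \<open>The relation holds only at x; its coefficients are extended as constants. Each
      summand repeats another argument, so \<open>\<nu>\<close> vanishes on this
      combination.\<close>
    let ?\<zeta> = "\<Sum>j\<in>{..p} - {k}. fmul (\<lambda>_. c j) (\<eta>s ! j)"
    have ks: "k < Suc p" using k by simp
    have \<zeta>: "?\<zeta> \<in> BB \<and> \<nu> (\<eta>s[k := ?\<zeta>]) = (\<Sum>j\<in>{..p} - {k}. fmul (\<lambda>_. c j) (\<nu> (\<eta>s[k := \<eta>s ! j])))"
      by (rule hor.alt_hom_sum[OF \<nu> \<eta>s ks]) (use nth SF_const in auto)
    have "\<nu> (\<eta>s[k := \<eta>s ! j]) = 0" if "j \<in> {..p} - {k}" for j
      by (rule alt_form_zero[OF \<nu>(1), of _ j k]) (use that ks nth len \<eta>s in \<open>auto intro!: tuples_update\<close>)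
    then have \<zeta>0: "\<nu> (\<eta>s[k := ?\<zeta>]) = 0" using \<zeta> by (simp add: fmul_def fun_eq_iff fun_apply)
    let ?\<eta> = "\<eta>s ! k - ?\<zeta>"
    have \<eta>: "?\<eta> \<in> BB" using nth[OF k] \<zeta> by (intro BB_diff) auto
    have "vf_at ?\<eta> x = 0" by (simp add: vf_at_simps vf_at_sum kc)
    then have "\<nu> (\<eta>s[k := ?\<eta>]) Zs x = 0"
      using len ks by (intro point_zero[OF \<nu> tuples_update[OF \<eta>s \<eta>] ks]) simp
    moreover have "\<nu> (\<eta>s[k := ?\<eta> + ?\<zeta>]) = \<nu> (\<eta>s[k := ?\<eta>]) + \<nu> (\<eta>s[k := ?\<zeta>])"
      using hor.alt_D(2)[OF \<nu>(1) \<eta>s ks \<eta>] \<zeta> by blast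
    ultimately show ?thesis using \<zeta>0 by (simp add: fun_apply)
  qed
  then show ?thesis by (simp add: fun_eq_iff fun_apply)
qed

section \<open>The horizontal and vertical complexes\<close>

abbreviation "PH \<equiv> Phi atl S"
abbreviation "lP \<equiv> lie_Phi atl S"

lemma Phi_iff:
  "\<Omega> \<in> PH r s \<longleftrightarrow> (\<forall>\<eta>s. \<eta>s \<notin> tuples BB s \<longrightarrow> \<Omega> \<eta>s = 0) \<and> hor.alt r s \<Omega> \<and> hor.hom_form s \<Omega>"
  unfolding Phi_def alt_form_def additive_form_def hor.hom_form_def extC_BF by auto

lemma PhiD:
  assumes "\<Omega> \<in> PH r s"
  shows "\<eta>s \<notin> tuples BB s \<Longrightarrow> \<Omega> \<eta>s = 0" "hor.alt r s \<Omega>" "hor.hom_form s \<Omega>"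
  using assms by (auto simp: Phi_iff)

lemma Phi_BF: "\<Omega> \<in> PH r s \<Longrightarrow> \<Omega> \<eta>s \<in> BF r"
  using hor.alt_D(1)[OF PhiD(2), of \<Omega> r s \<eta>s] PhiD(1)[of \<Omega> r s \<eta>s] BF_zero by (cases "\<eta>s \<in> tuples BB s") auto

lemma Phi_eqI:
  assumes "\<Omega> \<in> PH r s" "\<Omega>' \<in> PH r s" "\<And>\<eta>s. \<eta>s \<in> tuples BB s \<Longrightarrow> \<Omega> \<eta>s = \<Omega>' \<eta>s"
  shows "\<Omega> = \<Omega>'"
proof
  show "\<Omega> \<eta>s = \<Omega>' \<eta>s" for \<eta>s
    using assms(3) PhiD(1)[OF assms(1)] PhiD(1)[OF assms(2)] by (cases "\<eta>s \<in> tuples BB s") auto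
qed

lemma PhiI:
  assumes "\<And>\<eta>s. \<eta>s \<notin> tuples BB s \<Longrightarrow> \<Omega> \<eta>s = 0" "hor.alt r s c" "hor.hom_form s c"
    "\<And>\<eta>s. \<eta>s \<in> tuples BB s \<Longrightarrow> \<Omega> \<eta>s = c \<eta>s"
  shows "\<Omega> \<in> PH r s"
  unfolding Phi_iff
proof (intro conjI allI impI)
  show "hor.alt r s \<Omega>" by (rule alt_form_cong[OF assms(2) BB_add]) (simp_all add: assms(4))
  show "hor.hom_form s \<Omega>" by (rule hor.hom_form_cong[OF assms(3)]) (simp add: assms(4))
qed (rule assms(1))

lemma Phi_add: assumes "\<Omega> \<in> PH r s" "\<Omega>' \<in> PH r s" shows "\<Omega> + \<Omega>' \<in> PH r s"
  using assms BF_add unfolding Phi_iff alt_form_def additive_form_def hor.hom_form_def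
  by (auto simp: fun_apply fmul_add_right)

lemma Phi_zero: "0 \<in> PH r s"
  unfolding Phi_iff alt_form_def additive_form_def hor.hom_form_def
  by (auto simp: fun_apply BF_zero fmul_def fun_eq_iff)

definition sn :: "('m \<Rightarrow> real) \<Rightarrow> 'm hform \<Rightarrow> 'm hform" where "sn f \<Omega> = (\<lambda>\<eta>s. fmul f (\<Omega> \<eta>s))"

lemma Phi_sn: assumes "\<Omega> \<in> PH r s" "f \<in> SF" shows "sn f \<Omega> \<in> PH r s"
proof -
  have c: "fmul f (fmul g \<omega>) = fmul g (fmul f \<omega>)" for g and \<omega> :: "'m form"
    by (simp add: fmul_def fun_eq_iff fun_apply)
  have z: "fmul f 0 = (0 :: 'm form)" by (simp add: fmul_def fun_eq_iff fun_apply)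
  show ?thesis
    using assms BF_fmul unfolding Phi_iff alt_form_def additive_form_def hor.hom_form_def sn_def
    by (auto simp: fmul_add_right c z)
qed

lemma sn_const: "sn (\<lambda>_. c) \<Omega> = c *\<^sub>R \<Omega>"
  by (simp add: sn_def fmul_const fun_eq_iff fun_apply)

lemma Phi_scale: "\<Omega> \<in> PH r s \<Longrightarrow> c *\<^sub>R \<Omega> \<in> PH r s"
  using Phi_sn[OF _ SF_const[of c]] by (simp add: sn_const)

lemma Phi_subspace: "subspace (PH r s)"
  unfolding subspace_def by (simp add: Phi_zero Phi_add Phi_scale)

lemmas Phi_diff = subspace_diff[OF Phi_subspace] and Phi_sum = subspace_sum[OF Phi_subspace]

lemma lP_eq: "\<eta>s \<in> tuples BB s \<Longrightarrow> lP \<xi> \<mu> \<eta>s = hor.lie \<xi> \<mu> \<eta>s"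
  by (simp add: lie_Phi_def cel_def tuples_def)

lemma lie_form_zero: "\<xi> \<in> VF \<Longrightarrow> lie_form atl \<xi> 0 = 0"
  by (rule ext) (simp add: lie_form_def zero_fun_apply[of Xs for Xs :: "'m vf list"] vf_zero)

lemma lP_Phi: assumes \<xi>: "\<xi> \<in> AA" and \<mu>: "\<mu> \<in> PH r s" shows "lP \<xi> \<mu> \<in> PH r s"
proof (rule PhiI)
  show "hor.alt r s (hor.lie \<xi> \<mu>)" by (rule hor.lie_alt[OF PhiD(2)[OF \<mu>] \<xi>])
  show "hor.hom_form s (hor.lie \<xi> \<mu>)" by (rule hor.lie_hom[OF PhiD(2,3)[OF \<mu>] \<xi>])
  show "lP \<xi> \<mu> \<eta>s = hor.lie \<xi> \<mu> \<eta>s" if "\<eta>s \<in> tuples BB s" for \<eta>s by (rule lP_eq[OF that])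
  fix \<eta>s assume n: "\<eta>s \<notin> tuples BB s"
  show "lP \<xi> \<mu> \<eta>s = 0"
  proof (cases "set \<eta>s \<subseteq> BB")
    case True
    then have "length \<eta>s \<noteq> s" using n by (simp add: tuples_def)
    then have "\<mu> \<eta>s = 0" "\<And>i Y. \<mu> (\<eta>s[i := Y]) = 0"
      using PhiD(1)[OF \<mu>] by (simp_all add: tuples_def)
    then show ?thesis using lie_form_zero[OF AA_VF[OF \<xi>]] by (simp add: lie_Phi_def)
  qed (simp add: lie_Phi_def)
qed

lemma dH_eq: "\<eta>s \<in> tuples BB (Suc s) \<Longrightarrow> dH atl S s \<Omega> \<eta>s = hor.d \<Omega> \<eta>s"
  by (simp add: dH_def ced_def tuples_length)

lemma dH_Phi: assumes \<Omega>: "\<Omega> \<in> PH r s" shows "dH atl S s \<Omega> \<in> PH r (Suc s)"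
  by (rule PhiI[OF _ hor.d_alt[OF PhiD(2)[OF \<Omega>]] hor.d_hom[OF PhiD(2,3)[OF \<Omega>]]])
    (simp_all add: dH_eq, simp add: dH_def)

lemma dH_add:
  assumes "\<Omega> \<in> PH r s" "\<Omega>' \<in> PH r s"
  shows "dH atl S s (\<Omega> + \<Omega>') = dH atl S s \<Omega> + dH atl S s \<Omega>'"
proof (rule Phi_eqI[of _ r "Suc s"])
  fix \<eta>s assume \<eta>s: "\<eta>s \<in> tuples BB (Suc s)"
  have "hor.d (\<Omega> + \<Omega>') \<eta>s = hor.d \<Omega> \<eta>s + hor.d \<Omega>' \<eta>s"
    unfolding plus_fun_def[of \<Omega> \<Omega>']
    by (rule hor.d_add[OF hor.alt_D(1)[OF PhiD(2)[OF assms(1)]] hor.alt_D(1)[OF PhiD(2)[OF assms(2)]] \<eta>s])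
  then show "dH atl S s (\<Omega> + \<Omega>') \<eta>s = (dH atl S s \<Omega> + dH atl S s \<Omega>') \<eta>s"
    unfolding plus_fun_apply[of "dH atl S s \<Omega>"] dH_eq[OF \<eta>s] .
qed (intro dH_Phi Phi_add assms)+

lemma lie_form_scale:
  assumes "\<xi> \<in> VF" "\<omega> \<in> forms r"
  shows "lie_form atl \<xi> (c *\<^sub>R \<omega>) = c *\<^sub>R lie_form atl \<xi> \<omega>"
  by (rule ext) (simp add: lie_form_def fun_apply vf_scale[OF assms(1) forms_SF[OF assms(2)]]
      scaleR_diff_right scaleR_sum_right)

lemma dH_scale:
  assumes \<Omega>: "\<Omega> \<in> PH r s"
  shows "dH atl S s (c *\<^sub>R \<Omega>) = c *\<^sub>R dH atl S s \<Omega>"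
proof (rule ext)
  fix \<eta>s
  have l: "lie_form atl (\<eta>s ! i) (c *\<^sub>R \<Omega> (del i \<eta>s)) = c *\<^sub>R lie_form atl (\<eta>s ! i) (\<Omega> (del i \<eta>s))"
    if "\<eta>s \<in> tuples BB (Suc s)" "i < Suc s" for i
    by (rule lie_form_scale[OF BB_VF[OF tuples_nth[OF that]] BF_forms[OF Phi_BF[OF \<Omega>]]])
  have "(\<Sum>i<Suc s. (-1) ^ i *\<^sub>R lie_form atl (\<eta>s ! i) (c *\<^sub>R \<Omega> (del i \<eta>s))) =
      c *\<^sub>R (\<Sum>i<Suc s. (-1) ^ i *\<^sub>R lie_form atl (\<eta>s ! i) (\<Omega> (del i \<eta>s)))" if "\<eta>s \<in> tuples BB (Suc s)"
    unfolding scaleR_sum_right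
    by (intro sum.cong refl) (simp add: l[OF that] mult.commute del: sum.lessThan_Suc)
  moreover have "(\<Sum>j<Suc s. \<Sum>i<j. (-1) ^ (i + j) *\<^sub>R (c *\<^sub>R \<Omega> (vbr (\<eta>s ! i) (\<eta>s ! j) # del i (del j \<eta>s)))) =
      c *\<^sub>R (\<Sum>j<Suc s. \<Sum>i<j. (-1) ^ (i + j) *\<^sub>R \<Omega> (vbr (\<eta>s ! i) (\<eta>s ! j) # del i (del j \<eta>s)))"
    unfolding scaleR_sum_right
    by (intro sum.cong refl) (simp add: mult.commute)
  ultimately show "dH atl S s (c *\<^sub>R \<Omega>) \<eta>s = (c *\<^sub>R dH atl S s \<Omega>) \<eta>s"
    unfolding dH_def scaleR_fun_apply[of c \<Omega>] scaleR_fun_apply[of c "\<lambda>\<eta>s. if P \<eta>s then F \<eta>s else 0" for P F]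
    by (simp add: scaleR_add_right del: sum.lessThan_Suc)
qed

abbreviation "IM r \<equiv> dH_image atl S p r"

lemma IM_subspace: "subspace (IM r)"
proof (cases p)
  case 0
  then show ?thesis by (simp add: dH_image_def subspace_def)
next
  case (Suc s)
  show ?thesis
    unfolding dH_image_def Suc nat.case subspace_def
  proof (intro conjI ballI allI)
    have "dH atl S s (0 *\<^sub>R 0) = 0 *\<^sub>R dH atl S s 0" by (rule dH_scale[OF Phi_zero])
    then show "0 \<in> dH atl S s ` PH r s" using Phi_zero[of r s] by (auto intro!: image_eqI[of _ _ 0])
    show "x + y \<in> dH atl S s ` PH r s" if xy: "x \<in> dH atl S s ` PH r s" "y \<in> dH atl S s ` PH r s" for x y
    proof -
      obtain a b where ab: "x = dH atl S s a" "a \<in> PH r s" "y = dH atl S s b" "b \<in> PH r s"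
        using xy by blast
      show ?thesis unfolding ab(1,3) dH_add[OF ab(2,4), symmetric] by (intro imageI Phi_add ab)
    qed
    show "c *\<^sub>R x \<in> dH atl S s ` PH r s" if x: "x \<in> dH atl S s ` PH r s" for c x
    proof -
      obtain a where a: "x = dH atl S s a" "a \<in> PH r s" using x by blast
      show ?thesis unfolding a(1) dH_scale[OF a(2), symmetric] by (intro imageI Phi_scale a)
    qed
  qed
qed

lemma IM_Phi: "\<mu> \<in> IM r \<Longrightarrow> \<mu> \<in> PH r p"
  by (auto simp: dH_image_def Phi_zero dH_Phi split: nat.splits)

section \<open>Evaluation of forms on automorphisms\<close>

lemma zform_simps:
  "zform (f + g) = zform f + zform g" "zform 0 = 0" "zform (c *\<^sub>R f) = c *\<^sub>R zform f"
  "zform (f * g) = fmul f (zform g)" "zform f [] = f" "zform (f - g) = zform f - zform g"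
  by (auto simp: zform_def fun_eq_iff fun_apply fmul_def)

lemma zform_sum: "zform (\<Sum>i\<in>I. f i) = (\<Sum>i\<in>I. zform (f i))"
  by (auto simp: zform_def fun_eq_iff fun_apply)

lemma zform_BF: "f \<in> SF \<Longrightarrow> zform f \<in> BF 0"
  unfolding BF_def forms_def alt_form_def additive_form_def func.hom_form_def
  by (auto simp: tuples_0 zform_def)

lemma BF_zform: "\<omega> \<in> BF 0 \<Longrightarrow> zform (\<omega> []) = \<omega>"
  using formsD(1)[OF BF_forms, of \<omega> 0] by (auto simp: zform_def tuples_0 fun_eq_iff)

lemma lie_zform: "\<xi> \<in> VF \<Longrightarrow> lie_form atl \<xi> (zform f) = zform (\<xi> f)"
  by (rule ext) (auto simp: lie_form_def zform_def vf_zero)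

text \<open>The correction terms of the Lie derivative contain brackets of \<xi> in \<B> with
  automorphisms. These lie in \<B>, where the form vanishes; this is why evaluation commutes with
  d_H.\<close>

lemma zform_lie_form:
  assumes \<xi>: "\<xi> \<in> BB" and \<omega>: "\<omega> \<in> BF r" and Zs: "Zs \<in> tuples AA r"
  shows "zform (lie_form atl \<xi> \<omega> Zs) = lie_form atl \<xi> (zform (\<omega> Zs))"
proof -
  have V: "Zs \<in> tuples VF r" using Zs AA_VF by (auto simp: tuples_def)
  have "\<omega> (Zs[i := vbr \<xi> (Zs ! i)]) = 0" if i: "i < r" for i
  proof -
    have "vbr \<xi> (Zs ! i) = - vbr (Zs ! i) \<xi>"
      by (rule ext) (simp only: vbr_apply uminus_apply minus_diff_eq)
    moreover have "- vbr (Zs ! i) \<xi> \<in> BB"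
      using BB_diff[OF BB_zero AA_BB[OF tuples_nth[OF Zs i] \<xi>]] by simp
    ultimately have b: "vbr \<xi> (Zs ! i) \<in> BB" by simp
    have "vbr \<xi> (Zs ! i) \<in> set (Zs[i := vbr \<xi> (Zs ! i)])"
      using i tuples_length[OF Zs] by (simp add: set_update_memI)
    then show ?thesis by (rule BF_BB[OF \<omega> tuples_update[OF V BB_VF[OF b]] _ b])
  qed
  then have "lie_form atl \<xi> \<omega> Zs = \<xi> (\<omega> Zs)"
    unfolding lie_form_tuples[OF V] cel_def by (simp add: tuples_length[OF Zs])
  then show ?thesis using lie_zform[OF BB_VF[OF \<xi>]] by simp
qed

lemma ev_simps:
  "ev Zs (\<Omega> + \<Omega>') = ev Zs \<Omega> + ev Zs \<Omega>'" "ev Zs (\<Omega> - \<Omega>') = ev Zs \<Omega> - ev Zs \<Omega>'"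
  "ev Zs (c *\<^sub>R \<Omega>) = c *\<^sub>R ev Zs \<Omega>" "ev Zs 0 = 0"
  by (auto simp: ev_def fun_apply zform_simps)

lemma ev_Phi: assumes \<Omega>: "\<Omega> \<in> PH r s" shows "ev Zs \<Omega> \<in> PH 0 s"
proof -
  have SFv: "\<Omega> \<eta>s Zs \<in> SF" for \<eta>s by (rule forms_SF[OF BF_forms[OF Phi_BF[OF \<Omega>]]])
  have "hor.alt 0 s (ev Zs \<Omega>)"
    using PhiD(2)[OF \<Omega>] zform_BF[OF SFv]
    unfolding alt_form_def additive_form_def ev_def by (auto simp: fun_apply zform_simps)
  moreover have "hor.hom_form s (ev Zs \<Omega>)"
    using PhiD(3)[OF \<Omega>] unfolding hor.hom_form_def ev_def by (auto simp: fmul_apply zform_simps)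
  moreover have "ev Zs \<Omega> \<eta>s = 0" if "\<eta>s \<notin> tuples BB s" for \<eta>s
    using PhiD(1)[OF \<Omega> that] by (simp add: ev_def fun_apply zform_simps)
  ultimately show ?thesis by (simp add: Phi_iff)
qed

lemma ev_Nil: "\<mu> \<in> PH 0 s \<Longrightarrow> ev [] \<mu> = \<mu>"
  by (rule ext) (simp add: ev_def BF_zform[OF Phi_BF])

lemma ev_alt:
  assumes \<Omega>: "\<Omega> \<in> PH r s"
  shows "alt_form VF (PH 0 s) r (\<lambda>Zs. ev Zs \<Omega>)"
    and "Zs \<in> tuples VF r \<Longrightarrow> i < r \<Longrightarrow> Z \<in> VF \<Longrightarrow> f \<in> SF \<Longrightarrow> ev (Zs[i := fmul f Z]) \<Omega> = sn f (ev (Zs[i := Z]) \<Omega>)"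
    and "Zs \<in> tuples VF r \<Longrightarrow> Z \<in> set Zs \<Longrightarrow> Z \<in> BB \<Longrightarrow> ev Zs \<Omega> = 0"
proof -
  note F = BF_forms[OF Phi_BF[OF \<Omega>]]
  show "alt_form VF (PH 0 s) r (\<lambda>Zs. ev Zs \<Omega>)"
    unfolding alt_form_def additive_form_def
  proof (intro conjI ballI allI impI)
    show "ev Zs \<Omega> \<in> PH 0 s" for Zs by (rule ev_Phi[OF \<Omega>])
    fix Zs assume Zs: "Zs \<in> tuples VF r"
    show "ev (Zs[i := X + Y]) \<Omega> = ev (Zs[i := X]) \<Omega> + ev (Zs[i := Y]) \<Omega>" if "i < r" "X \<in> VF" "Y \<in> VF" for i X Y
      by (rule ext) (simp add: ev_def fun_apply(1) func.alt_D(2)[OF formsD(2)[OF F] Zs that] zform_simps)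
    show "ev Zs \<Omega> = 0" if "j < r" "i < j" "Zs ! i = Zs ! j" for i j
      by (rule ext) (use alt_form_zero[OF formsD(2)[OF F] Zs, of i j] that in \<open>simp add: ev_def zform_simps zero_fun_apply[of "_ :: 'm vf list"]\<close>)
  qed
  show "ev (Zs[i := fmul f Z]) \<Omega> = sn f (ev (Zs[i := Z]) \<Omega>)" if "Zs \<in> tuples VF r" "i < r" "Z \<in> VF" "f \<in> SF"
  proof
    fix \<eta>s
    have "\<Omega> \<eta>s (Zs[i := fmul f Z]) = f * \<Omega> \<eta>s (Zs[i := Z])"
      using formsD(3)[OF F, of \<eta>s] that unfolding func.hom_form_def by blast
    then show "ev (Zs[i := fmul f Z]) \<Omega> \<eta>s = sn f (ev (Zs[i := Z]) \<Omega>) \<eta>s"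
      by (simp add: ev_def sn_def zform_simps)
  qed
  show "ev Zs \<Omega> = 0" if "Zs \<in> tuples VF r" "Z \<in> set Zs" "Z \<in> BB"
    by (rule ext) (simp add: ev_def BF_BB[OF Phi_BF[OF \<Omega>] that] zform_simps zero_fun_apply[of "_ :: 'm vf list"])
qed

lemma ev_dH:
  assumes \<Omega>: "\<Omega> \<in> PH r s" and Zs: "Zs \<in> tuples AA r"
  shows "ev Zs (dH atl S s \<Omega>) = dH atl S s (ev Zs \<Omega>)"
proof (rule Phi_eqI[OF ev_Phi[OF dH_Phi[OF \<Omega>]] dH_Phi[OF ev_Phi[OF \<Omega>]]])
  fix \<eta>s assume \<eta>s: "\<eta>s \<in> tuples BB (Suc s)"
  have len: "length \<eta>s = Suc s" using \<eta>s by (rule tuples_length)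
  have l: "zform (lie_form atl (\<eta>s ! i) (\<Omega> (del i \<eta>s)) Zs) = lie_form atl (\<eta>s ! i) (ev Zs \<Omega> (del i \<eta>s))"
    if "i < Suc s" for i
    unfolding ev_def by (rule zform_lie_form[OF tuples_nth[OF \<eta>s that] Phi_BF[OF \<Omega>] Zs])
  have "ev Zs (dH atl S s \<Omega>) \<eta>s = zform (hor.d \<Omega> \<eta>s Zs)" unfolding ev_def dH_eq[OF \<eta>s] ..
  also have "\<dots> = (\<Sum>i<Suc s. (-1) ^ i *\<^sub>R zform (lie_form atl (\<eta>s ! i) (\<Omega> (del i \<eta>s)) Zs)) +
      (\<Sum>j<Suc s. \<Sum>i<j. (-1) ^ (i + j) *\<^sub>R zform (\<Omega> (vbr (\<eta>s ! i) (\<eta>s ! j) # del i (del j \<eta>s)) Zs))"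
    unfolding ced_def len plus_fun_apply sum_fun_apply scaleR_fun_apply zform_simps zform_sum ..
  also have "\<dots> = hor.d (ev Zs \<Omega>) \<eta>s"
    unfolding ced_def len
    by (intro arg_cong2[where f = "(+)"] sum.cong refl) (simp_all add: l, simp_all add: ev_def)
  finally show "ev Zs (dH atl S s \<Omega>) \<eta>s = dH atl S s (ev Zs \<Omega>) \<eta>s" unfolding dH_eq[OF \<eta>s] .
qed

lemma ev_IM: assumes "\<Omega> \<in> IM r" "Zs \<in> tuples AA r" shows "ev Zs \<Omega> \<in> IM 0"
proof (cases p)
  case 0
  then show ?thesis using assms by (simp add: dH_image_def ev_simps)
next
  case (Suc s)
  then obtain \<nu> where "\<Omega> = dH atl S s \<nu>" "\<nu> \<in> PH r s" using assms(1) by (auto simp: dH_image_def)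
  then show ?thesis using ev_dH[of \<nu> r s Zs] assms(2) ev_Phi Suc by (simp add: dH_image_def)
qed

text \<open>The commutation of Lie derivative and differential in the horizontal calculus; it makes
  automorphisms act on classes modulo d_H.\<close>

lemma lP_dH:
  assumes \<mu>: "\<mu> \<in> PH r s" and \<xi>: "\<xi> \<in> AA"
  shows "lP \<xi> (dH atl S s \<mu>) = dH atl S s (lP \<xi> \<mu>)"
proof (rule Phi_eqI[OF lP_Phi[OF \<xi> dH_Phi[OF \<mu>]] dH_Phi[OF lP_Phi[OF \<xi> \<mu>]]])
  fix \<eta>s assume \<eta>s: "\<eta>s \<in> tuples BB (Suc s)"
  have "hor.lie \<xi> (dH atl S s \<mu>) \<eta>s = hor.lie \<xi> (hor.d \<mu>) \<eta>s"
    by (rule hor.lie_cong[OF dH_eq \<xi> \<eta>s])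
  also have "\<dots> = hor.d (hor.lie \<xi> \<mu>) \<eta>s" by (rule hor.lie_d_commute[OF PhiD(2)[OF \<mu>] \<xi> \<eta>s])
  also have "\<dots> = hor.d (lP \<xi> \<mu>) \<eta>s" by (rule hor.d_cong[OF lP_eq[symmetric] \<eta>s])
  finally show "lP \<xi> (dH atl S s \<mu>) \<eta>s = dH atl S s (lP \<xi> \<mu>) \<eta>s" unfolding lP_eq[OF \<eta>s] dH_eq[OF \<eta>s] .
qed

lemma lP_IM: assumes "\<xi> \<in> AA" "\<mu> \<in> IM r" shows "lP \<xi> \<mu> \<in> IM r"
proof (cases p)
  case 0
  have "lP \<xi> 0 \<eta>s = 0" for \<eta>s
    using lie_form_zero[OF AA_VF[OF assms(1)]] by (simp add: lie_Phi_def zero_fun_apply[of "_ :: 'm vf list"])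
  then have "lP \<xi> 0 = 0" by (simp add: fun_eq_iff zero_fun_apply)
  then show ?thesis using assms 0 by (simp add: dH_image_def)
next
  case (Suc s)
  then obtain \<nu> where "\<mu> = dH atl S s \<nu>" "\<nu> \<in> PH r s" using assms(2) by (auto simp: dH_image_def)
  then show ?thesis using lP_dH[of \<nu> r s \<xi>] assms(1) lP_Phi Suc by (simp add: dH_image_def)
qed

text \<open>Cartan's formula; the term \<open>i\<^sub>\<eta> d\<^sub>H \<mu>\<close> vanishes because \<open>\<mu>\<close> has top degree.\<close>

lemma lP_BB_exact:
  assumes \<eta>: "\<eta> \<in> BB" and \<mu>: "\<mu> \<in> PH r p"
  shows "lP \<eta> \<mu> \<in> IM r"
proof -
  note A = PhiD(2)[OF \<mu>] and H = PhiD(3)[OF \<mu>]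
  have \<eta>A: "\<eta> \<in> AA" using \<eta> BB_AA by blast
  have C: "hor.lie \<eta> \<mu> \<eta>s = hor.d (\<lambda>ys. \<mu> (\<eta> # ys)) \<eta>s" if \<eta>s: "\<eta>s \<in> tuples BB p" for \<eta>s
  proof -
    have "hor.d \<mu> (\<eta> # \<eta>s) = 0"
      by (rule top_degree_zero[OF hor.d_alt[OF A] hor.d_hom[OF A H]]) (simp add: tuples_Cons \<eta> \<eta>s)
    then show ?thesis using hor.d_Cons[OF A \<eta> \<eta>s] by simp
  qed
  show ?thesis
  proof (cases p)
    case 0
    have "lP \<eta> \<mu> = 0"
    proof (rule Phi_eqI[OF lP_Phi[OF \<eta>A \<mu>] Phi_zero])
      fix \<eta>s assume \<eta>s: "\<eta>s \<in> tuples BB p"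
      then have "\<eta>s = []" using 0 by (simp add: tuples_0)
      then show "lP \<eta> \<mu> \<eta>s = 0 \<eta>s" unfolding lP_eq[OF \<eta>s] C[OF \<eta>s] by (simp add: ced_def zero_fun_apply)
    qed
    then show ?thesis using 0 by (simp add: dH_image_def)
  next
    case (Suc s)
    \<comment> \<open>The contraction of \<open>\<mu>\<close> with \<open>\<eta>\<close>, set to 0
      outside its domain as membership in \<open>Phi\<close> requires.\<close>
    define \<nu> where "\<nu> = (\<lambda>ys. if ys \<in> tuples BB s then \<mu> (\<eta> # ys) else 0)"
    have \<nu>: "\<nu> \<in> PH r s"
      by (rule PhiI[OF _ alt_form_contract[OF A[unfolded Suc] \<eta>] hor.hom_contract[OF H[unfolded Suc] \<eta>]])
        (simp_all add: \<nu>_def)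
    have "lP \<eta> \<mu> = dH atl S s \<nu>"
    proof (rule Phi_eqI[OF lP_Phi[OF \<eta>A \<mu>] dH_Phi[OF \<nu>, folded Suc]])
      fix \<eta>s assume \<eta>s: "\<eta>s \<in> tuples BB p"
      have "hor.d (\<lambda>ys. \<mu> (\<eta> # ys)) \<eta>s = hor.d \<nu> \<eta>s"
        by (rule hor.d_cong[OF _ \<eta>s[unfolded Suc]]) (simp add: \<nu>_def)
      then show "lP \<eta> \<mu> \<eta>s = dH atl S s \<nu> \<eta>s"
        unfolding lP_eq[OF \<eta>s] C[OF \<eta>s] dH_eq[OF \<eta>s[unfolded Suc]] .
    qed
    then show ?thesis using \<nu> Suc by (simp add: dH_image_def)
  qed
qed

section \<open>First integrals and the vertical calculus\<close>

lemma vf_const: assumes X: "X \<in> VF" shows "X (\<lambda>_. c) = 0"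
proof -
  have "X (1 * 1) = 1 * X 1 + 1 * X 1" by (rule vf_mult[OF X SF_one SF_one])
  then have 1: "X 1 = 0" by simp
  have "(\<lambda>_. c) = c *\<^sub>R (1 :: 'm \<Rightarrow> real)" by (simp add: fun_eq_iff fun_apply)
  then show ?thesis using vf_scale[OF X SF_one, of c] 1 by simp
qed

text \<open>The ring of first integrals.\<close>

definition II :: "('m \<Rightarrow> real) set" where "II = {f \<in> SF. \<forall>\<eta>\<in>BB. \<eta> f = 0}"

lemma II_SF: "f \<in> II \<Longrightarrow> f \<in> SF" by (simp add: II_def)

lemma II_const: "(\<lambda>_. c) \<in> II" by (simp add: II_def SF_const vf_const BB_VF)

lemma fmul_zero_left: "fmul 0 X = 0"
  by (simp add: fmul_def fun_eq_iff fun_apply)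

lemma vbr_II: assumes "f \<in> II" "\<xi> \<in> AA" "\<eta> \<in> BB" shows "vbr (fmul f \<xi>) \<eta> = fmul f (vbr \<xi> \<eta>)"
  using vbr_fmul_left[OF AA_VF[OF assms(2)] BB_VF[OF assms(3)] II_SF[OF assms(1)]] assms(1,3)
  by (simp add: II_def fmul_zero_left)

lemma sn_add_right: "sn f (\<mu> + \<nu>) = sn f \<mu> + sn f \<nu>"
  by (simp add: sn_def fun_eq_iff fmul_def fun_apply algebra_simps)

text \<open>Third instance: automorphisms acting on horizontal forms of degree p, before passing to
  classes. Linearity holds over the first integrals, and \<open>ver.d\<close> represents
  d_V.\<close>

sublocale ver: lie_rinehart AA AA "PH 0 p" vbr lP II fmul sn "\<lambda>X f. X f"
proof
  show "AA \<subseteq> AA" by simp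
  show "X + Y \<in> AA" if "X \<in> AA" "Y \<in> AA" for X Y by (rule AA_add[OF that])
  show "0 \<in> AA" by (rule AA_zero)
  show "subspace (PH 0 p)" by (rule Phi_subspace)
  show "vbr X Y \<in> AA" if "X \<in> AA" "Y \<in> AA" for X Y by (rule AA_vbr[OF that])
  show "vbr X (Y + Z) = vbr X Y + vbr X Z" if "X \<in> AA" "Y \<in> AA" "Z \<in> AA" for X Y Z
    by (rule vbr_add_right[OF AA_VF[OF that(1)] AA_VF[OF that(2)] AA_VF[OF that(3)]])
  show "vbr (X + Y) Z = vbr X Z + vbr Y Z" if "X \<in> AA" "Y \<in> AA" "Z \<in> AA" for X Y Z
    by (rule vbr_add_left[OF AA_VF[OF that(1)] AA_VF[OF that(2)] AA_VF[OF that(3)]])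
  show "vbr X X = 0" if "X \<in> AA" for X :: "'m vf" by (rule vbr_self)
  show "vbr W (vbr X Y) = vbr (vbr W X) Y + vbr X (vbr W Y)" if "W \<in> AA" "X \<in> AA" "Y \<in> AA" for W X Y
    by (rule vbr_jacobi[OF AA_VF[OF that(1)] AA_VF[OF that(2)] AA_VF[OF that(3)]])
  show "lP X \<mu> \<in> PH 0 p" if "X \<in> AA" "\<mu> \<in> PH 0 p" for X \<mu> by (rule lP_Phi[OF that])
  show "lP X (\<mu> + \<nu>) = lP X \<mu> + lP X \<nu>" if X: "X \<in> AA" and \<mu>: "\<mu> \<in> PH 0 p" and \<nu>: "\<nu> \<in> PH 0 p" for X \<mu> \<nu>
  proof (rule Phi_eqI[of _ 0 p])
    fix \<eta>s assume \<eta>s: "\<eta>s \<in> tuples BB p"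
    show "lP X (\<mu> + \<nu>) \<eta>s = (lP X \<mu> + lP X \<nu>) \<eta>s"
      unfolding plus_fun_apply[of "lP X \<mu>"] lP_eq[OF \<eta>s] cel_def plus_fun_apply[of \<mu> \<nu>]
        lie_form_add[OF AA_VF[OF X] BF_forms[OF Phi_BF[OF \<mu>]] BF_forms[OF Phi_BF[OF \<nu>]]] sum.distrib
      by simp
  qed (intro lP_Phi Phi_add X \<mu> \<nu>)+
  show "lP (X + Y) \<mu> = lP X \<mu> + lP Y \<mu>" if X: "X \<in> AA" and Y: "Y \<in> AA" and \<mu>: "\<mu> \<in> PH 0 p" for X Y \<mu>
  proof (rule Phi_eqI[of _ 0 p])
    fix \<eta>s assume \<eta>s: "\<eta>s \<in> tuples BB p"
    show "lP (X + Y) \<mu> \<eta>s = (lP X \<mu> + lP Y \<mu>) \<eta>s"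
      unfolding plus_fun_apply[of "lP X \<mu>"] lP_eq[OF \<eta>s] by (rule hor.lie_add_left[OF PhiD(2)[OF \<mu>] \<eta>s X Y])
  qed (intro lP_Phi Phi_add AA_add X Y \<mu>)+
  show "lP X (lP Y \<mu>) = lP Y (lP X \<mu>) + lP (vbr X Y) \<mu>" if X: "X \<in> AA" and Y: "Y \<in> AA" and \<mu>: "\<mu> \<in> PH 0 p" for X Y \<mu>
  proof (rule Phi_eqI[of _ 0 p])
    fix \<eta>s assume \<eta>s: "\<eta>s \<in> tuples BB p"
    have "hor.lie X (lP Y \<mu>) \<eta>s = hor.lie X (hor.lie Y \<mu>) \<eta>s" by (rule hor.lie_cong[OF lP_eq X \<eta>s])
    moreover have "hor.lie Y (lP X \<mu>) \<eta>s = hor.lie Y (hor.lie X \<mu>) \<eta>s" by (rule hor.lie_cong[OF lP_eq Y \<eta>s])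
    ultimately show "lP X (lP Y \<mu>) \<eta>s = (lP Y (lP X \<mu>) + lP (vbr X Y) \<mu>) \<eta>s"
      unfolding plus_fun_apply[of "lP Y (lP X \<mu>)"] lP_eq[OF \<eta>s]
      using hor.lie_commutator[OF PhiD(2)[OF \<mu>] X Y \<eta>s] by simp
  qed (intro lP_Phi Phi_add AA_vbr X Y \<mu>)+
  show "fmul f X \<in> AA" if f: "f \<in> II" and X: "X \<in> AA" for f X
    unfolding AA_def using VF_fmul[OF AA_VF[OF X] II_SF[OF f]] vbr_II[OF f X] BB_fmul[OF II_SF[OF f] AA_BB[OF X]] by simp
  show "X f \<in> II" if f: "f \<in> II" and X: "X \<in> AA" for f X
    unfolding II_def
  proof (intro CollectI conjI ballI)
    show "X f \<in> SF" by (rule vf_SF[OF AA_VF[OF X]])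
    fix \<eta> assume \<eta>: "\<eta> \<in> BB"
    have "vbr X \<eta> f = 0" "\<eta> f = 0" using f AA_BB[OF X \<eta>] \<eta> by (auto simp: II_def)
    then show "\<eta> (X f) = 0" using vf_zero[OF AA_VF[OF X]] by (simp add: vbr_apply)
  qed
  show "sn f (\<mu> + \<nu>) = sn f \<mu> + sn f \<nu>" for f \<mu> \<nu> by (rule sn_add_right)
  show "vbr X (fmul f Y) = fmul f (vbr X Y) + fmul (X f) Y" if "f \<in> II" "X \<in> AA" "Y \<in> AA" for f X Y
    by (rule vbr_fmul[OF AA_VF[OF that(2)] AA_VF[OF that(3)] II_SF[OF that(1)]])
  \<comment> \<open>A first integral passes through brackets with \<B>: [f X, eta] = f [X, eta],
    because eta f = 0.\<close>
  show "lP (fmul f X) \<mu> = sn f (lP X \<mu>)" if f: "f \<in> II" and X: "X \<in> AA" and \<mu>: "\<mu> \<in> PH 0 p" for f X \<mu>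
  proof
    fix \<eta>s
    have A: "lie_form atl (fmul f X) (\<mu> \<eta>s) = fmul f (lie_form atl X (\<mu> \<eta>s))"
      using lie_zform[OF VF_fmul[OF AA_VF[OF X] II_SF[OF f]], of "\<mu> \<eta>s []"] lie_zform[OF AA_VF[OF X], of "\<mu> \<eta>s []"]
        BF_zform[OF Phi_BF[OF \<mu>]] by (simp add: fmul_apply zform_simps)
    have Bq: "\<mu> (\<eta>s[i := vbr (fmul f X) (\<eta>s ! i)]) = fmul f (\<mu> (\<eta>s[i := vbr X (\<eta>s ! i)]))"
      if \<eta>s: "set \<eta>s \<subseteq> BB" and i: "i < length \<eta>s" for i
    proof -
      have b: "\<eta>s ! i \<in> BB" using \<eta>s i nth_mem by blast
      show ?thesis
      proof (cases "length \<eta>s = p")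
        case True
        then show ?thesis
          using PhiD(3)[OF \<mu>] \<eta>s i AA_BB[OF X b] II_SF[OF f] unfolding vbr_II[OF f X b] hor.hom_form_def
          by (simp add: tuples_def)
      next
        case False
        have "\<mu> (\<eta>s[i := Y]) = 0" for Y by (rule PhiD(1)[OF \<mu>]) (use False in \<open>simp add: tuples_def\<close>)
        then show ?thesis by (simp add: fmul_def fun_eq_iff fun_apply)
      qed
    qed
    show "lP (fmul f X) \<mu> \<eta>s = sn f (lP X \<mu>) \<eta>s"
    proof (cases "set \<eta>s \<subseteq> BB")
      case True
      have s: "(\<Sum>i<length \<eta>s. \<mu> (\<eta>s[i := vbr (fmul f X) (\<eta>s ! i)])) = (\<Sum>i<length \<eta>s. fmul f (\<mu> (\<eta>s[i := vbr X (\<eta>s ! i)])))"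
        using Bq[OF True] by (intro sum.cong refl) simp
      show ?thesis
        unfolding sn_def lie_Phi_def A s using True
        by (simp add: hor.sn_diff hor.sn_sum)
    next
      case False
      then show ?thesis by (auto simp: sn_def lie_Phi_def hor.sn_zero)
    qed
  qed
  show "lP X (sn f \<mu>) = sn f (lP X \<mu>) + sn (X f) \<mu>" if f: "f \<in> II" and X: "X \<in> AA" and \<mu>: "\<mu> \<in> PH 0 p" for f X \<mu>
  proof (rule Phi_eqI[of _ 0 p])
    fix \<eta>s assume \<eta>s: "\<eta>s \<in> tuples BB p"
    show "lP X (sn f \<mu>) \<eta>s = (sn f (lP X \<mu>) + sn (X f) \<mu>) \<eta>s"
      unfolding plus_fun_apply[of "sn f (lP X \<mu>)"]
      unfolding sn_def lP_eq[OF \<eta>s] cel_def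
        lie_form_fmul[OF II_SF[OF f] AA_VF[OF X] BF_forms[OF Phi_BF[OF \<mu>]]]
      by (simp add: hor.sn_diff hor.sn_sum)
  qed (intro lP_Phi Phi_add Phi_sn II_SF[OF f] X \<mu> vf_SF[OF AA_VF[OF X]])+
qed

lemma sn_lie: "f \<in> II \<Longrightarrow> \<eta> \<in> BB \<Longrightarrow> \<omega> \<in> BF r \<Longrightarrow> lie_form atl \<eta> (fmul f \<omega>) = fmul f (lie_form atl \<eta> \<omega>)"
  using lie_form_fmul[OF II_SF BB_VF BF_forms, of f \<eta> \<omega> r] by (simp add: II_def fmul_zero_left)

lemma fmul_scale: "fmul f (c *\<^sub>R X) = c *\<^sub>R fmul f X"
  by (simp add: fmul_def fun_eq_iff fun_apply)

text \<open>The fields in \<B> annihilate f, so no derivative of f appears and multiplication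
  descends to classes.\<close>

lemma sn_dH:
  assumes f: "f \<in> II" and \<nu>: "\<nu> \<in> PH r s"
  shows "sn f (dH atl S s \<nu>) = dH atl S s (sn f \<nu>)"
proof (rule Phi_eqI[OF Phi_sn[OF dH_Phi[OF \<nu>] II_SF[OF f]] dH_Phi[OF Phi_sn[OF \<nu> II_SF[OF f]]]])
  fix \<eta>s assume \<eta>s: "\<eta>s \<in> tuples BB (Suc s)"
  have l: "lie_form atl (\<eta>s ! i) (fmul f (\<nu> (del i \<eta>s))) = fmul f (lie_form atl (\<eta>s ! i) (\<nu> (del i \<eta>s)))" if "i < Suc s" for i
    by (rule sn_lie[OF f tuples_nth[OF \<eta>s that] Phi_BF[OF \<nu>]])
  show "sn f (dH atl S s \<nu>) \<eta>s = dH atl S s (sn f \<nu>) \<eta>s"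
    unfolding sn_def[of f "dH atl S s \<nu>"] dH_eq[OF \<eta>s] ced_def tuples_length[OF \<eta>s] hor.sn_add hor.sn_sum fmul_scale
    by (intro arg_cong2[where f = "(+)"] sum.cong refl) (simp_all add: sn_def l)
qed

lemma sn_IM: assumes "f \<in> II" "\<mu> \<in> IM r" shows "sn f \<mu> \<in> IM r"
proof (cases p)
  case 0
  have "sn f (0 :: 'm hform) = 0" by (simp add: sn_def fmul_def fun_eq_iff fun_apply)
  then show ?thesis using assms 0 by (simp add: dH_image_def)
next
  case (Suc s)
  then obtain \<nu> where "\<mu> = dH atl S s \<nu>" "\<nu> \<in> PH r s" using assms(2) by (auto simp: dH_image_def)
  then show ?thesis using sn_dH[OF assms(1), of \<nu> r s] Phi_sn[of \<nu> r s f] II_SF[OF assms(1)] Suc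
    by (simp add: dH_image_def)
qed

section \<open>Elements of \<open>Phi\<close> with prescribed values on the frame\<close>

lemma tensor_Phi:
  assumes \<nu>: "\<nu> \<in> PH 0 s" and \<omega>: "\<omega> \<in> BF r"
  shows "(\<lambda>\<eta>s. fmul (\<nu> \<eta>s []) \<omega>) \<in> PH r s"
proof -
  have SFv: "\<nu> \<eta>s [] \<in> SF" for \<eta>s by (rule forms_SF[OF BF_forms[OF Phi_BF[OF \<nu>]]])
  have z: "fmul (0 \<eta>s) \<omega> = 0" for \<eta>s :: "'m vf list"
    by (simp add: zero_fun_apply[of Xs for Xs :: "'m vf list"] fmul_zero_left)
  have m: "fmul (f * g) \<omega> = fmul f (fmul g \<omega>)" for f g by (simp add: fmul_def fun_eq_iff fun_apply)
  have "hor.alt r s (\<lambda>\<eta>s. fmul (\<nu> \<eta>s []) \<omega>)"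
    using PhiD(2)[OF \<nu>] BF_fmul[OF \<omega> SFv] unfolding alt_form_def additive_form_def
    by (auto simp: plus_fun_apply[of _ _ "[] :: 'm vf list"] fmul_add_left z)
  moreover have "hor.hom_form s (\<lambda>\<eta>s. fmul (\<nu> \<eta>s []) \<omega>)"
    using PhiD(3)[OF \<nu>] unfolding hor.hom_form_def by (auto simp: fmul_apply m)
  moreover have "fmul (\<nu> \<eta>s []) \<omega> = 0" if "\<eta>s \<notin> tuples BB s" for \<eta>s
    using PhiD(1)[OF \<nu> that] z by simp
  ultimately show ?thesis by (simp add: Phi_iff)
qed

text \<open>The sum of the tensors of the dual products with the given coefficients. The family need
  not be alternating in its indices; the construction antisymmetrises it.\<close>

lemma Phi_of_family:
  assumes \<nu>: "\<And>I. I \<in> tuples {..<n} r \<Longrightarrow> \<nu> I \<in> PH 0 s"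
  obtains \<Omega> where "\<Omega> \<in> PH r s"
    "\<And>J. J \<in> tuples {..<n} r \<Longrightarrow> ev (map XX J) \<Omega> = (\<Sum>\<sigma> | \<sigma> permutes {..<r}. of_int (sign \<sigma>) *\<^sub>R \<nu> (permute_args \<sigma> J))"
proof -
  let ?T = "tuples {..<n} r"
  let ?\<Omega> = "\<Sum>I\<in>?T. (\<lambda>\<eta>s. fmul (\<nu> I \<eta>s []) (wedge atl (map wf I)))"
  show thesis
  proof (rule that)
    show "?\<Omega> \<in> PH r s"
      by (intro Phi_sum tensor_Phi \<nu> wedge_wf_BF tuples_map[of _ "{..<n}"] wf_Csec) auto
    fix J assume J: "J \<in> ?T"
    show "ev (map XX J) ?\<Omega> = (\<Sum>\<sigma> | \<sigma> permutes {..<r}. of_int (sign \<sigma>) *\<^sub>R \<nu> (permute_args \<sigma> J))"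
    proof
      fix \<eta>s
      have b: "zform (\<nu> (permute_args \<sigma> J) \<eta>s []) = \<nu> (permute_args \<sigma> J) \<eta>s" if "\<sigma> permutes {..<r}" for \<sigma>
        by (rule BF_zform[OF Phi_BF[OF \<nu>[OF permute_args_tuples[OF J that]]]])
      have "?\<Omega> \<eta>s (map XX J) = (\<Sum>\<sigma> | \<sigma> permutes {..<r}. of_int (sign \<sigma>) *\<^sub>R \<nu> (permute_args \<sigma> J) \<eta>s [])"
      proof
        fix x
        have "?\<Omega> \<eta>s (map XX J) x = (\<Sum>I\<in>?T. wedge atl (map wf I) (map XX J) x *\<^sub>R \<nu> I \<eta>s [] x)"
          by (simp add: fun_apply fmul_apply mult.commute)
        also have "\<dots> = (\<Sum>\<sigma> | \<sigma> permutes {..<r}. of_int (sign \<sigma>) *\<^sub>R \<nu> (permute_args \<sigma> J) \<eta>s [] x)"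
          by (rule wedge_XX_sum[OF J])
        finally show "?\<Omega> \<eta>s (map XX J) x = (\<Sum>\<sigma> | \<sigma> permutes {..<r}. of_int (sign \<sigma>) *\<^sub>R \<nu> (permute_args \<sigma> J) \<eta>s []) x"
          by (simp add: fun_apply)
      qed
      then have "ev (map XX J) ?\<Omega> \<eta>s = (\<Sum>\<sigma> | \<sigma> permutes {..<r}. of_int (sign \<sigma>) *\<^sub>R zform (\<nu> (permute_args \<sigma> J) \<eta>s []))"
        unfolding ev_def by (simp add: zform_sum zform_simps)
      also have "\<dots> = (\<Sum>\<sigma> | \<sigma> permutes {..<r}. of_int (sign \<sigma>) *\<^sub>R \<nu> (permute_args \<sigma> J) \<eta>s)"
        using b by (intro sum.cong refl) simp
      also have "\<dots> = (\<Sum>\<sigma> | \<sigma> permutes {..<r}. of_int (sign \<sigma>) *\<^sub>R \<nu> (permute_args \<sigma> J)) \<eta>s"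
        by (simp add: sum_fun_apply scaleR_fun_apply[of _ _ \<eta>s])
      finally show "ev (map XX J) ?\<Omega> \<eta>s = (\<Sum>\<sigma> | \<sigma> permutes {..<r}. of_int (sign \<sigma>) *\<^sub>R \<nu> (permute_args \<sigma> J)) \<eta>s" .
    qed
  qed
qed

text \<open>The coefficients are divided by r! so that antisymmetrising returns the alternating map
  itself. Its arguments \<open>z\<close> are left general: the frame fields serve for d_V, the basis
  of the Lie algebra for cochains.\<close>

lemma Phi_of_alternating_values:
  assumes c: "alt_form L (PH 0 s) r c" and L: "\<And>x y. x \<in> L \<Longrightarrow> y \<in> L \<Longrightarrow> x + y \<in> L"
    and z: "\<And>i. i < n \<Longrightarrow> z i \<in> L"
  obtains \<Omega> where "\<Omega> \<in> PH r s" "\<And>J. J \<in> tuples {..<n} r \<Longrightarrow> ev (map XX J) \<Omega> = c (map z J)"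
proof -
  have t: "map z J \<in> tuples L r" if "J \<in> tuples {..<n} r" for J by (rule tuples_map[OF that]) (use z in simp)
  have \<nu>: "inverse (fact r) *\<^sub>R c (map z I) \<in> PH 0 s" if "I \<in> tuples {..<n} r" for I
    by (intro Phi_scale additive_formD(1)[OF alt_form_additive[OF c]] t that)
  obtain \<Omega> where \<Omega>: "\<Omega> \<in> PH r s" "\<And>J. J \<in> tuples {..<n} r \<Longrightarrow> ev (map XX J) \<Omega> =
      (\<Sum>\<sigma> | \<sigma> permutes {..<r}. of_int (sign \<sigma>) *\<^sub>R (inverse (fact r) *\<^sub>R c (map z (permute_args \<sigma> J))))"
    by (rule Phi_of_family[of r "\<lambda>I. inverse (fact r) *\<^sub>R c (map z I)" s, OF \<nu>]) blast+
  show thesis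
    by (rule that[OF \<Omega>(1)]) (simp only: \<Omega>(2) signed_sum_alt[OF c L t])
qed

lemma XX_tuples: "J \<in> tuples {..<n} r \<Longrightarrow> map XX J \<in> tuples AA r"
  by (rule tuples_map[of _ "{..<n}"]) (simp_all add: act_AA)

lemma AA_tuples_VF: "Zs \<in> tuples AA r \<Longrightarrow> Zs \<in> tuples VF r"
  using AA_VF by (auto simp: tuples_def)

lemma Phi_eq_0_on_frame:
  assumes \<Omega>: "\<Omega> \<in> PH r s" and z: "\<And>J. J \<in> tuples {..<n} r \<Longrightarrow> ev (map XX J) \<Omega> = 0"
  shows "\<Omega> = 0"
proof -
  have "\<Omega> \<eta>s = 0" for \<eta>s
  proof (rule BF_eq_0_on_frame[OF Phi_BF[OF \<Omega>]])
    fix J assume J: "J \<in> tuples {..<n} r"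
    have "zform (\<Omega> \<eta>s (map XX J)) = 0"
      using fun_cong[OF z[OF J], of \<eta>s] by (simp add: ev_def zero_fun_apply[of \<eta>s])
    then show "\<Omega> \<eta>s (map XX J) = 0"
      using zform_simps(5)[of "\<Omega> \<eta>s (map XX J)"] by (simp add: zero_fun_apply[of "[] :: 'm vf list"])
  qed
  then show ?thesis by (simp add: fun_eq_iff zero_fun_apply)
qed

text \<open>This makes a class depend only on its frame values. Primitives of the frame values are
  chosen independently for each index tuple, hence without symmetry; antisymmetrised with weight
  1/r! they form one element whose d_H has the frame values of \<open>\<Omega>\<close>, which are
  already alternating.\<close>

lemma IM_of_frame_values:
  assumes \<Omega>: "\<Omega> \<in> PH r p" and z: "\<And>J. J \<in> tuples {..<n} r \<Longrightarrow> ev (map XX J) \<Omega> \<in> IM 0"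
  shows "\<Omega> \<in> IM r"
proof (cases p)
  case 0
  then have "\<Omega> = 0" using z by (intro Phi_eq_0_on_frame[OF \<Omega>]) (simp add: dH_image_def)
  then show ?thesis using 0 by (simp add: dH_image_def)
next
  case (Suc s)
  note \<Omega>s = \<Omega>[unfolded Suc]
  have "\<forall>J. \<exists>\<nu>. J \<in> tuples {..<n} r \<longrightarrow> \<nu> \<in> PH 0 s \<and> ev (map XX J) \<Omega> = dH atl S s \<nu>"
    using z Suc by (auto simp: dH_image_def image_iff)
  then obtain \<nu> where \<nu>: "\<forall>J. J \<in> tuples {..<n} r \<longrightarrow> \<nu> J \<in> PH 0 s \<and> ev (map XX J) \<Omega> = dH atl S s (\<nu> J)"
    using choice[of "\<lambda>J \<nu>. J \<in> tuples {..<n} r \<longrightarrow> \<nu> \<in> PH 0 s \<and> ev (map XX J) \<Omega> = dH atl S s \<nu>"] by blast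
  have \<nu>': "inverse (fact r) *\<^sub>R \<nu> J \<in> PH 0 s" if "J \<in> tuples {..<n} r" for J using \<nu> that by (intro Phi_scale) blast
  obtain \<Theta> where \<Theta>: "\<Theta> \<in> PH r s" "\<And>J. J \<in> tuples {..<n} r \<Longrightarrow> ev (map XX J) \<Theta> =
      (\<Sum>\<sigma> | \<sigma> permutes {..<r}. of_int (sign \<sigma>) *\<^sub>R (inverse (fact r) *\<^sub>R \<nu> (permute_args \<sigma> J)))"
    by (rule Phi_of_family[of r "\<lambda>I. inverse (fact r) *\<^sub>R \<nu> I" s, OF \<nu>']) blast+
  have dsum: "dH atl S s (\<Sum>i\<in>I. F i) = (\<Sum>i\<in>I. dH atl S s (F i)) \<and> (\<Sum>i\<in>I. F i) \<in> PH 0 s"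
    if "\<And>i. i \<in> I \<Longrightarrow> F i \<in> PH 0 s" for I :: "(nat \<Rightarrow> nat) set" and F
    using that
  proof (induction I rule: infinite_finite_induct)
    case (insert i I)
    then have h: "F i \<in> PH 0 s" "(\<Sum>i\<in>I. F i) \<in> PH 0 s" "dH atl S s (\<Sum>i\<in>I. F i) = (\<Sum>i\<in>I. dH atl S s (F i))" by auto
    show ?case unfolding sum.insert[OF insert.hyps] dH_add[OF h(1,2)] h(3) using Phi_add[OF h(1,2)] by simp
  qed (use dH_scale[OF Phi_zero[of 0 s], of 0] Phi_zero in simp_all)
  have "\<Omega> - dH atl S s \<Theta> = 0"
  proof (rule Phi_eq_0_on_frame[OF Phi_diff[OF \<Omega>s dH_Phi[OF \<Theta>(1)]]])
    fix J assume J: "J \<in> tuples {..<n} r"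
    let ?P = "{\<sigma>. \<sigma> permutes {..<r}}"
    have p: "permute_args \<sigma> J \<in> tuples {..<n} r" if "\<sigma> \<in> ?P" for \<sigma> using permute_args_tuples[OF J] that by simp
    have "ev (map XX J) (dH atl S s \<Theta>) = dH atl S s (ev (map XX J) \<Theta>)"
      by (rule ev_dH[OF \<Theta>(1) XX_tuples[OF J]])
    also have "\<dots> = (\<Sum>\<sigma>\<in>?P. dH atl S s (of_int (sign \<sigma>) *\<^sub>R (inverse (fact r) *\<^sub>R \<nu> (permute_args \<sigma> J))))"
      unfolding \<Theta>(2)[OF J]
      by (rule conjunct1[OF dsum]) (intro Phi_scale \<nu>' p)
    also have "\<dots> = (\<Sum>\<sigma>\<in>?P. of_int (sign \<sigma>) *\<^sub>R (inverse (fact r) *\<^sub>R ev (map XX (permute_args \<sigma> J)) \<Omega>))"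
    proof (rule sum.cong[OF refl])
      fix \<sigma> assume \<sigma>: "\<sigma> \<in> ?P"
      have v: "\<nu> (permute_args \<sigma> J) \<in> PH 0 s" "ev (map XX (permute_args \<sigma> J)) \<Omega> = dH atl S s (\<nu> (permute_args \<sigma> J))" using \<nu> p[OF \<sigma>] by blast+
      show "dH atl S s (of_int (sign \<sigma>) *\<^sub>R (inverse (fact r) *\<^sub>R \<nu> (permute_args \<sigma> J))) =
          of_int (sign \<sigma>) *\<^sub>R (inverse (fact r) *\<^sub>R ev (map XX (permute_args \<sigma> J)) \<Omega>)"
        unfolding v(2) dH_scale[OF Phi_scale[OF v(1)]] dH_scale[OF v(1)] ..
    qed
    also have "\<dots> = ev (map XX J) \<Omega>"
      by (rule signed_sum_alt[OF ev_alt(1)[OF \<Omega>] VF_add AA_tuples_VF[OF XX_tuples[OF J]]])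
    finally show "ev (map XX J) (\<Omega> - dH atl S s \<Theta>) = 0" by (simp add: ev_simps)
  qed
  then have "\<Omega> = dH atl S s \<Theta>" by simp
  then show ?thesis using \<Theta>(1) Suc by (simp add: dH_image_def)
qed

section \<open>The vertical differential on representatives\<close>

abbreviation "DD \<Omega> \<equiv> ver.d (\<lambda>Zs. ev Zs \<Omega>)"

lemma ev_ver:
  assumes \<Omega>: "\<Omega> \<in> PH r p"
  shows "ver.alt r (\<lambda>Zs. ev Zs \<Omega>)" "ver.hom_form r (\<lambda>Zs. ev Zs \<Omega>)"
proof -
  show "ver.alt r (\<lambda>Zs. ev Zs \<Omega>)" by (rule alt_form_subset[OF ev_alt(1)[OF \<Omega>]]) (use AA_VF in blast)
  show "ver.hom_form r (\<lambda>Zs. ev Zs \<Omega>)"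
    unfolding ver.hom_form_def using ev_alt(2)[OF \<Omega> AA_tuples_VF _ AA_VF II_SF] by blast
qed

lemma ver_d_IM:
  assumes c: "\<And>Zs. Zs \<in> tuples AA r \<Longrightarrow> c Zs \<in> IM 0" and Zs: "Zs \<in> tuples AA (Suc r)"
  shows "ver.d c Zs \<in> IM 0"
proof -
  note sub = IM_subspace[of 0]
  have 1: "lP (Zs ! i) (c (del i Zs)) \<in> IM 0" if "i < Suc r" for i
    by (intro lP_IM c tuples_nth[OF Zs that] tuples_del[OF Zs that])
  have 2: "c (vbr (Zs ! i) (Zs ! j) # del i (del j Zs)) \<in> IM 0" if ij: "i < j" "j < Suc r" for i j
  proof -
    obtain s where s: "r = Suc s" using ij by (cases r) auto
    have "del i (del j Zs) \<in> tuples AA s" using Zs ij s by (auto intro!: tuples_del)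
    then show ?thesis using tuples_nth[OF Zs] ij s by (intro c) (simp add: tuples_Cons AA_vbr)
  qed
  show ?thesis
    unfolding ced_def tuples_length[OF Zs]
    by (intro subspace_add[OF sub] subspace_sum[OF sub] subspace_scale[OF sub] 1 2) auto
qed

text \<open>After moving \<eta> to the front, Cartan's formula leaves only \<open>L_eta\<close>
  applied to a value of the form: the contraction with \<eta> and all brackets with \<eta> have an
  argument in \<B>. The remaining term is exact by \<open>lP_BB_exact\<close>.\<close>

lemma DD_BB:
  assumes \<Omega>: "\<Omega> \<in> PH r p" and Zs: "Zs \<in> tuples AA (Suc r)" and k: "k < Suc r" and \<eta>: "\<eta> \<in> BB"
  shows "DD \<Omega> (Zs[k := \<eta>]) \<in> IM 0"
proof -
  note sub = IM_subspace[of 0]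
  have \<eta>A: "\<eta> \<in> AA" using \<eta> BB_AA by blast
  let ?Y = "del k Zs"
  have Y: "?Y \<in> tuples AA r" by (rule tuples_del[OF Zs k])
  have z: "ev (\<eta> # us) \<Omega> = 0" if "\<eta> # us \<in> tuples AA r" for us
    by (rule ev_alt(3)[OF \<Omega> AA_tuples_VF[OF that] _ \<eta>]) simp
  have d0: "ver.d (\<lambda>us. ev (\<eta> # us) \<Omega>) ?Y = 0"
  proof (cases r)
    case 0
    then show ?thesis using Y by (simp add: tuples_0 ced_def)
  next
    case (Suc s)
    have "ver.d (\<lambda>us. ev (\<eta> # us) \<Omega>) ?Y = ver.d (\<lambda>us. 0) ?Y"
      by (rule ver.d_cong[OF _ Y[unfolded Suc]]) (use z Suc \<eta>A in \<open>simp add: tuples_Cons\<close>)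
    then show ?thesis using ver.d_zero[OF Y] by simp
  qed
  have l0: "ev (?Y[i := vbr \<eta> (?Y ! i)]) \<Omega> = 0" if i: "i < r" for i
  proof -
    have "vbr \<eta> (?Y ! i) = - vbr (?Y ! i) \<eta>"
      by (rule ext) (simp only: vbr_apply uminus_apply minus_diff_eq)
    then have b: "vbr \<eta> (?Y ! i) \<in> BB" using BB_diff[OF BB_zero AA_BB[OF tuples_nth[OF Y i] \<eta>]] by simp
    show ?thesis
      by (rule ev_alt(3)[OF \<Omega> AA_tuples_VF[OF tuples_update[OF Y]] _ b])
        (use b BB_AA i tuples_length[OF Y] in \<open>auto simp: set_update_memI\<close>)
  qed
  have "ver.lie \<eta> (\<lambda>Zs. ev Zs \<Omega>) ?Y = lP \<eta> (ev ?Y \<Omega>)"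
    unfolding cel_def by (simp add: l0 tuples_length[OF Y])
  then have "DD \<Omega> (\<eta> # ?Y) = lP \<eta> (ev ?Y \<Omega>)" using ver.d_Cons[OF ev_ver(1)[OF \<Omega>] \<eta>A Y] d0 by simp
  also have "\<dots> \<in> IM 0" by (rule lP_BB_exact[OF \<eta> ev_Phi[OF \<Omega>]])
  finally have "DD \<Omega> (\<eta> # ?Y) \<in> IM 0" .
  moreover have "DD \<Omega> (Zs[k := \<eta>]) = (-1) ^ k *\<^sub>R DD \<Omega> (\<eta> # ?Y)"
    by (rule alt_form_move[OF ver.d_alt[OF ev_ver(1)[OF \<Omega>]] AA_add Zs k \<eta>A])
  ultimately show ?thesis using subspace_scale[OF sub] by simp
qed

text \<open>Write \<xi> as the sum of its frame part and its horizontal part and bracket with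
  \<eta>. All terms lie in \<B> except possibly the sum of (eta f_i) X_i, so that sum does too;
  being in the orbit directions, it vanishes.\<close>

lemma frame_coefficient_II:
  assumes \<xi>: "\<xi> \<in> AA" and k: "k < n"
  shows "pair (om k) \<xi> \<in> II"
  unfolding II_def
proof (intro CollectI conjI ballI)
  note V = AA_VF[OF \<xi>]
  have F: "pair (om i) \<xi> \<in> SF" if "i < n" for i by (rule pair_vf(1)[OF om_smooth[OF that] V])
  show "pair (om k) \<xi> \<in> SF" by (rule F[OF k])
  fix \<eta> assume \<eta>: "\<eta> \<in> BB"
  note \<eta>V = BB_VF[OF \<eta>]
  have sw: "vbr \<eta> Z \<in> BB" if "Z \<in> AA" for Z
  proof -
    have "vbr \<eta> Z = - vbr Z \<eta>"
      by (rule ext) (simp only: vbr_apply uminus_apply minus_diff_eq)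
    then show ?thesis using BB_diff[OF BB_zero AA_BB[OF that \<eta>]] by simp
  qed
  let ?f = "\<lambda>i. pair (om i) \<xi>"
  let ?D = "\<Sum>i<n. fmul (\<eta> (?f i)) (XX i)"
  have vsum: "vbr \<eta> (\<Sum>i\<in>I. Z i) = (\<Sum>i\<in>I. vbr \<eta> (Z i))" if "\<And>i. i \<in> I \<Longrightarrow> Z i \<in> VF" for I :: "nat set" and Z
    using that
  proof (induction I rule: infinite_finite_induct)
    case (insert i I)
    then show ?case using vbr_add_right[OF \<eta>V, of "Z i" "\<Sum>i\<in>I. Z i"] VF_sum[of I Z] by simp
  qed (use vbr_add_right[OF \<eta>V VF_zero VF_zero] in simp_all)
  have "vbr \<eta> \<xi> = vbr \<eta> ((\<Sum>i<n. fmul (?f i) (XX i)) + horizontal_part \<xi>)" by (simp only: VF_split[symmetric])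
  also have "\<dots> = vbr \<eta> (\<Sum>i<n. fmul (?f i) (XX i)) + vbr \<eta> (horizontal_part \<xi>)"
    by (intro vbr_add_right \<eta>V VF_sum VF_fmul act_VF F BB_VF[OF horizontal_part_BB[OF V]]) simp
  also have "vbr \<eta> (\<Sum>i<n. fmul (?f i) (XX i)) = (\<Sum>i<n. vbr \<eta> (fmul (?f i) (XX i)))"
    by (intro vsum VF_fmul act_VF F) simp
  also have "\<dots> = (\<Sum>i<n. fmul (?f i) (vbr \<eta> (XX i)) + fmul (\<eta> (?f i)) (XX i))"
    by (intro sum.cong refl vbr_fmul \<eta>V act_VF F) simp
  finally have D: "?D = vbr \<eta> \<xi> - vbr \<eta> (horizontal_part \<xi>) - (\<Sum>i<n. fmul (?f i) (vbr \<eta> (XX i)))"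
    by (simp add: sum.distrib)
  have "(\<Sum>i\<in>I. fmul (?f i) (vbr \<eta> (XX i))) \<in> BB" if "I \<subseteq> {..<n}" for I
    using that
  proof (induction I rule: infinite_finite_induct)
    case (insert i I)
    then show ?case using BB_add[OF BB_fmul[OF F sw[OF act_AA]], of i] by simp
  qed (simp_all add: BB_zero)
  then have DB: "?D \<in> BB"
    unfolding D by (intro BB_diff sw \<xi>) (use horizontal_part_BB[OF V] BB_AA in auto)
  show "\<eta> (?f k) = 0"
  proof
    fix x
    have "vf_at ?D x = (\<Sum>i<n. \<eta> (?f i) x *\<^sub>R xx i x)" by (simp add: vf_at_sum vf_at_simps)
    moreover have "vf_at ?D x \<in> annih atl S x" using DB by (simp add: BB_iff)
    ultimately have "(\<Sum>i<n. \<eta> (?f i) x *\<^sub>R xx i x) = 0"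
      by (intro annih_orbit) (auto simp: orbit_expand)
    then show "\<eta> (?f k) x = 0 x" using orbit_independent k by (simp add: zero_fun_apply)
  qed
qed

text \<open>The new form is made to agree exactly with \<open>DD\<close> on the frame. For other
  automorphisms the agreement is modulo d_H, obtained slot by slot.\<close>

lemma dV_representative:
  assumes \<Omega>: "\<Omega> \<in> PH r p"
  obtains \<Omega>' where "\<Omega>' \<in> PH (Suc r) p" "\<And>Zs. Zs \<in> tuples AA (Suc r) \<Longrightarrow> ev Zs \<Omega>' - DD \<Omega> Zs \<in> IM 0"
proof -
  note sub = IM_subspace[of 0]
  have Da: "ver.alt (Suc r) (DD \<Omega>)" and Dh: "ver.hom_form (Suc r) (DD \<Omega>)"
    using ver.d_alt ver.d_hom ev_ver[OF \<Omega>] by blast+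
  obtain \<Omega>' where \<Omega>': "\<Omega>' \<in> PH (Suc r) p"
    and eq: "\<And>J. J \<in> tuples {..<n} (Suc r) \<Longrightarrow> ev (map XX J) \<Omega>' = DD \<Omega> (map XX J)"
    by (rule Phi_of_alternating_values[OF Da AA_add, of XX]) (use act_AA in blast)+
  note Ea = ev_ver(1)[OF \<Omega>'] and Eh = ev_ver(2)[OF \<Omega>']
  show thesis
  proof (rule that[OF \<Omega>'])
    fix Zs assume Zs: "Zs \<in> tuples AA (Suc r)"
    show "ev Zs \<Omega>' - DD \<Omega> Zs \<in> IM 0"
    proof (rule tuples_slotwise[where P = "\<lambda>Zs. ev Zs \<Omega>' - DD \<Omega> Zs \<in> IM 0" and G = "XX ` {..<n}" and L = AA, OF _ _ _ Zs])
      fix Zs assume "Zs \<in> tuples (XX ` {..<n}) (Suc r)"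
      then have l: "set Zs \<subseteq> XX ` {..<n}" "length Zs = Suc r" by (auto simp: tuples_def)
      then have "Zs \<in> map XX ` lists {..<n}" unfolding lists_image[symmetric] by auto
      then obtain J where "Zs = map XX J" "J \<in> lists {..<n}" by (rule imageE)
      then have "ev Zs \<Omega>' = DD \<Omega> Zs" using eq[of J] l(2) by (auto simp: tuples_def)
      then show "ev Zs \<Omega>' - DD \<Omega> Zs \<in> IM 0" using subspace_0[OF sub] by simp
    next
      fix Zs i \<xi> assume Zs: "Zs \<in> tuples AA (Suc r)" and i: "i < Suc r" and \<xi>: "\<xi> \<in> AA"
        and h: "\<And>g. g \<in> XX ` {..<n} \<Longrightarrow> ev (Zs[i := g]) \<Omega>' - DD \<Omega> (Zs[i := g]) \<in> IM 0"
      let ?s = "\<Sum>k<n. fmul (pair (om k) \<xi>) (XX k)"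
      have b: "horizontal_part \<xi> \<in> BB" by (rule horizontal_part_BB[OF AA_VF[OF \<xi>]])
      then have bA: "horizontal_part \<xi> \<in> AA" using BB_AA by blast
      have s1: "?s \<in> AA \<and> ev (Zs[i := ?s]) \<Omega>' = (\<Sum>k<n. sn (pair (om k) \<xi>) (ev (Zs[i := XX k]) \<Omega>'))"
        by (rule ver.alt_hom_sum[OF Ea Eh Zs i]) (use frame_coefficient_II[OF \<xi>] act_AA in auto)
      have s2: "?s \<in> AA \<and> DD \<Omega> (Zs[i := ?s]) = (\<Sum>k<n. sn (pair (om k) \<xi>) (DD \<Omega> (Zs[i := XX k])))"
        by (rule ver.alt_hom_sum[OF Da Dh Zs i]) (use frame_coefficient_II[OF \<xi>] act_AA in auto)
      \<comment> \<open>Multiplication preserves exactness only for first integrals; this is where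
        the coefficients have to be such.\<close>
      have "sn (pair (om k) \<xi>) (ev (Zs[i := XX k]) \<Omega>') - sn (pair (om k) \<xi>) (DD \<Omega> (Zs[i := XX k])) \<in> IM 0" if "k < n" for k
        unfolding ver.sn_diff[symmetric] by (rule sn_IM[OF frame_coefficient_II[OF \<xi> that] h]) (use that in simp)
      then have "ev (Zs[i := ?s]) \<Omega>' - DD \<Omega> (Zs[i := ?s]) \<in> IM 0"
        using s1 s2 by (auto simp: sum_subtractf[symmetric] intro!: subspace_sum[OF sub])
      moreover have "ev (Zs[i := horizontal_part \<xi>]) \<Omega>' = 0"
        by (rule ev_alt(3)[OF \<Omega>' AA_tuples_VF[OF tuples_update[OF Zs bA]] _ b])
          (use i tuples_length[OF Zs] in \<open>simp add: set_update_memI\<close>)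
      moreover have "DD \<Omega> (Zs[i := horizontal_part \<xi>]) \<in> IM 0" by (rule DD_BB[OF \<Omega> Zs i b])
      moreover have "ev (Zs[i := ?s + horizontal_part \<xi>]) \<Omega>' = ev (Zs[i := ?s]) \<Omega>' + ev (Zs[i := horizontal_part \<xi>]) \<Omega>'"
        using ver.alt_D(2)[OF Ea Zs i _ bA] s1 by blast
      moreover have "DD \<Omega> (Zs[i := ?s + horizontal_part \<xi>]) = DD \<Omega> (Zs[i := ?s]) + DD \<Omega> (Zs[i := horizontal_part \<xi>])"
        using ver.alt_D(2)[OF Da Zs i _ bA] s1 by blast
      ultimately have "ev (Zs[i := ?s + horizontal_part \<xi>]) \<Omega>' - DD \<Omega> (Zs[i := ?s + horizontal_part \<xi>]) \<in> IM 0"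
        using subspace_diff[OF sub, of "ev (Zs[i := ?s]) \<Omega>' - DD \<Omega> (Zs[i := ?s])" "DD \<Omega> (Zs[i := horizontal_part \<xi>])"]
        by (simp add: algebra_simps)
      then show "ev (Zs[i := \<xi>]) \<Omega>' - DD \<Omega> (Zs[i := \<xi>]) \<in> IM 0" unfolding VF_split[of \<xi>, symmetric] .
    qed (use act_AA in blast)
  qed
qed

section \<open>Classes modulo horizontal coboundaries\<close>

abbreviation "Q \<equiv> qmap atl S p"
abbreviation "xad \<equiv> xadd atl S p"
abbreviation "xsc \<equiv> xscale atl S p"
abbreviation "AUT \<equiv> auts atl S"

lemma qrel_equiv: "equiv (PH r p) (qrel atl S p r)"
proof (rule equivI)
  show "qrel atl S p r \<subseteq> PH r p \<times> PH r p" by (auto simp: qrel_def)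
  show "refl_on (PH r p) (qrel atl S p r)"
    using subspace_0[OF IM_subspace] by (auto simp: refl_on_def qrel_def)
  show "sym (qrel atl S p r)"
  proof (rule symI)
    show "(b, a) \<in> qrel atl S p r" if "(a, b) \<in> qrel atl S p r" for a b
      using that subspace_neg[OF IM_subspace, of "b - a" r] by (simp add: qrel_def)
  qed
  show "trans (qrel atl S p r)"
  proof (rule transI)
    show "(a, c) \<in> qrel atl S p r" if "(a, b) \<in> qrel atl S p r" "(b, c) \<in> qrel atl S p r" for a b c
      using that subspace_add[OF IM_subspace, of "c - b" r "b - a"] by (simp add: qrel_def)
  qed
qed

lemma Q_eq: "\<Omega> \<in> PH r p \<Longrightarrow> \<Omega>' \<in> PH r p \<Longrightarrow> Q r \<Omega> = Q r \<Omega>' \<longleftrightarrow> \<Omega>' - \<Omega> \<in> IM r"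
  unfolding qmap_def using eq_equiv_class_iff[OF qrel_equiv, of \<Omega> r \<Omega>'] by (simp add: qrel_def)

lemma Q_self: "\<Omega> \<in> PH r p \<Longrightarrow> \<Omega> \<in> Q r \<Omega>"
  using subspace_0[OF IM_subspace] by (simp add: qmap_def qrel_def)

lemma Q_mem: "\<Omega>' \<in> Q r \<Omega> \<Longrightarrow> \<Omega> \<in> PH r p \<and> \<Omega>' \<in> PH r p \<and> \<Omega>' - \<Omega> \<in> IM r"
  by (simp add: qmap_def qrel_def)

lemma Xi_Q: "Xi atl S p r = Q r ` PH r p"
  by (auto simp: Xi_def quotient_def qmap_def)

lemma Q_Xi: "\<Omega> \<in> PH r p \<Longrightarrow> Q r \<Omega> \<in> Xi atl S p r"
  by (simp add: Xi_Q)

lemma Q_lift: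
  assumes "\<Omega> \<in> PH r p" "\<And>\<Omega>'. \<Omega>' \<in> PH r p \<Longrightarrow> \<Omega>' - \<Omega> \<in> IM r \<Longrightarrow> f \<Omega>' = f \<Omega>"
  shows "(\<Union>\<Omega>'\<in>Q r \<Omega>. f \<Omega>') = f \<Omega>"
proof (rule UN_equal)
  show "Q r \<Omega> \<noteq> {}" using Q_self[OF assms(1)] by blast
  show "f \<Omega>' = f \<Omega>" if "\<Omega>' \<in> Q r \<Omega>" for \<Omega>' using assms(2) Q_mem[OF that] by simp
qed

lemma xadd_Q:
  assumes "\<mu> \<in> PH 0 p" "\<nu> \<in> PH 0 p"
  shows "xad (Q 0 \<mu>) (Q 0 \<nu>) = Q 0 (\<mu> + \<nu>)"
proof -
  have "(\<Union>\<nu>'\<in>Q 0 \<nu>. Q 0 (\<mu>' + \<nu>')) = Q 0 (\<mu>' + \<nu>)" if "\<mu>' \<in> PH 0 p" for \<mu>'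
  proof (rule Q_lift[OF assms(2)])
    fix \<nu>' assume "\<nu>' \<in> PH 0 p" "\<nu>' - \<nu> \<in> IM 0"
    then show "Q 0 (\<mu>' + \<nu>') = Q 0 (\<mu>' + \<nu>)"
      by (subst eq_commute) (simp add: Q_eq Phi_add that assms)
  qed
  then have "xad (Q 0 \<mu>) (Q 0 \<nu>) = (\<Union>\<mu>'\<in>Q 0 \<mu>. Q 0 (\<mu>' + \<nu>))"
    unfolding xadd_def using Q_mem by (intro SUP_cong refl) simp
  also have "\<dots> = Q 0 (\<mu> + \<nu>)"
  proof (rule Q_lift[OF assms(1)])
    fix \<mu>' assume "\<mu>' \<in> PH 0 p" "\<mu>' - \<mu> \<in> IM 0"
    then show "Q 0 (\<mu>' + \<nu>) = Q 0 (\<mu> + \<nu>)"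
      by (subst eq_commute) (simp add: Q_eq Phi_add assms)
  qed
  finally show ?thesis .
qed

lemma xscale_Q:
  assumes "\<mu> \<in> PH 0 p"
  shows "xsc c (Q 0 \<mu>) = Q 0 (c *\<^sub>R \<mu>)"
  unfolding xscale_def
proof (rule Q_lift[OF assms])
  fix \<mu>' assume "\<mu>' \<in> PH 0 p" "\<mu>' - \<mu> \<in> IM 0"
  then show "Q 0 (c *\<^sub>R \<mu>') = Q 0 (c *\<^sub>R \<mu>)"
    using subspace_scale[OF IM_subspace, of "\<mu>' - \<mu>" 0 c]
    by (subst eq_commute) (simp add: Q_eq Phi_scale assms scaleR_diff_right)
qed

lemma xsum_Q:
  assumes "\<And>x. x \<in> set xs \<Longrightarrow> f x \<in> PH 0 p"
  shows "(\<Sum>x\<leftarrow>xs. f x) \<in> PH 0 p \<and> xsum atl S p (map (\<lambda>x. Q 0 (f x)) xs) = Q 0 (\<Sum>x\<leftarrow>xs. f x)"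
  using assms by (induction xs) (auto simp: xsum_def xzero_def Phi_zero Phi_add xadd_Q)

lemma rho_Q:
  assumes "\<mu> \<in> PH 0 p"
  shows "rho atl S p act v (Q 0 \<mu>) = Q 0 (lP (act v) \<mu>)"
  unfolding rho_def
proof (rule Q_lift[OF assms])
  fix \<mu>' assume \<mu>': "\<mu>' \<in> PH 0 p" "\<mu>' - \<mu> \<in> IM 0"
  then have "lP (act v) \<mu>' - lP (act v) \<mu> \<in> IM 0"
    using lP_IM[OF act_AA \<mu>'(2)] ver.th_diff[OF act_AA \<mu>'(1) assms] by simp
  then show "Q 0 (lP (act v) \<mu>') = Q 0 (lP (act v) \<mu>)"
    using lP_Phi[OF act_AA] \<mu>' assms by (subst eq_commute) (simp add: Q_eq)
qed

text \<open>The arguments are exchanged one at a time from the left, each exchange changing the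
  value by a term with an argument in \<B>. Hence evaluation is defined on classes of
  automorphisms.\<close>

lemma ev_mod_BB:
  assumes \<Omega>: "\<Omega> \<in> PH r p" and Zs: "Zs \<in> tuples AA r" and Ys: "Ys \<in> tuples AA r"
    and d: "\<And>i. i < r \<Longrightarrow> Ys ! i - Zs ! i \<in> BB"
  shows "ev Ys \<Omega> = ev Zs \<Omega>"
proof -
  note l = tuples_length[OF Zs] tuples_length[OF Ys]
  have W: "take k Ys @ drop k Zs \<in> tuples AA r" if "k \<le> r" for k
    using Zs Ys that by (auto simp: tuples_def dest: in_set_takeD in_set_dropD)
  have "k \<le> r \<Longrightarrow> ev (take k Ys @ drop k Zs) \<Omega> = ev Zs \<Omega>" for k
  proof (induction k)
    case (Suc k)
    let ?W = "take k Ys @ drop k Zs" and ?b = "Ys ! k - Zs ! k"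
    have k: "k < r" using Suc by simp
    have bA: "?b \<in> AA" using d[OF k] BB_AA by blast
    have W1: "take (Suc k) Ys @ drop (Suc k) Zs = ?W[k := Zs ! k + ?b]"
      using k l by (simp add: take_Suc_conv_app_nth list_update_append Cons_nth_drop_Suc[symmetric])
    have W0: "?W[k := Zs ! k] = ?W"
      using k l by (simp add: list_update_append Cons_nth_drop_Suc[symmetric])
    have Wk: "?W \<in> tuples AA r" using W[of k] k by simp
    have "ev (?W[k := Zs ! k + ?b]) \<Omega> = ev (?W[k := Zs ! k]) \<Omega> + ev (?W[k := ?b]) \<Omega>"
      by (rule ver.alt_D(2)[OF ev_ver(1)[OF \<Omega>] Wk k tuples_nth[OF Zs k] bA])
    moreover have "ev (?W[k := ?b]) \<Omega> = 0"
      by (rule ev_alt(3)[OF \<Omega> AA_tuples_VF[OF tuples_update[OF Wk bA]] _ d[OF k]])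
        (use k tuples_length[OF Wk] in \<open>auto intro: set_update_memI\<close>)
    ultimately show ?case using Suc W0 W1 by simp
  qed simp
  from this[of r] show ?thesis using l by simp
qed

lemma AUT_tuples: "Zs \<in> tuples AUT r \<Longrightarrow> Zs \<in> tuples AA r"
  using auts_AA by (auto simp: tuples_def)

text \<open>Both unions in \<open>bform\<close> run over equal sets: changing the automorphisms by
  \<B> leaves the value unchanged, and changing the form by d_H changes it by d_H.\<close>

lemma bform_Q:
  assumes \<Omega>: "\<Omega> \<in> PH r p" and Zs: "Zs \<in> tuples AUT r"
  shows "bform atl S p (Q r \<Omega>) (map (cls atl S) Zs) = Q 0 (ev Zs \<Omega>)"
proof -
  let ?cs = "map (cls atl S) Zs"
  have ZA: "Zs \<in> tuples AA r" by (rule AUT_tuples[OF Zs])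
  have A: "Zs ! i \<in> AUT" if "i < r" for i by (rule tuples_nth[OF Zs that])
  have in_cs: "Ys \<in> tuples AA r \<and> (\<forall>i<r. Ys ! i - Zs ! i \<in> BB)" if "Ys \<in> listset ?cs" for Ys
  proof -
    have l: "length Ys = r" and c: "\<forall>i<r. Ys ! i \<in> cls atl S (Zs ! i)"
      using that tuples_length[OF Zs] by (auto simp: listset_iff)
    have "Ys ! i \<in> AUT \<and> Ys ! i - Zs ! i \<in> BB" if "i < r" for i using c that by (auto simp: cls_def)
    then show ?thesis using l auts_AA by (auto simp: tuples_def in_set_conv_nth)
  qed
  have Z: "Zs \<in> listset ?cs"
    using A tuples_length[OF Zs] by (simp add: listset_iff cls_def BB_zero)
  have "(\<Union>Ys\<in>listset ?cs. Q 0 (ev Ys \<Omega>')) = Q 0 (ev Zs \<Omega>')" if "\<Omega>' \<in> PH r p" for \<Omega>'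
  proof (rule UN_equal)
    show "Q 0 (ev Ys \<Omega>') = Q 0 (ev Zs \<Omega>')" if "Ys \<in> listset ?cs" for Ys
      using ev_mod_BB[OF \<open>\<Omega>' \<in> PH r p\<close> ZA] in_cs[OF that] by simp
  qed (use Z in blast)
  then have "bform atl S p (Q r \<Omega>) ?cs = (\<Union>\<Omega>'\<in>Q r \<Omega>. Q 0 (ev Zs \<Omega>'))"
    unfolding bform_def using Q_mem by (intro SUP_cong refl) simp
  also have "\<dots> = Q 0 (ev Zs \<Omega>)"
  proof (rule Q_lift[OF \<Omega>])
    fix \<Omega>' assume \<Omega>': "\<Omega>' \<in> PH r p" "\<Omega>' - \<Omega> \<in> IM r"
    then have "ev Zs \<Omega>' - ev Zs \<Omega> \<in> IM 0" using ev_IM[OF \<Omega>'(2) ZA] by (simp add: ev_simps)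
    then show "Q 0 (ev Zs \<Omega>') = Q 0 (ev Zs \<Omega>)"
      by (subst eq_commute) (simp add: Q_eq ev_Phi[OF \<Omega>'(1)] ev_Phi[OF \<Omega>])
  qed
  finally show ?thesis .
qed

lemma DD_Phi: "\<Omega> \<in> PH r p \<Longrightarrow> Zs \<in> tuples AA (Suc r) \<Longrightarrow> DD \<Omega> Zs \<in> PH 0 p"
  by (rule ver.alt_D(1)[OF ver.d_alt[OF ev_ver(1)]])

lemma dV_val_Q:
  assumes \<Omega>: "\<Omega> \<in> PH r p" and Zs: "Zs \<in> tuples AA (Suc r)"
  shows "dV_val atl S p \<Omega> Zs = Q 0 (DD \<Omega> Zs)"
  unfolding dV_val_def ced_def
  by (intro xadd_Q Phi_sum Phi_scale lP_Phi ev_Phi[OF \<Omega>] tuples_nth[OF Zs]) (simp add: tuples_length[OF Zs])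

lemma DD_mod_IM:
  assumes \<Omega>: "\<Omega> \<in> PH r p" "\<Omega>' \<in> PH r p" "\<Omega>' - \<Omega> \<in> IM r" and Zs: "Zs \<in> tuples AA (Suc r)"
  shows "DD \<Omega>' Zs - DD \<Omega> Zs \<in> IM 0"
proof -
  have d: "\<Omega>' - \<Omega> \<in> PH r p" by (rule Phi_diff[OF \<Omega>(2,1)])
  have "DD ((\<Omega>' - \<Omega>) + \<Omega>) Zs = DD (\<Omega>' - \<Omega>) Zs + DD \<Omega> Zs"
    unfolding ev_simps(1) by (rule ver.d_add[OF ver.alt_D(1)[OF ev_ver(1)[OF d]] ver.alt_D(1)[OF ev_ver(1)[OF \<Omega>(1)]] Zs])
  moreover have "DD (\<Omega>' - \<Omega>) Zs \<in> IM 0" by (rule ver_d_IM[OF ev_IM[OF \<Omega>(3)] Zs])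
  ultimately show ?thesis by simp
qed

lemma XX_AUT: "J \<in> tuples {..<n} r \<Longrightarrow> map XX J \<in> tuples AUT r"
  by (rule tuples_map[of _ "{..<n}"]) (simp_all add: aut)

text \<open>Justifies the description \<open>THE\<close> in \<open>dV\<close>:
  \<open>dV_representative\<close> gives existence, and uniqueness follows by testing on the frame
  fields, which are automorphisms.\<close>

lemma dV_Q:
  assumes \<Omega>: "\<Omega> \<in> PH r p"
  obtains \<Omega>' where "\<Omega>' \<in> PH (Suc r) p" "dV atl S p r (Q r \<Omega>) = Q (Suc r) \<Omega>'"
    "\<And>Zs. Zs \<in> tuples AA (Suc r) \<Longrightarrow> Q 0 (ev Zs \<Omega>') = Q 0 (DD \<Omega> Zs)"
proof -
  obtain \<Omega>' where \<Omega>': "\<Omega>' \<in> PH (Suc r) p"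
    and eq: "\<And>Zs. Zs \<in> tuples AA (Suc r) \<Longrightarrow> ev Zs \<Omega>' - DD \<Omega> Zs \<in> IM 0"
    by (rule dV_representative[OF \<Omega>]) (rule that, assumption, blast)
  have Qe: "Q 0 (ev Zs \<Omega>') = Q 0 (DD \<Omega> Zs)" if Zs: "Zs \<in> tuples AA (Suc r)" for Zs
    by (subst eq_commute) (simp add: Q_eq[OF DD_Phi[OF \<Omega> Zs] ev_Phi[OF \<Omega>']] eq[OF Zs])
  have "dV atl S p r (Q r \<Omega>) = Q (Suc r) \<Omega>'"
    unfolding dV_def
  proof (rule the_equality)
    show "Q (Suc r) \<Omega>' \<in> Xi atl S p (Suc r) \<and> (\<forall>\<Theta>\<in>Q r \<Omega>. \<forall>Zs\<in>tuples AUT (Suc r).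
        bform atl S p (Q (Suc r) \<Omega>') (map (cls atl S) Zs) = dV_val atl S p \<Theta> Zs)"
    proof (intro conjI ballI Q_Xi[OF \<Omega>'])
      fix \<Theta> Zs assume \<Theta>: "\<Theta> \<in> Q r \<Omega>" and Zs: "Zs \<in> tuples AUT (Suc r)"
      note ZA = AUT_tuples[OF Zs]
      have \<Theta>P: "\<Theta> \<in> PH r p" and m: "\<Theta> - \<Omega> \<in> IM r" using Q_mem[OF \<Theta>] by simp_all
      have "Q 0 (DD \<Omega> Zs) = Q 0 (DD \<Theta> Zs)"
        by (simp add: Q_eq[OF DD_Phi[OF \<Omega> ZA] DD_Phi[OF \<Theta>P ZA]] DD_mod_IM[OF \<Omega> \<Theta>P m ZA])
      then show "bform atl S p (Q (Suc r) \<Omega>') (map (cls atl S) Zs) = dV_val atl S p \<Theta> Zs"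
        unfolding bform_Q[OF \<Omega>' Zs] dV_val_Q[OF \<Theta>P ZA] Qe[OF ZA] .
    qed
    fix \<tau> assume \<tau>: "\<tau> \<in> Xi atl S p (Suc r) \<and> (\<forall>\<Theta>\<in>Q r \<Omega>. \<forall>Zs\<in>tuples AUT (Suc r).
        bform atl S p \<tau> (map (cls atl S) Zs) = dV_val atl S p \<Theta> Zs)"
    then obtain \<Theta> where \<Theta>: "\<Theta> \<in> PH (Suc r) p" "\<tau> = Q (Suc r) \<Theta>" unfolding Xi_Q by blast
    \<comment> \<open>Two solutions have the same frame values modulo d_H and therefore the same
      class.\<close>
    have "\<Omega>' - \<Theta> \<in> IM (Suc r)"
    proof (rule IM_of_frame_values[OF Phi_diff[OF \<Omega>' \<Theta>(1)]])
      fix J assume J: "J \<in> tuples {..<n} (Suc r)"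
      note A = XX_AUT[OF J] and AX = XX_tuples[OF J]
      have "Q 0 (ev (map XX J) \<Theta>) = bform atl S p \<tau> (map (cls atl S) (map XX J))"
        unfolding \<Theta>(2) by (rule bform_Q[OF \<Theta>(1) A, symmetric])
      also have "\<dots> = dV_val atl S p \<Omega> (map XX J)" using \<tau> Q_self[OF \<Omega>] A by blast
      also have "\<dots> = Q 0 (ev (map XX J) \<Omega>')" unfolding dV_val_Q[OF \<Omega> AX] Qe[OF AX] ..
      finally show "ev (map XX J) (\<Omega>' - \<Theta>) \<in> IM 0"
        by (simp add: Q_eq[OF ev_Phi[OF \<Theta>(1)] ev_Phi[OF \<Omega>']] ev_simps)
    qed
    then show "\<tau> = Q (Suc r) \<Omega>'" unfolding \<Theta>(2) using Q_eq[OF \<Theta>(1) \<Omega>'] by simp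
  qed
  then show thesis using that[OF \<Omega>' _ Qe] by blast
qed

section \<open>The comparison map to Lie algebra cochains\<close>

abbreviation "TC \<equiv> to_cochain atl S p act"

lemma act_AUT: "vs \<in> tuples UNIV r \<Longrightarrow> map act vs \<in> tuples AUT r"
  by (rule tuples_map[of _ UNIV]) (simp_all add: aut)

lemma act_tuples: "vs \<in> tuples UNIV r \<Longrightarrow> map act vs \<in> tuples AA r"
  by (rule AUT_tuples[OF act_AUT])

lemma TC_Q:
  assumes \<Omega>: "\<Omega> \<in> PH r p"
  shows "TC r (Q r \<Omega>) = (\<lambda>vs\<in>tuples UNIV r. Q 0 (ev (map act vs) \<Omega>))"
  unfolding to_cochain_def
proof (rule restrict_ext)
  fix vs :: "'g list" assume vs: "vs \<in> tuples UNIV r"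
  show "bform atl S p (Q r \<Omega>) (map (\<lambda>v. cls atl S (act v)) vs) = Q 0 (ev (map act vs) \<Omega>)"
    using bform_Q[OF \<Omega> act_AUT[OF vs]] by (simp add: comp_def)
qed

text \<open>The cochain is computed through a lift \<open>C\<close> to representatives, where the
  Chevalley-Eilenberg formula is an ordinary sum.\<close>

lemma delta_Q:
  assumes c: "\<And>vs. vs \<in> tuples UNIV r \<Longrightarrow> c vs = Q 0 (C vs)"
    and C: "\<And>vs. vs \<in> tuples UNIV r \<Longrightarrow> C vs \<in> PH 0 p"
    and vs: "vs \<in> tuples UNIV (Suc r)"
  shows "delta atl S p br (rho atl S p act) r c vs = Q 0 (ced br (\<lambda>v. lP (act v)) C vs)"
proof -
  let ?R = "rho atl S p act"
  let ?s = "\<lambda>i. (-1) ^ i *\<^sub>R lP (act (vs ! i)) (C (del i vs))"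
  let ?t = "\<lambda>(j, i). (-1) ^ (i + j) *\<^sub>R C (br (vs ! i) (vs ! j) # del i (del j vs))"
  \<comment> \<open>The index pairs in the order of the nested comprehension in
    \<open>delta\<close>, so that its second list becomes a single map.\<close>
  let ?P = "concat (map (\<lambda>j. map (\<lambda>i. (j, i)) [0..<j]) [0..<Suc r])"
  have d: "del i vs \<in> tuples UNIV r" if "i < Suc r" for i by (rule tuples_del[OF vs that])
  have s: "?s i \<in> PH 0 p" if "i < Suc r" for i by (intro Phi_scale lP_Phi act_AA C d that)
  have dd: "br (vs ! i) (vs ! j) # del i (del j vs) \<in> tuples UNIV r" if "i < j" "j < Suc r" for i j
  proof -
    obtain k where "r = Suc k" using \<open>i < j\<close> \<open>j < Suc r\<close> by (cases r) auto
    then show ?thesis using that tuples_del[OF d[OF that(2), unfolded \<open>r = Suc k\<close>], of i] by (simp add: tuples_Cons)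
  qed
  have P: "ji \<in> set ?P \<Longrightarrow> snd ji < fst ji \<and> fst ji < Suc r" for ji by auto
  have t: "?t ji \<in> PH 0 p" if "ji \<in> set ?P" for ji
    using P[OF that] C[OF dd] by (auto simp: case_prod_beta intro: Phi_scale)
  have 1: "map (\<lambda>i. xsc ((-1) ^ i) (?R (vs ! i) (c (del i vs)))) [0..<Suc r] = map (\<lambda>i. Q 0 (?s i)) [0..<Suc r]"
  proof (rule map_cong[OF refl])
    fix i assume "i \<in> set [0..<Suc r]"
    then have i: "i < Suc r" by auto
    show "xsc ((-1) ^ i) (?R (vs ! i) (c (del i vs))) = Q 0 (?s i)"
      unfolding c[OF d[OF i]] rho_Q[OF C[OF d[OF i]]] by (rule xscale_Q[OF lP_Phi[OF act_AA C[OF d[OF i]]]])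
  qed
  have 2: "concat (map (\<lambda>j. map (\<lambda>i. xsc ((-1) ^ (i + j)) (c (br (vs ! i) (vs ! j) # del i (del j vs)))) [0..<j]) [0..<Suc r])
      = map (\<lambda>ji. Q 0 (?t ji)) ?P"
    unfolding map_concat map_map comp_def
  proof (intro arg_cong[where f = concat] map_cong refl)
    fix j i assume "j \<in> set [0..<Suc r]" "i \<in> set [0..<j]"
    then have ij: "i < j" "j < Suc r" by auto
    show "xsc ((-1) ^ (i + j)) (c (br (vs ! i) (vs ! j) # del i (del j vs))) = Q 0 (?t (j, i))"
      unfolding c[OF dd[OF ij]] prod.case by (rule xscale_Q[OF C[OF dd[OF ij]]])
  qed
  have s': "(\<Sum>i\<leftarrow>[0..<Suc r]. ?s i) = (\<Sum>i<Suc r. ?s i)"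
    unfolding interv_sum_list_conv_sum_set_nat atLeast0LessThan set_upt ..
  have "(\<Sum>ji\<leftarrow>concat (map (\<lambda>j. map (Pair j) [0..<j]) js). ?t ji) = (\<Sum>j\<leftarrow>js. \<Sum>i<j. ?t (j, i))" for js
    by (induction js) (simp_all add: comp_def interv_sum_list_conv_sum_set_nat atLeast0LessThan)
  then have t': "(\<Sum>ji\<leftarrow>?P. ?t ji) = (\<Sum>j<Suc r. \<Sum>i<j. ?t (j, i))"
    by (simp only: interv_sum_list_conv_sum_set_nat set_upt atLeast0LessThan)
  have X1: "(\<Sum>i\<leftarrow>[0..<Suc r]. ?s i) \<in> PH 0 p \<and>
      xsum atl S p (map (\<lambda>i. Q 0 (?s i)) [0..<Suc r]) = Q 0 (\<Sum>i\<leftarrow>[0..<Suc r]. ?s i)"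
    by (rule xsum_Q[OF s]) auto
  have X2: "(\<Sum>ji\<leftarrow>?P. ?t ji) \<in> PH 0 p \<and> xsum atl S p (map (\<lambda>ji. Q 0 (?t ji)) ?P) = Q 0 (\<Sum>ji\<leftarrow>?P. ?t ji)"
    by (rule xsum_Q[OF t])
  have "delta atl S p br ?R r c vs = xad (xsum atl S p (map (\<lambda>i. Q 0 (?s i)) [0..<Suc r])) (xsum atl S p (map (\<lambda>ji. Q 0 (?t ji)) ?P))"
    unfolding delta_def restrict_apply'[OF vs] 1 2 ..
  also have "\<dots> = xad (Q 0 (\<Sum>i\<leftarrow>[0..<Suc r]. ?s i)) (Q 0 (\<Sum>ji\<leftarrow>?P. ?t ji))"
    unfolding conjunct2[OF X1] conjunct2[OF X2] ..
  also have "\<dots> = Q 0 ((\<Sum>i\<leftarrow>[0..<Suc r]. ?s i) + (\<Sum>ji\<leftarrow>?P. ?t ji))"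
    by (rule xadd_Q[OF conjunct1[OF X1] conjunct1[OF X2]])
  finally show ?thesis unfolding s' t' ced_def tuples_length[OF vs] prod.case .
qed

text \<open>The action preserves brackets, so the vertical formula on its fields is the
  Chevalley-Eilenberg formula on the Lie algebra.\<close>

lemma ced_act:
  assumes vs: "vs \<in> tuples UNIV (Suc r)"
  shows "ced br (\<lambda>v. lP (act v)) (\<lambda>vs. ev (map act vs) \<Omega>) vs = DD \<Omega> (map act vs)"
  unfolding ced_def length_map
  by (intro arg_cong2[where f = "(+)"] sum.cong refl) (simp_all add: map_del act_br)

text \<open>Degree 0 is included; it yields the statement about the Euler operator.\<close>

lemma TC_dV:
  assumes \<Omega>: "\<Omega> \<in> PH r p"
  shows "dV atl S p r (Q r \<Omega>) \<in> Xi atl S p (Suc r)"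
    and "TC (Suc r) (dV atl S p r (Q r \<Omega>)) = delta atl S p br (rho atl S p act) r (TC r (Q r \<Omega>))"
proof -
  obtain \<Omega>' where \<Omega>': "\<Omega>' \<in> PH (Suc r) p" "dV atl S p r (Q r \<Omega>) = Q (Suc r) \<Omega>'"
    "\<And>Zs. Zs \<in> tuples AA (Suc r) \<Longrightarrow> Q 0 (ev Zs \<Omega>') = Q 0 (DD \<Omega> Zs)"
    by (rule dV_Q[OF \<Omega>]) (rule that, assumption, assumption, blast)
  show "dV atl S p r (Q r \<Omega>) \<in> Xi atl S p (Suc r)" unfolding \<Omega>'(2) by (rule Q_Xi[OF \<Omega>'(1)])
  show "TC (Suc r) (dV atl S p r (Q r \<Omega>)) = delta atl S p br (rho atl S p act) r (TC r (Q r \<Omega>))"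
  proof (rule extensionalityI[of _ "tuples UNIV (Suc r)"])
    fix vs :: "'g list" assume vs: "vs \<in> tuples UNIV (Suc r)"
    have "delta atl S p br (rho atl S p act) r (TC r (Q r \<Omega>)) vs
        = Q 0 (ced br (\<lambda>v. lP (act v)) (\<lambda>vs. ev (map act vs) \<Omega>) vs)"
      by (rule delta_Q[OF _ ev_Phi[OF \<Omega>] vs]) (simp add: TC_Q[OF \<Omega>])
    also have "\<dots> = Q 0 (ev (map act vs) \<Omega>')"
      unfolding ced_act[OF vs] \<Omega>'(3)[OF act_tuples[OF vs]] ..
    finally show "TC (Suc r) (dV atl S p r (Q r \<Omega>)) vs = delta atl S p br (rho atl S p act) r (TC r (Q r \<Omega>)) vs"
      unfolding \<Omega>'(2) TC_Q[OF \<Omega>'(1)] restrict_apply'[OF vs] by simp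
  qed (simp_all add: to_cochain_def delta_def)
qed

text \<open>Constants are first integrals with zero derivative, so real homogeneity is a case of
  linearity over \<open>II\<close>.\<close>

lemma lP_scale:
  assumes "\<xi> \<in> AA" "\<mu> \<in> PH 0 p"
  shows "lP \<xi> (c *\<^sub>R \<mu>) = c *\<^sub>R lP \<xi> \<mu>" "lP (c *\<^sub>R \<xi>) \<mu> = c *\<^sub>R lP \<xi> \<mu>"
proof -
  have "sn 0 \<mu> = 0" by (simp add: sn_def fmul_zero_left fun_eq_iff zero_fun_apply)
  then show "lP \<xi> (c *\<^sub>R \<mu>) = c *\<^sub>R lP \<xi> \<mu>"
    using ver.th_sn[OF II_const assms, of c] vf_const[OF AA_VF[OF assms(1)]] by (simp add: sn_const)
  show "lP (c *\<^sub>R \<xi>) \<mu> = c *\<^sub>R lP \<xi> \<mu>"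
    using ver.th_sl[OF II_const assms, of c] by (simp add: sn_const fmul_const)
qed

lemma AA_scale: "\<xi> \<in> AA \<Longrightarrow> c *\<^sub>R \<xi> \<in> AA"
  using ver.sl_closed[OF II_const, of \<xi> c] by (simp add: fmul_const)

lemma rho_lie_rep: "lie_rep atl S p br (rho atl S p act)"
  unfolding lie_rep_def Xi_Q ball_simps(9)
proof (intro conjI allI ballI)
  fix v and \<mu> assume \<mu>: "\<mu> \<in> PH 0 p"
  note A = act_AA
  show "rho atl S p act v (Q 0 \<mu>) \<in> Q 0 ` PH 0 p"
    unfolding rho_Q[OF \<mu>] by (intro imageI lP_Phi A \<mu>)
  show "rho atl S p act v (xad (xsc s (Q 0 \<mu>)) (xsc t (Q 0 \<nu>))) =
      xad (xsc s (rho atl S p act v (Q 0 \<mu>))) (xsc t (rho atl S p act v (Q 0 \<nu>)))"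
    if \<nu>: "\<nu> \<in> PH 0 p" for s t \<nu>
    by (simp add: \<mu> \<nu> xscale_Q xadd_Q rho_Q Phi_scale Phi_add lP_Phi A ver.th_add_right lP_scale)
  show "rho atl S p act (s *\<^sub>R v + t *\<^sub>R w) (Q 0 \<mu>) =
      xad (xsc s (rho atl S p act v (Q 0 \<mu>))) (xsc t (rho atl S p act w (Q 0 \<mu>)))" for w s t
    by (simp add: \<mu> xscale_Q xadd_Q rho_Q Phi_scale lP_Phi A linear_add[OF act_linear] linear_cmul[OF act_linear]
        ver.th_add_left AA_scale lP_scale)
  show "rho atl S p act (br v w) (Q 0 \<mu>) =
      xad (rho atl S p act v (rho atl S p act w (Q 0 \<mu>))) (xsc (-1) (rho atl S p act w (rho atl S p act v (Q 0 \<mu>))))" for w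
    by (simp add: \<mu> xscale_Q xadd_Q rho_Q Phi_scale lP_Phi A act_br ver.th_br[OF A A \<mu>, of v w]
        Phi_add AA_vbr subspace_neg[OF Phi_subspace])
qed

lemma ev_act_linear:
  assumes \<Omega>: "\<Omega> \<in> PH r p" and vs: "vs \<in> tuples UNIV r" and i: "i < r"
  shows "linear (\<lambda>v. ev (map act (vs[i := v])) \<Omega>)"
proof (rule linearI)
  note t = AA_tuples_VF[OF act_tuples[OF vs]]
  show "ev (map act (vs[i := v + w])) \<Omega> = ev (map act (vs[i := v])) \<Omega> + ev (map act (vs[i := w])) \<Omega>" for v w
    unfolding map_update linear_add[OF act_linear]
    by (rule ver.alt_D(2)[OF ev_ver(1)[OF \<Omega>] act_tuples[OF vs] i act_AA act_AA])
  show "ev (map act (vs[i := c *\<^sub>R v])) \<Omega> = c *\<^sub>R ev (map act (vs[i := v])) \<Omega>" for c v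
    using ev_alt(2)[OF \<Omega> t i act_VF SF_const[of c], of v]
    by (simp add: map_update linear_cmul[OF act_linear] fmul_const sn_const)
qed

lemma TC_cochain:
  assumes \<Omega>: "\<Omega> \<in> PH r p"
  shows "TC r (Q r \<Omega>) \<in> cochains atl S p r"
  unfolding cochains_def TC_Q[OF \<Omega>]
proof (intro CollectI conjI ballI allI impI)
  show "(\<lambda>vs\<in>tuples UNIV r. Q 0 (ev (map act vs) \<Omega>)) \<in> tuples UNIV r \<rightarrow>\<^sub>E Xi atl S p 0"
    using Q_Xi[OF ev_Phi[OF \<Omega>]] by simp
  fix vs :: "'g list" assume vs: "vs \<in> tuples UNIV r"
  note P = ev_Phi[OF \<Omega>]
  show "(\<lambda>vs\<in>tuples UNIV r. Q 0 (ev (map act vs) \<Omega>)) (vs[i := s *\<^sub>R u + t *\<^sub>R w]) =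
      xad (xsc s ((\<lambda>vs\<in>tuples UNIV r. Q 0 (ev (map act vs) \<Omega>)) (vs[i := u])))
        (xsc t ((\<lambda>vs\<in>tuples UNIV r. Q 0 (ev (map act vs) \<Omega>)) (vs[i := w])))" if i: "i < r" for i u w s t
  proof -
    have u: "vs[i := z] \<in> tuples UNIV r" for z by (rule tuples_update[OF vs]) simp
    show ?thesis
      unfolding restrict_apply'[OF u] xscale_Q[OF P] xadd_Q[OF Phi_scale[OF P] Phi_scale[OF P]]
      using linear_add[OF ev_act_linear[OF \<Omega> vs i]] linear_cmul[OF ev_act_linear[OF \<Omega> vs i]] by simp
  qed
  show "(\<lambda>vs\<in>tuples UNIV r. Q 0 (ev (map act vs) \<Omega>)) vs = xzero atl S p" if "j < r" "i < j" "vs ! i = vs ! j" for i j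
  proof -
    have "ev (map act vs) \<Omega> = 0"
      by (rule alt_form_zero[OF ev_ver(1)[OF \<Omega>] act_tuples[OF vs], of i j]) (use that tuples_length[OF vs] in auto)
    then show ?thesis using vs by (simp add: xzero_def)
  qed
qed

lemma e_tuples_UNIV: "map e J \<in> tuples UNIV r \<longleftrightarrow> length J = r"
  by (simp add: tuples_def)

text \<open>Tuples of basis vectors go to tuples of frame fields, and the values there already
  determine the class.\<close>

lemma TC_inj: "inj_on (TC r) (Xi atl S p r)"
proof (rule inj_onI)
  fix \<tau> \<tau>' assume "\<tau> \<in> Xi atl S p r" "\<tau>' \<in> Xi atl S p r" and eq: "TC r \<tau> = TC r \<tau>'"
  then obtain \<Omega> \<Omega>' where \<Omega>: "\<Omega> \<in> PH r p" "\<tau> = Q r \<Omega>" and \<Omega>': "\<Omega>' \<in> PH r p" "\<tau>' = Q r \<Omega>'"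
    unfolding Xi_Q by blast
  have "\<Omega>' - \<Omega> \<in> IM r"
  proof (rule IM_of_frame_values[OF Phi_diff[OF \<Omega>'(1) \<Omega>(1)]])
    fix J assume J: "J \<in> tuples {..<n} r"
    have "Q 0 (ev (map act (map e J)) \<Omega>) = Q 0 (ev (map act (map e J)) \<Omega>')"
      using fun_cong[OF eq, of "map e J"] J
      by (simp add: \<Omega>(2) \<Omega>'(2) TC_Q \<Omega>(1) \<Omega>'(1) e_tuples_UNIV tuples_length[OF J])
    then show "ev (map XX J) (\<Omega>' - \<Omega>) \<in> IM 0"
      by (simp add: Q_eq[OF ev_Phi[OF \<Omega>(1)] ev_Phi[OF \<Omega>'(1)]] ev_simps comp_def)
  qed
  then show "\<tau> = \<tau>'" by (simp add: \<Omega>(2) \<Omega>'(2) Q_eq[OF \<Omega>(1) \<Omega>'(1)])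
qed

text \<open>Surjectivity: a linear projection killing \<open>d\<^sub>H \<Phi>\<^sup>0\<^sup>,\<^sup>p\<^sup>-\<^sup>1\<close> lifts a cochain with values
  in \<open>\<Xi>\<^sup>0\<close> to an alternating multilinear map with values in \<open>\<Phi>\<^sup>0\<^sup>,\<^sup>p\<close>.\<close>

lemma TC_surj:
  assumes c: "c \<in> cochains atl S p r"
  obtains \<Omega> where "\<Omega> \<in> PH r p" "TC r (Q r \<Omega>) = c"
proof -
  obtain \<pi> :: "'m hform \<Rightarrow> 'm hform" where \<pi>: "linear \<pi>" "\<And>x. x - \<pi> x \<in> IM 0" "\<And>x. x \<in> IM 0 \<Longrightarrow> \<pi> x = 0"
    by (rule subspace_projection_exists[OF IM_subspace[of 0]]) (rule that, assumption, blast, blast)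
  have \<pi>P: "\<pi> \<mu> \<in> PH 0 p" if "\<mu> \<in> PH 0 p" for \<mu>
    using Phi_diff[OF that IM_Phi[OF \<pi>(2)[of \<mu>]]] by simp
  have \<pi>Q: "Q 0 (\<pi> \<mu>) = Q 0 \<mu>" if "\<mu> \<in> PH 0 p" for \<mu>
    using \<pi>(2) by (simp add: Q_eq[OF \<pi>P[OF that] that])
  define rep where "rep a = (SOME \<mu>. \<mu> \<in> PH 0 p \<and> Q 0 \<mu> = a)" for a
  define C where "C vs = \<pi> (rep (c vs))" for vs
  \<comment> \<open>The choice of representative is not linear, but the projection kills every
    ambiguity. So \<open>C\<close> may be computed from any representative and inherits
    multilinearity from \<open>c\<close>.\<close>
  have Cv: "C vs = \<pi> \<mu>" if m: "\<mu> \<in> PH 0 p" "c vs = Q 0 \<mu>" for vs \<mu>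
  proof -
    have "rep (c vs) \<in> PH 0 p \<and> Q 0 (rep (c vs)) = c vs"
      unfolding rep_def by (rule someI[of _ \<mu>]) (simp add: m)
    then have "\<mu> - rep (c vs) \<in> IM 0" using m Q_eq[of "rep (c vs)" 0 \<mu>] by simp
    from \<pi>(3)[OF this] show ?thesis unfolding C_def linear_diff[OF \<pi>(1)] by simp
  qed
  have mu: "\<exists>\<mu>. \<mu> \<in> PH 0 p \<and> c vs = Q 0 \<mu>" if "vs \<in> tuples UNIV r" for vs
    using c that unfolding cochains_def Xi_Q by (auto dest!: PiE_mem)
  have CP: "C vs \<in> PH 0 p" and CQ: "Q 0 (C vs) = c vs" if vs: "vs \<in> tuples UNIV r" for vs
  proof -
    obtain \<mu> where \<mu>: "\<mu> \<in> PH 0 p" "c vs = Q 0 \<mu>" using mu[OF vs] by (elim exE conjE) (rule that)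
    show "C vs \<in> PH 0 p" "Q 0 (C vs) = c vs" unfolding Cv[OF \<mu>] \<pi>Q[OF \<mu>(1)] using \<pi>P \<mu> by simp_all
  qed
  have lin: "C (vs[i := s *\<^sub>R u + t *\<^sub>R w]) = s *\<^sub>R C (vs[i := u]) + t *\<^sub>R C (vs[i := w])"
    if vs: "vs \<in> tuples UNIV r" and i: "i < r" for vs i s t u w
  proof -
    have up: "vs[i := z] \<in> tuples UNIV r" for z by (rule tuples_update[OF vs]) simp
    obtain \<mu> where \<mu>: "\<mu> \<in> PH 0 p" "c (vs[i := u]) = Q 0 \<mu>" using mu[OF up[of u]] by (elim exE conjE) (rule that)
    obtain \<nu> where \<nu>: "\<nu> \<in> PH 0 p" "c (vs[i := w]) = Q 0 \<nu>" using mu[OF up[of w]] by (elim exE conjE) (rule that)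
    have "c (vs[i := s *\<^sub>R u + t *\<^sub>R w]) = xad (xsc s (c (vs[i := u]))) (xsc t (c (vs[i := w])))"
      using c vs i by (simp add: cochains_def)
    then have "c (vs[i := s *\<^sub>R u + t *\<^sub>R w]) = Q 0 (s *\<^sub>R \<mu> + t *\<^sub>R \<nu>)"
      by (simp add: \<mu> \<nu> xscale_Q xadd_Q Phi_scale)
    then have "C (vs[i := s *\<^sub>R u + t *\<^sub>R w]) = \<pi> (s *\<^sub>R \<mu> + t *\<^sub>R \<nu>)"
      by (intro Cv Phi_add Phi_scale \<mu> \<nu>)
    then show ?thesis unfolding Cv[OF \<mu>] Cv[OF \<nu>] linear_add[OF \<pi>(1)] linear_cmul[OF \<pi>(1)] .
  qed
  have alt: "alt_form UNIV (PH 0 p) r C"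
    unfolding alt_form_def additive_form_def
  proof (intro conjI ballI allI impI)
    show "C vs \<in> PH 0 p" if "vs \<in> tuples UNIV r" for vs by (rule CP[OF that])
    fix vs :: "'g list" assume vs: "vs \<in> tuples UNIV r"
    show "C (vs[i := x + y]) = C (vs[i := x]) + C (vs[i := y])" if "i < r" for i x y
      using lin[OF vs that, of 1 x 1 y] by simp
    show "C vs = 0" if "j < r" "i < j" "vs ! i = vs ! j" for i j
    proof -
      have "c vs = Q 0 0" using c vs that unfolding cochains_def xzero_def by blast
      then show ?thesis using Cv[OF Phi_zero] linear_0[OF \<pi>(1)] by simp
    qed
  qed
  obtain \<Omega> where \<Omega>: "\<Omega> \<in> PH r p" "\<And>J. J \<in> tuples {..<n} r \<Longrightarrow> ev (map XX J) \<Omega> = C (map e J)"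
    by (rule Phi_of_alternating_values[OF alt, of e]) simp_all
  \<comment> \<open>Equality is built in only on tuples of basis vectors; linearity in each slot of
    both sides extends it to all tuples.\<close>
  have eq: "ev (map act vs) \<Omega> = C vs" if vs: "vs \<in> tuples UNIV r" for vs
  proof (rule tuples_slotwise[where P = "\<lambda>vs. ev (map act vs) \<Omega> = C vs" and G = "e ` {..<n}" and L = UNIV, OF _ _ _ vs])
    fix vs assume "vs \<in> tuples (e ` {..<n}) r"
    then have l: "set vs \<subseteq> e ` {..<n}" "length vs = r" by (auto simp: tuples_def)
    then have "vs \<in> map e ` lists {..<n}" unfolding lists_image[symmetric] by auto
    then obtain J where "vs = map e J" "J \<in> lists {..<n}" by (rule imageE)
    then show "ev (map act vs) \<Omega> = C vs" using \<Omega>(2)[of J] l(2) by (auto simp: tuples_def comp_def)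
  next
    fix vs i x assume vs: "vs \<in> tuples UNIV r" and i: "i < r"
      and h: "\<And>g. g \<in> e ` {..<n} \<Longrightarrow> ev (map act (vs[i := g])) \<Omega> = C (vs[i := g])"
    have "linear (\<lambda>x. C (vs[i := x]))"
      by (rule linearI) (use lin[OF vs i, of 1 _ 1] lin[OF vs i, of _ _ 0] in simp_all)
    then show "ev (map act (vs[i := x])) \<Omega> = C (vs[i := x])"
      by (rule linear_eq_on[OF ev_act_linear[OF \<Omega>(1) vs i]]) (use e(3) h in auto)
  qed simp
  show thesis
  proof (rule that[OF \<Omega>(1)])
    show "TC r (Q r \<Omega>) = c"
    proof (rule extensionalityI[of _ "tuples UNIV r"])
      show "c \<in> extensional (tuples UNIV r)" using c by (auto simp: cochains_def PiE_def)
      show "TC r (Q r \<Omega>) vs = c vs" if "vs \<in> tuples UNIV r" for vs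
        using that by (simp add: TC_Q[OF \<Omega>(1)] eq CQ)
    qed (simp add: to_cochain_def)
  qed
qed

lemma TC_bij: "bij_betw (TC r) (Xi atl S p r) (cochains atl S p r)"
  unfolding bij_betw_def
proof (intro conjI TC_inj equalityI subsetI)
  show "c \<in> cochains atl S p r" if "c \<in> TC r ` Xi atl S p r" for c
    using that TC_cochain unfolding Xi_Q by auto
  show "c \<in> TC r ` Xi atl S p r" if c: "c \<in> cochains atl S p r" for c
    by (rule TC_surj[OF c]) (auto simp: Xi_Q)
qed

text \<open>With more than q = n entries an index tuple has a repetition, so every frame value
  vanishes, and with it the form.\<close>

lemma Xi_trivial: assumes r: "r > q" shows "Xi atl S p r = {Q r 0}"
proof -
  have "\<Omega> = 0" if \<Omega>: "\<Omega> \<in> PH r p" for \<Omega>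
  proof (rule Phi_eq_0_on_frame[OF \<Omega>])
    fix J assume J: "J \<in> tuples {..<n} r"
    have "card (set J) \<le> n" using J card_mono[of "{..<n}" "set J"] by (simp add: tuples_def)
    then have "\<not> distinct J" using r n_eq_q tuples_length[OF J] distinct_card[of J] by auto
    then obtain i j where "i < r" "j < r" "i \<noteq> j" "J ! i = J ! j"
      using tuples_length[OF J] by (auto simp: distinct_conv_nth)
    then show "ev (map XX J) \<Omega> = 0"
      by (intro alt_form_zero[OF ev_ver(1)[OF \<Omega>] XX_tuples[OF J], of i j]) (simp_all add: tuples_length[OF J])
  qed
  then show ?thesis unfolding Xi_Q using Phi_zero by auto
qed

text \<open>The identification of 0-cochains with values in the coefficient module: the empty tuple
  is the only argument.\<close>

lemma TC_0: "\<mu> \<in> PH 0 p \<Longrightarrow> TC 0 (Q 0 \<mu>) = (\<lambda>vs\<in>tuples UNIV 0. Q 0 \<mu>)"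
  unfolding TC_Q by (rule restrict_ext) (simp add: tuples_0 ev_Nil)

theorem resolution_is_cochain_complex:
  "lie_rep atl S p br (rho atl S p act) \<and>
    (\<forall>v. \<forall>\<mu>\<in>PH 0 p. rho atl S p act v (Q 0 \<mu>) = Q 0 (lP (act v) \<mu>)) \<and>
    (\<forall>r>q. Xi atl S p r = {Q r 0}) \<and>
    (\<forall>r\<ge>1. bij_betw (TC r) (Xi atl S p r) (cochains atl S p r)) \<and>
    (\<forall>r\<ge>1. \<forall>\<tau>\<in>Xi atl S p r. dV atl S p r \<tau> \<in> Xi atl S p (Suc r) \<and>
       TC (Suc r) (dV atl S p r \<tau>) = delta atl S p br (rho atl S p act) r (TC r \<tau>)) \<and>
    (\<forall>\<mu>\<in>PH 0 p. Euler atl S p \<mu> \<in> Xi atl S p 1 \<and>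
       TC 1 (Euler atl S p \<mu>) = delta atl S p br (rho atl S p act) 0 (\<lambda>vs\<in>tuples UNIV 0. Q 0 \<mu>))"
proof (intro conjI allI impI ballI)
  show "rho atl S p act v (Q 0 \<mu>) = Q 0 (lP (act v) \<mu>)" if "\<mu> \<in> PH 0 p" for v \<mu> by (rule rho_Q[OF that])
  show "Xi atl S p r = {Q r 0}" if "r > q" for r by (rule Xi_trivial[OF that])
  show "bij_betw (TC r) (Xi atl S p r) (cochains atl S p r)" for r by (rule TC_bij)
  show "dV atl S p r \<tau> \<in> Xi atl S p (Suc r)"
    "TC (Suc r) (dV atl S p r \<tau>) = delta atl S p br (rho atl S p act) r (TC r \<tau>)" if \<tau>: "\<tau> \<in> Xi atl S p r" for r \<tau>
  proof -
    obtain \<Omega> where \<Omega>: "\<Omega> \<in> PH r p" "\<tau> = Q r \<Omega>" using \<tau> unfolding Xi_Q by (elim imageE) (rule that)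
    show "dV atl S p r \<tau> \<in> Xi atl S p (Suc r)"
      "TC (Suc r) (dV atl S p r \<tau>) = delta atl S p br (rho atl S p act) r (TC r \<tau>)"
      unfolding \<Omega>(2) by (rule TC_dV[OF \<Omega>(1)])+
  qed
  show "Euler atl S p \<mu> \<in> Xi atl S p 1"
    "TC 1 (Euler atl S p \<mu>) = delta atl S p br (rho atl S p act) 0 (\<lambda>vs\<in>tuples UNIV 0. Q 0 \<mu>)"
    if \<mu>: "\<mu> \<in> PH 0 p" for \<mu>
    unfolding Euler_def TC_0[OF \<mu>, symmetric] One_nat_def by (rule TC_dV[OF \<mu>])+
qed (rule rho_lie_rep)

end

lemma indexed_basis_exists:
  assumes "finite b" "span b = (UNIV :: 'a::real_vector set)"
  obtains e :: "nat \<Rightarrow> 'a::real_vector" and n where "inj_on e {..<n}" "independent (e ` {..<n})" "span (e ` {..<n}) = UNIV"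
proof -
  obtain E where E: "E \<subseteq> b" "independent E" "b \<subseteq> span E" by (rule maximal_independent_subset)
  obtain e where e: "bij_betw e {0..<card E} E"
    using ex_bij_betw_nat_finite[OF finite_subset[OF E(1) assms(1)]] by blast
  have "span E = UNIV" using span_minimal[OF E(3) subspace_span] assms(2) by auto
  then show thesis using that[of e "card E"] e E(2) by (simp add: bij_betw_def atLeast0LessThan)
qed

theorem theorem1:
  fixes atl :: "('m::{t2_space, second_countable_topology} set \<times> ('m \<Rightarrow> 'e::real_inner)) set"
    and S :: "'m \<Rightarrow> 'm covec set"
    and br :: "'g::real_vector \<Rightarrow> 'g \<Rightarrow> 'g"
    and act :: "'g \<Rightarrow> 'm vf"
    and p q :: nat
  assumes "smooth_manifold atl"
    and "pfaffian_system atl q S"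
    and "p + q = dim (UNIV :: 'e set)"
    and "integrable_system atl S"
    and "findim_lie_algebra br"
    and "infinitesimal_action atl br act"
    and "\<forall>v. act v \<in> auts atl S"
    and "transversally_free atl S act"
  shows "lie_rep atl S p br (rho atl S p act) \<and>
    (\<forall>v. \<forall>\<mu>\<in>Phi atl S 0 p.
       rho atl S p act v (qmap atl S p 0 \<mu>) = qmap atl S p 0 (lie_Phi atl S (act v) \<mu>)) \<and>
    (\<forall>r>q. Xi atl S p r = {qmap atl S p r 0}) \<and>
    (\<forall>r\<ge>1. bij_betw (to_cochain atl S p act r) (Xi atl S p r) (cochains atl S p r)) \<and>
    (\<forall>r\<ge>1. \<forall>\<tau>\<in>Xi atl S p r.
       dV atl S p r \<tau> \<in> Xi atl S p (Suc r) \<and>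
       to_cochain atl S p act (Suc r) (dV atl S p r \<tau>) =
         delta atl S p br (rho atl S p act) r (to_cochain atl S p act r \<tau>)) \<and>
    (\<forall>\<mu>\<in>Phi atl S 0 p.
       Euler atl S p \<mu> \<in> Xi atl S p 1 \<and>
       to_cochain atl S p act 1 (Euler atl S p \<mu>) =
         delta atl S p br (rho atl S p act) 0 (\<lambda>vs\<in>tuples UNIV 0. qmap atl S p 0 \<mu>))"
proof -
  obtain B0 :: "'e set" where B0: "finite B0" "span B0 = UNIV"
    using assms(1) unfolding smooth_manifold_def by (elim conjE exE) (rule that)
  obtain B :: "'e set" where B: "onb B" using onb_exists[OF B0] by (elim exE) (rule that)
  obtain b :: "'g set" where b: "finite b" "span b = UNIV"
    using assms(5) unfolding findim_lie_algebra_def by (elim conjE exE) (rule that)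
  obtain e :: "nat \<Rightarrow> 'g" and n where e: "inj_on e {..<n}" "independent (e ` {..<n})" "span (e ` {..<n}) = UNIV"
    by (rule indexed_basis_exists[OF b])
  interpret pfaffian_action atl B S br act e n p q
    by unfold_locales (rule assms B e spec[OF assms(7)])+
  show ?thesis by (rule resolution_is_cochain_complex)
qed

end
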